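(* Let $n\ge2$, let $\Omega\subset\mathbb R^n$ be a bounded domain with smooth boundary, let $0<q<n-1<2n-1<p+1$ and $\beta=\frac{n}{n-1}$, let $m(s)=as+b$ with $a,b>0$, and let $h\in L^\gamma(\Omega)$ with $\gamma=\frac{n}{n-q-1}$ and $h^+\not\equiv0$ ($h$ may be indefinite in sign and may vanish in some open subset of $\Omega$). Then there exists $\lambda_{00}>0$ such that for $\lambda\in(0,\lambda_{00})$ the problem $$-m\Big(\int_\Omega|\nabla u|^n\,dx\Big)\Delta_nu=\lambda h(x)|u|^{q-1}u+u|u|^pe^{|u|^\beta}\ \text{ in }\Omega,\qquad u\ge0\ \text{ in }\Omega,\qquad u=0\ \text{ on }\partial\Omega,\qquad u\in W^{1,n}_0(\Omega),$$ admits a solution.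
   Context: $\Delta_nu=\operatorname{div}(|\nabla u|^{n-2}\nabla u)$ and $\|u\|=\left(\int_\Omega|\nabla u|^n\,dx\right)^{1/n}$. Solutions are understood in the weak sense: $u\in W^{1,n}_0(\Omega)$ (with $u\ge0$ in $\Omega$) such that for all $\phi\in W^{1,n}_0(\Omega)$, $$m(\|u\|^n)\int_\Omega|\nabla u|^{n-2}\nabla u\cdot\nabla\phi\,dx=\int_\Omega u|u|^pe^{|u|^\beta}\phi\,dx+\lambda\int_\Omega h(x)|u|^{q-1}u\,\phi\,dx.$$ *)

theory Defs
  imports "HOL-Analysis.Analysis"
begin

section \<open>Smooth functions and smooth domains\<close>

primrec Ck :: "nat \<Rightarrow> ('a::euclidean_space \<Rightarrow> real) \<Rightarrow> bool" where
  "Ck 0 f \<longleftrightarrow> continuous_on UNIV f"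
| "Ck (Suc k) f \<longleftrightarrow> (\<forall>x. f differentiable (at x)) \<and>
     (\<forall>b\<in>Basis. Ck k (\<lambda>x. frechet_derivative f (at x) b))"

definition smooth :: "('a::euclidean_space \<Rightarrow> real) \<Rightarrow> bool" where
  "smooth f \<longleftrightarrow> (\<forall>k. Ck k f)"

definition grad :: "('a::euclidean_space \<Rightarrow> real) \<Rightarrow> 'a \<Rightarrow> 'a" where
  "grad f x = (\<Sum>b\<in>Basis. frechet_derivative f (at x) b *\<^sub>R b)"

text \<open>Near each of its points the boundary is the graph of a smooth function over a hyperplane
  with unit normal \<open>e\<close>, and the set lies on one side of that graph.  Only the restriction
  of \<open>g\<close> to the hyperplane orthogonal to \<open>e\<close> matters.\<close>

definition smooth_boundary :: "'a::euclidean_space set \<Rightarrow> bool" where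
  "smooth_boundary \<Omega> \<longleftrightarrow> (\<forall>x\<in>frontier \<Omega>. \<exists>r>0. \<exists>e g. norm e = 1 \<and> smooth g \<and>
     \<Omega> \<inter> ball x r = {y \<in> ball x r. y \<bullet> e > g (y - (y \<bullet> e) *\<^sub>R e)})"

definition bounded_smooth_domain :: "'a::euclidean_space set \<Rightarrow> bool" where
  "bounded_smooth_domain \<Omega> \<longleftrightarrow>
     open \<Omega> \<and> connected \<Omega> \<and> \<Omega> \<noteq> {} \<and> bounded \<Omega> \<and> smooth_boundary \<Omega>"

section \<open>Lebesgue and Sobolev spaces\<close>

text \<open>The elements of the spaces below are functions on the whole space rather than equivalence
  classes; only their values on \<open>\<Omega>\<close>, up to null sets, are relevant.\<close>

definition Lebesgue_space ::
    "real \<Rightarrow> 'a::euclidean_space set \<Rightarrow> ('a \<Rightarrow> 'b::euclidean_space) set" where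
  "Lebesgue_space p \<Omega> = {f. f \<in> borel_measurable (lebesgue_on \<Omega>) \<and>
     integrable (lebesgue_on \<Omega>) (\<lambda>x. norm (f x) powr p)}"

definition test_functions :: "'a::euclidean_space set \<Rightarrow> ('a \<Rightarrow> real) set" where
  "test_functions \<Omega> =
     {\<phi>. smooth \<phi> \<and> (\<exists>K. compact K \<and> K \<subseteq> \<Omega> \<and> (\<forall>x. x \<notin> K \<longrightarrow> \<phi> x = 0))}"

definition locally_integrable_on ::
    "('a::euclidean_space \<Rightarrow> 'b::euclidean_space) \<Rightarrow> 'a set \<Rightarrow> bool" where
  "locally_integrable_on f \<Omega> \<longleftrightarrow>
     (\<forall>K. compact K \<and> K \<subseteq> \<Omega> \<longrightarrow> f absolutely_integrable_on K)"

definition has_weak_gradient ::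
    "'a::euclidean_space set \<Rightarrow> ('a \<Rightarrow> real) \<Rightarrow> ('a \<Rightarrow> 'a) \<Rightarrow> bool" where
  "has_weak_gradient \<Omega> u G \<longleftrightarrow> locally_integrable_on u \<Omega> \<and> locally_integrable_on G \<Omega> \<and>
     (\<forall>\<phi>\<in>test_functions \<Omega>.
        (\<integral>x. u x *\<^sub>R grad \<phi> x \<partial>lebesgue_on \<Omega>) = - (\<integral>x. \<phi> x *\<^sub>R G x \<partial>lebesgue_on \<Omega>))"

text \<open>For open \<open>\<Omega>\<close>, the weak gradient is unique up to a null subset of \<open>\<Omega>\<close>, so the choice of
  representative below is immaterial.\<close>

definition weak_grad :: "'a::euclidean_space set \<Rightarrow> ('a \<Rightarrow> real) \<Rightarrow> 'a \<Rightarrow> 'a" where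
  "weak_grad \<Omega> u = (SOME G. has_weak_gradient \<Omega> u G)"

definition Sobolev :: "real \<Rightarrow> 'a::euclidean_space set \<Rightarrow> ('a \<Rightarrow> real) set" where
  "Sobolev p \<Omega> = {u \<in> Lebesgue_space p \<Omega>.
     \<exists>G. has_weak_gradient \<Omega> u G \<and> G \<in> Lebesgue_space p \<Omega>}"

definition Sobolev_norm :: "real \<Rightarrow> 'a::euclidean_space set \<Rightarrow> ('a \<Rightarrow> real) \<Rightarrow> real" where
  "Sobolev_norm p \<Omega> u = ((\<integral>x. \<bar>u x\<bar> powr p \<partial>lebesgue_on \<Omega>)
     + (\<integral>x. norm (weak_grad \<Omega> u x) powr p \<partial>lebesgue_on \<Omega>)) powr (1 / p)"

definition Sobolev0 :: "real \<Rightarrow> 'a::euclidean_space set \<Rightarrow> ('a \<Rightarrow> real) set" where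
  "Sobolev0 p \<Omega> = {u \<in> Sobolev p \<Omega>.
     \<forall>\<epsilon>>0. \<exists>\<phi>\<in>test_functions \<Omega>. Sobolev_norm p \<Omega> (\<lambda>x. u x - \<phi> x) < \<epsilon>}"

section \<open>The Kirchhoff problem\<close>

text \<open>Integrability of the three integrands is spelled out because the Bochner integral of a
  non-integrable function is 0.  For exponents \<open>q - 1 < 0\<close> note that \<open>0 powr (q - 1) = 0\<close>,
  so \<open>\<bar>u\<bar> powr (q - 1) * u\<close> vanishes where \<open>u\<close> does.\<close>

definition weak_solution ::
    "(real \<Rightarrow> real) \<Rightarrow> real \<Rightarrow> real \<Rightarrow> real \<Rightarrow> (real ^ 'n \<Rightarrow> real) \<Rightarrow> real \<Rightarrow> (real ^ 'n) set
      \<Rightarrow> (real ^ 'n \<Rightarrow> real) \<Rightarrow> bool" where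
  "weak_solution m p q \<beta> h lam \<Omega> u \<longleftrightarrow>
     u \<in> Sobolev0 (real CARD('n)) \<Omega> \<and>
     (AE x in lebesgue_on \<Omega>. u x \<ge> 0) \<and>
     (\<forall>\<phi>\<in>Sobolev0 (real CARD('n)) \<Omega>.
        (let Du = weak_grad \<Omega> u;
             A = (\<lambda>x. norm (Du x) ^ (CARD('n) - 2) * (Du x \<bullet> weak_grad \<Omega> \<phi> x));
             F = (\<lambda>x. u x * \<bar>u x\<bar> powr p * exp (\<bar>u x\<bar> powr \<beta>) * \<phi> x);
             H = (\<lambda>x. h x * \<bar>u x\<bar> powr (q - 1) * u x * \<phi> x)
         in integrable (lebesgue_on \<Omega>) A \<and>
            integrable (lebesgue_on \<Omega>) F \<and>
            integrable (lebesgue_on \<Omega>) H \<and>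
            m (\<integral>x. norm (Du x) ^ CARD('n) \<partial>lebesgue_on \<Omega>) * (\<integral>x. A x \<partial>lebesgue_on \<Omega>)
              = (\<integral>x. F x \<partial>lebesgue_on \<Omega>) + lam * (\<integral>x. H x \<partial>lebesgue_on \<Omega>)))"

end

theory Submission
  imports Defs "HOL-Complex_Analysis.Great_Picard" "HOL-Library.Diagonal_Subsequence"
begin

text \<open>The solution is a local minimiser of the energy
  \<open>J(u) = a N(u)\<^sup>2 / (2n) + b N(u) / n - \<integral> F(u) - \<lambda> / (q + 1) \<integral> h \<bar>u\<bar> powr (q + 1)\<close>, where
  \<open>N(u) = \<integral> \<bar>\<nabla>u\<bar> ^ n\<close>, on a ball \<open>N \<le> \<rho> ^ n\<close>.  For small \<open>\<rho>\<close> a Moser--Trudinger inequality bounds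
  the integrals of \<open>exp (16 \<bar>u\<bar> powr \<beta>)\<close> over the whole ball, so that the lower order terms of \<open>J\<close> are
  uniformly continuous there with respect to the L1 distance.  For small \<open>\<lambda>\<close> the energy is negative
  somewhere in every ball (because of \<open>h\<^sup>+\<close>) but nonnegative near its boundary (because \<open>p + 2 > n\<close>).
  A minimising sequence of nonnegative test functions has a subsequence that converges in L1, and Clarkson's
  inequality together with the strong convexity of the leading part of \<open>J\<close> turns this into strong
  convergence of the gradients.  Weak compactness and reflexivity are thus avoided.  The limit is
  an interior minimiser along all test function directions, which gives the Euler--Lagrange
  equation first for test functions and then, by density, in the Sobolev space.

  The Moser--Trudinger inequality is obtained without rearrangement: comparing a truncation of \<open>u\<close> with
  its translates over a ball whose volume is twice that of a superlevel set gives a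
  recursive bound for the distribution function, and iterating it yields exponential decay.\<close>

subsection \<open>Smooth functions\<close>

text \<open>A global minimiser is out of reach, since the exponential term makes the energy
  unbounded below; this is why the search is confined to a ball. A minimiser in a ball yields the
  equation only if it stays away from the boundary, with room for a shift by a multiple of a test
  function, and for such shifts only the crude bound
  \<open>N (f + t g) \<le> 2 ^ n * (N f + \<bar>t\<bar> ^ n * N g)\<close> is at hand. Hence the
  parameters are arranged so that the energy is nonnegative as soon as \<open>N\<close> exceeds
  \<rho>^n / 2^(n+1); negative energy then keeps the whole sequence below that bound. The
  exponential inequality is proved for compactly supported C1 functions, so the minimisation runs
  over test functions, and their limit inherits the exponential bounds by Fatou's lemma. The infimum
  is taken over functions of both signs although the sequence is chosen nonnegative: passing to
  absolute values does not raise the energy, and variations in both directions remain admissible,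
  which gives an equation and not merely an inequality.\<close>

lemma CkI:
  assumes "\<And>x. (f has_derivative F x) (at x)" and "\<And>b. b \<in> Basis \<Longrightarrow> Ck k (\<lambda>x. F x b)"
  shows "Ck (Suc k) f"
proof -
  have "frechet_derivative f (at x) = F x" for x
    using frechet_derivative_at[OF assms(1)] by simp
  then show ?thesis
    using assms by (auto simp: differentiable_def)
qed

lemma Ck_Suc_has_derivative:
  "Ck (Suc k) f \<Longrightarrow> (f has_derivative frechet_derivative f (at x)) (at x)"
  using frechet_derivative_works by auto

lemma Ck_Suc_lower: "Ck (Suc k) f \<Longrightarrow> Ck k f"
proof (induction k arbitrary: f)
  case 0
  then show ?case
    by (auto intro!: differentiable_imp_continuous_on simp: differentiable_on_def
        intro: differentiable_at_withinI)
next
  case (Suc k)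
  show ?case
    unfolding Ck.simps(2)[of k f] using Suc.IH Suc.prems[unfolded Ck.simps(2)[of "Suc k" f]] by blast
qed

lemma Ck_imp_continuous: "Ck k f \<Longrightarrow> continuous_on UNIV f"
proof (induction k)
  case (Suc k)
  then show ?case using Ck_Suc_lower by blast
qed simp

lemma Ck_const [simp]: "Ck k (\<lambda>x. c)"
proof (induction k arbitrary: c)
  case (Suc k)
  then show ?case by (intro CkI[where F="\<lambda>x v. 0"]) auto
qed simp

lemma Ck_inner [simp]: "Ck k (\<lambda>x. x \<bullet> e)"
proof (cases k)
  case (Suc j)
  then show ?thesis
    by (simp only: Suc) (rule CkI[where F="\<lambda>x v. v \<bullet> e"], auto intro!: derivative_eq_intros)
qed (auto intro!: continuous_intros)

lemma Ck_add: "Ck k f \<Longrightarrow> Ck k g \<Longrightarrow> Ck k (\<lambda>x. f x + g x)"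
proof (induction k arbitrary: f g)
  case (Suc k)
  show ?case
    by (rule CkI[where F="\<lambda>x v. frechet_derivative f (at x) v + frechet_derivative g (at x) v"])
      (use Suc in \<open>auto intro!: has_derivative_add simp: frechet_derivative_works[symmetric]\<close>)
qed (auto intro: continuous_intros)

lemma Ck_mult: "Ck k f \<Longrightarrow> Ck k g \<Longrightarrow> Ck k (\<lambda>x. f x * g x)"
proof (induction k arbitrary: f g)
  case (Suc k)
  show ?case
  proof (rule CkI)
    show "((\<lambda>x. f x * g x) has_derivative
      (\<lambda>v. f x * frechet_derivative g (at x) v + frechet_derivative f (at x) v * g x)) (at x)" for x
      using Suc.prems by (intro has_derivative_mult Ck_Suc_has_derivative)
    show "Ck k (\<lambda>x. f x * frechet_derivative g (at x) b + frechet_derivative f (at x) b * g x)"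
      if "b \<in> Basis" for b
      using Suc that Ck_Suc_lower[OF Suc.prems(1)] Ck_Suc_lower[OF Suc.prems(2)]
      by (auto intro!: Ck_add)
  qed
qed (auto intro: continuous_intros)

lemma Ck_prod: "finite A \<Longrightarrow> (\<And>a. a \<in> A \<Longrightarrow> Ck k (f a)) \<Longrightarrow> Ck k (\<lambda>x. \<Prod>a\<in>A. f a x)"
  by (induction rule: finite_induct) (auto intro: Ck_mult)

text \<open>The derivative of the outer function is a new function, so an induction for a single one
  would not close; it runs over a family that is closed under differentiation. The set
  \<open>S\<close> restricts the requirement to the range of the inner function, so that real powers
  may be composed with positive functions.\<close>

lemma Ck_compose:
  assumes closed: "\<And>g. g \<in> \<G> \<Longrightarrow> \<exists>g'\<in>\<G>. \<forall>y\<in>S. (g has_real_derivative g' y) (at y)"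
    and S: "\<And>x. f x \<in> S"
  shows "Ck k f \<Longrightarrow> g \<in> \<G> \<Longrightarrow> Ck k (\<lambda>x. g (f x))"
proof (induction k arbitrary: g)
  case 0
  obtain g' where "\<forall>y\<in>S. (g has_real_derivative g' y) (at y)"
    using closed[OF 0(2)] by blast
  then have "isCont g (f x)" for x
    using S DERIV_isCont by blast
  moreover have "isCont f x" for x
    using 0(1) by (simp add: continuous_on_eq_continuous_at)
  ultimately show ?case
    by (simp add: continuous_on_eq_continuous_at isCont_o2)
next
  case (Suc k)
  obtain g' where g': "g' \<in> \<G>" "\<And>y. y \<in> S \<Longrightarrow> (g has_real_derivative g' y) (at y)"
    using closed[OF Suc.prems(2)] by blast
  show ?case
  proof (rule CkI)
    show "((\<lambda>x. g (f x)) has_derivative (\<lambda>v. frechet_derivative f (at x) v * g' (f x))) (at x)" for x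
      using DERIV_compose_FDERIV[where f=g and g=f, OF g'(2)[OF S[of x]]]
        Ck_Suc_has_derivative[OF Suc.prems(1)] by simp
    show "Ck k (\<lambda>x. frechet_derivative f (at x) b * g' (f x))" if "b \<in> Basis" for b
      using Suc that g'(1) Ck_Suc_lower[OF Suc.prems(1)] by (auto intro!: Ck_mult)
  qed
qed

lemma smooth_const [simp]: "smooth (\<lambda>x. c)"
  and smooth_inner [simp]: "smooth (\<lambda>x. x \<bullet> e)"
  and smooth_add: "smooth f \<Longrightarrow> smooth g \<Longrightarrow> smooth (\<lambda>x. f x + g x)"
  and smooth_mult: "smooth f \<Longrightarrow> smooth g \<Longrightarrow> smooth (\<lambda>x. f x * g x)"
  by (auto simp: smooth_def intro: Ck_add Ck_mult)

lemma smooth_prod: "finite A \<Longrightarrow> (\<And>a. a \<in> A \<Longrightarrow> smooth (f a)) \<Longrightarrow> smooth (\<lambda>x. \<Prod>a\<in>A. f a x)"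
  by (auto simp: smooth_def intro!: Ck_prod)

lemma smooth_compose:
  assumes "\<And>g. g \<in> \<G> \<Longrightarrow> \<exists>g'\<in>\<G>. \<forall>y\<in>S. (g has_real_derivative g' y) (at y)"
    and "\<And>x. f x \<in> S" "smooth f" "g \<in> \<G>"
  shows "smooth (\<lambda>x. g (f x))"
proof -
  have "Ck k (\<lambda>x. g (f x))" for k
    by (rule Ck_compose[of \<G> S f, OF assms(1,2) _ assms(4)]) (use assms(3) smooth_def in auto)
  then show ?thesis by (simp add: smooth_def)
qed

lemma grad_eqI: "(f has_derivative (\<lambda>v. w \<bullet> v)) (at x) \<Longrightarrow> grad f x = w"
  unfolding grad_def by (subst frechet_derivative_at[symmetric]) (auto simp: euclidean_representation)

lemma has_derivative_grad:
  assumes "f differentiable (at x)"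
  shows "(f has_derivative (\<lambda>v. grad f x \<bullet> v)) (at x)"
proof -
  have D: "(f has_derivative frechet_derivative f (at x)) (at x)"
    using assms frechet_derivative_works by blast
  have lin: "linear (frechet_derivative f (at x))"
    using D has_derivative_linear by blast
  have "frechet_derivative f (at x) v = grad f x \<bullet> v" for v
  proof -
    have "frechet_derivative f (at x) v = frechet_derivative f (at x) (\<Sum>b\<in>Basis. (v \<bullet> b) *\<^sub>R b)"
      by (simp add: euclidean_representation)
    also have "\<dots> = (\<Sum>b\<in>Basis. (v \<bullet> b) * frechet_derivative f (at x) b)"
      using lin by (simp add: linear_sum linear_scale)
    also have "\<dots> = grad f x \<bullet> v"
      by (simp add: grad_def inner_sum_left inner_commute[of v] mult.commute)
    finally show ?thesis .
  qed
  then have "frechet_derivative f (at x) = (\<lambda>v. grad f x \<bullet> v)" by (rule ext)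
  with D show ?thesis by simp
qed

lemma smooth_differentiable: "smooth f \<Longrightarrow> f differentiable (at x)"
  using Ck.simps(2)[of 0 f] unfolding smooth_def by blast

lemma smooth_has_derivative: "smooth f \<Longrightarrow> (f has_derivative (\<lambda>v. grad f x \<bullet> v)) (at x)"
  by (intro has_derivative_grad smooth_differentiable)

lemma smooth_continuous: "smooth f \<Longrightarrow> continuous_on UNIV f"
  unfolding smooth_def by (blast intro: Ck_imp_continuous)

lemma smooth_continuous_grad: "smooth f \<Longrightarrow> continuous_on UNIV (grad f)"
proof -
  assume "smooth f"
  then have "Ck (Suc 0) f" unfolding smooth_def by blast
  then have "\<forall>b\<in>Basis. continuous_on UNIV (\<lambda>x. frechet_derivative f (at x) b)" by simp
  then show ?thesis unfolding grad_def by (auto intro!: continuous_intros)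
qed

lemma grad_add_scaled:
  assumes "smooth f" "smooth g"
  shows "grad (\<lambda>x. f x + c * g x) x = grad f x + c *\<^sub>R grad g x"
  by (rule grad_eqI)
    (auto intro!: derivative_eq_intros smooth_has_derivative assms simp: inner_add_left)

lemma grad_compose:
  assumes "smooth f" "(g has_real_derivative d) (at (f x))"
  shows "grad (\<lambda>x. g (f x)) x = d *\<^sub>R grad f x"
  using DERIV_compose_FDERIV[where f=g and g=f, OF assms(2) smooth_has_derivative[OF assms(1)]]
  by (intro grad_eqI) (simp add: mult.commute)

subsection \<open>Test functions\<close>

lemma test_functions_smooth: "f \<in> test_functions \<Omega> \<Longrightarrow> smooth f"
  by (simp add: test_functions_def)

lemma test_functions_zero: "f \<in> test_functions \<Omega> \<Longrightarrow> x \<notin> \<Omega> \<Longrightarrow> f x = 0"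
  by (auto simp: test_functions_def)

text \<open>The complement of the compact set is open and the function is constant on it, so one set
  supports the gradient as well.\<close>

lemma test_functions_support:
  assumes "f \<in> test_functions \<Omega>"
  obtains K where "compact K" "K \<subseteq> \<Omega>" "\<And>x. x \<notin> K \<Longrightarrow> f x = 0" "\<And>x. x \<notin> K \<Longrightarrow> grad f x = 0"
proof -
  obtain K where K: "compact K" "K \<subseteq> \<Omega>" "\<And>x. x \<notin> K \<Longrightarrow> f x = 0"
    using assms unfolding test_functions_def by blast
  have "grad f x = 0" if "x \<notin> K" for x
  proof (rule grad_eqI)
    have "((\<lambda>x. 0) has_derivative (\<lambda>v. 0 \<bullet> v)) (at x)" by simp
    then show "(f has_derivative (\<lambda>v. 0 \<bullet> v)) (at x)"
      by (rule has_derivative_transform_within_open[where s="- K"])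
        (use that K in \<open>auto simp: compact_imp_closed open_Compl\<close>)
  qed
  with K show ?thesis by (rule that)
qed

lemma test_functions_add_scaled:
  assumes "f \<in> test_functions \<Omega>" "g \<in> test_functions \<Omega>"
  shows "(\<lambda>x. f x + c * g x) \<in> test_functions \<Omega>"
proof -
  obtain K L where "compact K" "K \<subseteq> \<Omega>" "\<And>x. x \<notin> K \<Longrightarrow> f x = 0"
    "compact L" "L \<subseteq> \<Omega>" "\<And>x. x \<notin> L \<Longrightarrow> g x = 0"
    using assms by (auto simp: test_functions_def)
  then show ?thesis
    using assms unfolding test_functions_def
    by (auto intro!: smooth_add smooth_mult exI[of _ "K \<union> L"])
qed

lemma zero_test_function: "(\<lambda>x. 0) \<in> test_functions \<Omega>"
  unfolding test_functions_def by (auto intro: exI[of _ "{}"])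

lemma test_functions_scale: "f \<in> test_functions \<Omega> \<Longrightarrow> (\<lambda>x. c * f x) \<in> test_functions \<Omega>"
  using test_functions_add_scaled[OF zero_test_function, of f] by simp

lemma grad_zero: "grad (\<lambda>x. 0) x = 0"
  by (rule grad_eqI) simp

lemma grad_scale: "smooth f \<Longrightarrow> grad (\<lambda>x. c * f x) x = c *\<^sub>R grad f x"
  using grad_add_scaled[of "\<lambda>x. 0" f c x] by (simp add: grad_zero)

section \<open>A smooth substitute for the absolute value\<close>

text \<open>Subtracting \<epsilon> makes the value at 0 equal to 0, so that composition preserves
  compact support; the slope is at most 1, so that it does not increase the gradient.\<close>

definition soft_abs :: "real \<Rightarrow> real \<Rightarrow> real" where
  "soft_abs \<epsilon> t = sqrt (t\<^sup>2 + \<epsilon>\<^sup>2) - \<epsilon>"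

lemma soft_abs_bounds:
  assumes "\<epsilon> > 0"
  shows "0 \<le> soft_abs \<epsilon> t" "soft_abs \<epsilon> t \<le> \<bar>t\<bar>" "\<bar>t\<bar> - soft_abs \<epsilon> t \<le> \<epsilon>"
proof -
  have "sqrt (\<epsilon>\<^sup>2) \<le> sqrt (t\<^sup>2 + \<epsilon>\<^sup>2)" by (simp only: real_sqrt_le_iff) simp
  then show "0 \<le> soft_abs \<epsilon> t" using assms by (simp add: soft_abs_def)
  have "sqrt (t\<^sup>2) \<le> sqrt (t\<^sup>2 + \<epsilon>\<^sup>2)" by (simp only: real_sqrt_le_iff) simp
  then show "\<bar>t\<bar> - soft_abs \<epsilon> t \<le> \<epsilon>" by (simp add: soft_abs_def)
  show "soft_abs \<epsilon> t \<le> \<bar>t\<bar>"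
    using sqrt_sum_squares_le_sum_abs[of t \<epsilon>] assms by (simp add: soft_abs_def)
qed

lemma soft_abs_deriv:
  assumes "\<epsilon> > 0"
  shows "(soft_abs \<epsilon> has_real_derivative t / sqrt (t\<^sup>2 + \<epsilon>\<^sup>2)) (at t)"
    and "\<bar>t / sqrt (t\<^sup>2 + \<epsilon>\<^sup>2)\<bar> \<le> 1"
proof -
  have pos: "t\<^sup>2 + \<epsilon>\<^sup>2 > 0" using assms by (simp add: sum_power2_gt_zero_iff)
  show "(soft_abs \<epsilon> has_real_derivative t / sqrt (t\<^sup>2 + \<epsilon>\<^sup>2)) (at t)"
    unfolding soft_abs_def using pos by (auto intro!: derivative_eq_intros simp: field_simps)
  have "sqrt (t\<^sup>2) \<le> sqrt (t\<^sup>2 + \<epsilon>\<^sup>2)" by (simp only: real_sqrt_le_iff) simp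
  then show "\<bar>t / sqrt (t\<^sup>2 + \<epsilon>\<^sup>2)\<bar> \<le> 1" using pos by (simp add: abs_divide divide_le_eq)
qed

lemma smooth_sqrt:
  assumes "smooth f" "\<And>x. f x > 0"
  shows "smooth (\<lambda>x. sqrt (f x))"
proof -
  \<comment> \<open>Derivatives of the square root are multiples of other real powers, so the closed
    family consists of all multiples of all real powers on the positive half-line.\<close>
  define \<G> where "\<G> = {g. \<exists>c r. g = (\<lambda>y::real. c * y powr r)}"
  have "\<exists>g'\<in>\<G>. \<forall>y\<in>{0<..}. (g has_real_derivative g' y) (at y)" if "g \<in> \<G>" for g
  proof -
    obtain c r where g: "g = (\<lambda>y::real. c * y powr r)" using \<open>g \<in> \<G>\<close> by (auto simp: \<G>_def)
    show ?thesis
      by (rule bexI[of _ "\<lambda>y. (c * r) * y powr (r - 1)"])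
        (auto simp: g \<G>_def intro!: derivative_eq_intros)
  qed
  moreover have "(\<lambda>y. 1 * y powr (1/2)) \<in> \<G>" unfolding \<G>_def by blast
  ultimately have "smooth (\<lambda>x. 1 * f x powr (1/2))"
    using smooth_compose[of \<G> "{0<..}" f "\<lambda>y. 1 * y powr (1/2)"] assms by simp
  then show ?thesis using assms(2) by (simp add: powr_half_sqrt less_imp_le)
qed

lemma test_functions_soft_abs:
  assumes "\<epsilon> > 0" "f \<in> test_functions \<Omega>"
  shows "(\<lambda>x. soft_abs \<epsilon> (f x)) \<in> test_functions \<Omega>"
proof -
  have f: "smooth f" using assms test_functions_smooth by blast
  have "smooth (\<lambda>x. f x * f x + \<epsilon>\<^sup>2)" by (intro smooth_add smooth_mult f smooth_const)
  moreover have "f x * f x + \<epsilon>\<^sup>2 > 0" for x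
    using assms by (simp add: add_nonneg_pos)
  ultimately have "smooth (\<lambda>x. sqrt (f x * f x + \<epsilon>\<^sup>2) + (- \<epsilon>))"
    using smooth_add[OF smooth_sqrt smooth_const] by blast
  moreover have "soft_abs \<epsilon> 0 = 0" using assms by (simp add: soft_abs_def)
  ultimately show ?thesis
    using assms by (auto simp: test_functions_def soft_abs_def power2_eq_square)
qed

text \<open>The classical smooth function that is flat at 0, multiplied by a polynomial in \<open>1/t\<close>
  so that the family is closed under differentiation.\<close>

definition flat :: "real poly \<Rightarrow> real \<Rightarrow> real" where
  "flat P t = (if t > 0 then poly P (inverse t) * exp (- inverse t) else 0)"

lemma poly_times_exp_minus_tendsto_0:
  "((\<lambda>x::real. poly P x * exp (- x)) \<longlongrightarrow> 0) at_top"
proof -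
  have "((\<lambda>x::real. \<Sum>i\<le>degree P. coeff P i * (x ^ i / exp x)) \<longlongrightarrow> (\<Sum>i\<le>degree P. coeff P i * 0)) at_top"
    by (intro tendsto_intros tendsto_power_div_exp_0)
  then show ?thesis
    by (simp add: poly_altdef exp_minus divide_inverse sum_distrib_right mult.assoc)
qed

text \<open>With s = 1/t the chain rule turns P(s) exp(-s) into s^2 (P - P')(s) exp(-s), which
  explains the polynomial \<open>[:0, 0, 1:]\<close>. At 0 the difference quotient from the right is
  s P(s) exp(-s) with s tending to infinity.\<close>

lemma flat_deriv:
  "(flat P has_real_derivative flat ([:0, 0, 1:] * (P - pderiv P)) t) (at t)"
proof -
  consider "t > 0" | "t < 0" | "t = 0" by linarith
  then show ?thesis
  proof cases
    case 1
    have "((\<lambda>t. poly P (inverse t) * exp (- inverse t)) has_real_derivative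
        flat ([:0, 0, 1:] * (P - pderiv P)) t) (at t)"
      using 1 by (auto intro!: derivative_eq_intros DERIV_chain'[where g="poly P"] poly_DERIV
          simp: flat_def algebra_simps power2_eq_square)
    then show ?thesis
      by (rule has_field_derivative_transform_within_open[where S="{0<..}"])
        (use 1 in \<open>auto simp: flat_def\<close>)
  next
    case 2
    have "((\<lambda>t. 0) has_real_derivative flat ([:0, 0, 1:] * (P - pderiv P)) t) (at t)"
      using 2 by (auto simp: flat_def)
    then show ?thesis
      by (rule has_field_derivative_transform_within_open[where S="{..<0}"])
        (use 2 in \<open>auto simp: flat_def\<close>)
  next
    case 3
    have "((\<lambda>h. flat P h / h) \<longlongrightarrow> 0) (at 0)"
    proof (rule filterlim_split_at)
      have "((\<lambda>h. poly ([:0,1:] * P) (inverse h) * exp (- inverse h)) \<longlongrightarrow> 0) (at_right (0::real))"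
        by (rule filterlim_compose[OF poly_times_exp_minus_tendsto_0 filterlim_inverse_at_top_right])
      then show "((\<lambda>h. flat P h / h) \<longlongrightarrow> 0) (at_right 0)"
        by (rule Lim_transform_eventually)
          (auto simp: flat_def eventually_at_filter divide_inverse)
      show "((\<lambda>h. flat P h / h) \<longlongrightarrow> 0) (at_left 0)"
        by (rule Lim_transform_eventually[OF tendsto_const])
          (auto simp: flat_def eventually_at_filter)
    qed
    then show ?thesis using 3 by (simp add: DERIV_def flat_def)
  qed
qed

lemma smooth_flat: "smooth f \<Longrightarrow> smooth (\<lambda>x. flat P (f x))"
proof -
  assume "smooth f"
  moreover have "\<exists>g'\<in>range flat. \<forall>y\<in>UNIV. (g has_real_derivative g' y) (at y)"
    if "g \<in> range flat" for g
    using that by (auto intro: flat_deriv)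
  ultimately show ?thesis
    using smooth_compose[of "range flat" UNIV f "flat P"] by simp
qed

lemma flat_1_bounds: "0 \<le> flat 1 t" "flat 1 t \<le> 1"
  by (auto simp: flat_def)

lemma flat_1_scaled_tendsto: "(\<lambda>k. flat 1 (real (Suc k) * t)) \<longlonglongrightarrow> indicator {0<..} t"
proof (cases "t > 0")
  case True
  have "(\<lambda>k. inverse (real (Suc k)) * inverse t) \<longlonglongrightarrow> 0 * inverse t"
    by (intro tendsto_intros LIMSEQ_inverse_real_of_nat)
  then have "(\<lambda>k. exp (- (inverse (real (Suc k)) * inverse t))) \<longlonglongrightarrow> exp (- 0)"
    by (intro tendsto_intros) simp
  then show ?thesis using True by (simp add: flat_def zero_less_mult_iff)
next
  case False
  then have "\<not> 0 < real (Suc k) * t" for k by (simp add: zero_less_mult_iff)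
  then show ?thesis using False by (simp add: flat_def del: of_nat_Suc)
qed

text \<open>In each coordinate one flat factor vanishes below the lower face and another one above
  the upper face; the growing scale \<open>real (Suc k)\<close> drives both to 1 strictly between
  them. The product gives bounded pointwise convergence to the indicator without any mollification,
  so test functions can detect integrals over boxes.\<close>

lemma box_approximation:
  fixes a b :: "'a::euclidean_space"
  assumes "cbox a b \<subseteq> \<Omega>"
  obtains f where "\<And>k. f k \<in> test_functions \<Omega>" "\<And>k x. 0 \<le> f k x \<and> f k x \<le> 1"
    "\<And>k x. x \<notin> cbox a b \<Longrightarrow> f k x = 0" "\<And>x. (\<lambda>k. f k x) \<longlonglongrightarrow> indicator (box a b) x"
proof -
  define f :: "nat \<Rightarrow> 'a \<Rightarrow> real" where "f = (\<lambda>k x. \<Prod>i\<in>Basis.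
    flat 1 (real (Suc k) * (x \<bullet> i + - (a \<bullet> i))) * flat 1 (real (Suc k) * (b \<bullet> i + (-1) * (x \<bullet> i))))"
  have zero: "f k x = 0" if x: "x \<notin> box a b" for k x
  proof -
    obtain i where i: "i \<in> Basis" "\<not> (a \<bullet> i < x \<bullet> i) \<or> \<not> (x \<bullet> i < b \<bullet> i)"
      using x by (auto simp: mem_box)
    then have "\<not> 0 < real (Suc k) * (x \<bullet> i + - (a \<bullet> i)) \<or> \<not> 0 < real (Suc k) * (b \<bullet> i + (-1) * (x \<bullet> i))"
      by (simp add: zero_less_mult_iff)
    then have "flat 1 (real (Suc k) * (x \<bullet> i + - (a \<bullet> i))) * flat 1 (real (Suc k) * (b \<bullet> i + (-1) * (x \<bullet> i))) = 0"
      by (auto simp: flat_def simp del: of_nat_Suc)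
    then show ?thesis unfolding f_def using i(1) by (intro prod_zero) auto
  qed
  have sm: "smooth (f k)" for k
    unfolding f_def by (intro smooth_prod smooth_mult smooth_flat smooth_add smooth_const smooth_inner) simp
  show thesis
  proof (rule that)
    show "f k \<in> test_functions \<Omega>" for k
    proof -
      have "\<forall>x. x \<notin> cbox a b \<longrightarrow> f k x = 0" using zero box_subset_cbox by blast
      then show ?thesis unfolding test_functions_def using sm assms by (auto intro: exI[of _ "cbox a b"])
    qed
    show "0 \<le> f k x \<and> f k x \<le> 1" for k x
      unfolding f_def
      by (intro conjI prod_nonneg prod_le_1 mult_nonneg_nonneg mult_le_one flat_1_bounds)
    show "f k x = 0" if "x \<notin> cbox a b" for k x
      using zero that box_subset_cbox by blast
    have "(\<lambda>k. f k x) \<longlonglongrightarrow> (\<Prod>i\<in>Basis. indicator {0<..} (x \<bullet> i + - (a \<bullet> i)) *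
        indicator {0<..} (b \<bullet> i + (-1) * (x \<bullet> i)))" for x
      unfolding f_def by (intro tendsto_prod tendsto_mult flat_1_scaled_tendsto)
    moreover have "(\<Prod>i\<in>Basis. indicator {0<..} (x \<bullet> i + - (a \<bullet> i)) *
        indicator {0<..} (b \<bullet> i + (-1) * (x \<bullet> i))) = (indicator (box a b) x :: real)" for x
    proof (cases "x \<in> box a b")
      case True
      then show ?thesis by (auto simp: mem_box intro!: prod.neutral)
    next
      case False
      then obtain i where "i \<in> Basis" "\<not> (a \<bullet> i < x \<bullet> i) \<or> \<not> (x \<bullet> i < b \<bullet> i)"
        by (auto simp: mem_box)
      then show ?thesis using False by (auto simp: indicator_def intro!: prod_zero bexI[of _ i])
    qed
    ultimately show "(\<lambda>k. f k x) \<longlonglongrightarrow> indicator (box a b) x" for x by simp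
  qed
qed

subsection \<open>Compactly supported functions of class C1\<close>

text \<open>The truncations of test functions used for the exponential estimate are only of class
  C1. The analytic estimates are therefore proved for this wider class, with support and gradient
  carried as explicit arguments.\<close>

definition C1c :: "'a::euclidean_space set \<Rightarrow> ('a \<Rightarrow> real) \<Rightarrow> ('a \<Rightarrow> 'a) \<Rightarrow> bool" where
  "C1c K f g \<longleftrightarrow> compact K \<and> (\<forall>x. (f has_derivative (\<lambda>v. g x \<bullet> v)) (at x)) \<and>
     continuous_on UNIV g \<and> (\<forall>x. x \<notin> K \<longrightarrow> f x = 0 \<and> g x = 0)"

lemma test_functions_C1c:
  assumes "f \<in> test_functions \<Omega>"
  obtains K where "K \<subseteq> \<Omega>" "C1c K f (grad f)"
proof -
  obtain K where "compact K" "K \<subseteq> \<Omega>" "\<And>x. x \<notin> K \<Longrightarrow> f x = 0" "\<And>x. x \<notin> K \<Longrightarrow> grad f x = 0"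
    using test_functions_support[OF assms] by blast
  then show ?thesis
    using test_functions_smooth[OF assms]
    by (intro that[of K]) (auto simp: C1c_def smooth_has_derivative smooth_continuous_grad)
qed

lemma C1c_continuous: "C1c K f g \<Longrightarrow> continuous_on UNIV f"
  by (auto simp: C1c_def intro!: has_derivative_continuous_on)

lemma C1c_measurable:
  assumes "C1c K f g"
  shows "f \<in> borel_measurable borel" "g \<in> borel_measurable borel"
  using assms C1c_continuous[OF assms] by (auto simp: C1c_def intro!: borel_measurable_continuous_onI)

lemma integrable_compact_support:
  fixes f :: "'a::euclidean_space \<Rightarrow> 'b::euclidean_space"
  assumes "continuous_on UNIV f" "compact K" "\<And>x. x \<notin> K \<Longrightarrow> f x = 0"
  shows "integrable lborel f"
proof -
  have "(\<lambda>x. indicator K x *\<^sub>R f x) = f" using assms(3) by (auto simp: indicator_def)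
  then show ?thesis
    using borel_integrable_compact[OF assms(2) continuous_on_subset[OF assms(1)]] by simp
qed

lemma C1c_integrable:
  assumes "C1c K f g"
  shows "integrable lborel f" "integrable lborel g" "integrable lborel (\<lambda>x. \<bar>f x\<bar>)"
    "integrable lborel (\<lambda>x. norm (g x))" "n > 0 \<Longrightarrow> integrable lborel (\<lambda>x. norm (g x) ^ n)"
proof -
  show "integrable lborel f" "integrable lborel g"
    using assms C1c_continuous[OF assms] by (auto simp: C1c_def intro!: integrable_compact_support[of _ K])
  then show "integrable lborel (\<lambda>x. \<bar>f x\<bar>)" "integrable lborel (\<lambda>x. norm (g x))" by auto
  show "integrable lborel (\<lambda>x. norm (g x) ^ n)" if "n > 0"
    using assms that by (auto simp: C1c_def intro!: integrable_compact_support[of _ K] continuous_intros)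
qed

lemma C1c_Lipschitz:
  assumes "C1c K f g"
  obtains L where "L \<ge> 0" "\<And>x. norm (g x) \<le> L" "\<And>x y. \<bar>f x - f y\<bar> \<le> L * norm (x - y)"
proof -
  have "compact (g ` K)" using assms
    by (intro compact_continuous_image) (auto simp: C1c_def intro: continuous_on_subset)
  then obtain L where L: "L > 0" "\<forall>y\<in>g ` K. norm y \<le> L"
    using compact_imp_bounded bounded_pos by metis
  have gL: "norm (g x) \<le> L" for x using L assms by (cases "x \<in> K") (auto simp: C1c_def)
  have "\<bar>f x - f y\<bar> \<le> L * norm (x - y)" for x y
  proof -
    have "norm (f x - f y) \<le> L * norm (x - y)"
    proof (rule differentiable_bound[where S=UNIV and f'="\<lambda>x v. g x \<bullet> v"])
      show "onorm ((\<bullet>) (g x)) \<le> L" for x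
      proof (rule onorm_le)
        show "norm (g x \<bullet> v) \<le> L * norm v" for v
          using order_trans[OF Cauchy_Schwarz_ineq2[of "g x" v] mult_right_mono[OF gL[of x] norm_ge_zero]]
          by simp
      qed
    qed (use assms in \<open>auto simp: C1c_def\<close>)
    then show ?thesis by simp
  qed
  then show ?thesis using that[of L] L gL by simp
qed

section \<open>Translations and integration by parts\<close>

lemma lborel_translation:
  fixes f :: "'a::euclidean_space \<Rightarrow> 'b::euclidean_space"
  assumes "f \<in> borel_measurable borel"
  shows "(\<integral>x. f (x + c) \<partial>lborel) = (\<integral>x. f x \<partial>lborel)"
    and "integrable lborel f \<Longrightarrow> integrable lborel (\<lambda>x. f (x + c))"
proof -
  have D: "distr lborel borel ((+) c) = lborel" by (rule lborel_distr_plus)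
  show "(\<integral>x. f (x + c) \<partial>lborel) = (\<integral>x. f x \<partial>lborel)"
    using integral_distr[of "(+) c" lborel borel f] assms by (simp add: D add.commute)
  show "integrable lborel (\<lambda>x. f (x + c))" if "integrable lborel f"
    using integrable_distr_eq[of "(+) c" lborel borel f] assms that by (simp add: D add.commute)
qed

text \<open>Dominated convergence: the quotients are bounded by the Lipschitz constant and all
  vanish off the support enlarged by \<open>norm v\<close>, because the step lengths
  \<open>1 / real (Suc m)\<close> are at most 1. Two choices of \<open>\<Phi>\<close> are used: the
  identity, for the integral of a gradient, and the absolute value, for the translation
  estimate.\<close>

lemma difference_quotient_integral:
  fixes \<Phi> :: "real \<Rightarrow> real" and v :: "'a::euclidean_space"
  assumes C: "C1c K f g" and \<Phi>: "continuous_on UNIV \<Phi>" "\<And>s. \<bar>\<Phi> s\<bar> \<le> \<bar>s\<bar>"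
  defines "D \<equiv> (\<lambda>m x. \<Phi> (real (Suc m) * (f (x + (1 / real (Suc m)) *\<^sub>R v) - f x)))"
  shows "\<And>m. integrable lborel (D m)"
    and "(\<lambda>m. \<integral>x. D m x \<partial>lborel) \<longlonglongrightarrow> (\<integral>x. \<Phi> (g x \<bullet> v) \<partial>lborel)"
proof -
  obtain L where L: "L \<ge> 0" "\<And>x. norm (g x) \<le> L" "\<And>x y. \<bar>f x - f y\<bar> \<le> L * norm (x - y)"
    using C1c_Lipschitz[OF C] by blast
  define K' where "K' = {x + y | x y. x \<in> K \<and> y \<in> cball 0 (norm v)}"
  have K': "compact K'" unfolding K'_def using C by (intro compact_sums) (auto simp: C1c_def)
  have [measurable]: "f \<in> borel_measurable borel" "g \<in> borel_measurable borel"
    "\<Phi> \<in> borel_measurable borel"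
    using C1c_measurable[OF C] \<Phi>(1) borel_measurable_continuous_onI by auto
  have meas: "D m \<in> borel_measurable lborel" for m unfolding D_def by measurable
  have \<Phi>0: "\<Phi> 0 = 0" using \<Phi>(2)[of 0] by simp
  define w where "w = (\<lambda>x. indicator K' x *\<^sub>R (L * norm v))"
  have w: "integrable lborel w"
    unfolding w_def using K' by (intro borel_integrable_compact) auto
  have bd: "norm (D m x) \<le> w x" for m x
  proof (cases "x \<in> K'")
    case True
    have "\<bar>f (x + (1 / real (Suc m)) *\<^sub>R v) - f x\<bar> \<le> L * (norm v / real (Suc m))"
      using L(3)[of "x + (1 / real (Suc m)) *\<^sub>R v" x] by (simp add: divide_inverse mult.commute)
    then have "real (Suc m) * \<bar>f (x + (1 / real (Suc m)) *\<^sub>R v) - f x\<bar> \<le> L * norm v"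
      by (simp add: field_simps del: of_nat_Suc)
    then have "\<bar>real (Suc m) * (f (x + (1 / real (Suc m)) *\<^sub>R v) - f x)\<bar> \<le> L * norm v"
      by (simp add: abs_mult del: of_nat_Suc)
    then show ?thesis
      using True \<Phi>(2) unfolding D_def w_def by (simp del: of_nat_Suc) (meson order_trans)
  next
    case False
    have 1: "x + (1 / real (Suc m)) *\<^sub>R v \<notin> K"
    proof
      assume a: "x + (1 / real (Suc m)) *\<^sub>R v \<in> K"
      have "- ((1 / real (Suc m)) *\<^sub>R v) \<in> cball 0 (norm v)"
        by (simp add: divide_le_eq mult_le_cancel_left1)
      then have "(x + (1 / real (Suc m)) *\<^sub>R v) + - ((1 / real (Suc m)) *\<^sub>R v) \<in> K'"
        unfolding K'_def using a by blast
      then show False using False by simp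
    qed
    have "x + 0 \<in> K'" if "x \<in> K" unfolding K'_def using that by force
    then have "x \<notin> K" using False by auto
    then have "f x = 0" "f (x + (1 / real (Suc m)) *\<^sub>R v) = 0" using C 1 by (auto simp: C1c_def)
    then show ?thesis unfolding D_def w_def by (simp add: \<Phi>0 False del: of_nat_Suc)
  qed
  show "integrable lborel (D m)" for m
    using order_trans[OF bd abs_ge_self]
    by (intro Bochner_Integration.integrable_bound[OF w meas] AE_I2) simp
  have lim: "(\<lambda>m. D m x) \<longlonglongrightarrow> \<Phi> (g x \<bullet> v)" for x
  proof -
    have "((\<lambda>t. f (x + t *\<^sub>R v)) has_derivative (\<lambda>t. g x \<bullet> (t *\<^sub>R v))) (at 0)"
    proof -
      have "(f has_derivative (\<lambda>v. g x \<bullet> v)) (at (x + 0 *\<^sub>R v))"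
        using C by (simp add: C1c_def)
      moreover have "((\<lambda>t. x + t *\<^sub>R v) has_derivative (\<lambda>t. t *\<^sub>R v)) (at (0::real))"
        by (auto intro!: derivative_eq_intros)
      ultimately show ?thesis
        using has_derivative_compose[of "\<lambda>t. x + t *\<^sub>R v" "\<lambda>t. t *\<^sub>R v" 0 UNIV f "\<lambda>v. g x \<bullet> v"] by simp
    qed
    moreover have "(\<lambda>t. g x \<bullet> (t *\<^sub>R v)) = (*) (g x \<bullet> v)" by (auto simp: mult.commute)
    ultimately have "((\<lambda>t. f (x + t *\<^sub>R v)) has_real_derivative g x \<bullet> v) (at 0)"
      by (simp add: has_field_derivative_def)
    then have "((\<lambda>h. (f (x + h *\<^sub>R v) - f x) / h) \<longlongrightarrow> g x \<bullet> v) (at 0)"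
      by (simp add: DERIV_def)
    moreover have "filterlim (\<lambda>m. 1 / real (Suc m)) (at 0) sequentially"
      using LIMSEQ_inverse_real_of_nat by (auto simp: filterlim_at divide_inverse)
    ultimately have "(\<lambda>m. (f (x + (1 / real (Suc m)) *\<^sub>R v) - f x) / (1 / real (Suc m))) \<longlonglongrightarrow> g x \<bullet> v"
      by (rule filterlim_compose)
    then have "(\<lambda>m. real (Suc m) * (f (x + (1 / real (Suc m)) *\<^sub>R v) - f x)) \<longlonglongrightarrow> g x \<bullet> v"
      by (simp add: mult.commute del: of_nat_Suc)
    moreover have "isCont \<Phi> (g x \<bullet> v)" using \<Phi>(1) by (simp add: continuous_on_eq_continuous_at)
    ultimately show ?thesis unfolding D_def by (rule isCont_tendsto_compose[rotated])
  qed
  show "(\<lambda>m. \<integral>x. D m x \<partial>lborel) \<longlonglongrightarrow> (\<integral>x. \<Phi> (g x \<bullet> v) \<partial>lborel)"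
    by (rule integral_dominated_convergence[where w=w]) (use meas w bd lim in auto)
qed

text \<open>Translation invariance makes every difference quotient integrate to 0, and this passes
  to the limit. Applied to a product it becomes integration by parts.\<close>

lemma C1c_integral_gradient:
  assumes C: "C1c K f g"
  shows "(\<integral>x. g x \<partial>lborel) = 0"
proof (rule euclidean_eqI)
  fix v :: 'a assume "v \<in> Basis"
  have [measurable]: "f \<in> borel_measurable borel" using C1c_measurable[OF C] by auto
  have "(\<integral>x. real (Suc m) * (f (x + (1 / real (Suc m)) *\<^sub>R v) - f x) \<partial>lborel) = 0" for m
    using lborel_translation[of f "(1 / real (Suc m)) *\<^sub>R v"] C1c_integrable(1)[OF C]
    by (simp del: of_nat_Suc)
  then have "(\<lambda>m. 0) \<longlonglongrightarrow> (\<integral>x. g x \<bullet> v \<partial>lborel)"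
    using difference_quotient_integral(2)[OF C, of "\<lambda>s. s" v] by simp
  then have "(\<integral>x. g x \<bullet> v \<partial>lborel) = 0" using LIMSEQ_const_iff by metis
  then show "(\<integral>x. g x \<partial>lborel) \<bullet> v = 0 \<bullet> v" using C1c_integrable(2)[OF C] by simp
qed

text \<open>The shift by \<open>v\<close> is cut into \<open>Suc m\<close> equal steps. By
  translation invariance all steps contribute the same integral, so their sum is the integral of the
  absolute difference quotient for step \<open>v / Suc m\<close>; its limit is the integral of
  \<bar>g \<bullet> v\<bar>. Integration along segments is avoided in this way.\<close>

lemma translation_estimate:
  assumes C: "C1c K f g"
  shows "integrable lborel (\<lambda>x. \<bar>f (x + v) - f x\<bar>)"
    and "(\<integral>x. \<bar>f (x + v) - f x\<bar> \<partial>lborel) \<le> norm v * (\<integral>x. norm (g x) \<partial>lborel)"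
proof -
  have [measurable]: "f \<in> borel_measurable borel" using C1c_measurable[OF C] by auto
  note intf = C1c_integrable(1)[OF C]
  have int: "integrable lborel (\<lambda>x. \<bar>f (x + a) - f (x + b)\<bar>)" for a b
    using lborel_translation(2)[of f, OF _ intf] by (intro integrable_abs Bochner_Integration.integrable_diff) auto
  from int[of v 0] show "integrable lborel (\<lambda>x. \<bar>f (x + v) - f x\<bar>)" by simp
  define D where "D = (\<lambda>m x. \<bar>real (Suc m) * (f (x + (1 / real (Suc m)) *\<^sub>R v) - f x)\<bar>)"
  have "(\<integral>x. \<bar>f (x + v) - f x\<bar> \<partial>lborel) \<le> (\<integral>x. D m x \<partial>lborel)" for m
  proof -
    define w where "w = (1 / real (Suc m)) *\<^sub>R v"
    have w: "real (Suc m) *\<^sub>R w = v" by (simp add: w_def del: of_nat_Suc)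
    have pt: "\<bar>f (x + real k *\<^sub>R w) - f x\<bar> \<le> (\<Sum>i<k. \<bar>f (x + real (Suc i) *\<^sub>R w) - f (x + real i *\<^sub>R w)\<bar>)" for x k
    proof (induction k)
      case (Suc k)
      have "\<bar>f (x + real (Suc k) *\<^sub>R w) - f x\<bar> \<le> \<bar>f (x + real (Suc k) *\<^sub>R w) - f (x + real k *\<^sub>R w)\<bar>
        + \<bar>f (x + real k *\<^sub>R w) - f x\<bar>" by (simp del: of_nat_Suc)
      with Suc show ?case by (simp del: of_nat_Suc)
    qed simp
    have "(\<integral>x. \<bar>f (x + v) - f x\<bar> \<partial>lborel)
      \<le> (\<integral>x. (\<Sum>i<Suc m. \<bar>f (x + real (Suc i) *\<^sub>R w) - f (x + real i *\<^sub>R w)\<bar>) \<partial>lborel)"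
      using int[of v 0] int pt[of _ "Suc m"] by (intro integral_mono) (auto simp del: of_nat_Suc simp: w)
    also have "\<dots> = (\<Sum>i<Suc m. (\<integral>x. \<bar>f (x + real (Suc i) *\<^sub>R w) - f (x + real i *\<^sub>R w)\<bar> \<partial>lborel))"
      using int by (intro Bochner_Integration.integral_sum) auto
    also have "\<dots> = (\<Sum>i<Suc m. (\<integral>x. \<bar>f (x + w) - f x\<bar> \<partial>lborel))"
    proof (intro sum.cong refl)
      fix i
      have "(\<integral>x. \<bar>f (x + real (Suc i) *\<^sub>R w) - f (x + real i *\<^sub>R w)\<bar> \<partial>lborel)
        = (\<integral>x. (\<lambda>x. \<bar>f (x + w) - f x\<bar>) (x + real i *\<^sub>R w) \<partial>lborel)"
        by (simp add: algebra_simps)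
      also have "\<dots> = (\<integral>x. \<bar>f (x + w) - f x\<bar> \<partial>lborel)"
        by (rule lborel_translation(1)) measurable
      finally show "(\<integral>x. \<bar>f (x + real (Suc i) *\<^sub>R w) - f (x + real i *\<^sub>R w)\<bar> \<partial>lborel)
        = (\<integral>x. \<bar>f (x + w) - f x\<bar> \<partial>lborel)" .
    qed
    also have "\<dots> = (\<integral>x. D m x \<partial>lborel)"
      unfolding D_def w_def by (simp add: abs_mult del: of_nat_Suc)
    finally show ?thesis .
  qed
  moreover have "(\<lambda>m. \<integral>x. D m x \<partial>lborel) \<longlonglongrightarrow> (\<integral>x. \<bar>g x \<bullet> v\<bar> \<partial>lborel)"
    unfolding D_def using difference_quotient_integral(2)[OF C, of abs v]
    by (simp add: continuous_intros del: of_nat_Suc)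
  ultimately have "(\<integral>x. \<bar>f (x + v) - f x\<bar> \<partial>lborel) \<le> (\<integral>x. \<bar>g x \<bullet> v\<bar> \<partial>lborel)"
    by (intro LIMSEQ_le_const) auto
  also have "\<dots> \<le> (\<integral>x. norm v * norm (g x) \<partial>lborel)"
    using C1c_integrable[OF C] Cauchy_Schwarz_ineq2[of "g _" v]
    by (intro integral_mono) (auto simp: mult.commute)
  also have "\<dots> = norm v * (\<integral>x. norm (g x) \<partial>lborel)" by simp
  finally show "(\<integral>x. \<bar>f (x + v) - f x\<bar> \<partial>lborel) \<le> norm v * (\<integral>x. norm (g x) \<partial>lborel)" .
qed

lemma integration_by_parts:
  assumes "C1c K f f'" "C1c L h h'"
  shows "(\<integral>x. f x *\<^sub>R h' x \<partial>lborel) = - (\<integral>x. h x *\<^sub>R f' x \<partial>lborel)"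
proof -
  have "((\<lambda>x. f x * h x) has_derivative (\<lambda>v. (f x *\<^sub>R h' x + h x *\<^sub>R f' x) \<bullet> v)) (at x)" for x
    using assms by (auto intro!: derivative_eq_intros simp: C1c_def inner_add_left)
  then have P: "C1c K (\<lambda>x. f x * h x) (\<lambda>x. f x *\<^sub>R h' x + h x *\<^sub>R f' x)"
    using assms C1c_continuous[OF assms(1)] C1c_continuous[OF assms(2)]
    by (auto simp: C1c_def intro!: continuous_intros)
  have i: "integrable lborel (\<lambda>x. f x *\<^sub>R h' x)" "integrable lborel (\<lambda>x. h x *\<^sub>R f' x)"
    using assms C1c_continuous[OF assms(1)] C1c_continuous[OF assms(2)]
    by (auto simp: C1c_def intro!: integrable_compact_support[of _ K] continuous_intros)
  show ?thesis
    using C1c_integral_gradient[OF P] i by (simp add: add_eq_0_iff)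
qed

text \<open>After exchanging the integrals each \<open>v\<close> in the ball costs at most r times
  the mass of the gradient. Working with nonnegative extended integrals reduces the exchange to
  joint measurability.\<close>

lemma averaged_translation_estimate:
  assumes C: "C1c K f g" and r: "r > 0"
  shows "(\<integral>\<^sup>+x. (\<integral>\<^sup>+v. ennreal (indicator (ball 0 r) v * \<bar>f (x + v) - f x\<bar>) \<partial>lborel) \<partial>lborel)
    \<le> ennreal (measure lborel (ball (0::'a::euclidean_space) r) * (r * (\<integral>x. norm (g (x::'a)) \<partial>lborel)))"
proof -
  have [measurable]: "f \<in> borel_measurable borel" using C1c_measurable[OF C] by auto
  have "(\<integral>\<^sup>+x. (\<integral>\<^sup>+v. ennreal (indicator (ball 0 r) v * \<bar>f (x + v) - f x\<bar>) \<partial>lborel) \<partial>lborel)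
    = (\<integral>\<^sup>+v. (\<integral>\<^sup>+x. ennreal (indicator (ball 0 r) v * \<bar>f (x + v) - f x\<bar>) \<partial>lborel) \<partial>lborel)"
  proof (rule lborel_pair.Fubini'[symmetric])
    \<comment> \<open>Joint measurability is checked on the Borel sets of the product space, where
      continuity in the pair of variables suffices.\<close>
    have S: "sets (lborel \<Otimes>\<^sub>M lborel) = sets (borel :: ('a \<times> 'a) measure)"
      by (metis borel_prod sets_lborel sets_pair_measure_cong)
    have "(\<lambda>p. \<bar>f (fst p + snd p) - f (fst p)\<bar>) \<in> borel_measurable borel"
      by (intro borel_measurable_continuous_onI continuous_intros
          continuous_on_compose2[OF C1c_continuous[OF C]]) auto
    moreover have "(\<lambda>p. indicator (ball 0 r) (snd p :: 'a)) \<in> borel_measurable (borel :: ('a \<times> 'a) measure)"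
    proof (rule measurable_compose[of snd borel borel])
      show "snd \<in> borel_measurable (borel :: ('a \<times> 'a) measure)"
        by (rule borel_measurable_continuous_onI) (rule continuous_on_snd[OF continuous_on_id])
    qed (rule borel_measurable_indicator, simp)
    ultimately have "(\<lambda>p. ennreal (indicator (ball 0 r) (snd p) * \<bar>f (fst p + snd p) - f (fst p)\<bar>))
      \<in> borel_measurable (borel :: ('a \<times> 'a) measure)"
      by measurable
    then have "(\<lambda>p. ennreal (indicator (ball 0 r) (snd p) * \<bar>f (fst p + snd p) - f (fst p)\<bar>))
      \<in> borel_measurable (lborel \<Otimes>\<^sub>M lborel)"
      by (subst measurable_cong_sets[OF S refl])
    then show "(\<lambda>(x, v). ennreal (indicator (ball 0 r) v * \<bar>f (x + v) - f x\<bar>))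
      \<in> borel_measurable (lborel \<Otimes>\<^sub>M lborel)"
      by (simp add: case_prod_beta')
  qed
  also have "\<dots> \<le> (\<integral>\<^sup>+v. ennreal (r * (\<integral>x. norm (g x) \<partial>lborel)) * indicator (ball (0::'a) r) v \<partial>lborel)"
  proof (rule nn_integral_mono)
    fix v :: 'a
    show "(\<integral>\<^sup>+x. ennreal (indicator (ball 0 r) v * \<bar>f (x + v) - f x\<bar>) \<partial>lborel)
      \<le> ennreal (r * (\<integral>x. norm (g x) \<partial>lborel)) * indicator (ball (0::'a) r) v"
    proof (cases "v \<in> ball 0 r")
      case True
      have "(\<integral>x. \<bar>f (x + v) - f x\<bar> \<partial>lborel) \<le> norm v * (\<integral>x. norm (g x) \<partial>lborel)"
        using translation_estimate[OF C] by blast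
      also have "\<dots> \<le> r * (\<integral>x. norm (g x) \<partial>lborel)"
        using True by (intro mult_right_mono) (auto intro: Bochner_Integration.integral_nonneg)
      finally show ?thesis
        using True nn_integral_eq_integral[OF translation_estimate(1)[OF C, of v]]
        by (simp add: ennreal_leI)
    qed simp
  qed
  also have "\<dots> = ennreal (r * (\<integral>x. norm (g x) \<partial>lborel)) * emeasure lborel (ball (0::'a) r)"
    by (simp add: nn_integral_cmult_indicator)
  also have "emeasure lborel (ball (0::'a) r) = ennreal (measure lborel (ball (0::'a) r))"
    using emeasure_eq_ennreal_measure[of lborel "ball (0::'a) r"] emeasure_lborel_ball_finite[of 0 r]
    by (simp add: less_top)
  also have "ennreal (r * (\<integral>x. norm (g x) \<partial>lborel)) * ennreal (measure lborel (ball (0::'a) r))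
    = ennreal (r * (\<integral>x. norm (g x) \<partial>lborel) * measure lborel (ball (0::'a) r))"
    by (rule ennreal_mult'[symmetric]) (simp add: r less_imp_le Bochner_Integration.integral_nonneg)
  finally show ?thesis by (simp only: mult.commute)
qed

subsection \<open>Exponential integrability\<close>

text \<open>On the unit interval this is the ramp 1 - (1 - s^2)^2. Its slope 4 s (1 - s^2) vanishes
  at both ends, so truncation with it stays of class C1 and the gradient of the truncation lives on
  the open slab between two levels.\<close>

definition step :: "real \<Rightarrow> real" where
  "step s = 1 - (max 0 (1 - (max 0 s)\<^sup>2))\<^sup>2"

definition step' :: "real \<Rightarrow> real" where
  "step' s = 4 * max 0 (1 - (max 0 s)\<^sup>2) * max 0 s"

lemma max_0_power2_deriv: "((\<lambda>s. (max 0 s)\<^sup>2) has_real_derivative 2 * max 0 s) (at s)"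
proof -
  consider "s > 0" | "s < 0" | "s = 0" by linarith
  then show ?thesis
  proof cases
    case 1
    have "((\<lambda>s. s\<^sup>2) has_real_derivative 2 * max 0 s) (at s)"
      using 1 by (auto intro!: derivative_eq_intros)
    then show ?thesis
      by (rule has_field_derivative_transform_within_open[where S="{0<..}"]) (use 1 in auto)
  next
    case 2
    have "((\<lambda>s. 0) has_real_derivative 2 * max 0 s) (at s)" using 2 by auto
    then show ?thesis
      by (rule has_field_derivative_transform_within_open[where S="{..<0}"]) (use 2 in auto)
  next
    case 3
    have "((\<lambda>h. (max 0 h)\<^sup>2 / h) \<longlongrightarrow> 0) (at (0::real))"
    proof (rule Lim_null_comparison)
      show "\<forall>\<^sub>F h in at (0::real). norm ((max 0 h)\<^sup>2 / h) \<le> \<bar>h\<bar>"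
        by (auto simp: eventually_at_filter max_def power2_eq_square)
      show "((\<lambda>h::real. \<bar>h\<bar>) \<longlongrightarrow> 0) (at 0)"
        using tendsto_rabs_zero[OF tendsto_ident_at] by blast
    qed
    then show ?thesis using 3 by (simp add: DERIV_def)
  qed
qed

lemma step_deriv: "(step has_real_derivative step' s) (at s)"
proof -
  have "((\<lambda>s. (\<lambda>u. (max 0 u)\<^sup>2) (1 - (max 0 s)\<^sup>2)) has_real_derivative
      (2 * max 0 (1 - (max 0 s)\<^sup>2)) * (0 - 2 * max 0 s)) (at s)"
    by (rule DERIV_chain2[OF max_0_power2_deriv]) (intro DERIV_diff DERIV_const max_0_power2_deriv)
  from DERIV_diff[OF DERIV_const[of 1] this] show ?thesis
    unfolding step_def step'_def by (simp add: mult.assoc)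
qed

lemma step_simps:
  "s \<le> 0 \<Longrightarrow> step s = 0" "s \<ge> 1 \<Longrightarrow> step s = 1" "0 \<le> step s" "step s \<le> 1"
proof -
  show "s \<le> 0 \<Longrightarrow> step s = 0" by (simp add: step_def max_def)
  show "step s = 1" if "s \<ge> 1"
  proof -
    have "1 \<le> s\<^sup>2" using that by (rule one_le_power)
    then show ?thesis using that by (simp add: step_def)
  qed
  have "0 \<le> max 0 (1 - (max 0 s)\<^sup>2)" "max 0 (1 - (max 0 s)\<^sup>2) \<le> 1" by auto
  then have "(max 0 (1 - (max 0 s)\<^sup>2))\<^sup>2 \<le> 1" by (intro power_le_one)
  then show "0 \<le> step s" by (simp add: step_def)
  show "step s \<le> 1" by (simp add: step_def)
qed

lemma step'_bound: "\<bar>step' s\<bar> \<le> 4 * indicator {0<..<1} s"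
proof -
  consider "s \<le> 0" | "s \<ge> 1" | "0 < s \<and> s < 1" by linarith
  then show ?thesis
  proof cases
    case 2
    then have "1 \<le> s\<^sup>2" by (rule one_le_power)
    then show ?thesis using 2 by (simp add: step'_def)
  next
    case 3
    then have "s\<^sup>2 < 1" by (simp add: power_less_one_iff)
    then have "0 \<le> (1 - s\<^sup>2) * s" using 3 by (intro mult_nonneg_nonneg) auto
    moreover have "(1 - s\<^sup>2) * s \<le> 1 * 1" using 3 \<open>s\<^sup>2 < 1\<close> by (intro mult_mono) auto
    ultimately show ?thesis using 3 \<open>s\<^sup>2 < 1\<close> by (simp add: step'_def max_def algebra_simps)
  qed (simp add: step'_def)
qed

lemma continuous_step': "continuous_on UNIV step'"
  unfolding step'_def by (intro continuous_intros)

lemma C1c_superlevel_finite: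
  fixes \<phi> :: "'a::euclidean_space \<Rightarrow> real"
  assumes "C1c K \<phi> g" "t \<ge> 0"
  shows "{x. \<phi> x > t} \<in> sets lborel" "emeasure lborel {x. \<phi> x > t} < \<infinity>" "{x. \<phi> x > t} \<subseteq> K"
proof -
  show 1: "{x. \<phi> x > t} \<in> sets lborel"
    using C1c_measurable[OF assms(1)] by auto
  show "{x. \<phi> x > t} \<subseteq> K" using assms by (force simp: C1c_def)
  then have "emeasure lborel {x. \<phi> x > t} \<le> emeasure lborel K"
    using assms by (intro emeasure_mono) (auto simp: C1c_def compact_imp_closed)
  also have "\<dots> < \<infinity>" using assms by (intro emeasure_bounded_finite compact_imp_bounded) (simp add: C1c_def)
  finally show "emeasure lborel {x. \<phi> x > t} < \<infinity>" .
qed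

text \<open>The constant of the level-set estimate; \<open>8 = 2 \<cdot> 4\<close> with 4 the bound for \<open>step'\<close>.\<close>

definition level_const :: "'a::euclidean_space itself \<Rightarrow> real" where
  "level_const _ = 8 * root DIM('a) (2 / measure lborel (ball (0::'a) 1))"

lemma level_const_pos: "level_const TYPE('a::euclidean_space) > 0"
  unfolding level_const_def by (simp add: real_root_gt_zero)

text \<open>A function that equals \<open>\<delta>\<close> on \<open>E = {\<phi> > t + \<delta>}\<close> and vanishes off \<open>P = {\<phi> > t}\<close> has average at
  most \<open>\<delta> / 2\<close> over any ball of volume \<open>2 |P|\<close>, so its gradient must have mass.\<close>

lemma level_set_estimate:
  fixes \<phi> :: "'a::euclidean_space \<Rightarrow> real"
  assumes C: "C1c K \<phi> g" and t: "t \<ge> 0" and \<delta>: "\<delta> > 0" and \<sigma>: "\<sigma> > 0"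
  defines "n \<equiv> DIM('a)"
  defines "A \<equiv> \<integral>x. indicator {x. t < \<phi> x \<and> \<phi> x < t + \<delta>} x * norm (g x) ^ n \<partial>lborel"
  shows "measure lborel {x. \<phi> x > t + \<delta>}
    \<le> level_const TYPE('a) / \<delta> * (\<sigma> + A / \<sigma> ^ (n - 1)) * measure lborel {x. \<phi> x > t}"
proof -
  define P where "P = {x. \<phi> x > t}"
  define E where "E = {x. \<phi> x > t + \<delta>}"
  define Q where "Q = {x. t < \<phi> x \<and> \<phi> x < t + \<delta>}"
  define M where "M = measure lborel P"
  have n: "n > 0" by (simp add: n_def)
  have [measurable]: "\<phi> \<in> borel_measurable borel" "g \<in> borel_measurable borel"
    using C1c_measurable[OF C] by auto
  have Pm: "P \<in> sets lborel" "emeasure lborel P < \<infinity>"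
    using C1c_superlevel_finite[OF C t] by (auto simp: P_def)
  have Em: "E \<in> sets lborel" "emeasure lborel E < \<infinity>"
    using C1c_superlevel_finite[OF C, of "t + \<delta>"] t \<delta> by (auto simp: E_def)
  have EP: "E \<subseteq> P" using \<delta> by (auto simp: E_def P_def)
  have QP: "Q \<subseteq> P" by (auto simp: Q_def P_def)
  have Qm: "Q \<in> sets lborel" unfolding Q_def by measurable
  have Qfin: "emeasure lborel Q < \<infinity>" using emeasure_mono[OF QP Pm(1)] Pm(2) by (simp add: order_le_less_trans)
  have A0: "A \<ge> 0" unfolding A_def by (intro Bochner_Integration.integral_nonneg) auto
  show ?thesis
  proof (cases "M = 0")
    case True
    then have "emeasure lborel P = 0" using Pm(2) by (simp add: M_def measure_def enn2real_eq_0_iff less_top[symmetric])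
    then have "emeasure lborel E = 0" using emeasure_mono[OF EP Pm(1)] by simp
    then show ?thesis using True by (simp add: E_def[symmetric] P_def[symmetric] M_def[symmetric]) (simp add: measure_def)
  next
    case False
    then have M: "M > 0" using measure_nonneg[of lborel P] by (simp add: M_def less_le)
    define y where "y = root n M"
    have y: "y > 0" "y ^ n = M" using M n by (auto simp: y_def real_root_gt_zero)
    define \<omega> where "\<omega> = measure lborel (ball (0::'a) 1)"
    have \<omega>: "\<omega> > 0" unfolding \<omega>_def by simp
    define \<kappa> where "\<kappa> = root n (2 / \<omega>)"
    have \<kappa>: "\<kappa> > 0" "\<kappa> ^ n = 2 / \<omega>" using \<omega> n by (auto simp: \<kappa>_def real_root_gt_zero)
    \<comment> \<open>Since \<kappa>^n = 2 / \<omega> and y^n = M, the ball of this radius has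
      volume 2 M.\<close>
    define r where "r = \<kappa> * y"
    have r: "r > 0" using \<kappa> y by (simp add: r_def)
    have Br: "measure lborel (ball (0::'a) r) = 2 * M"
    proof -
      have "measure lborel (ball (0::'a) r) = r ^ n * \<omega>"
        unfolding \<omega>_def n_def using r content_ball[of r "0::'a"] content_ball[of 1 "0::'a"] by simp
      then show ?thesis using \<kappa> y \<omega> by (simp add: r_def power_mult_distrib)
    qed
    define f where "f = (\<lambda>x. \<delta> * step ((\<phi> x - t) / \<delta>))"
    define f' where "f' = (\<lambda>x. step' ((\<phi> x - t) / \<delta>) *\<^sub>R g x)"
    have Cf: "C1c K f f'"
    proof -
      have "(f has_derivative (\<lambda>v. f' x \<bullet> v)) (at x)" for x
      proof -
        have d1: "((\<lambda>u. \<delta> * step ((u - t) / \<delta>)) has_real_derivative step' ((\<phi> x - t) / \<delta>)) (at (\<phi> x))"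
          using \<delta> by (auto intro!: derivative_eq_intros DERIV_chain2[OF step_deriv])
        have d2: "(\<phi> has_derivative (\<lambda>v. g x \<bullet> v)) (at x)" using C by (simp add: C1c_def)
        show ?thesis
          using DERIV_compose_FDERIV[where f="\<lambda>u. \<delta> * step ((u - t) / \<delta>)" and g=\<phi>, OF d1 d2]
          by (simp add: f_def f'_def mult.commute)
      qed
      moreover have "continuous_on UNIV f'"
        unfolding f'_def using C C1c_continuous[OF C] \<delta>
        by (intro continuous_intros continuous_on_compose2[OF continuous_step']) (auto simp: C1c_def)
      moreover have "f x = 0 \<and> f' x = 0" if "x \<notin> K" for x
        using that C t \<delta> by (auto simp: C1c_def f_def f'_def step_simps)
      ultimately show ?thesis using C by (auto simp: C1c_def)
    qed
    have [measurable]: "f \<in> borel_measurable borel" using C1c_measurable[OF Cf] by auto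
    have fE: "f x = \<delta>" if "x \<in> E" for x
      using that \<delta> by (auto simp: f_def E_def step_simps field_simps)
    have f0: "0 \<le> f x" for x using \<delta> by (simp add: f_def step_simps)
    have fP: "f x \<le> \<delta> * indicator P x" for x
    proof (cases "x \<in> P")
      case True then show ?thesis using \<delta> step_simps(4) by (simp add: f_def)
    next
      case False
      then have "(\<phi> x - t) / \<delta> \<le> 0" using \<delta> by (simp add: P_def divide_le_0_iff)
      then show ?thesis using False by (simp add: f_def step_simps)
    qed
    have intP: "integrable lborel (\<lambda>x. indicator P x :: real)" "(\<integral>x. indicator P x \<partial>lborel) = M"
      using Pm by (auto simp: M_def)
    have int_f: "(\<integral>x. f x \<partial>lborel) \<le> \<delta> * M"
    proof -
      have "(\<integral>x. f x \<partial>lborel) \<le> (\<integral>x. \<delta> * indicator P x \<partial>lborel)"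
        using C1c_integrable(1)[OF Cf] intP fP by (intro integral_mono) auto
      then show ?thesis using intP by simp
    qed
    \<comment> \<open>At a point of \<open>E\<close> the truncation has its maximal value \<delta>.
      Over a ball of volume 2 M the differences therefore integrate to at least 2 M \<delta> minus
      the integral of \<open>f\<close>, which is at most M \<delta>.\<close>
    have inner: "ennreal (\<delta> * M) \<le> (\<integral>\<^sup>+v. ennreal (indicator (ball 0 r) v * \<bar>f (x + v) - f x\<bar>) \<partial>lborel)"
      if "x \<in> E" for x
    proof -
      have ib: "integrable lborel (\<lambda>v. indicator (ball (0::'a) r) v :: real)"
        using emeasure_lborel_ball_finite[of "0::'a" r] by (intro integrable_real_indicator) auto
      have it: "integrable lborel (\<lambda>v. f (v + x))"
        using C1c_integrable(1)[OF Cf] by (intro lborel_translation(2)) auto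
      have [measurable]: "ball (0::'a) r \<in> sets borel" by simp
      have i1: "integrable lborel (\<lambda>v. indicator (ball 0 r) v * \<bar>f (x + v) - f x\<bar>)"
      proof (rule Bochner_Integration.integrable_bound[OF integrable_mult_left[OF ib, of \<delta>]])
        show "AE v in lborel. norm (indicator (ball 0 r) v * \<bar>f (x + v) - f x\<bar>) \<le> norm (indicator (ball 0 r) v * \<delta>)"
        proof (rule AE_I2)
          fix v
          have "f (x + v) \<le> \<delta>" using fP[of "x + v"] \<delta> by (cases "x + v \<in> P") auto
          then show "norm (indicator (ball 0 r) v * \<bar>f (x + v) - f x\<bar>) \<le> norm (indicator (ball 0 r) v * \<delta>)"
            using f0[of "x + v"] \<delta> fE[OF that] by (auto simp: indicator_def)
        qed
      qed measurable
      have "\<delta> * M \<le> (\<integral>v. indicator (ball 0 r) v * \<delta> - f (v + x) \<partial>lborel)"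
        using ib it int_f Br lborel_translation(1)[of f x] by (simp add: algebra_simps)
      also have "\<dots> \<le> (\<integral>v. indicator (ball 0 r) v * \<bar>f (x + v) - f x\<bar> \<partial>lborel)"
      proof (rule integral_mono)
        fix v show "indicator (ball 0 r) v * \<delta> - f (v + x) \<le> indicator (ball 0 r) v * \<bar>f (x + v) - f x\<bar>"
          using f0[of "v + x"] fE[OF that] by (auto simp: indicator_def add.commute)
      qed (use ib it i1 in auto)
      finally show ?thesis
        using nn_integral_eq_integral[OF i1] by (simp add: ennreal_leI)
    qed
    have G: "(\<integral>x. norm (f' x) \<partial>lborel) \<le> 4 * (\<sigma> * y ^ (n - 1) + A * y ^ (n - 1) / \<sigma> ^ (n - 1))"
    proof -
      \<comment> \<open>The gradient is split by c \<le> s + c^n / s^(n-1), in place of Hoelder's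
        inequality. With the threshold \<sigma> / y both contributions are proportional to y^(n-1),
        and \<sigma> remains free.\<close>
      define s where "s = \<sigma> / y"
      have s: "s > 0" using \<sigma> y by (simp add: s_def)
      have iA: "integrable lborel (\<lambda>x. indicator Q x * norm (g x) ^ n)"
      proof (rule Bochner_Integration.integrable_bound[OF C1c_integrable(5)[OF C n]])
        show "AE x in lborel. norm (indicator Q x * norm (g x) ^ n) \<le> norm (norm (g x) ^ n)"
          by (auto simp: indicator_def)
      qed (use Qm in measurable)
      have iQ: "integrable lborel (\<lambda>x. indicator Q x :: real)" "(\<integral>x. indicator Q x \<partial>lborel) \<le> M"
        using Qm Qfin Pm QP by (auto simp: M_def intro!: measure_mono_fmeasurable simp: fmeasurable_def)
      have "norm (f' x) \<le> 4 * (s * indicator Q x + indicator Q x * norm (g x) ^ n / s ^ (n - 1))" for x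
      proof -
        have Qx: "(\<phi> x - t) / \<delta> \<in> {0<..<1} \<longleftrightarrow> x \<in> Q" using \<delta> by (auto simp: Q_def field_simps)
        have "norm (g x) \<le> s + norm (g x) ^ n / s ^ (n - 1)"
        proof (cases "norm (g x) \<le> s")
          case True then show ?thesis using s by (simp add: add_increasing2)
        next
          case False
          then have "s ^ (n - 1) \<le> norm (g x) ^ (n - 1)" using s by (intro power_mono) auto
          then have "norm (g x) * s ^ (n - 1) \<le> norm (g x) * norm (g x) ^ (n - 1)"
            by (intro mult_left_mono) auto
          also have "\<dots> = norm (g x) ^ n" using n by (simp add: power_eq_if)
          finally have "norm (g x) \<le> norm (g x) ^ n / s ^ (n - 1)"
            using s by (simp add: pos_le_divide_eq)
          then show ?thesis using s by simp
        qed
        moreover have "norm (f' x) \<le> 4 * indicator Q x * norm (g x)"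
          unfolding f'_def norm_scaleR using step'_bound[of "(\<phi> x - t) / \<delta>"] Qx
          by (intro mult_right_mono) (auto simp: indicator_def)
        ultimately show ?thesis by (cases "x \<in> Q") auto
      qed
      then have "(\<integral>x. norm (f' x) \<partial>lborel) \<le>
          (\<integral>x. 4 * (s * indicator Q x + indicator Q x * norm (g x) ^ n / s ^ (n - 1)) \<partial>lborel)"
        using C1c_integrable(4)[OF Cf] iA iQ by (intro integral_mono) auto
      also have "\<dots> = 4 * (s * (\<integral>x. indicator Q x \<partial>lborel) + A / s ^ (n - 1))"
        using iA iQ by (simp add: A_def Q_def)
      also have "\<dots> \<le> 4 * (s * M + A / s ^ (n - 1))" using iQ s by simp
      also have "s * M = \<sigma> * y ^ (n - 1)"
        using y n by (simp add: s_def power_eq_if flip: y(2))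
      also have "A / s ^ (n - 1) = A * y ^ (n - 1) / \<sigma> ^ (n - 1)"
        by (simp add: s_def power_divide)
      finally show ?thesis .
    qed
    have "ennreal (\<delta> * M * measure lborel E) = (\<integral>\<^sup>+x. ennreal (\<delta> * M) * indicator E x \<partial>lborel)"
    proof -
      have "(\<integral>\<^sup>+x. ennreal (\<delta> * M) * indicator E x \<partial>lborel) = ennreal (\<delta> * M) * emeasure lborel E"
        using Em by (intro nn_integral_cmult_indicator) auto
      also have "emeasure lborel E = ennreal (measure lborel E)"
        using Em by (intro emeasure_eq_ennreal_measure) auto
      also have "ennreal (\<delta> * M) * ennreal (measure lborel E) = ennreal (\<delta> * M * measure lborel E)"
        using \<delta> M by (intro ennreal_mult'[symmetric]) auto
      finally show ?thesis by simp
    qed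
    also have "\<dots> \<le> (\<integral>\<^sup>+x. (\<integral>\<^sup>+v. ennreal (indicator (ball 0 r) v * \<bar>f (x + v) - f x\<bar>) \<partial>lborel) \<partial>lborel)"
      by (intro nn_integral_mono) (use inner in \<open>auto simp: indicator_def\<close>)
    also have "\<dots> \<le> ennreal (2 * M * (r * (\<integral>x. norm (f' x) \<partial>lborel)))"
      using averaged_translation_estimate[OF Cf r] unfolding Br .
    finally have "\<delta> * M * measure lborel E \<le> 2 * M * (r * (\<integral>x. norm (f' x) \<partial>lborel))"
      using M r by (subst (asm) ennreal_le_iff) (auto intro!: mult_nonneg_nonneg Bochner_Integration.integral_nonneg)
    \<comment> \<open>One factor M cancels here; another one is recovered below as r is a multiple
      of y and the gradient bound a multiple of y^(n-1).\<close>
    then have "M * (\<delta> * measure lborel E) \<le> M * (2 * (r * (\<integral>x. norm (f' x) \<partial>lborel)))" by (simp add: mult_ac)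
    then have "\<delta> * measure lborel E \<le> 2 * (r * (\<integral>x. norm (f' x) \<partial>lborel))" using M by simp
    also have "\<dots> \<le> 2 * (r * (4 * (\<sigma> * y ^ (n - 1) + A * y ^ (n - 1) / \<sigma> ^ (n - 1))))"
      using G r by simp
    also have "\<dots> = 8 * \<kappa> * (\<sigma> + A / \<sigma> ^ (n - 1)) * (y * y ^ (n - 1))"
      by (simp add: r_def algebra_simps)
    also have "y * y ^ (n - 1) = M" using y n by (simp add: power_eq_if)
    also have "8 * \<kappa> = level_const TYPE('a)" by (simp add: level_const_def \<kappa>_def n_def \<omega>_def)
    finally have "\<delta> * measure lborel E \<le> level_const TYPE('a) * (\<sigma> + A / \<sigma> ^ (n - 1)) * M" .
    then have "measure lborel E \<le> level_const TYPE('a) * (\<sigma> + A / \<sigma> ^ (n - 1)) * M / \<delta>"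
      using \<delta> by (simp add: pos_le_divide_eq mult.commute)
    then show ?thesis by (simp add: E_def P_def M_def)
  qed
qed

text \<open>A level step of height \<open>decay_const * \<sigma>\<close> turns the prefactor of the
  level-set estimate into exp(-2).\<close>

definition decay_const :: "'a::euclidean_space itself \<Rightarrow> real" where
  "decay_const _ = exp 2 * level_const TYPE('a)"

lemma decay_const_pos: "decay_const TYPE('a::euclidean_space) > 0"
  by (simp add: decay_const_def level_const_pos)

text \<open>The height is divided into k equal steps with \<sigma>^n = 1/k. A step whose slab
  carries energy A multiplies the measure by at most exp(-2) (1 + k A) \<le> exp(-2 + k A). The
  slabs are disjoint and share total energy at most 1, so the exponents add up to at most -2 k + k =
  -k. The level reached is a multiple of k^(1 - 1/n), the growth that the Moser-Trudinger exponent
  requires.\<close>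

lemma superlevel_decay:
  fixes \<phi> :: "'a::euclidean_space \<Rightarrow> real"
  assumes C: "C1c K \<phi> g" and G: "(\<integral>x. norm (g x) ^ DIM('a) \<partial>lborel) \<le> 1" and k: "k > 0"
  shows "measure lborel {x. \<phi> x > decay_const TYPE('a) * (real k / root DIM('a) (real k))}
    \<le> exp (- real k) * measure lborel {x. \<phi> x > 0}"
proof -
  define n where "n = DIM('a)"
  have n: "n > 0" by (simp add: n_def)
  have [measurable]: "\<phi> \<in> borel_measurable borel" "g \<in> borel_measurable borel"
    using C1c_measurable[OF C] by auto
  define L where "L = level_const TYPE('a)"
  have L: "L > 0" using level_const_pos by (simp add: L_def)
  define \<sigma> where "\<sigma> = 1 / root n (real k)"
  have \<sigma>: "\<sigma> > 0" "\<sigma> ^ n = 1 / real k"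
    using k n by (auto simp: \<sigma>_def real_root_gt_zero power_one_over)
  define \<delta> where "\<delta> = exp 2 * L * \<sigma>"
  have \<delta>: "\<delta> > 0" using L \<sigma> by (simp add: \<delta>_def)
  define A where "A = (\<lambda>i. \<integral>x. indicator {x. real i * \<delta> < \<phi> x \<and> \<phi> x < real i * \<delta> + \<delta>} x * norm (g x) ^ n \<partial>lborel)"
  define \<mu> where "\<mu> = (\<lambda>i. measure lborel {x. \<phi> x > real i * \<delta>})"
  have step: "\<mu> (Suc i) \<le> exp (- 2) * exp (real k * A i) * \<mu> i" for i
  proof -
    have "\<mu> (Suc i) \<le> L / \<delta> * (\<sigma> + A i / \<sigma> ^ (n - 1)) * \<mu> i"
      using level_set_estimate[OF C _ \<delta> \<sigma>(1), of "real i * \<delta>"] \<delta>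
      by (simp add: \<mu>_def A_def L_def n_def algebra_simps)
    also have "L / \<delta> * (\<sigma> + A i / \<sigma> ^ (n - 1)) = exp (- 2) * (1 + real k * A i)"
    proof -
      have "\<sigma> ^ n = \<sigma> * \<sigma> ^ (n - 1)" using n by (simp add: power_eq_if)
      then have "A i / \<sigma> ^ (n - 1) = \<sigma> * (A i / \<sigma> ^ n)" using \<sigma>(1) by simp
      also have "\<dots> = \<sigma> * (real k * A i)" by (simp add: \<sigma>(2) mult.commute)
      finally have "L / \<delta> * (\<sigma> + A i / \<sigma> ^ (n - 1)) = L * \<sigma> / \<delta> * (1 + real k * A i)"
        by (simp add: algebra_simps)
      also have "L * \<sigma> / \<delta> = exp (- 2)" using L \<sigma>(1) by (simp add: \<delta>_def exp_minus field_simps)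
      finally show ?thesis .
    qed
    also have "exp (- 2) * (1 + real k * A i) * \<mu> i \<le> exp (- 2) * exp (real k * A i) * \<mu> i"
      by (intro mult_right_mono mult_left_mono exp_ge_add_one_self) (auto simp: \<mu>_def)
    finally show ?thesis .
  qed
  have iter: "\<mu> j \<le> exp (- 2 * real j + real k * (\<Sum>i<j. A i)) * \<mu> 0" for j
  proof (induction j)
    case (Suc j)
    have "\<mu> (Suc j) \<le> exp (- 2) * exp (real k * A j) * (exp (- 2 * real j + real k * (\<Sum>i<j. A i)) * \<mu> 0)"
      by (rule order_trans[OF step mult_left_mono[OF Suc]]) simp
    also have "\<dots> = exp (- 2 * real (Suc j) + real k * (\<Sum>i<Suc j. A i)) * \<mu> 0"
      by (simp add: algebra_simps exp_add[symmetric])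
    finally show ?case .
  qed simp
  have "(\<Sum>i<k. A i) \<le> 1"
  proof -
    let ?I = "\<lambda>i x. indicator {x. real i * \<delta> < \<phi> x \<and> \<phi> x < real i * \<delta> + \<delta>} x :: real"
    have ii: "integrable lborel (\<lambda>x. ?I i x * norm (g x) ^ n)" for i
    proof (rule Bochner_Integration.integrable_bound[OF C1c_integrable(5)[OF C n]])
      show "AE x in lborel. norm (?I i x * norm (g x) ^ n) \<le> norm (norm (g x) ^ n)"
        by (auto simp: indicator_def)
    qed measurable
    \<comment> \<open>At most one slab contains x. Recording whether x lies below the top level is
      what lets the induction add the next slab.\<close>
    have le: "(\<Sum>i<j. ?I i x) \<le> (if \<phi> x < real j * \<delta> then 1 else 0)" for j x
    proof (induction j)
      case (Suc j)
      then show ?case using \<delta> by (auto simp: indicator_def algebra_simps split: if_splits)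
    qed simp
    have "(\<Sum>i<k. A i) = (\<integral>x. (\<Sum>i<k. ?I i x * norm (g x) ^ n) \<partial>lborel)"
      unfolding A_def using ii by (intro Bochner_Integration.integral_sum[symmetric]) auto
    also have "\<dots> \<le> (\<integral>x. norm (g x) ^ n \<partial>lborel)"
    proof (rule integral_mono)
      fix x
      have "(\<Sum>i<k. ?I i x) \<le> 1" using le[of x k] by (auto split: if_splits)
      then have "(\<Sum>i<k. ?I i x) * norm (g x) ^ n \<le> 1 * norm (g x) ^ n" by (intro mult_right_mono) auto
      then show "(\<Sum>i<k. ?I i x * norm (g x) ^ n) \<le> norm (g x) ^ n" by (simp add: sum_distrib_right)
    qed (intro Bochner_Integration.integrable_sum ii C1c_integrable(5)[OF C n])+
    finally show ?thesis using G by (simp add: n_def)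
  qed
  then have "real k * (\<Sum>i<k. A i) \<le> real k * 1" by (intro mult_left_mono) auto
  then have "exp (- 2 * real k + real k * (\<Sum>i<k. A i)) * \<mu> 0 \<le> exp (- real k) * \<mu> 0"
    by (intro mult_right_mono) (auto simp: \<mu>_def)
  with iter[of k] have "\<mu> k \<le> exp (- real k) * \<mu> 0" by linarith
  moreover have "real k * \<delta> = decay_const TYPE('a) * (real k / root n (real k))"
    by (simp add: \<delta>_def decay_const_def L_def \<sigma>_def)
  ultimately show ?thesis by (simp add: \<mu>_def n_def)
qed

section \<open>The Moser-Trudinger inequality\<close>

definition mt_exponent :: "'a::euclidean_space itself \<Rightarrow> real" where
  "mt_exponent _ = real DIM('a) / (real DIM('a) - 1)"

text \<open>With B the decay constant, the rate times B^\<beta> is 1/2: from one level to the next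
  the integrand grows by exp(1/2) while the measure of the superlevel set shrinks by exp(-1). The
  rate is not optimal, which does no harm because the radius of the ball can be made small.\<close>

definition mt_rate :: "'a::euclidean_space itself \<Rightarrow> real" where
  "mt_rate _ = 1 / (2 * decay_const TYPE('a) powr mt_exponent TYPE('a))"

lemma mt_rate_pos: "mt_rate TYPE('a::euclidean_space) > 0"
  using decay_const_pos[where 'a='a] by (simp add: mt_rate_def)

text \<open>The k-th term is the integrand bound exp((k + 1)/2) times the measure bound 2 exp(-k);
  the leading 1 accounts for the zero set of the function.\<close>

definition mt_bound :: real where
  "mt_bound = 1 + (\<Sum>k. 2 * exp (1 / 2) * exp (- 1 / 2) ^ k)"

text \<open>The levels B k^(1/\<beta>) are those of the decay estimate. Between levels k and k + 1
  the integrand is at most exp((k + 1)/2), and the set above level k has measure at most 2 exp(-k)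
  times that of \<Omega>, the factor 2 coming from \<phi> and its negative. The resulting series is
  geometric.\<close>

lemma moser_trudinger:
  fixes \<phi> :: "'a::euclidean_space \<Rightarrow> real"
  assumes C: "C1c K \<phi> g" and G: "(\<integral>x. norm (g x) ^ DIM('a) \<partial>lborel) \<le> 1"
    and \<Omega>: "\<Omega> \<in> sets borel" "bounded \<Omega>" "K \<subseteq> \<Omega>" and dim: "DIM('a) \<ge> 2"
  shows "integrable (lebesgue_on \<Omega>) (\<lambda>x. exp (mt_rate TYPE('a) * \<bar>\<phi> x\<bar> powr mt_exponent TYPE('a)))"
    and "(\<integral>x. exp (mt_rate TYPE('a) * \<bar>\<phi> x\<bar> powr mt_exponent TYPE('a)) \<partial>lebesgue_on \<Omega>)
      \<le> mt_bound * measure lebesgue \<Omega>"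
proof -
  define n where "n = DIM('a)"
  have n: "n \<ge> 2" using dim by (simp add: n_def)
  define B where "B = decay_const TYPE('a)"
  have B: "B > 0" using decay_const_pos by (simp add: B_def)
  define \<beta> where "\<beta> = mt_exponent TYPE('a)"
  have \<beta>: "\<beta> > 0" "1 / \<beta> = 1 - 1 / real n" using n by (auto simp: \<beta>_def mt_exponent_def n_def field_simps)
  define \<alpha> where "\<alpha> = mt_rate TYPE('a)"
  have \<alpha>: "\<alpha> * B powr \<beta> = 1 / 2" using B by (simp add: \<alpha>_def mt_rate_def B_def \<beta>_def)
  define V where "V = measure lborel \<Omega>"
  have \<Omega>fin: "emeasure lborel \<Omega> < \<infinity>" using \<Omega>(2) by (rule emeasure_bounded_finite)
  have V: "emeasure lborel \<Omega> = ennreal V" "V \<ge> 0"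
    unfolding V_def using \<Omega>fin by (auto intro!: emeasure_eq_ennreal_measure)
  have [measurable]: "\<phi> \<in> borel_measurable borel" "\<Omega> \<in> sets borel"
    using C1c_measurable[OF C] \<Omega> by auto
  define T where "T = (\<lambda>k::nat. B * real k powr (1 / \<beta>))"
  have T: "T k = B * (real k / root n (real k))" if "k > 0" for k
  proof -
    have "real k powr (1 - 1 / real n) = real k / root n (real k)"
      using that n by (simp add: powr_diff root_powr_inverse)
    then show ?thesis by (simp add: T_def \<beta>(2))
  qed
  define a where "a = (\<lambda>k::nat. 2 * exp (1 / 2) * exp (- 1 / 2 :: real) ^ k)"
  have sum_a: "summable a" unfolding a_def by (intro summable_mult summable_geometric) simp
  have half: "emeasure lborel {x. \<psi> x > T k} \<le> ennreal (exp (- real k) * V)"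
    if \<psi>: "C1c K \<psi> g'" "(\<integral>x. norm (g' x) ^ n \<partial>lborel) \<le> 1" for \<psi> g' k
  proof -
    note fin = C1c_superlevel_finite[OF \<psi>(1)]
    have T0: "T k \<ge> 0" using B by (simp add: T_def)
    have "measure lborel {x. \<psi> x > 0} \<le> V"
      unfolding V_def using fin[of 0] \<Omega> \<Omega>fin by (intro measure_mono_fmeasurable) (auto simp: fmeasurable_def)
    moreover have "measure lborel {x. \<psi> x > T k} \<le> exp (- real k) * measure lborel {x. \<psi> x > 0}"
    proof (cases "k = 0")
      case False
      then show ?thesis
        using superlevel_decay[OF \<psi>(1), of k] \<psi>(2) T[of k] by (simp add: n_def B_def)
    qed (simp add: T_def)
    ultimately have "measure lborel {x. \<psi> x > T k} \<le> exp (- real k) * V"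
      by (meson exp_ge_zero mult_left_mono order_trans)
    moreover have "emeasure lborel {x. \<psi> x > T k} = ennreal (measure lborel {x. \<psi> x > T k})"
      using fin(2)[OF T0] by (intro emeasure_eq_ennreal_measure) auto
    ultimately show ?thesis by (simp add: ennreal_leI)
  qed
  have Cm: "C1c K (\<lambda>x. - \<phi> x) (\<lambda>x. - g x)"
    using C by (auto simp: C1c_def intro!: has_derivative_minus continuous_intros)
  have lev: "emeasure lborel {x. \<bar>\<phi> x\<bar> > T k} \<le> ennreal (2 * exp (- real k) * V)" for k
  proof -
    have "{x. \<bar>\<phi> x\<bar> > T k} = {x. \<phi> x > T k} \<union> {x. - \<phi> x > T k}" by auto
    then have "emeasure lborel {x. \<bar>\<phi> x\<bar> > T k} \<le> emeasure lborel {x. \<phi> x > T k} + emeasure lborel {x. - \<phi> x > T k}"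
      using emeasure_subadditive[of "{x. \<phi> x > T k}" lborel "{x. - \<phi> x > T k}"] by simp
    also have "\<dots> \<le> ennreal (exp (- real k) * V) + ennreal (exp (- real k) * V)"
      using half[OF C] half[OF Cm] G by (intro add_mono) (auto simp: n_def)
    also have "\<dots> = ennreal (2 * exp (- real k) * V)"
      using V by (subst ennreal_plus[symmetric]) auto
    finally show ?thesis .
  qed
  define F where "F = (\<lambda>x. exp (\<alpha> * \<bar>\<phi> x\<bar> powr \<beta>))"
  have Fm [measurable]: "F \<in> borel_measurable borel" unfolding F_def by measurable
  have pt: "ennreal (F x) \<le> 1 + (\<Sum>k. ennreal (exp ((real k + 1) / 2)) * indicator {x. \<bar>\<phi> x\<bar> > T k} x)" for x
  proof (cases "\<phi> x = 0")
    case True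
    then show ?thesis by (simp add: F_def)
  next
    case False
    define y where "y = (\<bar>\<phi> x\<bar> / B) powr \<beta>"
    have y: "y > 0" using False B by (simp add: y_def)
    have \<phi>y: "\<bar>\<phi> x\<bar> = B * y powr (1 / \<beta>)" 
    proof -
      have "\<beta> * (1 / \<beta>) = 1" using \<beta>(1) by simp
      then have "y powr (1 / \<beta>) = \<bar>\<phi> x\<bar> / B"
        unfolding y_def powr_powr using B by simp
      then show ?thesis using B by simp
    qed
    \<comment> \<open>The index with k < y \<le> k + 1. The strict inequality on the left puts x
      strictly above level k, as the superlevel set demands.\<close>
    define k where "k = nat (\<lceil>y\<rceil> - 1)"
    have k: "real k < y" "y \<le> real k + 1" using y by (auto simp: k_def) linarith+
    have "T k < \<bar>\<phi> x\<bar>" unfolding \<phi>y T_def using B k \<beta>(1) by (simp add: powr_less_mono2)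
    have "\<alpha> * \<bar>\<phi> x\<bar> powr \<beta> = \<alpha> * B powr \<beta> * y"
      unfolding \<phi>y using y B \<beta>(1) by (simp add: powr_mult powr_powr)
    then have "F x \<le> exp ((real k + 1) / 2)" using k \<alpha> by (simp add: F_def)
    define f where "f = (\<lambda>k. ennreal (exp ((real k + 1) / 2)) * indicator {x. \<bar>\<phi> x\<bar> > T k} x)"
    have "ennreal (F x) \<le> f k"
      using \<open>F x \<le> _\<close> \<open>T k < \<bar>\<phi> x\<bar>\<close> by (simp add: f_def ennreal_leI)
    also have "f k = sum f {k}" by simp
    also have "\<dots> \<le> suminf f" by (rule sum_le_suminf) auto
    finally have "ennreal (F x) \<le> suminf f" .
    then show ?thesis by (simp add: f_def add_increasing)
  qed
  have "(\<integral>\<^sup>+x. ennreal (F x) * indicator \<Omega> x \<partial>lborel)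
    \<le> (\<integral>\<^sup>+x. indicator \<Omega> x + (\<Sum>k. ennreal (exp ((real k + 1) / 2)) * indicator {x. \<bar>\<phi> x\<bar> > T k} x) \<partial>lborel)"
    by (intro nn_integral_mono) (use pt in \<open>auto simp: indicator_def\<close>)
  also have "\<dots> = emeasure lborel \<Omega> + (\<Sum>k. ennreal (exp ((real k + 1) / 2)) * emeasure lborel {x. \<bar>\<phi> x\<bar> > T k})"
    by (simp add: nn_integral_add nn_integral_suminf nn_integral_cmult)
  also have "\<dots> \<le> ennreal V + (\<Sum>k. ennreal (a k * V))"
  proof (intro add_mono suminf_le allI)
    fix k
    have "ennreal (exp ((real k + 1) / 2)) * emeasure lborel {x. \<bar>\<phi> x\<bar> > T k}
      \<le> ennreal (exp ((real k + 1) / 2)) * ennreal (2 * exp (- real k) * V)"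
      by (intro mult_left_mono lev) auto
    also have "\<dots> = ennreal (exp ((real k + 1) / 2) * (2 * exp (- real k) * V))"
      by (intro ennreal_mult'[symmetric]) auto
    also have "exp ((real k + 1) / 2) * (2 * exp (- real k) * V) = a k * V"
    proof -
      have "exp ((real k + 1) / 2) * exp (- real k) = exp (1 / 2) * exp (- 1 / 2) ^ k"
        by (simp add: exp_add[symmetric] exp_of_nat_mult[symmetric] field_simps)
      then show ?thesis by (simp add: a_def)
    qed
    finally show "ennreal (exp ((real k + 1) / 2)) * emeasure lborel {x. \<bar>\<phi> x\<bar> > T k} \<le> ennreal (a k * V)" .
  qed (use V in auto)
  also have "(\<Sum>k. ennreal (a k * V)) = ennreal (suminf a * V)"
    using V sum_a summable_mult2[OF sum_a, of V]
    by (subst suminf_ennreal2) (auto simp: a_def suminf_mult2)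
  also have "ennreal V + ennreal (suminf a * V) = ennreal (mt_bound * V)"
    using V sum_a by (subst ennreal_plus[symmetric])
      (auto simp: mt_bound_def a_def algebra_simps intro!: mult_nonneg_nonneg suminf_nonneg)
  finally have main: "(\<integral>\<^sup>+x. ennreal (F x) * indicator \<Omega> x \<partial>lborel) \<le> ennreal (mt_bound * V)" .
  have mb: "mt_bound * V \<ge> 0" using V sum_a
    by (auto simp: mt_bound_def a_def intro!: mult_nonneg_nonneg add_nonneg_nonneg suminf_nonneg)
  have "(\<integral>\<^sup>+x. ennreal (F x) \<partial>lebesgue_on \<Omega>) = (\<integral>\<^sup>+x. ennreal (F x) * indicator \<Omega> x \<partial>lebesgue)"
    using \<Omega>(1) by (intro nn_integral_restrict_space) simp
  also have "\<dots> = (\<integral>\<^sup>+x. ennreal (F x) * indicator \<Omega> x \<partial>lborel)"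
    by (intro nn_integral_completion)
  finally have nn: "(\<integral>\<^sup>+x. ennreal (F x) \<partial>lebesgue_on \<Omega>) \<le> ennreal (mt_bound * V)" using main by simp
  have Fl: "F \<in> borel_measurable (lebesgue_on \<Omega>)"
    using Fm by (intro measurable_restrict_space1) (simp add: measurable_completion)
  have F0: "F x \<ge> 0" for x by (simp add: F_def)
  have int: "integrable (lebesgue_on \<Omega>) F"
    using Fl nn F0 by (intro integrableI_nonneg) (auto intro: order_le_less_trans)
  then show "integrable (lebesgue_on \<Omega>) (\<lambda>x. exp (mt_rate TYPE('a) * \<bar>\<phi> x\<bar> powr mt_exponent TYPE('a)))"
    by (simp add: F_def \<alpha>_def \<beta>_def)
  have "ennreal (\<integral>x. F x \<partial>lebesgue_on \<Omega>) \<le> ennreal (mt_bound * V)"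
    using nn nn_integral_eq_integral[OF int] F0 by simp
  then have "(\<integral>x. F x \<partial>lebesgue_on \<Omega>) \<le> mt_bound * V" using mb by simp
  moreover have "V = measure lebesgue \<Omega>" unfolding V_def using \<Omega>(1) by simp
  ultimately show "(\<integral>x. exp (mt_rate TYPE('a) * \<bar>\<phi> x\<bar> powr mt_exponent TYPE('a)) \<partial>lebesgue_on \<Omega>)
      \<le> mt_bound * measure lebesgue \<Omega>"
    by (simp add: F_def \<alpha>_def \<beta>_def)
qed

subsection \<open>Compactness in L1\<close>

text \<open>A shift by 3 R exceeds the diameter of the ball, so the function and its translate have
  disjoint supports and their difference has exactly twice the L1 norm. The translation estimate
  then gives the constant 3 R / 2, which is rounded up.\<close>

lemma C1c_Poincare_L1:
  fixes f :: "'a::euclidean_space \<Rightarrow> real"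
  assumes C: "C1c K f g" and K: "K \<subseteq> cball 0 R" and R: "R > 0"
  shows "(\<integral>x. \<bar>f x\<bar> \<partial>lborel) \<le> 2 * R * (\<integral>x. norm (g x) \<partial>lborel)"
proof -
  have [measurable]: "f \<in> borel_measurable borel" using C1c_measurable[OF C] by auto
  obtain b :: 'a where b: "b \<in> Basis" using nonempty_Basis by blast
  define v where "v = (3 * R) *\<^sub>R b"
  have nv: "norm v = 3 * R" using R b by (simp add: v_def)
  have disj: "f x = 0 \<or> f (x + v) = 0" for x
  proof (rule ccontr)
    assume "\<not> (f x = 0 \<or> f (x + v) = 0)"
    then have "x \<in> cball 0 R" "x + v \<in> cball 0 R" using C K by (auto simp: C1c_def)
    then have "norm ((x + v) - x) \<le> R + R"
      using norm_triangle_ineq4[of "x + v" x] by simp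
    then show False using nv R by simp
  qed
  have "(\<integral>x. \<bar>f x\<bar> \<partial>lborel) + (\<integral>x. \<bar>f (x + v)\<bar> \<partial>lborel) = (\<integral>x. \<bar>f x\<bar> + \<bar>f (x + v)\<bar> \<partial>lborel)"
    using C1c_integrable(3)[OF C] lborel_translation(2)[of "\<lambda>x. \<bar>f x\<bar>" v]
    by (intro Bochner_Integration.integral_add[symmetric]) auto
  also have "(\<lambda>x. \<bar>f x\<bar> + \<bar>f (x + v)\<bar>) = (\<lambda>x. \<bar>f (x + v) - f x\<bar>)"
  proof
    fix x show "\<bar>f x\<bar> + \<bar>f (x + v)\<bar> = \<bar>f (x + v) - f x\<bar>" using disj[of x] by auto
  qed
  also have "(\<integral>x. \<bar>f (x + v) - f x\<bar> \<partial>lborel) \<le> norm v * (\<integral>x. norm (g x) \<partial>lborel)"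
    by (rule translation_estimate(2)[OF C])
  finally have "2 * (\<integral>x. \<bar>f x\<bar> \<partial>lborel) \<le> 3 * R * (\<integral>x. norm (g x) \<partial>lborel)"
    using lborel_translation(1)[of "\<lambda>x. \<bar>f x\<bar>" v] nv by simp
  moreover have "0 \<le> R * (\<integral>x. norm (g x) \<partial>lborel)" using R by simp
  ultimately show ?thesis by linarith
qed

definition ball_average :: "real \<Rightarrow> ('a::euclidean_space \<Rightarrow> real) \<Rightarrow> 'a \<Rightarrow> real" where
  "ball_average r f x =
     (\<integral>v. indicator (ball 0 r) v * f (x + v) \<partial>lborel) / measure lborel (ball (0::'a) r)"

text \<open>These are the ingredients of compactness. For a fixed radius the averages are bounded
  and equi-Lipschitz in terms of L1 norms of the function and its gradient alone; as the radius
  shrinks they approach the function in L1 at a rate governed by the mass of the gradient.\<close>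

lemma ball_average:
  fixes f :: "'a::euclidean_space \<Rightarrow> real"
  assumes C: "C1c K f g" and r: "r > 0"
  defines "b \<equiv> measure lborel (ball (0::'a) r)"
  shows "\<bar>ball_average r f x\<bar> \<le> (\<integral>x. \<bar>f x\<bar> \<partial>lborel) / b"
    and "\<bar>ball_average r f x - ball_average r f y\<bar> \<le> norm (x - y) * (\<integral>x. norm (g x) \<partial>lborel) / b"
    and "continuous_on UNIV (ball_average r f)"
    and "(\<integral>\<^sup>+x. ennreal \<bar>f x - ball_average r f x\<bar> \<partial>lborel) \<le> ennreal (r * (\<integral>x. norm (g x) \<partial>lborel))"
proof -
  have b: "b > 0" unfolding b_def using r by simp
  have [measurable]: "f \<in> borel_measurable borel" "ball (0::'a) r \<in> sets borel"
    using C1c_measurable[OF C] by auto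
  note intf = C1c_integrable(1)[OF C]
  have itf: "integrable lborel (\<lambda>v. f (x + v))" for x
    using lborel_translation(2)[of f x] intf by (simp add: add.commute)
  have it: "integrable lborel (\<lambda>v. indicator (ball 0 r) v * f (x + v))" for x
    using integrable_mult_indicator[of "ball (0::'a) r" lborel, OF _ itf[of x]] by simp
  have ib: "integrable lborel (\<lambda>v. indicator (ball (0::'a) r) v :: real)" "(\<integral>v. indicator (ball (0::'a) r) v \<partial>lborel) = b"
    using emeasure_lborel_ball_finite[of "0::'a" r] unfolding b_def by (auto intro!: integrable_real_indicator)
  have "\<bar>\<integral>v. indicator (ball 0 r) v * f (x + v) \<partial>lborel\<bar> \<le> (\<integral>v. \<bar>f (x + v)\<bar> \<partial>lborel)" for x
  proof -
    have "\<bar>\<integral>v. indicator (ball 0 r) v * f (x + v) \<partial>lborel\<bar> \<le> (\<integral>v. \<bar>indicator (ball 0 r) v * f (x + v)\<bar> \<partial>lborel)"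
      using integral_norm_bound[of lborel "\<lambda>v. indicator (ball 0 r) v * f (x + v)"] by simp
    also have "\<dots> \<le> (\<integral>v. \<bar>f (x + v)\<bar> \<partial>lborel)"
      using it itf by (intro integral_mono) (auto simp: indicator_def)
    finally show ?thesis .
  qed
  moreover have "(\<integral>v. \<bar>f (x + v)\<bar> \<partial>lborel) = (\<integral>x. \<bar>f x\<bar> \<partial>lborel)" for x
    using lborel_translation(1)[of "\<lambda>v. \<bar>f v\<bar>" x] by (simp add: add.commute)
  ultimately show "\<bar>ball_average r f x\<bar> \<le> (\<integral>x. \<bar>f x\<bar> \<partial>lborel) / b"
    unfolding ball_average_def b_def[symmetric] using b by (simp add: abs_divide divide_right_mono)
  show lip: "\<bar>ball_average r f x - ball_average r f y\<bar> \<le> norm (x - y) * (\<integral>x. norm (g x) \<partial>lborel) / b" for x y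
  proof -
    have "ball_average r f x - ball_average r f y
      = (\<integral>v. indicator (ball 0 r) v * f (x + v) - indicator (ball 0 r) v * f (y + v) \<partial>lborel) / b"
      unfolding ball_average_def b_def[symmetric] using it by (simp add: diff_divide_distrib)
    moreover have "\<bar>\<integral>v. indicator (ball 0 r) v * f (x + v) - indicator (ball 0 r) v * f (y + v) \<partial>lborel\<bar>
      \<le> norm (x - y) * (\<integral>x. norm (g x) \<partial>lborel)"
    proof -
      have "\<bar>\<integral>v. indicator (ball 0 r) v * f (x + v) - indicator (ball 0 r) v * f (y + v) \<partial>lborel\<bar>
        \<le> (\<integral>v. \<bar>indicator (ball 0 r) v * f (x + v) - indicator (ball 0 r) v * f (y + v)\<bar> \<partial>lborel)"
        using integral_norm_bound[of lborel "\<lambda>v. indicator (ball 0 r) v * f (x + v) - indicator (ball 0 r) v * f (y + v)"]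
        by simp
      also have "\<dots> \<le> (\<integral>v. \<bar>f (x + v) - f (y + v)\<bar> \<partial>lborel)"
        using it itf by (intro integral_mono) (auto simp: indicator_def)
      also have "\<dots> = (\<integral>v. (\<lambda>z. \<bar>f (z + (x - y)) - f z\<bar>) (v + y) \<partial>lborel)"
        by (simp add: algebra_simps)
      also have "\<dots> = (\<integral>z. \<bar>f (z + (x - y)) - f z\<bar> \<partial>lborel)"
        by (rule lborel_translation(1)) measurable
      also note translation_estimate(2)[OF C, of "x - y"]
      finally show ?thesis .
    qed
    ultimately show ?thesis using b by (simp add: abs_divide divide_right_mono)
  qed
  show "continuous_on UNIV (ball_average r f)"
  proof (rule lipschitz_on_continuous_on[OF lipschitz_onI])
    show "dist (ball_average r f x) (ball_average r f y) \<le> ((\<integral>x. norm (g x) \<partial>lborel) / b) * dist x y" for x y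
      using lip[of x y] by (simp add: mult.commute dist_norm)
    show "0 \<le> (\<integral>x. norm (g x) \<partial>lborel) / b" using b by simp
  qed
  have "ennreal b * (\<integral>\<^sup>+x. ennreal \<bar>f x - ball_average r f x\<bar> \<partial>lborel)
    = (\<integral>\<^sup>+x. ennreal b * ennreal \<bar>f x - ball_average r f x\<bar> \<partial>lborel)"
  proof (intro nn_integral_cmult[symmetric])
    have [measurable]: "ball_average r f \<in> borel_measurable borel"
      using \<open>continuous_on UNIV (ball_average r f)\<close> by (rule borel_measurable_continuous_onI)
    show "(\<lambda>x. ennreal \<bar>f x - ball_average r f x\<bar>) \<in> borel_measurable lborel" by measurable
  qed
  also have "\<dots> \<le> (\<integral>\<^sup>+x. (\<integral>\<^sup>+v. ennreal (indicator (ball 0 r) v * \<bar>f (x + v) - f x\<bar>) \<partial>lborel) \<partial>lborel)"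
  proof (rule nn_integral_mono)
    fix x
    have i: "integrable lborel (\<lambda>v. indicator (ball 0 r) v * \<bar>f (x + v) - f x\<bar>)"
    proof -
      have "integrable lborel (\<lambda>v. \<bar>indicator (ball 0 r) v * f (x + v) - indicator (ball 0 r) v * f x\<bar>)"
        using it ib by (intro integrable_abs Bochner_Integration.integrable_diff integrable_mult_left) auto
      moreover have "(\<lambda>v. \<bar>indicator (ball 0 r) v * f (x + v) - indicator (ball 0 r) v * f x\<bar>)
        = (\<lambda>v. indicator (ball 0 r) v * \<bar>f (x + v) - f x\<bar>)" by (auto simp: indicator_def)
      ultimately show ?thesis by simp
    qed
    have "ball_average r f x - f x = (\<integral>v. indicator (ball 0 r) v * f (x + v) - indicator (ball 0 r) v * f x \<partial>lborel) / b"
      unfolding ball_average_def b_def[symmetric] using it ib b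
      by (simp add: diff_divide_distrib)
    then have "b * \<bar>f x - ball_average r f x\<bar> = \<bar>\<integral>v. indicator (ball 0 r) v * f (x + v) - indicator (ball 0 r) v * f x \<partial>lborel\<bar>"
      using b by (subst abs_minus_commute) (simp add: abs_divide)
    also have "\<dots> \<le> (\<integral>v. \<bar>indicator (ball 0 r) v * f (x + v) - indicator (ball 0 r) v * f x\<bar> \<partial>lborel)"
      using integral_norm_bound[of lborel "\<lambda>v. indicator (ball 0 r) v * f (x + v) - indicator (ball 0 r) v * f x"]
      by simp
    also have "(\<lambda>v. \<bar>indicator (ball 0 r) v * f (x + v) - indicator (ball 0 r) v * f x\<bar>)
      = (\<lambda>v. indicator (ball 0 r) v * \<bar>f (x + v) - f x\<bar>)" by (auto simp: indicator_def)
    finally have "b * \<bar>f x - ball_average r f x\<bar> \<le> (\<integral>v. indicator (ball 0 r) v * \<bar>f (x + v) - f x\<bar> \<partial>lborel)" .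
    then show "ennreal b * ennreal \<bar>f x - ball_average r f x\<bar>
      \<le> (\<integral>\<^sup>+v. ennreal (indicator (ball 0 r) v * \<bar>f (x + v) - f x\<bar>) \<partial>lborel)"
      using nn_integral_eq_integral[OF i] b by (simp add: ennreal_mult'[symmetric] ennreal_leI)
  qed
  also have "\<dots> \<le> ennreal (b * (r * (\<integral>x. norm (g x) \<partial>lborel)))"
    unfolding b_def by (rule averaged_translation_estimate[OF C r])
  also have "\<dots> = ennreal b * ennreal (r * (\<integral>x. norm (g x) \<partial>lborel))"
    using b by (intro ennreal_mult') simp
  finally show "(\<integral>\<^sup>+x. ennreal \<bar>f x - ball_average r f x\<bar> \<partial>lborel) \<le> ennreal (r * (\<integral>x. norm (g x) \<partial>lborel))"
    using b by (simp add: ennreal_mult_le_mult_iff)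
qed

text \<open>A Rellich theorem: averages over small balls are compact in the uniform norm by
  Arzela-Ascoli, and they are uniformly L1-close to the functions. This gives a subsequence for each
  single tolerance, and a diagonal sequence serves all of them. Only the Cauchy property is claimed,
  since the limit is constructed later in a better norm.\<close>

lemma L1_compactness:
  fixes f :: "nat \<Rightarrow> 'a::euclidean_space \<Rightarrow> real"
  assumes C: "\<And>k. C1c (K k) (f k) (g k)" and K: "\<And>k. K k \<subseteq> cball 0 R" and R: "R > 0"
    and G: "\<And>k. (\<integral>x. norm (g k x) \<partial>lborel) \<le> G"
  obtains s where "strict_mono (s :: nat \<Rightarrow> nat)"
    "\<And>\<epsilon>. \<epsilon> > 0 \<Longrightarrow> \<exists>N. \<forall>i\<ge>N. \<forall>j\<ge>N. (\<integral>x. \<bar>f (s i) x - f (s j) x\<bar> \<partial>lborel) < \<epsilon>"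
proof -
  have G0: "G \<ge> 0" using order_trans[OF _ G[of 0]] by (simp add: Bochner_Integration.integral_nonneg)
  have [measurable]: "f k \<in> borel_measurable borel" for k using C1c_measurable[OF C] by auto
  have idiff: "integrable lborel (\<lambda>x. \<bar>f i x - f j x\<bar>)" for i j
    using C1c_integrable(1)[OF C] by auto
  have sub: "\<exists>s'. strict_mono (s' :: nat \<Rightarrow> nat) \<and> (\<exists>N. \<forall>i\<ge>N. \<forall>j\<ge>N. (\<integral>x. \<bar>f ((s \<circ> s') i) x - f ((s \<circ> s') j) x\<bar> \<partial>lborel) < \<epsilon>)"
    if \<epsilon>: "\<epsilon> > 0" and s: "strict_mono s" for \<epsilon> :: real and s :: "nat \<Rightarrow> nat"
  proof -
    \<comment> \<open>Error budget: each of the two averaged functions is off by at most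
      \<epsilon>/4, and uniform closeness \<eta> on a ball of volume V adds 2 \<eta> V \<le>
      \<epsilon>/4.\<close>
    define r where "r = \<epsilon> / (4 * (G + 1))"
    have r: "r > 0" using \<epsilon> G0 by (simp add: r_def)
    have rG: "r * G \<le> \<epsilon> / 4" using \<epsilon> G0 by (simp add: r_def field_simps)
    define b where "b = measure lborel (ball (0::'a) r)"
    have b: "b > 0" unfolding b_def using r by simp
    define V where "V = measure lborel (cball (0::'a) R)"
    have V: "V \<ge> 0" "emeasure lborel (cball (0::'a) R) = ennreal V"
      unfolding V_def using emeasure_lborel_cball_finite[of "0::'a" R] by (auto intro!: emeasure_eq_ennreal_measure)
    define F where "F = (\<lambda>k. ball_average r (f (s k)))"
    note ba = ball_average[OF C r, folded b_def]
    have Fc: "continuous_on UNIV (F k)" for k unfolding F_def by (rule ba(3))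
    then have [measurable]: "F k \<in> borel_measurable borel" for k by (intro borel_measurable_continuous_onI)
    have near: "(\<integral>\<^sup>+x. ennreal \<bar>f (s k) x - F k x\<bar> \<partial>lborel) \<le> ennreal (\<epsilon> / 4)" for k
    proof -
      have "r * (\<integral>x. norm (g (s k) x) \<partial>lborel) \<le> \<epsilon> / 4"
        using rG mult_left_mono[OF G[of "s k"], of r] r by linarith
      then show ?thesis unfolding F_def using ba(4)[of "s k"] by (meson ennreal_leI order_trans)
    qed
    obtain h s' where s': "strict_mono (s' :: nat \<Rightarrow> nat)"
      and h: "\<And>e. 0 < e \<Longrightarrow> \<exists>N. \<forall>n x. n \<ge> N \<and> x \<in> cball 0 R \<longrightarrow> norm (F (s' n) x - h x) < e"
    proof (rule Arzela_Ascoli[of "cball (0::'a) R" F "2 * R * G / b"])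
      show "norm (F n x) \<le> 2 * R * G / b" for n x
      proof -
        have "(\<integral>x. \<bar>f (s n) x\<bar> \<partial>lborel) \<le> 2 * R * (\<integral>x. norm (g (s n) x) \<partial>lborel)"
          by (rule C1c_Poincare_L1[OF C K R])
        also have "\<dots> \<le> 2 * R * G" using G R by (intro mult_left_mono) auto
        finally have "(\<integral>x. \<bar>f (s n) x\<bar> \<partial>lborel) / b \<le> 2 * R * G / b"
          using b by (intro divide_right_mono) auto
        then show ?thesis unfolding F_def using ba(1)[of "s n" x] by simp
      qed
      show "\<exists>d>0. \<forall>n y. y \<in> cball 0 R \<and> norm (x - y) < d \<longrightarrow> norm (F n x - F n y) < e" if "e > 0" for x e
      proof (intro exI[of _ "e * b / (G + 1)"] conjI allI impI)
        show "0 < e * b / (G + 1)" using that b G0 by simp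
        fix n y assume y: "y \<in> cball 0 R \<and> norm (x - y) < e * b / (G + 1)"
        have "norm (x - y) * (\<integral>x. norm (g (s n) x) \<partial>lborel) \<le> norm (x - y) * (G + 1)"
          using G[of "s n"] by (intro mult_left_mono) auto
        also have "\<dots> < e * b" using y G0 by (simp add: pos_less_divide_eq)
        finally have "norm (x - y) * (\<integral>x. norm (g (s n) x) \<partial>lborel) / b < e" using b by (simp add: divide_less_eq)
        then show "norm (F n x - F n y) < e" unfolding F_def using ba(2)[of "s n" x y] by simp
      qed
    qed auto
    define \<eta> where "\<eta> = \<epsilon> / (8 * (V + 1))"
    have \<eta>: "\<eta> > 0" using \<epsilon> V by (simp add: \<eta>_def)
    obtain N where N: "\<And>n x. n \<ge> N \<Longrightarrow> x \<in> cball 0 R \<Longrightarrow> norm (F (s' n) x - h x) < \<eta>"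
      using h[OF \<eta>] by blast
    have "(\<integral>x. \<bar>f (s (s' i)) x - f (s (s' j)) x\<bar> \<partial>lborel) < \<epsilon>" if ij: "i \<ge> N" "j \<ge> N" for i j
    proof -
      have "\<bar>f (s (s' i)) x - f (s (s' j)) x\<bar>
        \<le> \<bar>f (s (s' i)) x - F (s' i) x\<bar> + \<bar>f (s (s' j)) x - F (s' j) x\<bar> + 2 * \<eta> * indicator (cball 0 R) x" for x
      proof (cases "x \<in> cball 0 R")
        case True
        then show ?thesis using N[OF ij(1) True] N[OF ij(2) True] by simp
      next
        case False
        then have "f (s (s' i)) x = 0" "f (s (s' j)) x = 0" using C K unfolding C1c_def by blast+
        then show ?thesis using \<eta> by (simp add: indicator_def)
      qed
      then have le: "ennreal \<bar>f (s (s' i)) x - f (s (s' j)) x\<bar>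
        \<le> ennreal (\<bar>f (s (s' i)) x - F (s' i) x\<bar> + \<bar>f (s (s' j)) x - F (s' j) x\<bar> + 2 * \<eta> * indicator (cball 0 R) x)" for x
        by (rule ennreal_leI)
      have eq: "ennreal (\<bar>f (s (s' i)) x - F (s' i) x\<bar> + \<bar>f (s (s' j)) x - F (s' j) x\<bar> + 2 * \<eta> * indicator (cball 0 R) x)
        = ennreal \<bar>f (s (s' i)) x - F (s' i) x\<bar> + ennreal \<bar>f (s (s' j)) x - F (s' j) x\<bar>
          + ennreal (2 * \<eta>) * indicator (cball 0 R) x" for x
        using \<eta> by (cases "x \<in> cball 0 R") (simp_all add: ennreal_plus)
      have meas_diff: "(\<lambda>x. ennreal \<bar>f (s (s' i)) x - F (s' i) x\<bar>) \<in> borel_measurable borel" for i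
        by measurable
      have "(\<integral>\<^sup>+x. ennreal \<bar>f (s (s' i)) x - f (s (s' j)) x\<bar> \<partial>lborel)
        \<le> (\<integral>\<^sup>+x. ennreal \<bar>f (s (s' i)) x - F (s' i) x\<bar> + ennreal \<bar>f (s (s' j)) x - F (s' j) x\<bar>
          + ennreal (2 * \<eta>) * indicator (cball 0 R) x \<partial>lborel)"
        unfolding eq[symmetric] by (intro nn_integral_mono le)
      also have "\<dots> = (\<integral>\<^sup>+x. ennreal \<bar>f (s (s' i)) x - F (s' i) x\<bar> \<partial>lborel)
          + (\<integral>\<^sup>+x. ennreal \<bar>f (s (s' j)) x - F (s' j) x\<bar> \<partial>lborel) + ennreal (2 * \<eta>) * ennreal V"
      proof -
        have "(\<integral>\<^sup>+x. ennreal (2 * \<eta>) * indicator (cball (0::'a) R) x \<partial>lborel) = ennreal (2 * \<eta>) * ennreal V"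
          unfolding V(2)[symmetric] by (rule nn_integral_cmult_indicator) simp
        moreover have m: "(\<lambda>x. ennreal \<bar>f (s (s' i)) x - F (s' i) x\<bar>) \<in> borel_measurable lborel" for i
          using meas_diff by simp
        moreover have m2: "(\<lambda>x. ennreal (2 * \<eta>) * indicator (cball (0::'a) R) x) \<in> borel_measurable lborel"
          by (intro borel_measurable_times_ennreal borel_measurable_indicator borel_measurable_const) simp
        ultimately show ?thesis
          by (simp only: nn_integral_add[OF borel_measurable_add[OF m m] m2] nn_integral_add[OF m m])
      qed
      also have "\<dots> \<le> ennreal (\<epsilon> / 4) + ennreal (\<epsilon> / 4) + ennreal (2 * \<eta>) * ennreal V"
        by (intro add_mono near order_refl)
      also have "\<dots> = ennreal (\<epsilon> / 2 + 2 * \<eta> * V)"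
        using \<epsilon> \<eta> V by (simp add: ennreal_plus[symmetric] ennreal_mult'[symmetric] del: ennreal_plus)
      finally have "ennreal (\<integral>x. \<bar>f (s (s' i)) x - f (s (s' j)) x\<bar> \<partial>lborel) \<le> ennreal (\<epsilon> / 2 + 2 * \<eta> * V)"
        using nn_integral_eq_integral[OF idiff] by simp
      then have "(\<integral>x. \<bar>f (s (s' i)) x - f (s (s' j)) x\<bar> \<partial>lborel) \<le> \<epsilon> / 2 + 2 * \<eta> * V"
        using \<epsilon> \<eta> V by (subst (asm) ennreal_le_iff) auto
      also have "2 * \<eta> * V < \<epsilon> / 2"
      proof -
        have "2 * \<eta> * V \<le> 2 * \<eta> * (V + 1)" using \<eta> by simp
        also have "\<dots> = \<epsilon> / 4" using V by (simp add: \<eta>_def field_simps)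
        finally show ?thesis using \<epsilon> by simp
      qed
      finally show ?thesis by simp
    qed
    then have "\<exists>N. \<forall>i\<ge>N. \<forall>j\<ge>N. (\<integral>x. \<bar>f ((s \<circ> s') i) x - f ((s \<circ> s') j) x\<bar> \<partial>lborel) < \<epsilon>"
      by (intro exI[of _ N]) simp
    with s' show ?thesis by (intro exI[of _ s'] conjI)
  qed
  define P where "P = (\<lambda>(n::nat) (s :: nat \<Rightarrow> nat). \<exists>N. \<forall>i\<ge>N. \<forall>j\<ge>N. (\<integral>x. \<bar>f (s i) x - f (s j) x\<bar> \<partial>lborel) < inverse (real (Suc n)))"
  interpret subseqs P
    by unfold_locales (use sub in \<open>auto simp: P_def\<close>)
  have stable: "P n (s \<circ> r)" if r: "strict_mono r" and P: "P n s" for n s r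
  proof -
    obtain N where N: "\<forall>i\<ge>N. \<forall>j\<ge>N. (\<integral>x. \<bar>f (s i) x - f (s j) x\<bar> \<partial>lborel) < inverse (real (Suc n))"
      using P unfolding P_def by blast
    have "r i \<ge> N" if "i \<ge> N" for i using seq_suble[OF r, of i] that by linarith
    then have "\<forall>i\<ge>N. \<forall>j\<ge>N. (\<integral>x. \<bar>f ((s \<circ> r) i) x - f ((s \<circ> r) j) x\<bar> \<partial>lborel) < inverse (real (Suc n))"
      using N by simp
    then show ?thesis unfolding P_def by blast
  qed
  show thesis
  proof (rule that[of diagseq])
    show "strict_mono diagseq" by (rule subseq_diagseq)
    fix \<epsilon> :: real assume "\<epsilon> > 0"
    then obtain n where n: "inverse (real (Suc n)) < \<epsilon>" using reals_Archimedean by blast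
    \<comment> \<open>Only the tail from index \<open>Suc n\<close> on is a subsequence of the
      sequence chosen at stage n, whence the index shift below.\<close>
    have "P n (diagseq \<circ> ((+) (Suc n)))" by (rule diagseq_holds[OF stable])
    then obtain N where N: "\<And>i j. i \<ge> N \<Longrightarrow> j \<ge> N \<Longrightarrow>
        (\<integral>x. \<bar>f (diagseq (Suc n + i)) x - f (diagseq (Suc n + j)) x\<bar> \<partial>lborel) < inverse (real (Suc n))"
      unfolding P_def by auto
    show "\<exists>N. \<forall>i\<ge>N. \<forall>j\<ge>N. (\<integral>x. \<bar>f (diagseq i) x - f (diagseq j) x\<bar> \<partial>lborel) < \<epsilon>"
    proof (intro exI[of _ "N + Suc n"] allI impI)
      fix i j assume ij: "i \<ge> N + Suc n" "j \<ge> N + Suc n"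
      then have "N \<le> i - Suc n" "N \<le> j - Suc n" by linarith+
      then show "(\<integral>x. \<bar>f (diagseq i) x - f (diagseq j) x\<bar> \<partial>lborel) < \<epsilon>"
        using N[of "i - Suc n" "j - Suc n"] n ij by simp
    qed
  qed
qed

subsection \<open>Elementary inequalities\<close>

text \<open>Depending on whether y or x^(a-1) is larger, the product is bounded by one of the two
  powers alone. The factors 1/a and 1/b are given up, and no convexity is involved.\<close>

lemma young_crude:
  fixes x y a b :: real
  assumes a: "a > 1" and b: "b = a / (a - 1)" and xy: "x \<ge> 0" "y \<ge> 0"
  shows "x * y \<le> x powr a + y powr b"
proof (cases "y \<le> x powr (a - 1)")
  case True
  then have "x * y \<le> x * x powr (a - 1)" using xy by (intro mult_left_mono)
  also have "\<dots> = x powr a" using xy powr_add[of x 1 "a - 1"] by (cases "x = 0") auto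
  finally show ?thesis by (simp add: add_increasing2)
next
  case False
  have "x = (x powr (a - 1)) powr (1 / (a - 1))" using xy a by (simp add: powr_powr)
  also have "\<dots> \<le> y powr (1 / (a - 1))" using False a by (intro powr_mono2) auto
  finally have "x * y \<le> y powr (1 / (a - 1)) * y" using xy by (intro mult_right_mono)
  also have "\<dots> = y powr b"
  proof -
    have "b = 1 / (a - 1) + 1" using a b by (simp add: field_simps)
    then show ?thesis using xy by (cases "y = 0") (auto simp: powr_add)
  qed
  finally show ?thesis by (simp add: add_increasing)
qed

text \<open>The parameter e makes the first term small at the expense of the constant in the second.
  In this form the inequality takes the place of Hoelder's inequality in the limit arguments
  below.\<close>

lemma young_scaled:
  fixes x y a b e :: real
  assumes a: "a > 1" and b: "b = a / (a - 1)" and xy: "x \<ge> 0" "y \<ge> 0" and e: "e > 0"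
  shows "x * y \<le> e powr a * x powr a + e powr (- b) * y powr b"
proof -
  have "x * y = (e * x) * (y / e)" using e by simp
  also have "\<dots> \<le> (e * x) powr a + (y / e) powr b" using assms by (intro young_crude) auto
  also have "\<dots> = e powr a * x powr a + e powr (- b) * y powr b"
    using e xy by (simp add: powr_mult powr_divide powr_minus_divide)
  finally show ?thesis .
qed

text \<open>Any power is absorbed at an arbitrarily slow exponential rate c: take z \<le> exp z at z
  = c y / k and raise it to the k-th power.\<close>

lemma powr_le_exp_powr:
  fixes \<mu> \<beta> c :: real
  assumes "\<mu> \<ge> 0" "\<beta> > 0" "c > 0"
  obtains C where "C > 0" "\<And>s. \<bar>s\<bar> powr \<mu> \<le> C * exp (c * \<bar>s\<bar> powr \<beta>)"
proof -
  obtain k0 :: nat where k0: "\<mu> / \<beta> \<le> real k0" using real_arch_simple by blast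
  define k where "k = Suc k0"
  have k: "\<mu> / \<beta> \<le> real k" "k > 0" using k0 by (auto simp: k_def)
  define C where "C = 1 + (real k / c) ^ k"
  have C: "C > 0" "C \<ge> 1" using assms by (auto simp: C_def add_pos_nonneg)
  have "\<bar>s\<bar> powr \<mu> \<le> C * exp (c * \<bar>s\<bar> powr \<beta>)" for s
  proof -
    define y where "y = \<bar>s\<bar> powr \<beta>"
    have y: "y \<ge> 0" by (simp add: y_def)
    have s: "\<bar>s\<bar> powr \<mu> = y powr (\<mu> / \<beta>)" using assms by (simp add: y_def powr_powr)
    have e1: "exp (c * y) \<ge> 1" using y assms by simp
    have "y powr (\<mu> / \<beta>) \<le> 1 + y ^ k"
    proof (cases "y \<le> 1")
      case True
      then have "y powr (\<mu> / \<beta>) \<le> 1 powr (\<mu> / \<beta>)" using y assms by (intro powr_mono2) auto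
      then show ?thesis using y by (simp add: add_increasing2)
    next
      case False
      then have "y powr (\<mu> / \<beta>) \<le> y powr (real k)" using k by (intro powr_mono) auto
      then show ?thesis using False by (simp add: powr_realpow)
    qed
    also have "y ^ k \<le> (real k / c) ^ k * exp (c * y)"
    proof -
      have "c * y / real k \<le> exp (c * y / real k)" using exp_ge_add_one_self[of "c * y / real k"] by linarith
      then have "(c * y / real k) ^ k \<le> exp (c * y / real k) ^ k" using y assms by (intro power_mono) auto
      also have "\<dots> = exp (c * y)" using k by (simp add: exp_of_nat_mult[symmetric])
      finally have "(real k / c) ^ k * (c * y / real k) ^ k \<le> (real k / c) ^ k * exp (c * y)"
        using assms by (intro mult_left_mono) auto
      then show ?thesis using k assms by (simp add: power_mult_distrib[symmetric])
    qed
    also have "1 + (real k / c) ^ k * exp (c * y) \<le> C * exp (c * y)"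
      using e1 by (simp add: C_def algebra_simps)
    finally show ?thesis by (simp add: s y_def)
  qed
  with C that show ?thesis by blast
qed

lemma powr_diff_le:
  fixes s t r :: real
  assumes "r \<ge> 1"
  shows "\<bar>\<bar>s\<bar> powr r - \<bar>t\<bar> powr r\<bar> \<le> r * \<bar>s - t\<bar> * max \<bar>s\<bar> \<bar>t\<bar> powr (r - 1)"
proof -
  have *: "\<bar>a powr r - b powr r\<bar> \<le> r * (b - a) * b powr (r - 1)" if "0 \<le> a" "a \<le> b" for a b :: real
  proof (cases "a = 0")
    case True
    then show ?thesis using that assms powr_add[of b 1 "r - 1"]
      by (cases "b = 0") (auto simp: mult_le_cancel_right1 intro!: mult_right_mono)
  next
    case False
    show ?thesis
    proof (cases "a = b")
      case neq: False
      have "\<exists>z>a. z < b \<and> b powr r - a powr r = (b - a) * (r * z powr (r - 1))"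
        using that False neq by (intro MVT2) (auto intro!: derivative_eq_intros)
      then obtain z where z: "a < z" "z < b" "b powr r - a powr r = (b - a) * (r * z powr (r - 1))" by blast
      have "z powr (r - 1) \<le> b powr (r - 1)" using z that assms by (intro powr_mono2) auto
      then have "(b - a) * (r * z powr (r - 1)) \<le> (b - a) * (r * b powr (r - 1))"
        using that assms by (intro mult_left_mono) auto
      moreover have "a powr r \<le> b powr r" using that assms by (intro powr_mono2) auto
      ultimately show ?thesis using z(3) by (simp add: mult_ac abs_minus_commute)
    qed simp
  qed
  have **: "\<bar>\<bar>s\<bar> powr r - \<bar>t\<bar> powr r\<bar> \<le> r * \<bar>s - t\<bar> * \<bar>t\<bar> powr (r - 1)" if "\<bar>s\<bar> \<le> \<bar>t\<bar>" for s t :: real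
  proof -
    have "r * (\<bar>t\<bar> - \<bar>s\<bar>) * \<bar>t\<bar> powr (r - 1) \<le> r * \<bar>s - t\<bar> * \<bar>t\<bar> powr (r - 1)"
      using assms by (intro mult_right_mono mult_left_mono) auto
    then show ?thesis using *[of "\<bar>s\<bar>" "\<bar>t\<bar>"] that by simp
  qed
  show ?thesis
  proof (cases "\<bar>s\<bar> \<le> \<bar>t\<bar>")
    case True then show ?thesis using **[of s t] by (simp add: max_def)
  next
    case False
    then show ?thesis using **[of t s] by (simp add: max_def abs_minus_commute)
  qed
qed

lemma powr_diff_powr_le:
  fixes s t r c :: real
  assumes "r \<ge> 1" "c \<ge> 1"
  shows "\<bar>\<bar>s\<bar> powr r - \<bar>t\<bar> powr r\<bar> powr c
    \<le> \<bar>s - t\<bar> * (r * \<bar>s\<bar> powr (r * c - 1) + r * \<bar>t\<bar> powr (r * c - 1))"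
proof -
  define m where "m = max \<bar>s\<bar> \<bar>t\<bar>"
  define X where "X = \<bar>\<bar>s\<bar> powr r - \<bar>t\<bar> powr r\<bar>"
  have m: "m \<ge> 0" "\<bar>s\<bar> \<le> m" "\<bar>t\<bar> \<le> m" by (auto simp: m_def)
  have "\<bar>s\<bar> powr r \<le> m powr r" "\<bar>t\<bar> powr r \<le> m powr r" using m assms by (auto intro!: powr_mono2)
  then have X: "0 \<le> X" "X \<le> m powr r"
    using powr_ge_zero[of "\<bar>s\<bar>" r] powr_ge_zero[of "\<bar>t\<bar>" r] unfolding X_def by linarith+
  have "X powr c = X * X powr (c - 1)" using X powr_add[of X 1 "c - 1"] by (cases "X = 0") auto
  also have "\<dots> \<le> (r * \<bar>s - t\<bar> * m powr (r - 1)) * (m powr r) powr (c - 1)"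
    using X assms powr_diff_le[of r s t] by (intro mult_mono powr_mono2) (auto simp: X_def m_def)
  also have "\<dots> = r * \<bar>s - t\<bar> * m powr (r * c - 1)"
  proof -
    have "r * c - 1 = (r - 1) + r * (c - 1)" by (simp add: algebra_simps)
    then have "m powr (r * c - 1) = m powr (r - 1) * m powr (r * (c - 1))" by (simp only: powr_add)
    then show ?thesis by (simp add: powr_powr)
  qed
  also have "\<dots> \<le> r * \<bar>s - t\<bar> * (\<bar>s\<bar> powr (r * c - 1) + \<bar>t\<bar> powr (r * c - 1))"
    using assms by (intro mult_left_mono) (auto simp: m_def max_def)
  finally show ?thesis by (simp add: X_def algebra_simps)
qed

lemma norm_add_power_le:
  fixes x y :: "'a::real_normed_vector"
  shows "norm (x + y) ^ n \<le> 2 ^ n * (norm x ^ n + norm y ^ n)"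
proof -
  define m where "m = max (norm x) (norm y)"
  have "norm (x + y) \<le> 2 * m" using norm_triangle_ineq[of x y] by (auto simp: m_def)
  then have "norm (x + y) ^ n \<le> (2 * m) ^ n" by (intro power_mono) auto
  also have "\<dots> = 2 ^ n * m ^ n" by (simp add: power_mult_distrib)
  also have "m ^ n \<le> norm x ^ n + norm y ^ n" by (auto simp: m_def max_def)
  finally show ?thesis by simp
qed

text \<open>Midpoint convexity from the tangent at the midpoint c: the linear parts at A and B
  cancel. The tangent inequality is Bernoulli's inequality for x / c, proved through the minimum of
  t^m - m (t - 1) at t = 1.\<close>

lemma half_sum_powr_le:
  fixes A B m :: real
  assumes "A \<ge> 0" "B \<ge> 0" "m \<ge> 1"
  shows "((A + B) / 2) powr m \<le> (A powr m + B powr m) / 2"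
proof (cases "A + B = 0")
  case True then show ?thesis using assms by (simp add: add_nonneg_eq_0_iff)
next
  case False
  define c where "c = (A + B) / 2"
  have c: "c > 0" using False assms by (simp add: c_def)
  have tangent: "x powr m \<ge> c powr m + m * c powr (m - 1) * (x - c)" if x: "x \<ge> 0" for x
  proof -
    have "c powr m + m * c powr (m - 1) * (x - c) = c powr m * (1 + m * (x / c - 1))"
      using c by (simp add: powr_diff field_simps)
    also have "1 + m * (x / c - 1) \<le> (x / c) powr m"
    proof (cases "x = 0")
      case True then show ?thesis using assms by simp
    next
      case False
      define z where "z = x / c"
      have z: "z > 0" using False x c by (simp add: z_def)
      have "\<bar>\<bar>z\<bar> powr m - \<bar>1\<bar> powr m\<bar> \<ge> 0" by simp
      have "1 + m * (z - 1) \<le> z powr m"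
      proof -
        define g where "g = (\<lambda>t. t powr m - m * (t - 1))"
        have d: "(g has_real_derivative m * t powr (m - 1) - m) (at t)" if "t > 0" for t
          unfolding g_def using that by (auto intro!: derivative_eq_intros)
        have "g 1 \<le> g z"
        proof (cases "z \<ge> 1")
          case True
          show ?thesis
          proof (rule DERIV_nonneg_imp_nondecreasing[OF True])
            fix t assume t: "1 \<le> t" "t \<le> z"
            have "1 powr (m - 1) \<le> t powr (m - 1)" using t assms by (intro powr_mono2) auto
            then show "\<exists>y. (g has_real_derivative y) (at t) \<and> 0 \<le> y"
              using d[of t] t assms by (intro exI[of _ "m * t powr (m - 1) - m"]) auto
          qed
        next
          case False
          show ?thesis
          proof (rule DERIV_nonpos_imp_nonincreasing[of z 1])
            show "z \<le> 1" using False by simp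
            fix t assume t: "z \<le> t" "t \<le> 1"
            have "t powr (m - 1) \<le> 1 powr (m - 1)" using t z assms by (intro powr_mono2) auto
            then show "\<exists>y. (g has_real_derivative y) (at t) \<and> y \<le> 0"
              using d[of t] t z assms by (intro exI[of _ "m * t powr (m - 1) - m"]) auto
          qed
        qed
        then show ?thesis by (simp add: g_def)
      qed
      then show ?thesis by (simp add: z_def)
    qed
    also have "c powr m * (x / c) powr m = x powr m" using c x by (simp add: powr_divide)
    finally show ?thesis using c by (simp add: mult_left_mono)
  qed
  have "2 * c powr m + m * c powr (m - 1) * (A + B - 2 * c) \<le> A powr m + B powr m"
    using tangent[OF assms(1)] tangent[OF assms(2)] by (simp add: algebra_simps)
  moreover have "A + B - 2 * c = 0" by (simp add: c_def)
  ultimately have "c powr m \<le> (A powr m + B powr m) / 2" by simp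
  then show ?thesis by (simp only: c_def)
qed

text \<open>With a and b the squared norms on the left, the parallelogram law says that a + b is the
  mean of the two squared norms on the right. For m = n/2 \<ge> 1 one has a^m + b^m \<le> (a + b)^m,
  and convexity of the m-th power finishes the estimate.\<close>

lemma clarkson_power:
  fixes x y :: "'a::real_inner"
  assumes "n \<ge> 2"
  shows "norm ((1 / 2) *\<^sub>R (x + y)) ^ n + norm ((1 / 2) *\<^sub>R (x - y)) ^ n \<le> (norm x ^ n + norm y ^ n) / 2"
proof -
  define m where "m = real n / 2"
  have m: "m \<ge> 1" using assms by (simp add: m_def)
  have pw: "norm z ^ n = ((norm z)\<^sup>2) powr m" for z :: 'a
  proof -
    have "((norm z)\<^sup>2) powr m = norm z powr (2 * m)"
      by (cases "z = 0") (auto simp: powr_powr[symmetric] powr_numeral)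
    also have "\<dots> = norm z powr real n" by (simp add: m_def)
    also have "\<dots> = norm z ^ n" using assms by (intro powr_realpow') auto
    finally show ?thesis by simp
  qed
  define a where "a = (norm ((1 / 2) *\<^sub>R (x + y)))\<^sup>2"
  define b where "b = (norm ((1 / 2) *\<^sub>R (x - y)))\<^sup>2"
  have ab: "a \<ge> 0" "b \<ge> 0" by (auto simp: a_def b_def)
  have sum: "a + b = ((norm x)\<^sup>2 + (norm y)\<^sup>2) / 2"
    unfolding a_def b_def power2_norm_eq_inner
    by (simp add: inner_add_left inner_add_right inner_diff_left inner_diff_right inner_commute algebra_simps)
  have superadd: "u powr m \<le> u * (a + b) powr (m - 1)" if "0 \<le> u" "u \<le> a + b" for u
  proof (cases "u = 0")
    case False
    have "u powr m = u * u powr (m - 1)" using that powr_add[of u 1 "m - 1"] by (simp add: False)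
    also have "\<dots> \<le> u * (a + b) powr (m - 1)" using that m by (intro mult_left_mono powr_mono2) auto
    finally show ?thesis .
  qed simp
  have "a powr m + b powr m \<le> a * (a + b) powr (m - 1) + b * (a + b) powr (m - 1)"
    using ab by (intro add_mono superadd) auto
  also have "\<dots> = (a + b) powr m"
    using ab powr_add[of "a + b" 1 "m - 1"] by (cases "a + b = 0") (auto simp: algebra_simps)
  also have "\<dots> \<le> (((norm x)\<^sup>2) powr m + ((norm y)\<^sup>2) powr m) / 2"
    unfolding sum using m by (intro half_sum_powr_le) auto
  finally show ?thesis unfolding a_def b_def pw[symmetric] .
qed

subsection \<open>Integration over finite measures\<close>

lemma fast_Cauchy_subsequence:
  fixes P :: "nat \<Rightarrow> nat \<Rightarrow> nat \<Rightarrow> bool"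
  assumes "\<And>k. \<exists>N. \<forall>i\<ge>N. \<forall>j\<ge>N. P k i j"
  obtains s where "strict_mono (s :: nat \<Rightarrow> nat)" "\<And>k i j. i \<ge> s k \<Longrightarrow> j \<ge> s k \<Longrightarrow> P k i j"
proof -
  obtain N where N: "\<And>k i j. i \<ge> N k \<Longrightarrow> j \<ge> N k \<Longrightarrow> P k i j" using assms by metis
  define s where "s = (\<lambda>k. \<Sum>i\<le>k. Suc (N i))"
  have "strict_mono s" by (rule strict_monoI_Suc) (simp add: s_def)
  moreover have "N k \<le> s k" for k unfolding s_def using member_le_sum[of k "{..k}" "\<lambda>i. Suc (N i)"] by simp
  ultimately show ?thesis using that[of s] N order_trans by blast
qed

text \<open>The Riesz-Fischer argument: along a fast subsequence the increments have a finite
  integrable sum and hence converge almost everywhere, and Fatou's lemma bounds the distance to the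
  limit. The pointwise subsequence is part of the conclusion because signs and exponential bounds
  are transferred along it.\<close>

lemma Lp_complete:
  fixes f :: "nat \<Rightarrow> 'a \<Rightarrow> 'b::euclidean_space"
  assumes M: "finite_measure M" and f[measurable]: "\<And>k. f k \<in> borel_measurable M" and n: "n > 0"
    and int: "\<And>i j. integrable M (\<lambda>x. norm (f i x - f j x) ^ n)"
    and Cauchy: "\<And>\<epsilon>. \<epsilon> > 0 \<Longrightarrow> \<exists>N. \<forall>i\<ge>N. \<forall>j\<ge>N. (\<integral>x. norm (f i x - f j x) ^ n \<partial>M) < \<epsilon>"
  obtains F s where "F \<in> borel_measurable M" "strict_mono (s :: nat \<Rightarrow> nat)"
    "AE x in M. (\<lambda>k. f (s k) x) \<longlonglongrightarrow> F x"
    "\<And>i. integrable M (\<lambda>x. norm (f i x - F x) ^ n)"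
    "(\<lambda>i. \<integral>x. norm (f i x - F x) ^ n \<partial>M) \<longlonglongrightarrow> 0"
proof -
  interpret finite_measure M by fact
  have "\<exists>N. \<forall>i\<ge>N. \<forall>j\<ge>N. (\<integral>x. norm (f i x - f j x) ^ n \<partial>M) < (1 / 2) ^ (k * n)" for k
    using Cauchy by simp
  then obtain s where s: "strict_mono (s :: nat \<Rightarrow> nat)"
    and fast: "\<And>k i j. i \<ge> s k \<Longrightarrow> j \<ge> s k \<Longrightarrow> (\<integral>x. norm (f i x - f j x) ^ n \<partial>M) < (1 / 2) ^ (k * n)"
    using fast_Cauchy_subsequence[of "\<lambda>k i j. (\<integral>x. norm (f i x - f j x) ^ n \<partial>M) < (1 / 2) ^ (k * n)"] by blast
  define d where "d = (\<lambda>k x. norm (f (s (Suc k)) x - f (s k) x))"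
  have dm[measurable]: "d k \<in> borel_measurable M" for k unfolding d_def by measurable
  have d_int: "(\<integral>\<^sup>+x. ennreal (d k x) \<partial>M) \<le> ennreal ((1 / 2) ^ k * (measure M (space M) + 1))" for k
  proof -
    \<comment> \<open>With this threshold d \<le> t + d^n / t^(n-1), and the integral of d^n is at
      most t^n by the choice of the subsequence; so the L1 norms of the increments decay
      geometrically.\<close>
    define t :: real where "t = (1 / 2) ^ k"
    have t: "t > 0" by (simp add: t_def)
    have pt: "d k x \<le> t + d k x ^ n / t ^ (n - 1)" for x
    proof (cases "d k x \<le> t")
      case True then show ?thesis using t by (simp add: d_def add_increasing2)
    next
      case False
      then have "t ^ (n - 1) \<le> d k x ^ (n - 1)" using t by (intro power_mono) auto
      then have "d k x * t ^ (n - 1) \<le> d k x * d k x ^ (n - 1)" by (intro mult_left_mono) (auto simp: d_def)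
      also have "\<dots> = d k x ^ n" using n by (simp add: power_eq_if)
      finally show ?thesis using t by (simp add: pos_le_divide_eq add_increasing)
    qed
    have i: "integrable M (\<lambda>x. t + d k x ^ n / t ^ (n - 1))" using int by (simp add: d_def)
    have "(\<integral>\<^sup>+x. ennreal (d k x) \<partial>M) \<le> (\<integral>\<^sup>+x. ennreal (t + d k x ^ n / t ^ (n - 1)) \<partial>M)"
      by (intro nn_integral_mono ennreal_leI pt)
    also have "\<dots> = ennreal (\<integral>x. t + d k x ^ n / t ^ (n - 1) \<partial>M)"
      using t by (intro nn_integral_eq_integral[OF i]) (auto simp: d_def)
    finally have nn: "(\<integral>\<^sup>+x. ennreal (d k x) \<partial>M) \<le> ennreal (\<integral>x. t + d k x ^ n / t ^ (n - 1) \<partial>M)" .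
    have "(\<integral>x. t + d k x ^ n / t ^ (n - 1) \<partial>M) = t * measure M (space M) + (\<integral>x. d k x ^ n \<partial>M) / t ^ (n - 1)"
      using int by (simp add: d_def mult.commute)
    also have "\<dots> \<le> t * measure M (space M) + t ^ n / t ^ (n - 1)"
    proof -
      have "(\<integral>x. d k x ^ n \<partial>M) \<le> t ^ n"
        using fast[of k "s (Suc k)" "s k"] strict_mono_less_eq[OF s, of k "Suc k"]
        by (simp add: d_def t_def power_mult less_imp_le)
      then show ?thesis using t by (simp add: divide_right_mono)
    qed
    also have "t ^ n / t ^ (n - 1) = t" using t n by (cases n) auto
    also have "t * measure M (space M) + t = t * (measure M (space M) + 1)" by (simp add: algebra_simps)
    finally have "(\<integral>x. t + d k x ^ n / t ^ (n - 1) \<partial>M) \<le> t * (measure M (space M) + 1)" .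
    from order_trans[OF nn ennreal_leI[OF this]] show ?thesis by (simp only: t_def)
  qed
  have "(\<integral>\<^sup>+x. (\<Sum>k. ennreal (d k x)) \<partial>M) = (\<Sum>k. \<integral>\<^sup>+x. ennreal (d k x) \<partial>M)"
    by (rule nn_integral_suminf) measurable
  also have "\<dots> \<le> (\<Sum>k. ennreal ((1 / 2) ^ k * (measure M (space M) + 1)))"
    by (intro suminf_le allI d_int) auto
  also have "\<dots> < \<infinity>"
  proof -
    have "summable (\<lambda>k. (1 / 2 :: real) ^ k * (measure M (space M) + 1))"
      by (intro summable_mult2 summable_geometric) simp
    then show ?thesis by (subst suminf_ennreal2) auto
  qed
  finally have "AE x in M. (\<Sum>k. ennreal (d k x)) \<noteq> \<infinity>"
    by (intro nn_integral_PInf_AE) auto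
  then have conv: "AE x in M. convergent (\<lambda>k. f (s k) x)"
  proof eventually_elim
    case (elim x)
    have "summable (\<lambda>k. d k x)"
      using elim by (intro summable_suminf_not_top) (auto simp: d_def)
    then have "summable (\<lambda>k. f (s (Suc k)) x - f (s k) x)"
      unfolding d_def by (rule summable_norm_cancel)
    then obtain L where "(\<lambda>m. \<Sum>k<m. f (s (Suc k)) x - f (s k) x) \<longlonglongrightarrow> L"
      using summable_LIMSEQ by blast
    then have "(\<lambda>m. f (s m) x - f (s 0) x) \<longlonglongrightarrow> L"
      using sum_lessThan_telescope[of "\<lambda>k. f (s k) x"] by simp
    then have "(\<lambda>m. (f (s m) x - f (s 0) x) + f (s 0) x) \<longlonglongrightarrow> L + f (s 0) x"
      by (intro tendsto_intros)
    then show ?case by (auto simp: convergent_def)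
  qed
  define F where "F = (\<lambda>x. lim (\<lambda>k. f (s k) x))"
  have Fm[measurable]: "F \<in> borel_measurable M" unfolding F_def by (rule borel_measurable_lim_metric) measurable
  have lim: "AE x in M. (\<lambda>k. f (s k) x) \<longlonglongrightarrow> F x"
    using conv by eventually_elim (simp add: F_def convergent_LIMSEQ_iff)
  have fatou: "(\<integral>\<^sup>+x. ennreal (norm (f i x - F x) ^ n) \<partial>M) \<le> ennreal \<epsilon>"
    if N: "\<And>j. j \<ge> N \<Longrightarrow> (\<integral>x. norm (f i x - f j x) ^ n \<partial>M) \<le> \<epsilon>" for i N \<epsilon>
  proof -
    have "(\<integral>\<^sup>+x. ennreal (norm (f i x - F x) ^ n) \<partial>M) = (\<integral>\<^sup>+x. liminf (\<lambda>k. ennreal (norm (f i x - f (s k) x) ^ n)) \<partial>M)"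
    proof (rule nn_integral_cong_AE)
      show "AE x in M. ennreal (norm (f i x - F x) ^ n) = liminf (\<lambda>k. ennreal (norm (f i x - f (s k) x) ^ n))"
        using lim
      proof eventually_elim
        case (elim x)
        then have "(\<lambda>k. ennreal (norm (f i x - f (s k) x) ^ n)) \<longlonglongrightarrow> ennreal (norm (f i x - F x) ^ n)"
          by (intro tendsto_intros)
        from lim_imp_Liminf[OF trivial_limit_sequentially this] show ?case by (rule sym)
      qed
    qed
    also have "\<dots> \<le> liminf (\<lambda>k. \<integral>\<^sup>+x. ennreal (norm (f i x - f (s k) x) ^ n) \<partial>M)"
      by (rule nn_integral_liminf) measurable
    also have "\<dots> \<le> ennreal \<epsilon>"
    proof -
      have "\<forall>\<^sub>F k in sequentially. (\<integral>\<^sup>+x. ennreal (norm (f i x - f (s k) x) ^ n) \<partial>M) \<le> ennreal \<epsilon>"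
        using eventually_ge_at_top[of N]
      proof eventually_elim
        case (elim k)
        then have "s k \<ge> N" using seq_suble[OF s, of k] by linarith
        then show ?case using N nn_integral_eq_integral[OF int[of i "s k"]] by (simp add: ennreal_leI)
      qed
      from Liminf_mono[OF this] show ?thesis by (simp add: Liminf_const)
    qed
    finally show ?thesis .
  qed
  have F_int: "integrable M (\<lambda>x. norm (f i x - F x) ^ n)" for i
  proof -
    obtain N where N: "\<And>i j. i \<ge> N \<Longrightarrow> j \<ge> N \<Longrightarrow> (\<integral>x. norm (f i x - f j x) ^ n \<partial>M) < 1"
      using Cauchy[of 1] by auto
    have "(\<integral>\<^sup>+x. ennreal (norm (f N x - F x) ^ n) \<partial>M) \<le> ennreal 1"
      by (rule fatou[of N]) (use N in \<open>auto intro: less_imp_le\<close>)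
    then have iN: "integrable M (\<lambda>x. norm (f N x - F x) ^ n)"
      by (intro integrableI_nonneg) (auto intro: order_le_less_trans)
    show ?thesis
    proof (rule Bochner_Integration.integrable_bound)
      show "integrable M (\<lambda>x. 2 ^ n * (norm (f i x - f N x) ^ n + norm (f N x - F x) ^ n))"
        using int iN by auto
      show "AE x in M. norm (norm (f i x - F x) ^ n) \<le> norm (2 ^ n * (norm (f i x - f N x) ^ n + norm (f N x - F x) ^ n))"
      proof (rule AE_I2)
        fix x
        show "norm (norm (f i x - F x) ^ n) \<le> norm (2 ^ n * (norm (f i x - f N x) ^ n + norm (f N x - F x) ^ n))"
          using norm_add_power_le[of "f i x - f N x" "f N x - F x" n] by (simp add: abs_mult)
      qed
    qed measurable
  qed
  have "(\<lambda>i. \<integral>x. norm (f i x - F x) ^ n \<partial>M) \<longlonglongrightarrow> 0"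
  proof (rule LIMSEQ_I)
    fix r :: real assume r: "r > 0"
    obtain N where N: "\<And>i j. i \<ge> N \<Longrightarrow> j \<ge> N \<Longrightarrow> (\<integral>x. norm (f i x - f j x) ^ n \<partial>M) < r / 2"
      using Cauchy[of "r / 2"] r by auto
    have "norm ((\<integral>x. norm (f i x - F x) ^ n \<partial>M) - 0) < r" if "i \<ge> N" for i
    proof -
      have "(\<integral>\<^sup>+x. ennreal (norm (f i x - F x) ^ n) \<partial>M) \<le> ennreal (r / 2)"
        by (rule fatou[of N]) (use N that in \<open>auto intro: less_imp_le\<close>)
      then have "(\<integral>x. norm (f i x - F x) ^ n \<partial>M) \<le> r / 2"
        using nn_integral_eq_integral[OF F_int[of i]] r by simp
      then show ?thesis using r by (simp add: Bochner_Integration.integral_nonneg)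
    qed
    then show "\<exists>N. \<forall>i\<ge>N. norm ((\<integral>x. norm (f i x - F x) ^ n \<partial>M) - 0) < r" by blast
  qed
  with Fm s lim F_int that show ?thesis by blast
qed

text \<open>The mean value theorem bounds the difference quotients by \<open>w\<close>, and
  dominated convergence applies. A sequence tending to 0 is first cut at an index N, since the
  hypotheses hold only for parameters below \<open>r\<close> in absolute value.\<close>

lemma has_derivative_integral:
  fixes f f' :: "real \<Rightarrow> 'a \<Rightarrow> real"
  assumes r: "r > 0"
    and int: "\<And>t. \<bar>t\<bar> < r \<Longrightarrow> integrable M (f t)"
    and f': "f' 0 \<in> borel_measurable M"
    and der: "\<And>t x. \<bar>t\<bar> < r \<Longrightarrow> ((\<lambda>t. f t x) has_real_derivative f' t x) (at t)"
    and bd: "\<And>t x. \<bar>t\<bar> < r \<Longrightarrow> \<bar>f' t x\<bar> \<le> w x" and w: "integrable M w"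
  shows "((\<lambda>t. \<integral>x. f t x \<partial>M) has_real_derivative (\<integral>x. f' 0 x \<partial>M)) (at 0)"
  unfolding DERIV_def tendsto_at_iff_sequentially
proof (intro allI impI)
  fix X :: "nat \<Rightarrow> real"
  assume X: "\<forall>i. X i \<in> UNIV - {0}" "X \<longlonglongrightarrow> 0"
  obtain N where N: "\<And>i. i \<ge> N \<Longrightarrow> \<bar>X i\<bar> < r"
    using LIMSEQ_D[OF X(2) r] by auto
  define Y where "Y = (\<lambda>i. X (i + N))"
  have Y: "Y i \<noteq> 0" "\<bar>Y i\<bar> < r" for i using X(1) N by (auto simp: Y_def)
  have Ylim: "Y \<longlonglongrightarrow> 0" unfolding Y_def using X(2) by (rule LIMSEQ_ignore_initial_segment)
  have "(\<lambda>i. \<integral>x. (f (Y i) x - f 0 x) / Y i \<partial>M) \<longlonglongrightarrow> (\<integral>x. f' 0 x \<partial>M)"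
  proof (rule integral_dominated_convergence[where w=w])
    show "(\<lambda>x. (f (Y i) x - f 0 x) / Y i) \<in> borel_measurable M" for i
      using int[OF Y(2)[of i]] int[of 0] r by auto
    show "AE x in M. (\<lambda>i. (f (Y i) x - f 0 x) / Y i) \<longlonglongrightarrow> f' 0 x"
    proof (rule AE_I2)
      fix x
      have "((\<lambda>h. (f (0 + h) x - f 0 x) / h) \<longlongrightarrow> f' 0 x) (at 0)"
        using der[of 0 x] r by (simp add: DERIV_def)
      then show "(\<lambda>i. (f (Y i) x - f 0 x) / Y i) \<longlonglongrightarrow> f' 0 x"
        using Y(1) Ylim by (simp add: tendsto_at_iff_sequentially comp_def)
    qed
    show "AE x in M. norm ((f (Y i) x - f 0 x) / Y i) \<le> w x" for i
    proof (rule AE_I2)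
      fix x
      have "norm (f (Y i) x - f 0 x) \<le> w x * norm (Y i - 0)"
      proof (rule field_differentiable_bound[where S="{- \<bar>Y i\<bar>..\<bar>Y i\<bar>}" and f'="\<lambda>t. f' t x"])
        fix t assume "t \<in> {- \<bar>Y i\<bar>..\<bar>Y i\<bar>}"
        then have "\<bar>t\<bar> < r" using Y(2)[of i] by auto
        then show "((\<lambda>t. f t x) has_real_derivative f' t x) (at t within {- \<bar>Y i\<bar>..\<bar>Y i\<bar>})" "norm (f' t x) \<le> w x"
          using der bd by (auto intro: has_field_derivative_at_within)
      qed auto
      then show "norm ((f (Y i) x - f 0 x) / Y i) \<le> w x"
        using Y(1)[of i] by (simp add: abs_divide divide_le_eq)
    qed
  qed (use f' w in auto)
  also have "(\<lambda>i. \<integral>x. (f (Y i) x - f 0 x) / Y i \<partial>M) = (\<lambda>i. ((\<integral>x. f (Y i) x \<partial>M) - (\<integral>x. f 0 x \<partial>M)) / Y i)"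
    using int[OF Y(2)] int[of 0] r by (intro ext) simp
  finally have "(\<lambda>i. ((\<integral>x. f (X (i + N)) x \<partial>M) - (\<integral>x. f 0 x \<partial>M)) / X (i + N)) \<longlonglongrightarrow> (\<integral>x. f' 0 x \<partial>M)"
    by (simp add: Y_def)
  then have "(\<lambda>i. ((\<integral>x. f (X i) x \<partial>M) - (\<integral>x. f 0 x \<partial>M)) / X i) \<longlonglongrightarrow> (\<integral>x. f' 0 x \<partial>M)"
    by (rule LIMSEQ_offset)
  then show "((\<lambda>h. ((\<integral>x. f (0 + h) x \<partial>M) - (\<integral>x. f 0 x \<partial>M)) / h) \<circ> X) \<longlonglongrightarrow> (\<integral>x. f' 0 x \<partial>M)"
    by (simp add: comp_def)
qed

subsection \<open>Weak gradients\<close>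

text \<open>The bridge between the completed measure restricted to \<Omega>, in which the problem is
  stated, and the Borel measure on the whole space, where translations and Fubini's theorem were
  applied.\<close>

lemma integral_lebesgue_on_support:
  fixes f :: "'a::euclidean_space \<Rightarrow> 'b::euclidean_space"
  assumes \<Omega>: "\<Omega> \<in> sets borel" and f: "f \<in> borel_measurable borel" and z: "\<And>x. x \<notin> \<Omega> \<Longrightarrow> f x = 0"
  shows "(\<integral>x. f x \<partial>lebesgue_on \<Omega>) = (\<integral>x. f x \<partial>lborel)"
    and "integrable lborel f \<Longrightarrow> integrable (lebesgue_on \<Omega>) f"
proof -
  have eq: "(\<lambda>x. indicator \<Omega> x *\<^sub>R f x) = f" using z by (auto simp: indicator_def)
  have "(\<integral>x. f x \<partial>lebesgue_on \<Omega>) = (\<integral>x. indicator \<Omega> x *\<^sub>R f x \<partial>lebesgue)"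
    using \<Omega> by (intro integral_restrict_space) auto
  also have "\<dots> = (\<integral>x. f x \<partial>lborel)"
    unfolding eq using f by (intro integral_completion) simp
  finally show "(\<integral>x. f x \<partial>lebesgue_on \<Omega>) = (\<integral>x. f x \<partial>lborel)" .
  show "integrable (lebesgue_on \<Omega>) f" if "integrable lborel f"
  proof -
    have "integrable lebesgue f" using that f by (simp add: integrable_completion)
    then have "integrable lebesgue (\<lambda>x. indicator \<Omega> x *\<^sub>R f x)" unfolding eq .
    then show ?thesis using integrable_restrict_space[of \<Omega> lebesgue f] \<Omega> by simp
  qed
qed

lemma lebesgue_on_measurable:
  assumes "f \<in> borel_measurable borel"
  shows "f \<in> borel_measurable (lebesgue_on \<Omega>)"
  using assms by (intro measurable_restrict_space1) (simp add: measurable_completion)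

lemma test_function_integrals:
  assumes \<Omega>: "\<Omega> \<in> sets borel" and \<phi>: "\<phi> \<in> test_functions \<Omega>" and n: "n > 0"
  shows "\<phi> \<in> borel_measurable (lebesgue_on \<Omega>)" "grad \<phi> \<in> borel_measurable (lebesgue_on \<Omega>)"
    "integrable (lebesgue_on \<Omega>) \<phi>" "integrable (lebesgue_on \<Omega>) (grad \<phi>)"
    "integrable (lebesgue_on \<Omega>) (\<lambda>x. \<bar>\<phi> x\<bar> ^ n)" "integrable (lebesgue_on \<Omega>) (\<lambda>x. norm (grad \<phi> x) ^ n)"
    "(\<integral>x. norm (grad \<phi> x) ^ n \<partial>lebesgue_on \<Omega>) = (\<integral>x. norm (grad \<phi> x) ^ n \<partial>lborel)"
proof -
  obtain K where K: "K \<subseteq> \<Omega>" and C: "C1c K \<phi> (grad \<phi>)" using test_functions_C1c[OF \<phi>] by blast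
  have m[measurable]: "\<phi> \<in> borel_measurable borel" "grad \<phi> \<in> borel_measurable borel"
    using C1c_measurable[OF C] by auto
  then show "\<phi> \<in> borel_measurable (lebesgue_on \<Omega>)" "grad \<phi> \<in> borel_measurable (lebesgue_on \<Omega>)"
    by (auto intro: lebesgue_on_measurable)
  have z: "\<phi> x = 0" "grad \<phi> x = 0" if "x \<notin> \<Omega>" for x using that K C by (auto simp: C1c_def)
  show "integrable (lebesgue_on \<Omega>) \<phi>" "integrable (lebesgue_on \<Omega>) (grad \<phi>)"
    using C1c_integrable[OF C] m z by (auto intro!: integral_lebesgue_on_support(2)[OF \<Omega>])
  have "integrable lborel (\<lambda>x. \<bar>\<phi> x\<bar> ^ n)"
    using C n C1c_continuous[OF C] by (intro integrable_compact_support[of _ K]) (auto simp: C1c_def intro!: continuous_intros)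
  then show "integrable (lebesgue_on \<Omega>) (\<lambda>x. \<bar>\<phi> x\<bar> ^ n)"
    using z n by (intro integral_lebesgue_on_support(2)[OF \<Omega>]) auto
  show "integrable (lebesgue_on \<Omega>) (\<lambda>x. norm (grad \<phi> x) ^ n)"
    using C1c_integrable(5)[OF C n] z n by (intro integral_lebesgue_on_support(2)[OF \<Omega>]) auto
  show "(\<integral>x. norm (grad \<phi> x) ^ n \<partial>lebesgue_on \<Omega>) = (\<integral>x. norm (grad \<phi> x) ^ n \<partial>lborel)"
    using z n by (intro integral_lebesgue_on_support(1)[OF \<Omega>]) auto
qed

lemma test_functions_bounded:
  assumes "\<phi> \<in> test_functions \<Omega>"
  obtains B where "B \<ge> 0" "\<And>x. \<bar>\<phi> x\<bar> \<le> B" "\<And>x. norm (grad \<phi> x) \<le> B"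
proof -
  obtain K where K: "K \<subseteq> \<Omega>" and C: "C1c K \<phi> (grad \<phi>)" using test_functions_C1c[OF assms] by blast
  obtain L where L: "L \<ge> 0" "\<And>x. norm (grad \<phi> x) \<le> L" using C1c_Lipschitz[OF C] by metis
  have "compact (\<phi> ` K)" using C C1c_continuous[OF C]
    by (intro compact_continuous_image) (auto simp: C1c_def intro: continuous_on_subset)
  then obtain B where B: "B > 0" "\<forall>y\<in>\<phi> ` K. norm y \<le> B" using compact_imp_bounded bounded_pos by metis
  have "\<bar>\<phi> x\<bar> \<le> B" for x using B C by (cases "x \<in> K") (auto simp: C1c_def)
  then show ?thesis using that[of "max B L"] L B by (meson le_max_iff_disj)
qed

lemma continuous_absolutely_integrable_on_compact:
  fixes f :: "'a::euclidean_space \<Rightarrow> 'b::euclidean_space"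
  assumes "continuous_on UNIV f" "compact K"
  shows "f absolutely_integrable_on K"
proof -
  have "integrable lborel (\<lambda>x. indicator K x *\<^sub>R f x)"
    using assms by (intro borel_integrable_compact continuous_on_subset[OF assms(1)]) auto
  then show ?thesis
    unfolding set_integrable_def using integrable_completion[of "\<lambda>x. indicator K x *\<^sub>R f x" lborel] by auto
qed

lemma integrable_imp_locally_integrable:
  fixes f :: "'a::euclidean_space \<Rightarrow> 'b::euclidean_space"
  assumes "\<Omega> \<in> sets borel" "integrable (lebesgue_on \<Omega>) f"
  shows "locally_integrable_on f \<Omega>"
  unfolding locally_integrable_on_def
proof (intro allI impI)
  fix K assume K: "compact K \<and> K \<subseteq> \<Omega>"
  have "set_integrable lebesgue \<Omega> f"
    unfolding set_integrable_def using assms integrable_restrict_space[of \<Omega> lebesgue f] by simp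
  then show "f absolutely_integrable_on K"
    by (rule set_integrable_subset) (use K in \<open>auto simp: compact_imp_closed\<close>)
qed

lemma locally_integrable_mult:
  fixes G :: "'a::euclidean_space \<Rightarrow> 'b::euclidean_space"
  assumes G: "locally_integrable_on G \<Omega>" and \<Omega>: "\<Omega> \<in> sets borel" and K: "compact K" "K \<subseteq> \<Omega>"
    and c: "c \<in> borel_measurable borel" "\<And>x. x \<notin> K \<Longrightarrow> c x = 0" "\<And>x. \<bar>c x\<bar> \<le> B"
  shows "integrable (lebesgue_on \<Omega>) (\<lambda>x. c x *\<^sub>R G x)"
proof -
  have i: "integrable lebesgue (\<lambda>x. indicator K x *\<^sub>R G x)"
    using G K unfolding locally_integrable_on_def set_integrable_def by blast
  have "integrable lebesgue (\<lambda>x. c x *\<^sub>R (indicator K x *\<^sub>R G x))"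
  proof (rule Bochner_Integration.integrable_bound[OF integrable_scaleR_right[OF i, of B]])
    have "c \<in> borel_measurable lebesgue" using c(1) by (simp add: measurable_completion)
    then show "(\<lambda>x. c x *\<^sub>R (indicator K x *\<^sub>R G x)) \<in> borel_measurable lebesgue"
      by (intro borel_measurable_scaleR[OF _ borel_measurable_integrable[OF i]])
    have "\<bar>c x\<bar> * norm (indicator K x *\<^sub>R G x) \<le> \<bar>B\<bar> * norm (indicator K x *\<^sub>R G x)" for x
      using order_trans[OF c(3) abs_ge_self] by (intro mult_right_mono) auto
    then show "AE x in lebesgue. norm (c x *\<^sub>R (indicator K x *\<^sub>R G x)) \<le> norm (B *\<^sub>R (indicator K x *\<^sub>R G x))"
      by (intro AE_I2) (simp only: norm_scaleR[of "c _"] norm_scaleR[of B])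
  qed
  also have "(\<lambda>x. c x *\<^sub>R (indicator K x *\<^sub>R G x)) = (\<lambda>x. indicator \<Omega> x *\<^sub>R (c x *\<^sub>R G x))"
    using c(2) K(2) by (intro ext) (auto simp: indicator_def)
  finally show ?thesis using integrable_restrict_space[of \<Omega> lebesgue "\<lambda>x. c x *\<^sub>R G x"] \<Omega> by simp
qed

lemma test_function_mult_integrable:
  fixes G :: "'a::euclidean_space \<Rightarrow> 'b::euclidean_space"
  assumes G: "locally_integrable_on G \<Omega>" and \<Omega>: "\<Omega> \<in> sets borel" and \<phi>: "\<phi> \<in> test_functions \<Omega>"
  shows "integrable (lebesgue_on \<Omega>) (\<lambda>x. \<phi> x *\<^sub>R G x)"
proof -
  obtain K where K: "K \<subseteq> \<Omega>" and C: "C1c K \<phi> (grad \<phi>)" using test_functions_C1c[OF \<phi>] by blast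
  obtain B where "B \<ge> 0" "\<And>x. \<bar>\<phi> x\<bar> \<le> B" "\<And>x. norm (grad \<phi> x) \<le> B" using test_functions_bounded[OF \<phi>] by blast
  then show ?thesis
    using C K C1c_measurable(1)[OF C] by (intro locally_integrable_mult[OF G \<Omega>]) (auto simp: C1c_def)
qed

lemma test_gradient_mult_integrable:
  fixes u :: "'a::euclidean_space \<Rightarrow> real"
  assumes u: "locally_integrable_on u \<Omega>" and \<Omega>: "\<Omega> \<in> sets borel" and \<phi>: "\<phi> \<in> test_functions \<Omega>"
  shows "integrable (lebesgue_on \<Omega>) (\<lambda>x. u x *\<^sub>R grad \<phi> x)"
proof -
  obtain K where K: "K \<subseteq> \<Omega>" and C: "C1c K \<phi> (grad \<phi>)" using test_functions_C1c[OF \<phi>] by blast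
  obtain B where "B \<ge> 0" "\<And>x. \<bar>\<phi> x\<bar> \<le> B" and B: "\<And>x. norm (grad \<phi> x) \<le> B" using test_functions_bounded[OF \<phi>] by blast
  have "integrable (lebesgue_on \<Omega>) (\<lambda>x. (grad \<phi> x \<bullet> b) *\<^sub>R u x)" if b: "b \<in> Basis" for b
  proof (rule locally_integrable_mult[OF u \<Omega>, of K _ B])
    show "(\<lambda>x. grad \<phi> x \<bullet> b) \<in> borel_measurable borel" using C1c_measurable(2)[OF C] by auto
    show "\<bar>grad \<phi> x \<bullet> b\<bar> \<le> B" for x using Basis_le_norm[OF b, of "grad \<phi> x"] B[of x] by linarith
  qed (use C K in \<open>auto simp: C1c_def\<close>)
  then have "integrable (lebesgue_on \<Omega>) (\<lambda>x. \<Sum>b\<in>Basis. ((grad \<phi> x \<bullet> b) *\<^sub>R u x) *\<^sub>R b)"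
    by (intro Bochner_Integration.integrable_sum integrable_scaleR_left) auto
  moreover have "(\<Sum>b\<in>Basis. ((grad \<phi> x \<bullet> b) *\<^sub>R u x) *\<^sub>R b) = u x *\<^sub>R grad \<phi> x" for x
  proof -
    have "(\<Sum>b\<in>Basis. ((grad \<phi> x \<bullet> b) *\<^sub>R u x) *\<^sub>R b) = u x *\<^sub>R (\<Sum>b\<in>Basis. (grad \<phi> x \<bullet> b) *\<^sub>R b)"
      by (simp add: scaleR_sum_right mult.commute)
    then show ?thesis by (simp add: euclidean_representation)
  qed
  ultimately show ?thesis by simp
qed

lemma has_weak_gradient_test:
  assumes \<Omega>: "\<Omega> \<in> sets borel" and \<phi>: "\<phi> \<in> test_functions \<Omega>"
  shows "has_weak_gradient \<Omega> \<phi> (grad \<phi>)"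
  unfolding has_weak_gradient_def
proof (intro conjI ballI)
  have s: "smooth \<phi>" using \<phi> test_functions_smooth by blast
  show "locally_integrable_on \<phi> \<Omega>" "locally_integrable_on (grad \<phi>) \<Omega>"
    unfolding locally_integrable_on_def
    using continuous_absolutely_integrable_on_compact smooth_continuous[OF s] smooth_continuous_grad[OF s] by auto
  fix \<psi> assume \<psi>: "\<psi> \<in> test_functions \<Omega>"
  obtain K where K: "K \<subseteq> \<Omega>" and C: "C1c K \<phi> (grad \<phi>)" using test_functions_C1c[OF \<phi>] by blast
  obtain L where L: "L \<subseteq> \<Omega>" and D: "C1c L \<psi> (grad \<psi>)" using test_functions_C1c[OF \<psi>] by blast
  note m = C1c_measurable[OF C] C1c_measurable[OF D]
  have "(\<integral>x. \<phi> x *\<^sub>R grad \<psi> x \<partial>lebesgue_on \<Omega>) = (\<integral>x. \<phi> x *\<^sub>R grad \<psi> x \<partial>lborel)"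
    using m C K by (intro integral_lebesgue_on_support(1)[OF \<Omega>]) (auto simp: C1c_def)
  also have "\<dots> = - (\<integral>x. \<psi> x *\<^sub>R grad \<phi> x \<partial>lborel)" by (rule integration_by_parts[OF C D])
  also have "(\<integral>x. \<psi> x *\<^sub>R grad \<phi> x \<partial>lborel) = (\<integral>x. \<psi> x *\<^sub>R grad \<phi> x \<partial>lebesgue_on \<Omega>)"
    using m C K by (intro integral_lebesgue_on_support(1)[OF \<Omega>, symmetric]) (auto simp: C1c_def)
  finally show "(\<integral>x. \<phi> x *\<^sub>R grad \<psi> x \<partial>lebesgue_on \<Omega>) = - (\<integral>x. \<psi> x *\<^sub>R grad \<phi> x \<partial>lebesgue_on \<Omega>)" .
qed

section \<open>Test functions detect locally integrable functions\<close>

text \<open>Dominated convergence along the smooth approximations of the box, whose boundary is a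
  null set. The exponent \<open>r\<close> is 1 for the uniqueness of weak gradients and q + 1 for
  the weight term of the energy.\<close>

lemma integral_cbox_limit:
  fixes D :: "'a::euclidean_space \<Rightarrow> 'b::euclidean_space"
  assumes D: "locally_integrable_on D \<Omega>" and \<Omega>: "\<Omega> \<in> sets borel" and ab: "cbox a b \<subseteq> \<Omega>" and r: "r > 0"
  obtains f where "\<And>k. f k \<in> test_functions \<Omega>" "\<And>k x. 0 \<le> f k x"
    "(\<lambda>k. \<integral>x. (f k x powr r) *\<^sub>R D x \<partial>lebesgue_on \<Omega>) \<longlonglongrightarrow> integral (cbox a b) D"
proof -
  obtain f where f: "\<And>k. f k \<in> test_functions \<Omega>" "\<And>k x. 0 \<le> f k x \<and> f k x \<le> 1"
    "\<And>k x. x \<notin> cbox a b \<Longrightarrow> f k x = 0" "\<And>x. (\<lambda>k. f k x) \<longlonglongrightarrow> indicator (box a b) x"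
    using box_approximation[OF ab] by blast
  define DB where "DB = (\<lambda>x. indicator (cbox a b) x *\<^sub>R D x)"
  have aD: "D absolutely_integrable_on cbox a b"
    using D ab by (simp add: locally_integrable_on_def)
  then have iDB: "integrable lebesgue DB" unfolding DB_def set_integrable_def .
  have fm: "f k \<in> borel_measurable borel" for k
    using test_functions_C1c[OF f(1)] C1c_measurable by metis
  have eq1: "(\<integral>x. (f k x powr r) *\<^sub>R D x \<partial>lebesgue_on \<Omega>) = (\<integral>x. (f k x powr r) *\<^sub>R DB x \<partial>lebesgue)" for k
  proof -
    have "(\<integral>x. (f k x powr r) *\<^sub>R D x \<partial>lebesgue_on \<Omega>) = (\<integral>x. indicator \<Omega> x *\<^sub>R ((f k x powr r) *\<^sub>R D x) \<partial>lebesgue)"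
      using \<Omega> by (intro integral_restrict_space) auto
    also have "(\<lambda>x. indicator \<Omega> x *\<^sub>R ((f k x powr r) *\<^sub>R D x)) = (\<lambda>x. (f k x powr r) *\<^sub>R DB x)"
    proof
      fix x show "indicator \<Omega> x *\<^sub>R ((f k x powr r) *\<^sub>R D x) = (f k x powr r) *\<^sub>R DB x"
        using f(3)[of x k] ab by (cases "x \<in> cbox a b") (auto simp: DB_def)
    qed
    finally show ?thesis .
  qed
  have "(\<lambda>k. \<integral>x. (f k x powr r) *\<^sub>R DB x \<partial>lebesgue) \<longlonglongrightarrow> (\<integral>x. indicator (box a b) x *\<^sub>R DB x \<partial>lebesgue)"
  proof (rule integral_dominated_convergence[where w="\<lambda>x. norm (DB x)"])
    have pm: "(\<lambda>x. f k x powr r) \<in> borel_measurable lebesgue" for k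
    proof -
      have [measurable]: "f k \<in> borel_measurable borel" by (rule fm)
      have "(\<lambda>x. f k x powr r) \<in> borel_measurable borel" by measurable
      then show ?thesis by (simp add: measurable_completion)
    qed
    show "(\<lambda>x. (f k x powr r) *\<^sub>R DB x) \<in> borel_measurable lebesgue" for k
      using pm iDB by (intro borel_measurable_scaleR) auto
    show "(\<lambda>x. indicator (box a b) x *\<^sub>R DB x) \<in> borel_measurable lebesgue"
      using iDB by (intro borel_measurable_scaleR borel_measurable_indicator) auto
    show "AE x in lebesgue. (\<lambda>k. (f k x powr r) *\<^sub>R DB x) \<longlonglongrightarrow> indicator (box a b) x *\<^sub>R DB x"
    proof (rule AE_I2)
      fix x
      have "(\<lambda>k. f k x powr r) \<longlonglongrightarrow> indicator (box a b) x powr r"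
        using f(2,4) r by (intro tendsto_powr' tendsto_const) auto
      moreover have "indicator (box a b) x powr r = (indicator (box a b) x :: real)"
        by (simp add: indicator_def)
      ultimately show "(\<lambda>k. (f k x powr r) *\<^sub>R DB x) \<longlonglongrightarrow> indicator (box a b) x *\<^sub>R DB x"
        by (intro tendsto_scaleR tendsto_const) simp
    qed
    show "AE x in lebesgue. norm ((f k x powr r) *\<^sub>R DB x) \<le> norm (DB x)" for k
    proof (rule AE_I2)
      fix x
      have "f k x powr r \<le> 1" using f(2)[of k x] r powr_mono2[of r "f k x" 1] by simp
      then show "norm ((f k x powr r) *\<^sub>R DB x) \<le> norm (DB x)" by (simp add: mult_left_le_one_le)
    qed
  qed (use iDB in auto)
  also have "(\<integral>x. indicator (box a b) x *\<^sub>R DB x \<partial>lebesgue) = (\<integral>x. DB x \<partial>lebesgue)"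
  proof (rule integral_cong_AE)
    have "cbox a b - box a b \<in> null_sets lebesgue"
      using negligible_frontier_interval negligible_iff_null_sets by blast
    then show "AE x in lebesgue. indicator (box a b) x *\<^sub>R DB x = DB x"
      by (rule AE_I') (auto simp: DB_def indicator_def)
    show "(\<lambda>x. indicator (box a b) x *\<^sub>R DB x) \<in> borel_measurable lebesgue"
      using iDB by (intro borel_measurable_scaleR borel_measurable_indicator) auto
  qed (use iDB in auto)
  also have "(\<integral>x. DB x \<partial>lebesgue) = integral (cbox a b) D"
    using set_lebesgue_integral_eq_integral(2)[OF aD]
    unfolding DB_def set_lebesgue_integral_def .
  finally have "(\<lambda>k. \<integral>x. (f k x powr r) *\<^sub>R D x \<partial>lebesgue_on \<Omega>) \<longlonglongrightarrow> integral (cbox a b) D"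
    unfolding eq1 .
  with f that show ?thesis by blast
qed

text \<open>A weak form of the differentiation theorem. Countably many boxes fill \<Omega>; on each
  of them D, extended by 0, is integrable and is differentiated by cubes with lower corner x. The
  divisor is left as some positive c, because later only the vanishing or the sign of box integrals
  is exploited.\<close>

lemma lebesgue_points:
  fixes D :: "'a::euclidean_space \<Rightarrow> 'b::euclidean_space"
  assumes D: "locally_integrable_on D \<Omega>" and \<Omega>: "open \<Omega>"
  shows "AE x in lebesgue_on \<Omega>. \<forall>e>0. \<exists>a b c. c > 0 \<and> cbox a b \<subseteq> \<Omega> \<and>
    norm (integral (cbox a b) D /\<^sub>R c - D x) < e"
proof -
  obtain \<B> where \<B>: "countable \<B>" "\<B> \<subseteq> Pow \<Omega>" "\<And>X. X \<in> \<B> \<Longrightarrow> \<exists>a b. X = cbox a b" "\<Union>\<B> = \<Omega>"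
    using open_countable_Union_open_cbox[OF \<Omega>] by metis
  have "\<exists>N. negligible N \<and> (\<forall>x\<in>X - N. \<forall>e>0. \<exists>a b c. c > 0 \<and> cbox a b \<subseteq> \<Omega> \<and>
    norm (integral (cbox a b) D /\<^sub>R c - D x) < e)" if X: "X \<in> \<B>" for X
  proof -
    obtain a b where ab: "X = cbox a b" using \<B>(3) X by blast
    then have ab\<Omega>: "cbox a b \<subseteq> \<Omega>" using \<B>(2) X by auto
    define DB where "DB = (\<lambda>x. if x \<in> cbox a b then D x else 0)"
    have "D integrable_on cbox a b"
      using D ab\<Omega> unfolding locally_integrable_on_def by (auto intro: set_lebesgue_integral_eq_integral(1))
    then have "DB integrable_on UNIV" unfolding DB_def by (simp add: integrable_restrict_UNIV)
    then have "DB integrable_on cbox c d" for c d by (rule integrable_on_subcbox) simp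
    then obtain N where N: "negligible N" "\<And>x e. \<lbrakk>x \<notin> N; 0 < e\<rbrakk> \<Longrightarrow>
        \<exists>d>0. \<forall>h. 0 < h \<and> h < d \<longrightarrow> norm (integral (cbox x (x + h *\<^sub>R One)) DB /\<^sub>R h ^ DIM('a) - DB x) < e"
      using integrable_ccontinuous_explicit[of DB] by blast
    show ?thesis
    proof (intro exI[of _ "N \<union> (cbox a b - box a b)"] conjI ballI allI impI)
      show "negligible (N \<union> (cbox a b - box a b))" by (intro negligible_Un N(1) negligible_frontier_interval)
      fix x and e :: real assume x: "x \<in> X - (N \<union> (cbox a b - box a b))" and e: "e > 0"
      then have xb: "x \<in> box a b" "x \<notin> N" by (auto simp: ab)
      obtain d where d: "d > 0" "\<And>h. 0 < h \<Longrightarrow> h < d \<Longrightarrow>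
          norm (integral (cbox x (x + h *\<^sub>R One)) DB /\<^sub>R h ^ DIM('a) - DB x) < e"
        using N(2)[OF xb(2) e] by blast
      obtain \<epsilon> where \<epsilon>: "\<epsilon> > 0" "cball x \<epsilon> \<subseteq> box a b" using open_box xb(1) open_contains_cball by metis
      \<comment> \<open>The Euclidean norm is at most the sum of the coordinates, so a cube with
        side h stays within \<epsilon> of its corner x.\<close>
      define h where "h = min (d / 2) (\<epsilon> / real DIM('a))"
      have h: "0 < h" "h < d" "h * real DIM('a) \<le> \<epsilon>"
        using d \<epsilon> by (auto simp: h_def min_def field_simps)
      have sub: "cbox x (x + h *\<^sub>R One) \<subseteq> cbox a b"
      proof
        fix y assume y: "y \<in> cbox x (x + h *\<^sub>R One)"
        have "norm (y - x) \<le> (\<Sum>i\<in>Basis. \<bar>(y - x) \<bullet> i\<bar>)" by (rule norm_le_l1)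
        also have "\<dots> \<le> (\<Sum>i\<in>(Basis::'a set). h)"
          using y by (intro sum_mono) (auto simp: mem_box inner_diff_left inner_add_left)
        also have "\<dots> \<le> \<epsilon>" using h by (simp add: mult.commute)
        finally have "y \<in> cball x \<epsilon>" by (simp add: dist_norm norm_minus_commute)
        then show "y \<in> cbox a b" using \<epsilon>(2) box_subset_cbox by blast
      qed
      have "integral (cbox x (x + h *\<^sub>R One)) DB = integral (cbox x (x + h *\<^sub>R One)) D"
        using sub by (intro integral_cong) (auto simp: DB_def)
      moreover have "DB x = D x" using xb(1) box_subset_cbox by (auto simp: DB_def)
      ultimately have "norm (integral (cbox x (x + h *\<^sub>R One)) D /\<^sub>R h ^ DIM('a) - D x) < e"
        using d(2)[OF h(1,2)] by simp
      then show "\<exists>a b c. c > 0 \<and> cbox a b \<subseteq> \<Omega> \<and> norm (integral (cbox a b) D /\<^sub>R c - D x) < e"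
        using h(1) sub ab\<Omega> by (intro exI[of _ x] exI[of _ "x + h *\<^sub>R One"] exI[of _ "h ^ DIM('a)"]) auto
    qed
  qed
  then obtain N where N: "\<And>X. X \<in> \<B> \<Longrightarrow> negligible (N X)"
    "\<And>X x. X \<in> \<B> \<Longrightarrow> x \<in> X - N X \<Longrightarrow> \<forall>e>0. \<exists>a b c. c > 0 \<and> cbox a b \<subseteq> \<Omega> \<and>
      norm (integral (cbox a b) D /\<^sub>R c - D x) < e" by metis
  have "negligible (\<Union>(N ` \<B>))" using \<B>(1) N(1) by (intro negligible_countable_Union) auto
  then have "(\<Union>(N ` \<B>)) \<in> null_sets lebesgue" by (simp add: negligible_iff_null_sets)
  then have "AE x in lebesgue. x \<in> \<Omega> \<longrightarrow> (\<forall>e>0. \<exists>a b c. c > 0 \<and> cbox a b \<subseteq> \<Omega> \<and>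
    norm (integral (cbox a b) D /\<^sub>R c - D x) < e)"
  proof (rule AE_I')
    show "{x \<in> space lebesgue. \<not> (x \<in> \<Omega> \<longrightarrow> (\<forall>e>0. \<exists>a b c. c > 0 \<and> cbox a b \<subseteq> \<Omega> \<and>
      norm (integral (cbox a b) D /\<^sub>R c - D x) < e))} \<subseteq> \<Union>(N ` \<B>)"
    proof
      fix x assume x: "x \<in> {x \<in> space lebesgue. \<not> (x \<in> \<Omega> \<longrightarrow> (\<forall>e>0. \<exists>a b c. c > 0 \<and> cbox a b \<subseteq> \<Omega> \<and>
        norm (integral (cbox a b) D /\<^sub>R c - D x) < e))}"
      then obtain X where "X \<in> \<B>" "x \<in> X" using \<B>(4) by blast
      then show "x \<in> \<Union>(N ` \<B>)" using N(2)[of X x] x by blast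
    qed
  qed
  then show ?thesis using \<Omega> by (subst AE_restrict_space_iff) auto
qed

text \<open>The difference of two weak gradients integrates to 0 against all test functions, hence
  over every box in \<Omega>, hence it is 0 at almost every point.\<close>

lemma weak_gradient_unique:
  assumes \<Omega>: "open \<Omega>" and G: "has_weak_gradient \<Omega> u G" "has_weak_gradient \<Omega> u G'"
  shows "AE x in lebesgue_on \<Omega>. G x = G' x"
proof -
  have \<Omega>b: "\<Omega> \<in> sets borel" using \<Omega> by simp
  define D where "D = (\<lambda>x. G x - G' x)"
  have li: "locally_integrable_on G \<Omega>" "locally_integrable_on G' \<Omega>"
    using G by (auto simp: has_weak_gradient_def)
  then have D: "locally_integrable_on D \<Omega>"
    unfolding locally_integrable_on_def D_def by (auto intro: set_integral_diff)
  have zero: "integral (cbox a b) D = 0" if ab: "cbox a b \<subseteq> \<Omega>" for a b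
  proof -
    obtain f where f: "\<And>k. f k \<in> test_functions \<Omega>" "\<And>k x. 0 \<le> f k x"
      "(\<lambda>k. \<integral>x. (f k x powr 1) *\<^sub>R D x \<partial>lebesgue_on \<Omega>) \<longlonglongrightarrow> integral (cbox a b) D"
      using integral_cbox_limit[OF D \<Omega>b ab zero_less_one] by blast
    have "(\<integral>x. (f k x powr 1) *\<^sub>R D x \<partial>lebesgue_on \<Omega>) = 0" for k
    proof -
      have "(\<integral>x. (f k x powr 1) *\<^sub>R D x \<partial>lebesgue_on \<Omega>) = (\<integral>x. f k x *\<^sub>R G x - f k x *\<^sub>R G' x \<partial>lebesgue_on \<Omega>)"
        using f(2) by (simp add: D_def scaleR_diff_right)
      also have "\<dots> = (\<integral>x. f k x *\<^sub>R G x \<partial>lebesgue_on \<Omega>) - (\<integral>x. f k x *\<^sub>R G' x \<partial>lebesgue_on \<Omega>)"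
        using test_function_mult_integrable[OF li(1) \<Omega>b f(1)] test_function_mult_integrable[OF li(2) \<Omega>b f(1)]
        by (rule Bochner_Integration.integral_diff)
      also have "\<dots> = 0" using G f(1)[of k] unfolding has_weak_gradient_def by (simp add: minus_equation_iff)
      finally show ?thesis .
    qed
    then have "(\<lambda>k. 0) \<longlonglongrightarrow> integral (cbox a b) D" using f(3) by (simp only:)
    then show ?thesis using LIMSEQ_unique tendsto_const by blast
  qed
  from lebesgue_points[OF D \<Omega>] show ?thesis
  proof eventually_elim
    case (elim x)
    have "norm (D x) < e" if "e > 0" for e
      using elim that zero by (metis diff_0 norm_minus_cancel scaleR_zero_right)
    then have "\<not> 0 < norm (D x)" by blast
    then show ?case by (simp add: D_def)
  qed
qed

text \<open>If all these integrals were nonpositive, so would be the limits, the integrals of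
  \<open>h\<close> over boxes, and \<open>h\<close> would be nonpositive almost everywhere. The
  function found here is the direction in which the energy becomes negative.\<close>

lemma exists_test_function_positive:
  fixes h :: "'a::euclidean_space \<Rightarrow> real"
  assumes \<Omega>: "open \<Omega>" and h: "locally_integrable_on h \<Omega>" and r: "r > 0"
    and pos: "\<not> (AE x in lebesgue_on \<Omega>. max (h x) 0 = 0)"
  obtains \<psi> where "\<psi> \<in> test_functions \<Omega>" "(\<integral>x. h x * \<bar>\<psi> x\<bar> powr r \<partial>lebesgue_on \<Omega>) > 0"
proof (rule ccontr)
  assume neg: "\<not> thesis"
  note found = that
  have \<Omega>b: "\<Omega> \<in> sets borel" using \<Omega> by simp
  have le: "integral (cbox a b) h \<le> 0" if ab: "cbox a b \<subseteq> \<Omega>" for a b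
  proof -
    obtain f where f: "\<And>k. f k \<in> test_functions \<Omega>" "\<And>k x. 0 \<le> f k x"
      "(\<lambda>k. \<integral>x. (f k x powr r) *\<^sub>R h x \<partial>lebesgue_on \<Omega>) \<longlonglongrightarrow> integral (cbox a b) h"
      using integral_cbox_limit[OF h \<Omega>b ab r] by blast
    have "(\<integral>x. (f k x powr r) *\<^sub>R h x \<partial>lebesgue_on \<Omega>) \<le> 0" for k
    proof -
      have "\<not> (\<integral>x. h x * \<bar>f k x\<bar> powr r \<partial>lebesgue_on \<Omega>) > 0" using neg found[OF f(1)[of k]] by blast
      then show ?thesis using f(2)[of k] by (simp add: mult.commute abs_of_nonneg)
    qed
    then show ?thesis using f(3) by (intro LIMSEQ_le_const2) auto
  qed
  have "AE x in lebesgue_on \<Omega>. max (h x) 0 = 0"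
    using lebesgue_points[OF h \<Omega>]
  proof eventually_elim
    case (elim x)
    have "h x \<le> e" if e: "e > 0" for e
    proof -
      obtain a b c where "c > 0" "cbox a b \<subseteq> \<Omega>" "\<bar>integral (cbox a b) h / c - h x\<bar> < e"
      proof -
        obtain a b c where "c > 0" "cbox a b \<subseteq> \<Omega>" "norm (integral (cbox a b) h /\<^sub>R c - h x) < e"
          using elim e by blast
        then show thesis by (intro that[of c a b]) (simp_all add: divide_inverse mult.commute)
      qed
      then show ?thesis using le[of a b] divide_nonpos_pos[of "integral (cbox a b) h" c] by linarith
    qed
    then have "h x \<le> 0" by (rule field_le_epsilon) simp
    then show ?case by simp
  qed
  then show False using pos by simp
qed

lemma has_weak_gradient_weak_grad:
  assumes "has_weak_gradient \<Omega> u G"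
  shows "has_weak_gradient \<Omega> u (weak_grad \<Omega> u)"
  unfolding weak_grad_def using someI[of "has_weak_gradient \<Omega> u" G] assms by simp

lemma weak_grad_eq:
  assumes "open \<Omega>" "has_weak_gradient \<Omega> u G"
  shows "AE x in lebesgue_on \<Omega>. weak_grad \<Omega> u x = G x"
  using assms has_weak_gradient_weak_grad weak_gradient_unique by blast

lemma has_weak_gradient_diff:
  assumes \<Omega>: "\<Omega> \<in> sets borel" and u: "has_weak_gradient \<Omega> u G" and v: "has_weak_gradient \<Omega> v H"
  shows "has_weak_gradient \<Omega> (\<lambda>x. u x - v x) (\<lambda>x. G x - H x)"
  unfolding has_weak_gradient_def
proof (intro conjI ballI)
  have l: "locally_integrable_on u \<Omega>" "locally_integrable_on G \<Omega>" "locally_integrable_on v \<Omega>" "locally_integrable_on H \<Omega>"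
    using u v by (auto simp: has_weak_gradient_def)
  show "locally_integrable_on (\<lambda>x. u x - v x) \<Omega>" "locally_integrable_on (\<lambda>x. G x - H x) \<Omega>"
    using l unfolding locally_integrable_on_def by (auto intro: set_integral_diff)
  fix \<phi> assume \<phi>: "\<phi> \<in> test_functions \<Omega>"
  note i = test_gradient_mult_integrable[OF l(1) \<Omega> \<phi>] test_gradient_mult_integrable[OF l(3) \<Omega> \<phi>]
    test_function_mult_integrable[OF l(2) \<Omega> \<phi>] test_function_mult_integrable[OF l(4) \<Omega> \<phi>]
  show "(\<integral>x. (u x - v x) *\<^sub>R grad \<phi> x \<partial>lebesgue_on \<Omega>) = - (\<integral>x. \<phi> x *\<^sub>R (G x - H x) \<partial>lebesgue_on \<Omega>)"
    using i u v \<phi> by (simp add: scaleR_diff_left scaleR_diff_right has_weak_gradient_def)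
qed

text \<open>Test functions and their gradients are bounded, so L1 convergence carries both sides of
  the integration by parts formula to the limit.\<close>

lemma has_weak_gradient_limit:
  assumes \<Omega>: "\<Omega> \<in> sets borel" and \<phi>: "\<And>k. \<phi> k \<in> test_functions \<Omega>"
    and i: "integrable (lebesgue_on \<Omega>) u" "integrable (lebesgue_on \<Omega>) G"
    and u: "(\<lambda>k. \<integral>x. \<bar>\<phi> k x - u x\<bar> \<partial>lebesgue_on \<Omega>) \<longlonglongrightarrow> 0"
    and G: "(\<lambda>k. \<integral>x. norm (grad (\<phi> k) x - G x) \<partial>lebesgue_on \<Omega>) \<longlonglongrightarrow> 0"
  shows "has_weak_gradient \<Omega> u G"
  unfolding has_weak_gradient_def
proof (intro conjI ballI)
  show l: "locally_integrable_on u \<Omega>" "locally_integrable_on G \<Omega>"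
    using i by (auto intro: integrable_imp_locally_integrable[OF \<Omega>])
  fix \<psi> assume \<psi>: "\<psi> \<in> test_functions \<Omega>"
  obtain B where B: "B \<ge> 0" "\<And>x. \<bar>\<psi> x\<bar> \<le> B" "\<And>x. norm (grad \<psi> x) \<le> B"
    using test_functions_bounded[OF \<psi>] by blast
  note t = test_function_integrals[OF \<Omega> \<phi> zero_less_one]
  have lk: "locally_integrable_on (\<phi> k) \<Omega>" "locally_integrable_on (grad (\<phi> k)) \<Omega>" for k
    using t by (auto intro: integrable_imp_locally_integrable[OF \<Omega>])
  note j = test_gradient_mult_integrable[OF l(1) \<Omega> \<psi>] test_gradient_mult_integrable[OF lk(1) \<Omega> \<psi>]
    test_function_mult_integrable[OF l(2) \<Omega> \<psi>] test_function_mult_integrable[OF lk(2) \<Omega> \<psi>]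
  have "(\<lambda>k. (\<integral>x. \<phi> k x *\<^sub>R grad \<psi> x \<partial>lebesgue_on \<Omega>) - (\<integral>x. u x *\<^sub>R grad \<psi> x \<partial>lebesgue_on \<Omega>)) \<longlonglongrightarrow> 0"
  proof (rule Lim_null_comparison)
    show "\<forall>\<^sub>F k in sequentially. norm ((\<integral>x. \<phi> k x *\<^sub>R grad \<psi> x \<partial>lebesgue_on \<Omega>) - (\<integral>x. u x *\<^sub>R grad \<psi> x \<partial>lebesgue_on \<Omega>))
      \<le> B * (\<integral>x. \<bar>\<phi> k x - u x\<bar> \<partial>lebesgue_on \<Omega>)"
    proof (intro always_eventually allI)
      fix k
      have "(\<integral>x. \<phi> k x *\<^sub>R grad \<psi> x \<partial>lebesgue_on \<Omega>) - (\<integral>x. u x *\<^sub>R grad \<psi> x \<partial>lebesgue_on \<Omega>)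
        = (\<integral>x. \<phi> k x *\<^sub>R grad \<psi> x - u x *\<^sub>R grad \<psi> x \<partial>lebesgue_on \<Omega>)"
        using j by (intro Bochner_Integration.integral_diff[symmetric])
      also have "norm \<dots> \<le> (\<integral>x. norm (\<phi> k x *\<^sub>R grad \<psi> x - u x *\<^sub>R grad \<psi> x) \<partial>lebesgue_on \<Omega>)"
        by (rule integral_norm_bound)
      also have "\<dots> \<le> (\<integral>x. B * \<bar>\<phi> k x - u x\<bar> \<partial>lebesgue_on \<Omega>)"
      proof (rule integral_mono)
        fix x
        show "norm (\<phi> k x *\<^sub>R grad \<psi> x - u x *\<^sub>R grad \<psi> x) \<le> B * \<bar>\<phi> k x - u x\<bar>"
          using mult_right_mono[OF B(3)[of x], of "\<bar>\<phi> k x - u x\<bar>"]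
          by (simp add: scaleR_diff_left[symmetric] mult.commute)
      qed (use j t i in auto)
      finally show "norm ((\<integral>x. \<phi> k x *\<^sub>R grad \<psi> x \<partial>lebesgue_on \<Omega>) - (\<integral>x. u x *\<^sub>R grad \<psi> x \<partial>lebesgue_on \<Omega>))
        \<le> B * (\<integral>x. \<bar>\<phi> k x - u x\<bar> \<partial>lebesgue_on \<Omega>)" by simp
    qed
    show "(\<lambda>k. B * (\<integral>x. \<bar>\<phi> k x - u x\<bar> \<partial>lebesgue_on \<Omega>)) \<longlonglongrightarrow> 0"
      using tendsto_mult_right_zero[OF u] .
  qed
  then have 1: "(\<lambda>k. \<integral>x. \<phi> k x *\<^sub>R grad \<psi> x \<partial>lebesgue_on \<Omega>) \<longlonglongrightarrow> (\<integral>x. u x *\<^sub>R grad \<psi> x \<partial>lebesgue_on \<Omega>)"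
    by (simp add: LIM_zero_iff)
  have "(\<lambda>k. (\<integral>x. \<psi> x *\<^sub>R grad (\<phi> k) x \<partial>lebesgue_on \<Omega>) - (\<integral>x. \<psi> x *\<^sub>R G x \<partial>lebesgue_on \<Omega>)) \<longlonglongrightarrow> 0"
  proof (rule Lim_null_comparison)
    show "\<forall>\<^sub>F k in sequentially. norm ((\<integral>x. \<psi> x *\<^sub>R grad (\<phi> k) x \<partial>lebesgue_on \<Omega>) - (\<integral>x. \<psi> x *\<^sub>R G x \<partial>lebesgue_on \<Omega>))
      \<le> B * (\<integral>x. norm (grad (\<phi> k) x - G x) \<partial>lebesgue_on \<Omega>)"
    proof (intro always_eventually allI)
      fix k
      have "(\<integral>x. \<psi> x *\<^sub>R grad (\<phi> k) x \<partial>lebesgue_on \<Omega>) - (\<integral>x. \<psi> x *\<^sub>R G x \<partial>lebesgue_on \<Omega>)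
        = (\<integral>x. \<psi> x *\<^sub>R grad (\<phi> k) x - \<psi> x *\<^sub>R G x \<partial>lebesgue_on \<Omega>)"
        using j by (intro Bochner_Integration.integral_diff[symmetric])
      also have "norm \<dots> \<le> (\<integral>x. norm (\<psi> x *\<^sub>R grad (\<phi> k) x - \<psi> x *\<^sub>R G x) \<partial>lebesgue_on \<Omega>)"
        by (rule integral_norm_bound)
      also have "\<dots> \<le> (\<integral>x. B * norm (grad (\<phi> k) x - G x) \<partial>lebesgue_on \<Omega>)"
      proof (rule integral_mono)
        fix x
        show "norm (\<psi> x *\<^sub>R grad (\<phi> k) x - \<psi> x *\<^sub>R G x) \<le> B * norm (grad (\<phi> k) x - G x)"
          using mult_right_mono[OF B(2)[of x], of "norm (grad (\<phi> k) x - G x)"]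
          by (simp add: scaleR_diff_right[symmetric])
      qed (use j t i in auto)
      finally show "norm ((\<integral>x. \<psi> x *\<^sub>R grad (\<phi> k) x \<partial>lebesgue_on \<Omega>) - (\<integral>x. \<psi> x *\<^sub>R G x \<partial>lebesgue_on \<Omega>))
        \<le> B * (\<integral>x. norm (grad (\<phi> k) x - G x) \<partial>lebesgue_on \<Omega>)" by simp
    qed
    show "(\<lambda>k. B * (\<integral>x. norm (grad (\<phi> k) x - G x) \<partial>lebesgue_on \<Omega>)) \<longlonglongrightarrow> 0"
      using tendsto_mult_right_zero[OF G] .
  qed
  then have 2: "(\<lambda>k. \<integral>x. \<psi> x *\<^sub>R grad (\<phi> k) x \<partial>lebesgue_on \<Omega>) \<longlonglongrightarrow> (\<integral>x. \<psi> x *\<^sub>R G x \<partial>lebesgue_on \<Omega>)"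
    by (simp add: LIM_zero_iff)
  have "(\<integral>x. \<phi> k x *\<^sub>R grad \<psi> x \<partial>lebesgue_on \<Omega>) = - (\<integral>x. \<psi> x *\<^sub>R grad (\<phi> k) x \<partial>lebesgue_on \<Omega>)" for k
    using has_weak_gradient_test[OF \<Omega> \<phi>] \<psi> by (auto simp: has_weak_gradient_def)
  then show "(\<integral>x. u x *\<^sub>R grad \<psi> x \<partial>lebesgue_on \<Omega>) = - (\<integral>x. \<psi> x *\<^sub>R G x \<partial>lebesgue_on \<Omega>)"
    using LIMSEQ_unique[OF 1] tendsto_minus[OF 2] by simp
qed

subsection \<open>Functions with uniformly bounded exponential integrals\<close>

text \<open>The number \<beta> has two roles: it is the exponent of the Moser-Trudinger inequality
  and the exponent conjugate to the dimension.\<close>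

locale mt_domain =
  fixes \<Omega> :: "'a::euclidean_space set" and \<beta> :: real
  assumes open_\<Omega>: "open \<Omega>" and bounded_\<Omega>: "bounded \<Omega>" and dim: "DIM('a) \<ge> 2"
    and \<beta>_def: "\<beta> = real DIM('a) / (real DIM('a) - 1)"
begin

abbreviation "M \<equiv> lebesgue_on \<Omega>"
abbreviation "T \<equiv> test_functions \<Omega>"
abbreviation "CM \<equiv> mt_bound * measure lebesgue \<Omega>"

definition N :: "('a \<Rightarrow> real) \<Rightarrow> real" where
  "N \<phi> = (\<integral>x. norm (grad \<phi> x) ^ DIM('a) \<partial>M)"

text \<open>The rate 16 leaves room for every later use: the nonlinearity grows at rate 2, its
  square and its \<beta>-th power at rate at most 4, products with differences stay below 16, and a
  bounded shift of the argument needs 8. The common bound makes estimates uniform over the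
  class.\<close>

definition exp_class :: "('a \<Rightarrow> real) set" where
  "exp_class = {u \<in> borel_measurable M. integrable M (\<lambda>x. exp (16 * \<bar>u x\<bar> powr \<beta>)) \<and>
     (\<integral>x. exp (16 * \<bar>u x\<bar> powr \<beta>) \<partial>M) \<le> CM}"

lemma \<Omega>_borel: "\<Omega> \<in> sets borel" using open_\<Omega> by simp

lemma \<Omega>_lmeasurable: "\<Omega> \<in> lmeasurable"
  using open_\<Omega> bounded_\<Omega> by (rule lmeasurable_open[rotated])

lemma finite_M: "finite_measure M"
  using \<Omega>_lmeasurable by (rule finite_measure_lebesgue_on)

lemma dim_pos: "DIM('a) > 0" using dim by simp

lemma \<beta>_bounds: "1 < \<beta>" "\<beta> \<le> 2" "\<beta> > 0"
  using dim by (auto simp: \<beta>_def field_simps)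

lemma CM_nonneg: "CM \<ge> 0"
proof -
  have "summable (\<lambda>k. 2 * exp (1 / 2) * exp (- 1 / 2 :: real) ^ k)"
    by (intro summable_mult summable_geometric) simp
  then have "mt_bound \<ge> 0" unfolding mt_bound_def by (intro add_nonneg_nonneg suminf_nonneg) auto
  then show ?thesis by (intro mult_nonneg_nonneg) auto
qed

lemma N_nonneg: "N \<phi> \<ge> 0" unfolding N_def by (intro Bochner_Integration.integral_nonneg) auto

lemma N_scale: "\<phi> \<in> T \<Longrightarrow> N (\<lambda>x. c * \<phi> x) = \<bar>c\<bar> ^ DIM('a) * N \<phi>"
  using grad_scale[OF test_functions_smooth, of \<phi> \<Omega> c] by (simp add: N_def power_mult_distrib)

lemma T_integrals:
  assumes "\<phi> \<in> T"
  shows "\<phi> \<in> borel_measurable M" "grad \<phi> \<in> borel_measurable M"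
    "integrable M \<phi>" "integrable M (grad \<phi>)"
    "integrable M (\<lambda>x. \<bar>\<phi> x\<bar> ^ DIM('a))" "integrable M (\<lambda>x. norm (grad \<phi> x) ^ DIM('a))"
  using test_function_integrals[OF \<Omega>_borel assms dim_pos] by auto

text \<open>Applied to \<phi> / \<rho>, the inequality trades radius for rate: any rate, in
  particular 16, is reached on a sufficiently small ball with the same bound.\<close>

lemma scaled_moser_trudinger:
  assumes \<phi>: "\<phi> \<in> T" and \<rho>: "\<rho> > 0" and N: "N \<phi> \<le> \<rho> ^ DIM('a)" and c: "c * \<rho> powr \<beta> \<le> mt_rate TYPE('a)"
  shows "integrable M (\<lambda>x. exp (c * \<bar>\<phi> x\<bar> powr \<beta>))" "(\<integral>x. exp (c * \<bar>\<phi> x\<bar> powr \<beta>) \<partial>M) \<le> CM"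
proof -
  define \<psi> where "\<psi> = (\<lambda>x. (1 / \<rho>) * \<phi> x)"
  have \<psi>: "\<psi> \<in> T" unfolding \<psi>_def by (rule test_functions_scale[OF \<phi>])
  have "N \<psi> = N \<phi> / \<rho> ^ DIM('a)" unfolding \<psi>_def N_scale[OF \<phi>] using \<rho> by (simp add: power_one_over)
  also have "\<dots> \<le> 1" using N \<rho> by simp
  finally have "N \<psi> \<le> 1" .
  then have G: "(\<integral>x. norm (grad \<psi> x) ^ DIM('a) \<partial>lborel) \<le> 1"
    using test_function_integrals(7)[OF \<Omega>_borel \<psi> dim_pos] by (simp add: N_def)
  obtain K where K: "K \<subseteq> \<Omega>" "C1c K \<psi> (grad \<psi>)" using test_functions_C1c[OF \<psi>] by blast
  have mte: "mt_exponent TYPE('a) = \<beta>" by (simp add: mt_exponent_def \<beta>_def)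
  note mt = moser_trudinger[OF K(2) G \<Omega>_borel bounded_\<Omega> K(1) dim, unfolded mte]
  have pt: "exp (c * \<bar>\<phi> x\<bar> powr \<beta>) \<le> exp (mt_rate TYPE('a) * \<bar>\<psi> x\<bar> powr \<beta>)" for x
  proof -
    have "\<bar>\<phi> x\<bar> = \<rho> * \<bar>\<psi> x\<bar>" using \<rho> by (simp add: \<psi>_def abs_mult)
    then have "c * \<bar>\<phi> x\<bar> powr \<beta> = (c * \<rho> powr \<beta>) * \<bar>\<psi> x\<bar> powr \<beta>" using \<rho> by (simp add: powr_mult)
    also have "\<dots> \<le> mt_rate TYPE('a) * \<bar>\<psi> x\<bar> powr \<beta>" using c by (intro mult_right_mono) auto
    finally show ?thesis by simp
  qed
  have [measurable]: "\<phi> \<in> borel_measurable M" using T_integrals(1)[OF \<phi>] .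
  show i: "integrable M (\<lambda>x. exp (c * \<bar>\<phi> x\<bar> powr \<beta>))"
    by (rule Bochner_Integration.integrable_bound[OF mt(1)]) (use pt in auto)
  have "(\<integral>x. exp (c * \<bar>\<phi> x\<bar> powr \<beta>) \<partial>M) \<le> (\<integral>x. exp (mt_rate TYPE('a) * \<bar>\<psi> x\<bar> powr \<beta>) \<partial>M)"
    by (intro integral_mono i mt(1) pt)
  also note mt(2)
  finally show "(\<integral>x. exp (c * \<bar>\<phi> x\<bar> powr \<beta>) \<partial>M) \<le> CM" .
qed

lemma abs_le_exp_powr: "\<bar>s\<bar> \<le> exp (\<bar>s\<bar> powr \<beta>)"
proof (cases "\<bar>s\<bar> \<le> 1")
  case True
  have "1 \<le> exp (\<bar>s\<bar> powr \<beta>)" by simp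
  with True show ?thesis by linarith
next
  case False
  then have "\<bar>s\<bar> powr 1 \<le> \<bar>s\<bar> powr \<beta>" using \<beta>_bounds by (intro powr_mono) auto
  also have "\<dots> \<le> exp (\<bar>s\<bar> powr \<beta>)" using exp_ge_add_one_self[of "\<bar>s\<bar> powr \<beta>"] by linarith
  finally show ?thesis by simp
qed

lemma exp_class_measurable: "u \<in> exp_class \<Longrightarrow> u \<in> borel_measurable M"
  by (simp add: exp_class_def)

lemma exp_class_exp_integrable:
  assumes u: "u \<in> exp_class" and c: "c \<le> 16"
  shows "integrable M (\<lambda>x. exp (c * \<bar>u x\<bar> powr \<beta>))" "(\<integral>x. exp (c * \<bar>u x\<bar> powr \<beta>) \<partial>M) \<le> CM"
proof -
  have [measurable]: "u \<in> borel_measurable M" using u by (rule exp_class_measurable)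
  have i16: "integrable M (\<lambda>x. exp (16 * \<bar>u x\<bar> powr \<beta>))" using u by (simp add: exp_class_def)
  have pt: "exp (c * \<bar>u x\<bar> powr \<beta>) \<le> exp (16 * \<bar>u x\<bar> powr \<beta>)" for x
    using c by (simp add: mult_right_mono)
  show i: "integrable M (\<lambda>x. exp (c * \<bar>u x\<bar> powr \<beta>))"
    by (rule Bochner_Integration.integrable_bound[OF i16]) (use pt in auto)
  have "(\<integral>x. exp (c * \<bar>u x\<bar> powr \<beta>) \<partial>M) \<le> (\<integral>x. exp (16 * \<bar>u x\<bar> powr \<beta>) \<partial>M)"
    by (intro integral_mono i i16 pt)
  also have "\<dots> \<le> CM" using u by (simp add: exp_class_def)
  finally show "(\<integral>x. exp (c * \<bar>u x\<bar> powr \<beta>) \<partial>M) \<le> CM" .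
qed

lemma exp_class_bound_integrable:
  assumes u: "u \<in> exp_class" and f: "f \<in> borel_measurable M" and bd: "\<And>x. \<bar>f x\<bar> \<le> C * exp (c * \<bar>u x\<bar> powr \<beta>)" and c: "c \<le> 16"
  shows "integrable M f"
proof (rule Bochner_Integration.integrable_bound[OF _ f])
  show "integrable M (\<lambda>x. C * exp (c * \<bar>u x\<bar> powr \<beta>))"
    by (intro integrable_mult_right exp_class_exp_integrable[OF u c])
  show "AE x in M. norm (f x) \<le> norm (C * exp (c * \<bar>u x\<bar> powr \<beta>))"
    using order_trans[OF bd abs_ge_self] by (intro AE_I2) simp
qed

lemma exp_class_powr_integrable:
  assumes u: "u \<in> exp_class" and \<mu>: "\<mu> \<ge> 0"
  shows "integrable M (\<lambda>x. \<bar>u x\<bar> powr \<mu>)"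
proof -
  have [measurable]: "u \<in> borel_measurable M" using u by (rule exp_class_measurable)
  obtain C where C: "\<And>s. \<bar>s\<bar> powr \<mu> \<le> C * exp (1 * \<bar>s\<bar> powr \<beta>)"
    using powr_le_exp_powr[OF \<mu> \<beta>_bounds(3), of 1] by auto
  show ?thesis
    by (rule exp_class_bound_integrable[OF u _ _ , of _ C 1]) (use C in auto)
qed

lemma exp_class_integrable:
  assumes u: "u \<in> exp_class"
  shows "integrable M u"
  using abs_le_exp_powr exp_class_measurable[OF u]
  by (intro exp_class_bound_integrable[OF u, of _ 1 1]) auto

lemma exp_classI:
  assumes "\<phi> \<in> T" "\<rho> > 0" "N \<phi> \<le> \<rho> ^ DIM('a)" "16 * \<rho> powr \<beta> \<le> mt_rate TYPE('a)"
  shows "\<phi> \<in> exp_class"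
  using scaled_moser_trudinger[OF assms] T_integrals(1)[OF assms(1)] by (simp add: exp_class_def)

lemma exp_class_mono:
  assumes u: "u \<in> exp_class" and v: "v \<in> borel_measurable M" and le: "\<And>x. \<bar>v x\<bar> \<le> \<bar>u x\<bar>"
  shows "v \<in> exp_class"
proof -
  have pt: "exp (16 * \<bar>v x\<bar> powr \<beta>) \<le> exp (16 * \<bar>u x\<bar> powr \<beta>)" for x
    using le \<beta>_bounds by (simp add: powr_mono2)
  have i16: "integrable M (\<lambda>x. exp (16 * \<bar>u x\<bar> powr \<beta>))" using u by (simp add: exp_class_def)
  have i: "integrable M (\<lambda>x. exp (16 * \<bar>v x\<bar> powr \<beta>))"
    by (rule Bochner_Integration.integrable_bound[OF i16]) (use pt v in auto)
  have "(\<integral>x. exp (16 * \<bar>v x\<bar> powr \<beta>) \<partial>M) \<le> (\<integral>x. exp (16 * \<bar>u x\<bar> powr \<beta>) \<partial>M)"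
    by (intro integral_mono i i16 pt)
  also have "\<dots> \<le> CM" using u by (simp add: exp_class_def)
  finally show ?thesis using i v by (simp add: exp_class_def)
qed

text \<open>Fatou's lemma preserves the fixed bound. This carries exponential integrability from
  test functions to their limit.\<close>

lemma exp_class_closed:
  assumes v: "\<And>k. v k \<in> exp_class" and um: "u \<in> borel_measurable M" and lim: "AE x in M. (\<lambda>k. v k x) \<longlonglongrightarrow> u x"
  shows "u \<in> exp_class"
proof -
  define e where "e = (\<lambda>s::real. exp (16 * \<bar>s\<bar> powr \<beta>))"
  have "continuous_on UNIV e" unfolding e_def using \<beta>_bounds
    by (intro continuous_intros continuous_on_powr') auto
  then have ec: "isCont e s" for s by (simp add: continuous_on_eq_continuous_at)
  have em: "(\<lambda>x. e (w x)) \<in> borel_measurable M" if "w \<in> borel_measurable M" for w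
    using that unfolding e_def by measurable
  have "(\<integral>\<^sup>+x. ennreal (e (u x)) \<partial>M) = (\<integral>\<^sup>+x. liminf (\<lambda>k. ennreal (e (v k x))) \<partial>M)"
  proof (rule nn_integral_cong_AE)
    show "AE x in M. ennreal (e (u x)) = liminf (\<lambda>k. ennreal (e (v k x)))"
      using lim
    proof eventually_elim
      case (elim x)
      have "(\<lambda>k. ennreal (e (v k x))) \<longlonglongrightarrow> ennreal (e (u x))"
        by (intro tendsto_ennrealI isCont_tendsto_compose[OF ec] elim)
      from lim_imp_Liminf[OF trivial_limit_sequentially this] show ?case by (rule sym)
    qed
  qed
  also have "\<dots> \<le> liminf (\<lambda>k. \<integral>\<^sup>+x. ennreal (e (v k x)) \<partial>M)"
    using em[OF exp_class_measurable[OF v]] by (intro nn_integral_liminf) auto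
  also have "\<dots> \<le> ennreal CM"
  proof -
    have "(\<integral>\<^sup>+x. ennreal (e (v k x)) \<partial>M) \<le> ennreal CM" for k
      using v[of k] nn_integral_eq_integral[of M "\<lambda>x. e (v k x)"]
      by (simp add: exp_class_def e_def ennreal_leI)
    then show ?thesis by (intro Liminf_le always_eventually allI) auto
  qed
  finally have le: "(\<integral>\<^sup>+x. ennreal (e (u x)) \<partial>M) \<le> ennreal CM" .
  have i: "integrable M (\<lambda>x. e (u x))"
    using em[OF um] le by (intro integrableI_nonneg) (auto simp: e_def intro: order_le_less_trans)
  have "(\<integral>x. e (u x) \<partial>M) \<le> CM"
    using le nn_integral_eq_integral[OF i] CM_nonneg by (simp add: e_def)
  then show ?thesis using i um by (simp add: exp_class_def e_def)
qed

text \<open>The weight is split at a height L by E \<le> L + E^2 / L. The first part costs L times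
  the L1 distance; the second has an integral of order 1/L uniformly on the class. On the class, L1
  closeness therefore controls integrals with exponentially growing weights.\<close>

lemma exp_class_uniformly_continuous:
  fixes E :: "real \<Rightarrow> real"
  assumes E: "\<And>s. 0 \<le> E s" "\<And>s. E s \<le> C * exp (2 * \<bar>s\<bar> powr \<beta>)" and Em: "E \<in> borel_measurable borel"
    and \<epsilon>: "\<epsilon> > 0"
  obtains \<delta> where "\<delta> > 0"
    "\<And>u v. u \<in> exp_class \<Longrightarrow> v \<in> exp_class \<Longrightarrow> (\<integral>x. \<bar>u x - v x\<bar> \<partial>M) < \<delta> \<Longrightarrow>
      (\<integral>x. \<bar>u x - v x\<bar> * (E (u x) + E (v x)) \<partial>M) < \<epsilon>"
    "\<And>u v. u \<in> exp_class \<Longrightarrow> v \<in> exp_class \<Longrightarrow>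
      integrable M (\<lambda>x. \<bar>u x - v x\<bar> * (E (u x) + E (v x)))"
proof -
  \<comment> \<open>Large enough that the high part, 8 C^2 CM / L after integration, is at most
    \<epsilon>/2.\<close>
  define L where "L = 16 * (C\<^sup>2 + 1) * (CM + 1) / \<epsilon>"
  have L: "L > 0" unfolding L_def using CM_nonneg \<epsilon> by (intro divide_pos_pos mult_pos_pos) (auto simp: add_nonneg_pos)
  have half: "\<bar>s - t\<bar> * E s \<le> L * \<bar>s - t\<bar> + 2 * C\<^sup>2 / L * (exp (16 * \<bar>s\<bar> powr \<beta>) + exp (16 * \<bar>t\<bar> powr \<beta>))" for s t
  proof -
    have "E s \<le> L + (E s)\<^sup>2 / L"
    proof (cases "E s \<le> L")
      case True then show ?thesis using L by (simp add: add_increasing2)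
    next
      case False
      then have "E s * L \<le> (E s)\<^sup>2" using E(1)[of s] by (simp add: power2_eq_square mult_left_mono)
      then have "E s \<le> (E s)\<^sup>2 / L" using L by (simp add: pos_le_divide_eq)
      then show ?thesis using L by simp
    qed
    then have "\<bar>s - t\<bar> * E s \<le> \<bar>s - t\<bar> * (L + (E s)\<^sup>2 / L)" by (intro mult_left_mono) auto
    also have "\<dots> = L * \<bar>s - t\<bar> + \<bar>s - t\<bar> * (E s)\<^sup>2 / L" by (simp add: algebra_simps)
    also have "\<bar>s - t\<bar> * (E s)\<^sup>2 \<le> 2 * C\<^sup>2 * (exp (16 * \<bar>s\<bar> powr \<beta>) + exp (16 * \<bar>t\<bar> powr \<beta>))"
    proof -
      define y where "y = \<bar>s\<bar> powr \<beta>"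
      define z where "z = \<bar>t\<bar> powr \<beta>"
      have yz: "y \<ge> 0" "z \<ge> 0" by (auto simp: y_def z_def)
      have "(E s)\<^sup>2 \<le> (C * exp (2 * y))\<^sup>2" using E by (intro power_mono) (auto simp: y_def)
      also have "\<dots> = C\<^sup>2 * exp (4 * y)" by (simp add: power_mult_distrib exp_double[symmetric])
      finally have "(E s)\<^sup>2 \<le> C\<^sup>2 * exp (4 * y)" .
      moreover have "\<bar>s - t\<bar> \<le> exp y + exp z"
        using abs_le_exp_powr[of s] abs_le_exp_powr[of t] by (simp add: y_def z_def)
      ultimately have "\<bar>s - t\<bar> * (E s)\<^sup>2 \<le> (exp y + exp z) * (C\<^sup>2 * exp (4 * y))"
        by (intro mult_mono) auto
      also have "\<dots> = C\<^sup>2 * (exp (5 * y) + exp (z + 4 * y))"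
      proof -
        have e: "exp (5 * y) = exp y * exp (4 * y)" "exp (z + 4 * y) = exp z * exp (4 * y)"
          by (simp_all add: mult_exp_exp)
        show ?thesis unfolding e by (simp add: algebra_simps)
      qed
      also have "\<dots> \<le> C\<^sup>2 * (2 * (exp (16 * y) + exp (16 * z)))"
      proof (intro mult_left_mono)
        have "exp (5 * y) \<le> exp (16 * y)" using yz by simp
        moreover have "exp (z + 4 * y) \<le> exp (16 * y) + exp (16 * z)"
        proof (cases "z \<le> y")
          case True
          then have "exp (z + 4 * y) \<le> exp (16 * y)" using yz by simp
          then show ?thesis by (simp add: add_increasing2)
        next
          case False
          then have "exp (z + 4 * y) \<le> exp (16 * z)" using yz by simp
          then show ?thesis by (simp add: add_increasing)
        qed
        moreover have "exp (16 * z) > 0" by simp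
        moreover have "a + b \<le> 2 * (c + d)" if "a \<le> c" "b \<le> c + d" "0 < d" for a b c d :: real
        proof -
          have "a + b \<le> c + (c + d)" by (rule add_mono[OF that(1,2)])
          also have "\<dots> \<le> 2 * (c + d)" using that(3) by simp
          finally show ?thesis .
        qed
        ultimately show "exp (5 * y) + exp (z + 4 * y) \<le> 2 * (exp (16 * y) + exp (16 * z))" by blast
      qed simp
      also have "\<dots> = 2 * C\<^sup>2 * (exp (16 * y) + exp (16 * z))" by simp
      finally show ?thesis by (simp only: y_def z_def)
    qed
    finally show ?thesis using L by (simp add: divide_right_mono)
  qed
  define B where "B = (\<lambda>(u :: 'a \<Rightarrow> real) v x. 2 * L * \<bar>u x - v x\<bar> + 4 * C\<^sup>2 / L * (exp (16 * \<bar>u x\<bar> powr \<beta>) + exp (16 * \<bar>v x\<bar> powr \<beta>)))"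
  have pt: "\<bar>u x - v x\<bar> * (E (u x) + E (v x)) \<le> B u v x" for u v and x :: 'a
    using half[of "u x" "v x"] half[of "v x" "u x"] by (simp add: B_def algebra_simps abs_minus_commute)
  have iB: "integrable M (B u v)" if "u \<in> exp_class" "v \<in> exp_class" for u v
    using exp_class_integrable[OF that(1)] exp_class_integrable[OF that(2)] that
    unfolding B_def by (intro Bochner_Integration.integrable_add integrable_mult_right integrable_abs
        Bochner_Integration.integrable_diff) (auto simp: exp_class_def)
  have int: "integrable M (\<lambda>x. \<bar>u x - v x\<bar> * (E (u x) + E (v x)))" if "u \<in> exp_class" "v \<in> exp_class" for u v
  proof (rule Bochner_Integration.integrable_bound[OF iB[OF that]])
    have [measurable]: "u \<in> borel_measurable M" "v \<in> borel_measurable M" "E \<in> borel_measurable borel"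
      using that exp_class_measurable Em by auto
    show "(\<lambda>x. \<bar>u x - v x\<bar> * (E (u x) + E (v x))) \<in> borel_measurable M" by measurable
    show "AE x in M. norm (\<bar>u x - v x\<bar> * (E (u x) + E (v x))) \<le> norm (B u v x)"
      using order_trans[OF pt abs_ge_self] E(1) by (intro AE_I2) (simp add: abs_mult add_nonneg_nonneg)
  qed
  define \<delta> where "\<delta> = \<epsilon> / (4 * L)"
  have "(\<integral>x. \<bar>u x - v x\<bar> * (E (u x) + E (v x)) \<partial>M) < \<epsilon>"
    if uv: "u \<in> exp_class" "v \<in> exp_class" and d: "(\<integral>x. \<bar>u x - v x\<bar> \<partial>M) < \<delta>" for u v
  proof -
    have i: "integrable M (\<lambda>x. \<bar>u x - v x\<bar>)"
      using exp_class_integrable[OF uv(1)] exp_class_integrable[OF uv(2)] by auto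
    have "(\<integral>x. \<bar>u x - v x\<bar> * (E (u x) + E (v x)) \<partial>M) \<le> (\<integral>x. B u v x \<partial>M)"
      by (intro integral_mono int iB uv pt)
    also have "\<dots> = 2 * L * (\<integral>x. \<bar>u x - v x\<bar> \<partial>M)
      + 4 * C\<^sup>2 / L * ((\<integral>x. exp (16 * \<bar>u x\<bar> powr \<beta>) \<partial>M) + (\<integral>x. exp (16 * \<bar>v x\<bar> powr \<beta>) \<partial>M))"
      unfolding B_def using i uv by (simp add: exp_class_def)
    also have "\<dots> \<le> 2 * L * (\<integral>x. \<bar>u x - v x\<bar> \<partial>M) + 4 * C\<^sup>2 / L * (CM + CM)"
      using L uv by (intro add_left_mono mult_left_mono add_mono) (auto simp: exp_class_def)
    also have "4 * C\<^sup>2 / L * (CM + CM) \<le> \<epsilon> / 2"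
    proof -
      have "16 * (C\<^sup>2 * CM) \<le> 16 * ((C\<^sup>2 + 1) * (CM + 1))" using CM_nonneg by (intro mult_left_mono mult_mono) auto
      also have "\<dots> = \<epsilon> * L" using \<epsilon> by (simp add: L_def)
      finally have "16 * (C\<^sup>2 * CM) \<le> \<epsilon> * L" .
      moreover have "4 * x / L * (y + y) \<le> \<epsilon> / 2" if "16 * (x * y) \<le> \<epsilon> * L" for x y
        using that L by (simp add: field_simps)
      ultimately show ?thesis by blast
    qed
    also have "2 * L * (\<integral>x. \<bar>u x - v x\<bar> \<partial>M) < 2 * L * \<delta>" using d L by simp
    also have "2 * L * \<delta> = \<epsilon> / 2" using L by (simp add: \<delta>_def)
    finally show ?thesis by simp
  qed
  moreover have "\<delta> > 0" using \<epsilon> L by (simp add: \<delta>_def)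
  ultimately show ?thesis using that[of \<delta>] int by blast
qed

section \<open>Limits of powers and of dual pairings\<close>

text \<open>On a finite measure space the pointwise bound \<bar>y\<bar> \<le> t + \<bar>y\<bar>^n /
  t^(n-1) reduces L1 convergence to convergence of n-th powers: first t is chosen small, then the
  index large.\<close>

lemma L1_tendsto:
  fixes f :: "nat \<Rightarrow> 'a \<Rightarrow> 'b::euclidean_space"
  assumes m: "\<And>k. f k \<in> borel_measurable M" and i: "\<And>k. integrable M (\<lambda>x. norm (f k x) ^ DIM('a))"
    and lim: "(\<lambda>k. \<integral>x. norm (f k x) ^ DIM('a) \<partial>M) \<longlonglongrightarrow> 0"
  shows "\<And>k. integrable M (f k)" "(\<lambda>k. \<integral>x. norm (f k x) \<partial>M) \<longlonglongrightarrow> 0"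
proof -
  interpret finite_measure M by (rule finite_M)
  have pt: "norm y \<le> t + norm y ^ DIM('a) / t ^ (DIM('a) - 1)" if t: "t > 0" for t and y :: 'b
  proof (cases "norm y \<le> t")
    case True then show ?thesis using t by (simp add: add_increasing2)
  next
    case False
    then have "t ^ (DIM('a) - 1) \<le> norm y ^ (DIM('a) - 1)" using t by (intro power_mono) auto
    then have "norm y * t ^ (DIM('a) - 1) \<le> norm y * norm y ^ (DIM('a) - 1)" by (intro mult_left_mono) auto
    also have "\<dots> = norm y ^ DIM('a)" using dim_pos by (simp flip: power_Suc)
    finally have "norm y \<le> norm y ^ DIM('a) / t ^ (DIM('a) - 1)" using t by (simp add: pos_le_divide_eq)
    then show ?thesis using t by simp
  qed
  have ib: "integrable M (\<lambda>x. t + norm (f k x) ^ DIM('a) / t ^ (DIM('a) - 1))" for t k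
    by (intro Bochner_Integration.integrable_add integrable_const integrable_divide_zero i)
  show int: "integrable M (f k)" for k
    by (rule Bochner_Integration.integrable_bound[OF ib[of 1 k] m])
      (use pt[of 1 "f k _"] in \<open>auto intro!: AE_I2 order_trans[OF _ abs_ge_self]\<close>)
  show "(\<lambda>k. \<integral>x. norm (f k x) \<partial>M) \<longlonglongrightarrow> 0"
  proof (rule LIMSEQ_I)
    fix r :: real assume r: "r > 0"
    define mm where "mm = measure M (space M)"
    have mm: "mm \<ge> 0" by (simp add: mm_def)
    define t where "t = r / (2 * (mm + 1))"
    have t: "t > 0" using r mm by (simp add: t_def)
    have "t * mm < t * (mm + 1)" using t by simp
    also have "\<dots> = r / 2" using mm by (simp add: t_def field_simps)
    finally have tM: "t * measure M (space M) < r / 2" by (simp only: mm_def)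
    have "(r / 2) * t ^ (DIM('a) - 1) > 0" using r t by simp
    from LIMSEQ_D[OF lim this] obtain K where K: "\<And>k. k \<ge> K \<Longrightarrow> (\<integral>x. norm (f k x) ^ DIM('a) \<partial>M) < (r / 2) * t ^ (DIM('a) - 1)"
      by (auto simp: abs_less_iff)
    have "norm ((\<integral>x. norm (f k x) \<partial>M) - 0) < r" if "k \<ge> K" for k
    proof -
      have "(\<integral>x. norm (f k x) \<partial>M) \<le> (\<integral>x. t + norm (f k x) ^ DIM('a) / t ^ (DIM('a) - 1) \<partial>M)"
        using int[of k] by (intro integral_mono ib pt t) auto
      also have "\<dots> = t * measure M (space M) + (\<integral>x. norm (f k x) ^ DIM('a) \<partial>M) / t ^ (DIM('a) - 1)"
        using i[of k] by (simp add: mult.commute)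
      also have "(\<integral>x. norm (f k x) ^ DIM('a) \<partial>M) / t ^ (DIM('a) - 1) < r / 2"
        using K[OF that] t by (simp add: pos_divide_less_eq)
      finally have "(\<integral>x. norm (f k x) \<partial>M) < r" using tM by simp
      then show ?thesis by (simp add: Bochner_Integration.integral_nonneg)
    qed
    then show "\<exists>K. \<forall>k\<ge>K. norm ((\<integral>x. norm (f k x) \<partial>M) - 0) < r" by blast
  qed
qed

text \<open>The mean value bound for the difference of n-th powers is a product of
  \<open>norm (x - y)\<close> with an (n-1)-st power. The scaled Young inequality separates them
  into bounded n-th powers with a small factor and the n-th power of the difference.\<close>

lemma norm_power_integral_tendsto:
  fixes X :: "nat \<Rightarrow> 'a \<Rightarrow> 'b::euclidean_space"
  assumes m: "\<And>k. X k \<in> borel_measurable M" "Y \<in> borel_measurable M"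
    and i: "\<And>k. integrable M (\<lambda>x. norm (X k x) ^ DIM('a))" "integrable M (\<lambda>x. norm (Y x) ^ DIM('a))"
    and bd: "\<And>k. (\<integral>x. norm (X k x) ^ DIM('a) \<partial>M) \<le> B"
    and lim: "(\<lambda>k. \<integral>x. norm (X k x - Y x) ^ DIM('a) \<partial>M) \<longlonglongrightarrow> 0"
  shows "(\<lambda>k. \<integral>x. norm (X k x) ^ DIM('a) \<partial>M) \<longlonglongrightarrow> (\<integral>x. norm (Y x) ^ DIM('a) \<partial>M)"
proof (rule LIMSEQ_I)
  fix r :: real assume r: "r > 0"
  define d where "d = real DIM('a)"
  have d: "d \<ge> 2" using dim by (simp add: d_def)
  have pw: "norm z ^ DIM('a) = norm z powr d" for z :: 'b
    using dim by (simp add: d_def powr_realpow')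
  define S where "S = B + (\<integral>x. norm (Y x) ^ DIM('a) \<partial>M)"
  have B0: "B \<ge> 0" using bd[of 0] by (rule order_trans[rotated]) (simp add: Bochner_Integration.integral_nonneg)
  have S: "S \<ge> 0" unfolding S_def using B0 by (simp add: Bochner_Integration.integral_nonneg)
  \<comment> \<open>Chosen so that d e^\<beta> S \<le> r/2; the remaining term has a fixed constant
    and tends to 0.\<close>
  define e where "e = (r / (2 * d * (S + 1))) powr (1 / \<beta>)"
  have e: "e > 0" using r d S by (simp add: e_def)
  have e\<beta>: "e powr \<beta> = r / (2 * d * (S + 1))" using r d S \<beta>_bounds by (simp add: e_def powr_powr)
  have \<beta>eq: "\<beta> = d / (d - 1)" by (simp add: \<beta>_def d_def)
  have pt: "\<bar>norm x ^ DIM('a) - norm y ^ DIM('a)\<bar>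
    \<le> d * e powr \<beta> * (norm x ^ DIM('a) + norm y ^ DIM('a)) + d * e powr (- d) * norm (x - y) ^ DIM('a)" for x y :: 'b
  proof -
    define w where "w = max (norm x) (norm y)"
    have w: "w \<ge> 0" by (simp add: w_def le_max_iff_disj)
    have "\<bar>norm x powr d - norm y powr d\<bar> \<le> d * \<bar>norm x - norm y\<bar> * w powr (d - 1)"
      using powr_diff_le[of d "norm x" "norm y"] d by (simp add: w_def)
    also have "\<dots> \<le> d * norm (x - y) * w powr (d - 1)"
      using d norm_triangle_ineq3[of x y] by (intro mult_right_mono mult_left_mono) auto
    also have "\<dots> = d * (w powr (d - 1) * norm (x - y))" by simp
    also have "\<dots> \<le> d * (e powr \<beta> * (w powr (d - 1)) powr \<beta> + e powr (- d) * norm (x - y) powr d)"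
    proof (intro mult_left_mono young_scaled)
      show "1 < \<beta>" by (rule \<beta>_bounds)
      show "d = \<beta> / (\<beta> - 1)" using d by (simp add: \<beta>eq field_simps)
    qed (use d e in auto)
    also have "(w powr (d - 1)) powr \<beta> = w powr d" using d by (simp add: powr_powr \<beta>eq)
    also have "d * (e powr \<beta> * w powr d + e powr (- d) * norm (x - y) powr d)
      \<le> d * (e powr \<beta> * (norm x powr d + norm y powr d) + e powr (- d) * norm (x - y) powr d)"
      using d by (intro mult_left_mono add_right_mono) (auto simp: w_def max_def)
    finally show ?thesis unfolding pw by (simp add: algebra_simps)
  qed
  have idiff: "integrable M (\<lambda>x. norm (X k x - Y x) ^ DIM('a))" for k
  proof (rule Bochner_Integration.integrable_bound)
    show "integrable M (\<lambda>x. 2 ^ DIM('a) * (norm (X k x) ^ DIM('a) + norm (Y x) ^ DIM('a)))" using i by auto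
    show "AE x in M. norm (norm (X k x - Y x) ^ DIM('a)) \<le> norm (2 ^ DIM('a) * (norm (X k x) ^ DIM('a) + norm (Y x) ^ DIM('a)))"
    proof (rule AE_I2)
      fix x show "norm (norm (X k x - Y x) ^ DIM('a)) \<le> norm (2 ^ DIM('a) * (norm (X k x) ^ DIM('a) + norm (Y x) ^ DIM('a)))"
        using norm_add_power_le[of "X k x" "- Y x" "DIM('a)"] by (simp add: abs_mult)
    qed
  qed (use m in auto)
  have "r / (2 * d * e powr (- d)) > 0" using r d e by simp
  from LIMSEQ_D[OF lim this] obtain K where K: "\<And>k. k \<ge> K \<Longrightarrow>
      (\<integral>x. norm (X k x - Y x) ^ DIM('a) \<partial>M) < r / (2 * d * e powr (- d))"
    by (auto simp: abs_less_iff)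
  have "norm ((\<integral>x. norm (X k x) ^ DIM('a) \<partial>M) - (\<integral>x. norm (Y x) ^ DIM('a) \<partial>M)) < r" if k: "k \<ge> K" for k
  proof -
    have "norm ((\<integral>x. norm (X k x) ^ DIM('a) \<partial>M) - (\<integral>x. norm (Y x) ^ DIM('a) \<partial>M))
      = norm (\<integral>x. norm (X k x) ^ DIM('a) - norm (Y x) ^ DIM('a) \<partial>M)"
      using i by simp
    also have "\<dots> \<le> (\<integral>x. norm (norm (X k x) ^ DIM('a) - norm (Y x) ^ DIM('a)) \<partial>M)"
      by (rule integral_norm_bound)
    also have "\<dots> \<le> (\<integral>x. d * e powr \<beta> * (norm (X k x) ^ DIM('a) + norm (Y x) ^ DIM('a))
      + d * e powr (- d) * norm (X k x - Y x) ^ DIM('a) \<partial>M)"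
      using i idiff pt by (intro integral_mono) auto
    also have "\<dots> = d * e powr \<beta> * ((\<integral>x. norm (X k x) ^ DIM('a) \<partial>M) + (\<integral>x. norm (Y x) ^ DIM('a) \<partial>M))
      + d * e powr (- d) * (\<integral>x. norm (X k x - Y x) ^ DIM('a) \<partial>M)"
      using i idiff by simp
    also have "\<dots> \<le> d * e powr \<beta> * S + d * e powr (- d) * (\<integral>x. norm (X k x - Y x) ^ DIM('a) \<partial>M)"
      using bd[of k] d by (intro add_right_mono mult_left_mono) (auto simp: S_def)
    also have "d * e powr \<beta> * S \<le> r / 2"
      using r d S unfolding e\<beta> by (simp add: divide_simps)
    also have "d * e powr (- d) * (\<integral>x. norm (X k x - Y x) ^ DIM('a) \<partial>M) < r / 2"
    proof -
      have "d * e powr (- d) * (\<integral>x. norm (X k x - Y x) ^ DIM('a) \<partial>M) < d * e powr (- d) * (r / (2 * d * e powr (- d)))"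
        using K[OF k] d e by (intro mult_strict_left_mono) auto
      also have "\<dots> = r / 2" using d e by simp
      finally show ?thesis .
    qed
    finally show ?thesis by simp
  qed
  then show "\<exists>K. \<forall>k\<ge>K. norm ((\<integral>x. norm (X k x) ^ DIM('a) \<partial>M) - (\<integral>x. norm (Y x) ^ DIM('a) \<partial>M)) < r" by blast
qed

text \<open>A function in L^\<beta> paired with a sequence tending to 0 in L^n; e is fixed first to
  make the part of \<open>f\<close> small. The integrand is merely dominated by the product, so that
  inner products of gradients are covered too.\<close>

lemma dual_pairing_tendsto:
  assumes fm: "f \<in> borel_measurable M" and fi: "integrable M (\<lambda>x. \<bar>f x\<bar> powr \<beta>)"
    and Hm: "\<And>k. H k \<in> borel_measurable M" and gi: "\<And>k. integrable M (\<lambda>x. \<bar>g k x\<bar> ^ DIM('a))"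
    and H: "\<And>k. AE x in M. \<bar>H k x\<bar> \<le> \<bar>f x\<bar> * \<bar>g k x\<bar>"
    and lim: "(\<lambda>k. \<integral>x. \<bar>g k x\<bar> ^ DIM('a) \<partial>M) \<longlonglongrightarrow> 0"
  shows "\<And>k. integrable M (H k)" "(\<lambda>k. \<integral>x. H k x \<partial>M) \<longlonglongrightarrow> 0"
proof -
  define d where "d = real DIM('a)"
  have d: "d \<ge> 2" using dim by (simp add: d_def)
  have \<beta>eq: "\<beta> = d / (d - 1)" by (simp add: \<beta>_def d_def)
  have pw: "\<bar>z\<bar> ^ DIM('a) = \<bar>z\<bar> powr d" for z :: real
    using dim by (simp add: d_def powr_realpow')
  have pt: "AE x in M. \<bar>H k x\<bar> \<le> e powr \<beta> * \<bar>f x\<bar> powr \<beta> + e powr (- d) * \<bar>g k x\<bar> ^ DIM('a)" if "e > 0" for k e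
    using H[of k]
  proof eventually_elim
    case (elim x)
    have "\<bar>f x\<bar> * \<bar>g k x\<bar> \<le> e powr \<beta> * \<bar>f x\<bar> powr \<beta> + e powr (- d) * \<bar>g k x\<bar> powr d"
    proof (rule young_scaled)
      show "d = \<beta> / (\<beta> - 1)" using d by (simp add: \<beta>eq field_simps)
    qed (use \<beta>_bounds that in auto)
    with elim show ?case by (simp add: pw)
  qed
  have ib: "integrable M (\<lambda>x. e powr \<beta> * \<bar>f x\<bar> powr \<beta> + e powr (- d) * \<bar>g k x\<bar> ^ DIM('a))" for e k
    using fi gi by auto
  show int: "integrable M (H k)" for k
  proof (rule Bochner_Integration.integrable_bound[OF ib[where e=1 and k=k] Hm])
    show "AE x in M. norm (H k x) \<le> norm (1 powr \<beta> * \<bar>f x\<bar> powr \<beta> + 1 powr (- d) * \<bar>g k x\<bar> ^ DIM('a))"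
      using pt[OF zero_less_one, of k] by eventually_elim auto
  qed
  show "(\<lambda>k. \<integral>x. H k x \<partial>M) \<longlonglongrightarrow> 0"
  proof (rule LIMSEQ_I)
    fix r :: real assume r: "r > 0"
    define S where "S = (\<integral>x. \<bar>f x\<bar> powr \<beta> \<partial>M)"
    have S: "S \<ge> 0" by (simp add: S_def Bochner_Integration.integral_nonneg)
    define e where "e = (r / (2 * (S + 1))) powr (1 / \<beta>)"
    have e: "e > 0" using r S by (simp add: e_def)
    have e\<beta>: "e powr \<beta> = r / (2 * (S + 1))" using r S \<beta>_bounds by (simp add: e_def powr_powr)
    have "r / (2 * e powr (- d)) > 0" using r e by simp
    from LIMSEQ_D[OF lim this] obtain K where K: "\<And>k. k \<ge> K \<Longrightarrow> (\<integral>x. \<bar>g k x\<bar> ^ DIM('a) \<partial>M) < r / (2 * e powr (- d))"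
      by (auto simp: abs_less_iff)
    have "norm ((\<integral>x. H k x \<partial>M) - 0) < r" if k: "k \<ge> K" for k
    proof -
      have "norm ((\<integral>x. H k x \<partial>M) - 0) \<le> (\<integral>x. norm (H k x) \<partial>M)" using integral_norm_bound[of M "H k"] by simp
      also have "\<dots> \<le> (\<integral>x. e powr \<beta> * \<bar>f x\<bar> powr \<beta> + e powr (- d) * \<bar>g k x\<bar> ^ DIM('a) \<partial>M)"
        using pt[OF e, of k] int[of k] by (intro integral_mono_AE ib) auto
      also have "\<dots> = e powr \<beta> * S + e powr (- d) * (\<integral>x. \<bar>g k x\<bar> ^ DIM('a) \<partial>M)"
        using fi gi by (simp add: S_def)
      also have "e powr \<beta> * S \<le> r / 2" using r S unfolding e\<beta> by (simp add: divide_simps)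
      also have "e powr (- d) * (\<integral>x. \<bar>g k x\<bar> ^ DIM('a) \<partial>M) < r / 2"
      proof -
        have "e powr (- d) * (\<integral>x. \<bar>g k x\<bar> ^ DIM('a) \<partial>M) < e powr (- d) * (r / (2 * e powr (- d)))"
          using K[OF k] e by (intro mult_strict_left_mono) auto
        also have "\<dots> = r / 2" using e by simp
        finally show ?thesis .
      qed
      finally show ?thesis by simp
    qed
    then show "\<exists>K. \<forall>k\<ge>K. norm ((\<integral>x. H k x \<partial>M) - 0) < r" by blast
  qed
qed

text \<open>The n-th power is dominated by the exponential in the Moser-Trudinger inequality, and
  scaling by \<tau> restores homogeneity. The bound is phrased with a positive \<tau> instead of
  \<open>N \<phi>\<close> so that no case distinction at 0 arises.\<close>

lemma Poincare_power:
  obtains C where "C \<ge> 0" "\<And>\<phi> \<tau>. \<phi> \<in> T \<Longrightarrow> \<tau> > 0 \<Longrightarrow> N \<phi> \<le> \<tau> ^ DIM('a) \<Longrightarrow>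
    (\<integral>x. \<bar>\<phi> x\<bar> ^ DIM('a) \<partial>M) \<le> C * \<tau> ^ DIM('a)"
proof -
  define \<alpha> where "\<alpha> = mt_rate TYPE('a)"
  have \<alpha>: "\<alpha> > 0" using mt_rate_pos by (simp add: \<alpha>_def)
  obtain C where C: "C > 0" "\<And>s. \<bar>s\<bar> powr (real DIM('a)) \<le> C * exp (\<alpha> * \<bar>s\<bar> powr \<beta>)"
    using powr_le_exp_powr[OF _ \<beta>_bounds(3) \<alpha>, of "real DIM('a)"] by auto
  have "(\<integral>x. \<bar>\<phi> x\<bar> ^ DIM('a) \<partial>M) \<le> (C * CM) * \<tau> ^ DIM('a)"
    if \<phi>: "\<phi> \<in> T" and \<tau>: "\<tau> > 0" and N: "N \<phi> \<le> \<tau> ^ DIM('a)" for \<phi> \<tau>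
  proof -
    define \<psi> where "\<psi> = (\<lambda>x. (1 / \<tau>) * \<phi> x)"
    have \<psi>: "\<psi> \<in> T" unfolding \<psi>_def by (rule test_functions_scale[OF \<phi>])
    have "N \<psi> = N \<phi> / \<tau> ^ DIM('a)" unfolding \<psi>_def N_scale[OF \<phi>] using \<tau> by (simp add: power_one_over)
    also have "\<dots> \<le> 1" using N \<tau> by simp
    finally have "N \<psi> \<le> 1 ^ DIM('a)" by simp
    note mt = scaled_moser_trudinger[OF \<psi> zero_less_one this, of \<alpha>]
    have "(\<integral>x. \<bar>\<psi> x\<bar> ^ DIM('a) \<partial>M) \<le> (\<integral>x. C * exp (\<alpha> * \<bar>\<psi> x\<bar> powr \<beta>) \<partial>M)"
    proof (rule integral_mono)
      show "\<bar>\<psi> x\<bar> ^ DIM('a) \<le> C * exp (\<alpha> * \<bar>\<psi> x\<bar> powr \<beta>)" for x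
        using C(2)[of "\<psi> x"] dim by (simp add: powr_realpow')
    qed (use T_integrals(5)[OF \<psi>] mt in \<open>auto simp: \<alpha>_def\<close>)
    also have "\<dots> \<le> C * CM" using mt C(1) by (simp add: \<alpha>_def)
    finally have "(\<integral>x. \<bar>\<psi> x\<bar> ^ DIM('a) \<partial>M) \<le> C * CM" .
    moreover have "(\<integral>x. \<bar>\<phi> x\<bar> ^ DIM('a) \<partial>M) = \<tau> ^ DIM('a) * (\<integral>x. \<bar>\<psi> x\<bar> ^ DIM('a) \<partial>M)"
      using \<tau> by (simp add: \<psi>_def abs_mult power_mult_distrib power_divide)
    ultimately show ?thesis using \<tau> by (simp add: mult.commute mult_left_mono)
  qed
  then show ?thesis using that[of "C * CM"] C(1) CM_nonneg by simp
qed

end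

subsection \<open>The energy functional\<close>

definition nonlin :: "real \<Rightarrow> real \<Rightarrow> real \<Rightarrow> real" where
  "nonlin p \<beta> s = s * \<bar>s\<bar> powr p * exp (\<bar>s\<bar> powr \<beta>)"

definition prim :: "real \<Rightarrow> real \<Rightarrow> real \<Rightarrow> real" where
  "prim p \<beta> = (SOME G. G 0 = 0 \<and> (\<forall>s. (G has_real_derivative nonlin p \<beta> s) (at s)))"

lemma continuous_nonlin:
  assumes "p > 0" "\<beta> > 0"
  shows "continuous_on UNIV (nonlin p \<beta>)"
  unfolding nonlin_def using assms by (intro continuous_intros continuous_on_powr') auto

lemma prim:
  assumes "p > 0" "\<beta> > 0"
  shows "prim p \<beta> 0 = 0" "(prim p \<beta> has_real_derivative nonlin p \<beta> s) (at s)"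
proof -
  have "\<And>x. isCont (nonlin p \<beta>) x"
    using continuous_nonlin[OF assms] by (simp add: continuous_on_eq_continuous_at)
  then obtain F where F: "\<And>x. (F has_vector_derivative nonlin p \<beta> x) (at x)"
    using einterval_antiderivative[of "-\<infinity>" "\<infinity>" "nonlin p \<beta>"] by auto
  have "((\<lambda>x. F x - F 0) has_real_derivative nonlin p \<beta> x) (at x)" for x
    using F[of x] by (auto simp: has_real_derivative_iff_has_vector_derivative intro!: derivative_eq_intros)
  then have "\<exists>G. G 0 = 0 \<and> (\<forall>s. (G has_real_derivative nonlin p \<beta> s) (at s))"
    by (intro exI[of _ "\<lambda>x. F x - F 0"]) auto
  from someI_ex[OF this] show "prim p \<beta> 0 = 0" "(prim p \<beta> has_real_derivative nonlin p \<beta> s) (at s)"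
    unfolding prim_def by auto
qed

lemma abs_nonlin:
  "\<bar>nonlin p \<beta> s\<bar> = \<bar>s\<bar> powr (p + 1) * exp (\<bar>s\<bar> powr \<beta>)"
  by (cases "s = 0") (auto simp: nonlin_def abs_mult powr_add)

lemma abs_nonlin_mono:
  assumes "p > 0" "\<beta> > 0" "\<bar>s\<bar> \<le> \<bar>t\<bar>"
  shows "\<bar>nonlin p \<beta> s\<bar> \<le> \<bar>nonlin p \<beta> t\<bar>"
  unfolding abs_nonlin using assms by (intro mult_mono) (auto intro!: powr_mono2)

text \<open>The nonlinearity is odd, so the derivative of the difference vanishes. Evenness lets
  almost minimisers be replaced by nonnegative functions.\<close>

lemma prim_even:
  assumes "p > 0" "\<beta> > 0"
  shows "prim p \<beta> (- s) = prim p \<beta> s"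
proof -
  have d: "((\<lambda>x. prim p \<beta> x - prim p \<beta> (- x)) has_real_derivative 0) (at x)" for x
  proof -
    have "((\<lambda>x. prim p \<beta> (- x)) has_real_derivative nonlin p \<beta> (- x) * - 1) (at x)"
      by (rule DERIV_chain2[OF prim(2)[OF assms]]) (auto intro!: derivative_eq_intros)
    from DERIV_diff[OF prim(2)[OF assms] this] show ?thesis by (simp add: nonlin_def)
  qed
  have "prim p \<beta> s - prim p \<beta> (- s) = prim p \<beta> 0 - prim p \<beta> (- 0)"
    by (rule DERIV_isconst_all) (use d in blast)
  then show ?thesis by simp
qed

lemma prim_abs:
  assumes "p > 0" "\<beta> > 0"
  shows "prim p \<beta> \<bar>s\<bar> = prim p \<beta> s"
  using prim_even[OF assms, of s] by (simp add: abs_if)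

text \<open>The derivative is monotone in the absolute value of its argument, so on the segment it
  is at most its value at one of the two ends. The right side has the shape treated by
  \<open>exp_class_uniformly_continuous\<close>.\<close>

lemma prim_diff_le:
  assumes "p > 0" "\<beta> > 0"
  shows "\<bar>prim p \<beta> s - prim p \<beta> t\<bar> \<le> \<bar>s - t\<bar> * (\<bar>nonlin p \<beta> s\<bar> + \<bar>nonlin p \<beta> t\<bar>)"
proof -
  have "norm (prim p \<beta> s - prim p \<beta> t) \<le> (\<bar>nonlin p \<beta> s\<bar> + \<bar>nonlin p \<beta> t\<bar>) * norm (s - t)"
  proof (rule field_differentiable_bound[where S="closed_segment s t" and f'="nonlin p \<beta>"])
    fix z assume z: "z \<in> closed_segment s t"
    show "(prim p \<beta> has_real_derivative nonlin p \<beta> z) (at z within closed_segment s t)"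
      using prim(2)[OF assms] has_field_derivative_at_within by blast
    have "\<bar>z\<bar> \<le> \<bar>s\<bar> \<or> \<bar>z\<bar> \<le> \<bar>t\<bar>" using z by (auto simp: closed_segment_eq_real_ivl split: if_splits)
    then show "norm (nonlin p \<beta> z) \<le> \<bar>nonlin p \<beta> s\<bar> + \<bar>nonlin p \<beta> t\<bar>"
      using abs_nonlin_mono[OF assms] by (metis abs_ge_zero add_increasing add_increasing2 real_norm_def)
  qed auto
  then show ?thesis by (simp add: mult.commute)
qed

lemma prim_nonneg:
  assumes "p > 0" "\<beta> > 0"
  shows "0 \<le> prim p \<beta> s"
proof -
  have "prim p \<beta> 0 \<le> prim p \<beta> \<bar>s\<bar>"
  proof (rule DERIV_nonneg_imp_nondecreasing[of 0 "\<bar>s\<bar>" "prim p \<beta>"])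
    fix x :: real assume "0 \<le> x" "x \<le> \<bar>s\<bar>"
    then show "\<exists>y. (prim p \<beta> has_real_derivative y) (at x) \<and> 0 \<le> y"
      using prim(2)[OF assms, of x] by (intro exI[of _ "nonlin p \<beta> x"]) (simp add: nonlin_def)
  qed simp
  then show ?thesis using prim(1)[OF assms] prim_abs[OF assms] by simp
qed

lemma prim_le:
  assumes "p > 0" "\<beta> > 0"
  shows "prim p \<beta> s \<le> \<bar>s\<bar> powr (p + 2) * exp (\<bar>s\<bar> powr \<beta>)"
proof -
  have "\<bar>prim p \<beta> s - prim p \<beta> 0\<bar> \<le> \<bar>s - 0\<bar> * (\<bar>nonlin p \<beta> s\<bar> + \<bar>nonlin p \<beta> 0\<bar>)"
    by (rule prim_diff_le[OF assms])
  then have "prim p \<beta> s \<le> \<bar>s\<bar> * \<bar>nonlin p \<beta> s\<bar>" using prim(1)[OF assms] by (simp add: nonlin_def)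
  also have "\<dots> = \<bar>s\<bar> powr (p + 2) * exp (\<bar>s\<bar> powr \<beta>)"
    unfolding abs_nonlin using powr_add[of "\<bar>s\<bar>" 1 "p + 1"] by (cases "s = 0") (simp_all add: add.commute)
  finally show ?thesis .
qed

lemma nonlin_le_exp:
  assumes "p > 0" "\<beta> > 0"
  obtains C where "C > 0" "\<And>s. \<bar>nonlin p \<beta> s\<bar> \<le> C * exp (2 * \<bar>s\<bar> powr \<beta>)"
proof -
  obtain C where C: "C > 0" "\<And>s. \<bar>s\<bar> powr (p + 1) \<le> C * exp (1 * \<bar>s\<bar> powr \<beta>)"
    using powr_le_exp_powr[of "p + 1" \<beta> 1] assms by auto
  have "\<bar>nonlin p \<beta> s\<bar> \<le> C * exp (2 * \<bar>s\<bar> powr \<beta>)" for s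
  proof -
    have "\<bar>nonlin p \<beta> s\<bar> \<le> (C * exp (\<bar>s\<bar> powr \<beta>)) * exp (\<bar>s\<bar> powr \<beta>)"
      unfolding abs_nonlin using C(2)[of s] by (intro mult_right_mono) auto
    also have "\<dots> = C * exp (2 * \<bar>s\<bar> powr \<beta>)" by (simp add: mult_exp_exp)
    finally show ?thesis .
  qed
  with C(1) that show ?thesis by blast
qed

section \<open>Derivatives of powers of absolute values and norms\<close>

text \<open>The form with exponent r - 2 and a factor s matches the weak formulation. At 0 it
  evaluates to 0 even for r < 2, and this is the derivative there because r > 1.\<close>

lemma abs_powr_deriv:
  fixes r s :: real
  assumes "r > 1"
  shows "((\<lambda>s. \<bar>s\<bar> powr r) has_real_derivative r * (\<bar>s\<bar> powr (r - 2) * s)) (at s)"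
proof -
  consider "s > 0" | "s < 0" | "s = 0" by linarith
  then show ?thesis
  proof cases
    case 1
    have "((\<lambda>s. s powr r) has_real_derivative r * (\<bar>s\<bar> powr (r - 2) * s)) (at s)"
      using 1 powr_add[of s "r - 2" 1] by (auto intro!: derivative_eq_intros)
    then show ?thesis
      by (rule has_field_derivative_transform_within_open[where S="{0<..}"]) (use 1 in auto)
  next
    case 2
    have "((\<lambda>s. (- s) powr r) has_real_derivative r * (\<bar>s\<bar> powr (r - 2) * s)) (at s)"
      using 2 powr_add[of "- s" "r - 2" 1] by (auto intro!: derivative_eq_intros)
    then show ?thesis
      by (rule has_field_derivative_transform_within_open[where S="{..<0}"]) (use 2 in auto)
  next
    case 3
    have "((\<lambda>h. \<bar>h\<bar> powr r / h) \<longlongrightarrow> 0) (at (0::real))"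
    proof (rule Lim_null_comparison)
      show "\<forall>\<^sub>F h in at (0::real). norm (\<bar>h\<bar> powr r / h) \<le> \<bar>h\<bar> powr (r - 1)"
        by (auto simp: eventually_at_filter powr_diff abs_divide)
      show "((\<lambda>h::real. \<bar>h\<bar> powr (r - 1)) \<longlongrightarrow> 0) (at 0)"
        by (rule tendsto_zero_powrI[where b="r - 1"])
          (use assms in \<open>auto intro!: tendsto_rabs_zero tendsto_ident_at\<close>)
    qed
    then show ?thesis using 3 by (simp add: DERIV_def)
  qed
qed

text \<open>Where the vector is nonzero, the function is the power n/2 of a quadratic polynomial in
  t. Where it is zero, the function is \<bar>h\<bar>^n times a constant, and the inner product makes
  the formula vanish even for n = 2, when the power of the norm is 1.\<close>

lemma norm_power_deriv:
  fixes x y :: "'a::euclidean_space"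
  assumes "n \<ge> 2"
  shows "((\<lambda>t. norm (x + t *\<^sub>R y) ^ n) has_real_derivative
    real n * norm (x + t *\<^sub>R y) ^ (n - 2) * ((x + t *\<^sub>R y) \<bullet> y)) (at t)"
proof -
  define m where "m = real n / 2"
  have sq: "norm z ^ n = ((norm z)\<^sup>2) powr m" for z :: 'a
  proof -
    have "((norm z)\<^sup>2) powr m = norm z powr (2 * m)"
      by (cases "z = 0") (auto simp: powr_powr[symmetric] powr_numeral)
    also have "\<dots> = norm z powr real n" by (simp add: m_def)
    also have "\<dots> = norm z ^ n" using assms by (intro powr_realpow') auto
    finally show ?thesis by simp
  qed
  show ?thesis
  proof (cases "x + t *\<^sub>R y = 0")
    case False
    define z where "z = x + t *\<^sub>R y"
    have z: "norm z > 0" using False by (simp add: z_def)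
    have "((\<lambda>t. ((x + t *\<^sub>R y) \<bullet> (x + t *\<^sub>R y)) powr m) has_real_derivative
      m * ((x + t *\<^sub>R y) \<bullet> (x + t *\<^sub>R y)) powr (m - 1) * (2 * ((x + t *\<^sub>R y) \<bullet> y))) (at t)"
    proof (rule DERIV_chain2[where f="\<lambda>s. s powr m"])
      show "((\<lambda>s. s powr m) has_real_derivative m * ((x + t *\<^sub>R y) \<bullet> (x + t *\<^sub>R y)) powr (m - 1))
        (at ((x + t *\<^sub>R y) \<bullet> (x + t *\<^sub>R y)))"
        using False by (intro has_real_derivative_powr) auto
      have "((\<lambda>t. (x + t *\<^sub>R y) \<bullet> (x + t *\<^sub>R y)) has_derivative (\<lambda>h. h * (2 * ((x + t *\<^sub>R y) \<bullet> y)))) (at t)"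
        by (auto intro!: derivative_eq_intros simp: inner_add_left inner_add_right inner_commute algebra_simps)
      then show "((\<lambda>t. (x + t *\<^sub>R y) \<bullet> (x + t *\<^sub>R y)) has_real_derivative (2 * ((x + t *\<^sub>R y) \<bullet> y))) (at t)"
        by (simp add: has_field_derivative_def mult.commute[of "2 * _"] fun_eq_iff mult_commute_abs)
    qed
    moreover have "((x + t *\<^sub>R y) \<bullet> (x + t *\<^sub>R y)) powr (m - 1) = norm z ^ (n - 2)"
    proof -
      have "(z \<bullet> z) powr (m - 1) = (norm z powr 2) powr (m - 1)"
        using z by (simp add: power2_norm_eq_inner[symmetric] powr_numeral)
      also have "\<dots> = norm z powr (2 * (m - 1))" by (rule powr_powr)
      also have "2 * (m - 1) = real (n - 2)" using assms by (simp add: m_def of_nat_diff)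
      finally show ?thesis using z by (simp add: powr_realpow z_def)
    qed
    ultimately show ?thesis
      unfolding sq power2_norm_eq_inner[symmetric] by (simp add: m_def z_def sq[symmetric] power2_norm_eq_inner mult.assoc)
  next
    case True
    have "norm (x + (t + h) *\<^sub>R y) = \<bar>h\<bar> * norm y" for h
    proof -
      have "x + (t + h) *\<^sub>R y = (x + t *\<^sub>R y) + h *\<^sub>R y" by (simp add: algebra_simps)
      then show ?thesis using True by simp
    qed
    moreover have "((\<lambda>h. (\<bar>h\<bar> * norm y) ^ n / h) \<longlongrightarrow> 0) (at 0)"
    proof (rule Lim_null_comparison)
      show "\<forall>\<^sub>F h in at 0. norm ((\<bar>h\<bar> * norm y) ^ n / h) \<le> \<bar>h\<bar> ^ (n - 1) * norm y ^ n"
      proof -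
        have "norm ((\<bar>h\<bar> * norm y) ^ n / h) \<le> \<bar>h\<bar> ^ (n - 1) * norm y ^ n" if "h \<noteq> 0" for h
        proof -
          obtain k where k: "n = Suc k" using assms by (cases n) auto
          show ?thesis using that unfolding k by (simp add: power_mult_distrib abs_divide)
        qed
        then show ?thesis by (auto simp: eventually_at_filter)
      qed
      have "((\<lambda>h::real. \<bar>h\<bar> ^ (n - 1) * norm y ^ n) \<longlongrightarrow> \<bar>0\<bar> ^ (n - 1) * norm y ^ n) (at 0)"
        by (intro tendsto_intros)
      then show "((\<lambda>h::real. \<bar>h\<bar> ^ (n - 1) * norm y ^ n) \<longlongrightarrow> 0) (at 0)" using assms by (simp add: power_0_left)
    qed
    ultimately show ?thesis using True assms by (simp add: DERIV_def power_0_left)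
  qed
qed

section \<open>The lower order terms of the energy\<close>

locale kirchhoff = mt_domain \<Omega> \<beta> for \<Omega> :: "'a::euclidean_space set" and \<beta> +
  fixes a b p q \<gamma> :: real and h :: "'a \<Rightarrow> real"
  assumes q: "0 < q" "q < real DIM('a) - 1" and p: "2 * real DIM('a) - 1 < p + 1"
    and ab: "a > 0" "b > 0" and \<gamma>_def: "\<gamma> = real DIM('a) / (real DIM('a) - q - 1)"
    and h: "h \<in> Lebesgue_space \<gamma> \<Omega>" and h_pos: "\<not> (AE x in lebesgue_on \<Omega>. max (h x) 0 = 0)"
begin

lemma p_pos: "p > 0" and p_gt: "p + 2 > real DIM('a)"
proof -
  have "real DIM('a) \<ge> 2" using dim by simp
  with p show "p > 0" "p + 2 > real DIM('a)" by linarith+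
qed

lemma h_measurable: "h \<in> borel_measurable M" and h_powr: "integrable M (\<lambda>x. \<bar>h x\<bar> powr \<gamma>)"
  using h by (auto simp: Lebesgue_space_def)

text \<open>The exponent n / (q + 1) is conjugate to \<gamma>, so that h pairs with
  \<bar>u\<bar>^(q+1) for u in L^n.\<close>

lemma \<gamma>: "\<gamma> > 1" "(real DIM('a) / (q + 1)) = \<gamma> / (\<gamma> - 1)" "(real DIM('a) / (q + 1)) \<ge> 1" "(q + 1) * (real DIM('a) / (q + 1)) = real DIM('a)"
proof -
  have d: "real DIM('a) - q - 1 > 0" using q by simp
  show "\<gamma> > 1" using q d by (simp add: \<gamma>_def)
  have "\<gamma> - 1 = (q + 1) / (real DIM('a) - q - 1)" using d by (simp add: \<gamma>_def field_simps)
  then show "(real DIM('a) / (q + 1)) = \<gamma> / (\<gamma> - 1)" using d q by (simp add: \<gamma>_def)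
  show "(real DIM('a) / (q + 1)) \<ge> 1" "(q + 1) * (real DIM('a) / (q + 1)) = real DIM('a)" using q by (auto simp: field_simps)
qed

lemma pow_dim: "\<bar>s::real\<bar> powr real DIM('a) = \<bar>s\<bar> ^ DIM('a)"
  using dim by (simp add: powr_realpow')

lemma h_locally_integrable: "locally_integrable_on h \<Omega>"
proof (rule integrable_imp_locally_integrable[OF \<Omega>_borel])
  interpret finite_measure M by (rule finite_M)
  show "integrable M h"
  proof (rule Bochner_Integration.integrable_bound[OF _ h_measurable])
    show "integrable M (\<lambda>x. \<bar>h x\<bar> powr \<gamma> + 1)" using h_powr by auto
    show "AE x in M. norm (h x) \<le> norm (\<bar>h x\<bar> powr \<gamma> + 1)"
    proof (rule AE_I2)
      fix x
      have "\<bar>h x\<bar> * 1 \<le> \<bar>h x\<bar> powr \<gamma> + 1 powr (real DIM('a) / (q + 1))"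
        using \<gamma> by (intro young_crude) auto
      then show "norm (h x) \<le> norm (\<bar>h x\<bar> powr \<gamma> + 1)" by simp
    qed
  qed
qed

lemma h_mult_le:
  "\<bar>h x\<bar> * \<bar>s\<bar> powr (q + 1) \<le> \<bar>h x\<bar> powr \<gamma> + \<bar>s\<bar> ^ DIM('a)"
proof -
  have "\<bar>h x\<bar> * \<bar>s\<bar> powr (q + 1) \<le> \<bar>h x\<bar> powr \<gamma> + (\<bar>s\<bar> powr (q + 1)) powr (real DIM('a) / (q + 1))"
    using \<gamma> by (intro young_crude) auto
  also have "(\<bar>s\<bar> powr (q + 1)) powr (real DIM('a) / (q + 1)) = \<bar>s\<bar> powr real DIM('a)" using \<gamma>(4) by (simp only: powr_powr)
  finally show ?thesis by (simp only: pow_dim)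
qed

lemma h_mult_integrable:
  assumes u: "u \<in> borel_measurable M" "integrable M (\<lambda>x. \<bar>u x\<bar> ^ DIM('a))"
  shows "integrable M (\<lambda>x. h x * \<bar>u x\<bar> powr (q + 1))"
    "\<bar>\<integral>x. h x * \<bar>u x\<bar> powr (q + 1) \<partial>M\<bar> \<le> (\<integral>x. \<bar>h x\<bar> powr \<gamma> \<partial>M) + (\<integral>x. \<bar>u x\<bar> ^ DIM('a) \<partial>M)"
proof -
  have [measurable]: "u \<in> borel_measurable M" "h \<in> borel_measurable M" using u h_measurable by auto
  have i: "integrable M (\<lambda>x. \<bar>h x\<bar> powr \<gamma> + \<bar>u x\<bar> ^ DIM('a))" using h_powr u by auto
  show 1: "integrable M (\<lambda>x. h x * \<bar>u x\<bar> powr (q + 1))"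
    by (rule Bochner_Integration.integrable_bound[OF i])
      (use h_mult_le in \<open>auto simp: abs_mult intro!: AE_I2 order_trans[OF _ abs_ge_self]\<close>)
  have "\<bar>\<integral>x. h x * \<bar>u x\<bar> powr (q + 1) \<partial>M\<bar> \<le> (\<integral>x. \<bar>h x * \<bar>u x\<bar> powr (q + 1)\<bar> \<partial>M)"
    using integral_norm_bound[of M "\<lambda>x. h x * \<bar>u x\<bar> powr (q + 1)"] by simp
  also have "\<dots> \<le> (\<integral>x. \<bar>h x\<bar> powr \<gamma> + \<bar>u x\<bar> ^ DIM('a) \<partial>M)"
    using h_mult_le by (intro integral_mono[OF integrable_abs[OF 1] i]) (auto simp: abs_mult)
  also have "\<dots> = (\<integral>x. \<bar>h x\<bar> powr \<gamma> \<partial>M) + (\<integral>x. \<bar>u x\<bar> ^ DIM('a) \<partial>M)" using h_powr u by simp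
  finally show "\<bar>\<integral>x. h x * \<bar>u x\<bar> powr (q + 1) \<partial>M\<bar> \<le> (\<integral>x. \<bar>h x\<bar> powr \<gamma> \<partial>M) + (\<integral>x. \<bar>u x\<bar> ^ DIM('a) \<partial>M)" .
qed

abbreviation "g \<equiv> nonlin p \<beta>"
abbreviation "G \<equiv> prim p \<beta>"

lemma g_measurable: "g \<in> borel_measurable borel"
  using continuous_nonlin[OF p_pos \<beta>_bounds(3)] by (rule borel_measurable_continuous_onI)

lemma G_measurable: "G \<in> borel_measurable borel"
  using prim(2)[OF p_pos \<beta>_bounds(3)]
  by (intro borel_measurable_continuous_onI) (auto simp: continuous_on_eq_continuous_at intro: DERIV_isCont)

lemma exp_class_power_integrable:
  "u \<in> exp_class \<Longrightarrow> integrable M (\<lambda>x. \<bar>u x\<bar> ^ DIM('a))"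
  using exp_class_powr_integrable[of u "real DIM('a)"] by (simp add: pow_dim)

lemma G_integrable:
  assumes u: "u \<in> exp_class"
  shows "integrable M (\<lambda>x. G (u x))"
proof -
  obtain C where C: "C > 0" "\<And>s. \<bar>s\<bar> powr (p + 2) \<le> C * exp (1 * \<bar>s\<bar> powr \<beta>)"
    using powr_le_exp_powr[of "p + 2" \<beta> 1] p_pos \<beta>_bounds by auto
  have [measurable]: "u \<in> borel_measurable M" "G \<in> borel_measurable borel" using u exp_class_measurable G_measurable by auto
  show ?thesis
  proof (rule exp_class_bound_integrable[OF u])
    show "\<bar>G (u x)\<bar> \<le> C * exp (2 * \<bar>u x\<bar> powr \<beta>)" for x
    proof -
      have "\<bar>G (u x)\<bar> \<le> \<bar>u x\<bar> powr (p + 2) * exp (\<bar>u x\<bar> powr \<beta>)"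
        using prim_nonneg prim_le p_pos \<beta>_bounds(3) by simp
      also have "\<dots> \<le> (C * exp (1 * \<bar>u x\<bar> powr \<beta>)) * exp (\<bar>u x\<bar> powr \<beta>)" using C(2) by (intro mult_right_mono) auto
      also have "\<dots> = C * exp (2 * \<bar>u x\<bar> powr \<beta>)" by (simp add: mult_exp_exp)
      finally show ?thesis .
    qed
  qed auto
qed

definition lower_order :: "real \<Rightarrow> ('a \<Rightarrow> real) \<Rightarrow> real" where
  "lower_order lam u = (\<integral>x. G (u x) \<partial>M) + lam / (q + 1) * (\<integral>x. h x * \<bar>u x\<bar> powr (q + 1) \<partial>M)"

text \<open>The primitive is handled by \<open>prim_diff_le\<close>. For the weight term the Young
  inequality separates \<open>h\<close> from the difference of powers, and
  \<open>powr_diff_powr_le\<close> extracts an L1 factor from the latter. Both reduce to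
  \<open>exp_class_uniformly_continuous\<close>, and this is why compactness in L1 is enough for the
  whole minimisation.\<close>

lemma lower_order_uniformly_continuous:
  assumes \<epsilon>: "\<epsilon> > 0"
  obtains \<delta> where "\<delta> > 0" "\<And>u v. u \<in> exp_class \<Longrightarrow> v \<in> exp_class \<Longrightarrow> (\<integral>x. \<bar>u x - v x\<bar> \<partial>M) < \<delta> \<Longrightarrow>
    \<bar>lower_order lam u - lower_order lam v\<bar> < \<epsilon>"
proof -
  define c where "c = \<bar>lam\<bar> / (q + 1)"
  have c: "c \<ge> 0" using q by (simp add: c_def)
  define H0 where "H0 = (\<integral>x. \<bar>h x\<bar> powr \<gamma> \<partial>M)"
  have H0: "H0 \<ge> 0" by (simp add: H0_def Bochner_Integration.integral_nonneg)
  obtain Cg where Cg: "\<And>s. \<bar>g s\<bar> \<le> Cg * exp (2 * \<bar>s\<bar> powr \<beta>)"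
    using nonlin_le_exp[OF p_pos \<beta>_bounds(3)] by blast
  have gm: "(\<lambda>s. \<bar>g s\<bar>) \<in> borel_measurable borel" using g_measurable by measurable
  obtain \<delta>1 where \<delta>1: "\<delta>1 > 0"
    "\<And>u v. u \<in> exp_class \<Longrightarrow> v \<in> exp_class \<Longrightarrow> (\<integral>x. \<bar>u x - v x\<bar> \<partial>M) < \<delta>1 \<Longrightarrow>
      (\<integral>x. \<bar>u x - v x\<bar> * (\<bar>g (u x)\<bar> + \<bar>g (v x)\<bar>) \<partial>M) < \<epsilon> / 2"
    "\<And>u v. u \<in> exp_class \<Longrightarrow> v \<in> exp_class \<Longrightarrow>
      integrable M (\<lambda>x. \<bar>u x - v x\<bar> * (\<bar>g (u x)\<bar> + \<bar>g (v x)\<bar>))"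
    using exp_class_uniformly_continuous[of "\<lambda>s. \<bar>g s\<bar>" Cg "\<epsilon> / 2", OF abs_ge_zero Cg gm] \<epsilon> by auto
  define E where "E = (\<lambda>s::real. (q + 1) * \<bar>s\<bar> powr ((q + 1) * (real DIM('a) / (q + 1)) - 1))"
  obtain Ce where Ce: "Ce > 0" "\<And>s. \<bar>s\<bar> powr ((q + 1) * (real DIM('a) / (q + 1)) - 1) \<le> Ce * exp (2 * \<bar>s\<bar> powr \<beta>)"
    using powr_le_exp_powr[of "(q + 1) * (real DIM('a) / (q + 1)) - 1" \<beta> 2] \<gamma>(4) dim \<beta>_bounds by auto
  have E: "0 \<le> E s" "E s \<le> ((q + 1) * Ce) * exp (2 * \<bar>s\<bar> powr \<beta>)" for s
    using q Ce(2)[of s] by (auto simp: E_def mult.assoc intro!: mult_left_mono)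
  have Em: "E \<in> borel_measurable borel" unfolding E_def by measurable
  \<comment> \<open>Fixes the part of \<open>h\<close> at no more than \<epsilon> / (4 (c + 1));
    only then is the tolerance \<epsilon>2 for the other part known.\<close>
  define e where "e = (\<epsilon> / (4 * (c + 1) * (H0 + 1))) powr (1 / \<gamma>)"
  have e: "e > 0" using \<epsilon> c H0 by (simp add: e_def)
  have e\<gamma>: "e powr \<gamma> = \<epsilon> / (4 * (c + 1) * (H0 + 1))" using \<epsilon> c H0 \<gamma>(1) by (simp add: e_def powr_powr)
  define \<epsilon>2 where "\<epsilon>2 = \<epsilon> / (4 * (c + 1) * e powr (- (real DIM('a) / (q + 1))))"
  have \<epsilon>2: "\<epsilon>2 > 0" using \<epsilon> c e by (simp add: \<epsilon>2_def)
  obtain \<delta>2 where \<delta>2: "\<delta>2 > 0"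
    "\<And>u v. u \<in> exp_class \<Longrightarrow> v \<in> exp_class \<Longrightarrow> (\<integral>x. \<bar>u x - v x\<bar> \<partial>M) < \<delta>2 \<Longrightarrow>
      (\<integral>x. \<bar>u x - v x\<bar> * (E (u x) + E (v x)) \<partial>M) < \<epsilon>2"
    "\<And>u v. u \<in> exp_class \<Longrightarrow> v \<in> exp_class \<Longrightarrow>
      integrable M (\<lambda>x. \<bar>u x - v x\<bar> * (E (u x) + E (v x)))"
    using exp_class_uniformly_continuous[OF E Em \<epsilon>2] by blast
  have main: "\<bar>lower_order lam u - lower_order lam v\<bar> < \<epsilon>"
    if uv: "u \<in> exp_class" "v \<in> exp_class" and d: "(\<integral>x. \<bar>u x - v x\<bar> \<partial>M) < min \<delta>1 \<delta>2" for u v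
  proof -
    have [measurable]: "u \<in> borel_measurable M" "v \<in> borel_measurable M" using uv exp_class_measurable by auto
    have A: "\<bar>(\<integral>x. G (u x) \<partial>M) - (\<integral>x. G (v x) \<partial>M)\<bar> < \<epsilon> / 2"
    proof -
      have "\<bar>(\<integral>x. G (u x) \<partial>M) - (\<integral>x. G (v x) \<partial>M)\<bar> = norm (\<integral>x. G (u x) - G (v x) \<partial>M)"
        using G_integrable uv by simp
      also have "\<dots> \<le> (\<integral>x. norm (G (u x) - G (v x)) \<partial>M)" by (rule integral_norm_bound)
      also have "\<dots> \<le> (\<integral>x. \<bar>u x - v x\<bar> * (\<bar>g (u x)\<bar> + \<bar>g (v x)\<bar>) \<partial>M)"
        using G_integrable uv \<delta>1(3)[OF uv] prim_diff_le[OF p_pos \<beta>_bounds(3)] by (intro integral_mono) auto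
      also have "\<dots> < \<epsilon> / 2" using \<delta>1(2)[OF uv] d by simp
      finally show ?thesis .
    qed
    note hu = h_mult_integrable(1)[OF exp_class_measurable[OF uv(1)] exp_class_power_integrable[OF uv(1)]]
      and hv = h_mult_integrable(1)[OF exp_class_measurable[OF uv(2)] exp_class_power_integrable[OF uv(2)]]
    have B: "\<bar>(\<integral>x. h x * \<bar>u x\<bar> powr (q + 1) \<partial>M) - (\<integral>x. h x * \<bar>v x\<bar> powr (q + 1) \<partial>M)\<bar> \<le> \<epsilon> / (2 * (c + 1))"
    proof -
      have pt: "\<bar>h x * \<bar>u x\<bar> powr (q + 1) - h x * \<bar>v x\<bar> powr (q + 1)\<bar>
        \<le> e powr \<gamma> * \<bar>h x\<bar> powr \<gamma> + e powr (- (real DIM('a) / (q + 1))) * (\<bar>u x - v x\<bar> * (E (u x) + E (v x)))" for x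
      proof -
        define X where "X = \<bar>\<bar>u x\<bar> powr (q + 1) - \<bar>v x\<bar> powr (q + 1)\<bar>"
        have "\<bar>h x * \<bar>u x\<bar> powr (q + 1) - h x * \<bar>v x\<bar> powr (q + 1)\<bar> = \<bar>h x\<bar> * X"
          by (simp add: X_def abs_mult[symmetric] right_diff_distrib)
        also have "\<dots> \<le> e powr \<gamma> * \<bar>h x\<bar> powr \<gamma> + e powr (- (real DIM('a) / (q + 1))) * X powr (real DIM('a) / (q + 1))"
          using \<gamma> e by (intro young_scaled) (auto simp: X_def)
        also have "X powr (real DIM('a) / (q + 1)) \<le> \<bar>u x - v x\<bar> * (E (u x) + E (v x))"
          unfolding X_def E_def using q \<gamma> by (intro powr_diff_powr_le) auto
        finally show ?thesis by (simp add: mult_left_mono)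
      qed
      have "\<bar>(\<integral>x. h x * \<bar>u x\<bar> powr (q + 1) \<partial>M) - (\<integral>x. h x * \<bar>v x\<bar> powr (q + 1) \<partial>M)\<bar>
        = norm (\<integral>x. h x * \<bar>u x\<bar> powr (q + 1) - h x * \<bar>v x\<bar> powr (q + 1) \<partial>M)"
        using hu hv by simp
      also have "\<dots> \<le> (\<integral>x. norm (h x * \<bar>u x\<bar> powr (q + 1) - h x * \<bar>v x\<bar> powr (q + 1)) \<partial>M)"
        by (rule integral_norm_bound)
      also have "\<dots> \<le> (\<integral>x. e powr \<gamma> * \<bar>h x\<bar> powr \<gamma> + e powr (- (real DIM('a) / (q + 1))) * (\<bar>u x - v x\<bar> * (E (u x) + E (v x))) \<partial>M)"
        using pt hu hv h_powr \<delta>2(3)[OF uv] by (intro integral_mono) auto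
      also have "\<dots> = e powr \<gamma> * H0 + e powr (- (real DIM('a) / (q + 1))) * (\<integral>x. \<bar>u x - v x\<bar> * (E (u x) + E (v x)) \<partial>M)"
        using h_powr \<delta>2(3)[OF uv] by (simp add: H0_def)
      also have "e powr \<gamma> * H0 \<le> \<epsilon> / (4 * (c + 1))"
      proof -
        have "e powr \<gamma> * H0 \<le> e powr \<gamma> * (H0 + 1)" by (intro mult_left_mono) auto
        also have "\<dots> = \<epsilon> / (4 * (c + 1))" unfolding e\<gamma> using H0 by simp
        finally show ?thesis .
      qed
      also have "e powr (- (real DIM('a) / (q + 1))) * (\<integral>x. \<bar>u x - v x\<bar> * (E (u x) + E (v x)) \<partial>M) \<le> e powr (- (real DIM('a) / (q + 1))) * \<epsilon>2"
        using \<delta>2(2)[OF uv] d by (intro mult_left_mono) auto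
      also have "e powr (- (real DIM('a) / (q + 1))) * \<epsilon>2 = \<epsilon> / (4 * (c + 1))" using e by (simp add: \<epsilon>2_def)
      also have "\<epsilon> / (4 * (c + 1)) + \<epsilon> / (4 * (c + 1)) = \<epsilon> / (2 * (c + 1))"
        using c by (simp add: divide_simps)
      finally show ?thesis by simp
    qed
    have "\<bar>lower_order lam u - lower_order lam v\<bar>
      = \<bar>((\<integral>x. G (u x) \<partial>M) - (\<integral>x. G (v x) \<partial>M)) + lam / (q + 1) *
        ((\<integral>x. h x * \<bar>u x\<bar> powr (q + 1) \<partial>M) - (\<integral>x. h x * \<bar>v x\<bar> powr (q + 1) \<partial>M))\<bar>"
      by (simp add: lower_order_def right_diff_distrib)
    also have "\<dots> \<le> \<bar>(\<integral>x. G (u x) \<partial>M) - (\<integral>x. G (v x) \<partial>M)\<bar> + c *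
        \<bar>(\<integral>x. h x * \<bar>u x\<bar> powr (q + 1) \<partial>M) - (\<integral>x. h x * \<bar>v x\<bar> powr (q + 1) \<partial>M)\<bar>"
      using q by (intro order_trans[OF abs_triangle_ineq]) (simp add: abs_mult abs_divide c_def)
    also have "\<dots> \<le> \<bar>(\<integral>x. G (u x) \<partial>M) - (\<integral>x. G (v x) \<partial>M)\<bar> + c * (\<epsilon> / (2 * (c + 1)))"
      using B c by (intro add_left_mono mult_left_mono)
    also have "c * (\<epsilon> / (2 * (c + 1))) \<le> \<epsilon> / 2" using c \<epsilon> by (simp add: field_simps)
    finally show ?thesis using A by simp
  qed
  then show ?thesis using that[of "min \<delta>1 \<delta>2"] \<delta>1(1) \<delta>2(1) by simp
qed

text \<open>Both bounds come from writing \<phi> = \<rho> \<psi> with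
  \<open>N \<psi> \<le> 1\<close>. The powers of \<rho> matter: p + 2 exceeds the order n of the
  leading term, so a small radius makes the first bound negligible, whereas q + 1 is below n and has
  to be compensated by a small \<open>lam\<close>.\<close>

lemma ball_bounds:
  obtains C1 C2 where "C1 > 0" "C2 > 0"
    "\<And>\<phi> \<rho>. \<phi> \<in> T \<Longrightarrow> \<rho> > 0 \<Longrightarrow> 16 * \<rho> powr \<beta> \<le> mt_rate TYPE('a) \<Longrightarrow> N \<phi> \<le> \<rho> ^ DIM('a) \<Longrightarrow>
      (\<integral>x. G (\<phi> x) \<partial>M) \<le> C1 * \<rho> powr (p + 2)"
    "\<And>\<phi> \<rho>. \<phi> \<in> T \<Longrightarrow> \<rho> > 0 \<Longrightarrow> N \<phi> \<le> \<rho> ^ DIM('a) \<Longrightarrow>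
      \<bar>\<integral>x. h x * \<bar>\<phi> x\<bar> powr (q + 1) \<partial>M\<bar> \<le> C2 * \<rho> powr (q + 1)"
proof -
  define \<alpha> where "\<alpha> = mt_rate TYPE('a)"
  have \<alpha>: "\<alpha> > 0" using mt_rate_pos by (simp add: \<alpha>_def)
  obtain C where C: "C > 0" "\<And>s. \<bar>s\<bar> powr (p + 2) \<le> C * exp (\<alpha> / 2 * \<bar>s\<bar> powr \<beta>)"
    using powr_le_exp_powr[of "p + 2" \<beta> "\<alpha> / 2"] p_pos \<beta>_bounds \<alpha> by auto
  obtain CP where CP: "CP \<ge> 0" "\<And>\<phi> \<tau>. \<phi> \<in> T \<Longrightarrow> \<tau> > 0 \<Longrightarrow> N \<phi> \<le> \<tau> ^ DIM('a) \<Longrightarrow>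
    (\<integral>x. \<bar>\<phi> x\<bar> ^ DIM('a) \<partial>M) \<le> CP * \<tau> ^ DIM('a)" using Poincare_power by blast
  define H0 where "H0 = (\<integral>x. \<bar>h x\<bar> powr \<gamma> \<partial>M)"
  have H0: "H0 \<ge> 0" by (simp add: H0_def Bochner_Integration.integral_nonneg)
  have scaled: "(\<lambda>x. (1 / \<rho>) * \<phi> x) \<in> T \<and> N (\<lambda>x. (1 / \<rho>) * \<phi> x) \<le> 1 ^ DIM('a)"
    if "\<phi> \<in> T" "\<rho> > 0" "N \<phi> \<le> \<rho> ^ DIM('a)" for \<phi> \<rho>
    using that test_functions_scale[OF that(1), of "1 / \<rho>"] N_scale[OF that(1), of "1 / \<rho>"] by (simp add: power_one_over)
  have b1: "(\<integral>x. G (\<phi> x) \<partial>M) \<le> (C * CM + 1) * \<rho> powr (p + 2)"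
    if \<phi>: "\<phi> \<in> T" and \<rho>: "\<rho> > 0" "16 * \<rho> powr \<beta> \<le> mt_rate TYPE('a)" and N: "N \<phi> \<le> \<rho> ^ DIM('a)" for \<phi> \<rho>
  proof -
    define \<psi> where "\<psi> = (\<lambda>x. (1 / \<rho>) * \<phi> x)"
    have \<psi>: "\<psi> \<in> T" "N \<psi> \<le> 1 ^ DIM('a)" using scaled[OF \<phi> \<rho>(1) N] by (auto simp: \<psi>_def)
    note mt = scaled_moser_trudinger[OF \<psi>(1) zero_less_one \<psi>(2), of \<alpha>]
    have pt: "G (\<phi> x) \<le> \<rho> powr (p + 2) * (C * exp (\<alpha> * \<bar>\<psi> x\<bar> powr \<beta>))" for x
    proof -
      have \<phi>x: "\<bar>\<phi> x\<bar> = \<rho> * \<bar>\<psi> x\<bar>" using \<rho> by (simp add: \<psi>_def abs_mult)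
      have "G (\<phi> x) \<le> \<bar>\<phi> x\<bar> powr (p + 2) * exp (\<bar>\<phi> x\<bar> powr \<beta>)" using prim_le p_pos \<beta>_bounds(3) by simp
      also have "\<dots> = \<rho> powr (p + 2) * (\<bar>\<psi> x\<bar> powr (p + 2) * exp (\<rho> powr \<beta> * \<bar>\<psi> x\<bar> powr \<beta>))"
        unfolding \<phi>x using \<rho> by (simp add: powr_mult)
      also have "\<dots> \<le> \<rho> powr (p + 2) * ((C * exp (\<alpha> / 2 * \<bar>\<psi> x\<bar> powr \<beta>)) * exp (\<alpha> / 2 * \<bar>\<psi> x\<bar> powr \<beta>))"
      proof (intro mult_left_mono mult_mono C(2))
        \<comment> \<open>Half of the available rate pays for the exponential factor; the other half
          has absorbed the power p + 2.\<close>
        have "\<rho> powr \<beta> \<le> \<alpha> / 2" using \<rho> \<alpha> by (simp add: \<alpha>_def)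
        then show "exp (\<rho> powr \<beta> * \<bar>\<psi> x\<bar> powr \<beta>) \<le> exp (\<alpha> / 2 * \<bar>\<psi> x\<bar> powr \<beta>)"
          by (simp only: exp_le_cancel_iff) (rule mult_right_mono, auto)
      qed (use C(1) in auto)
      also have "\<dots> = \<rho> powr (p + 2) * (C * exp (\<alpha> * \<bar>\<psi> x\<bar> powr \<beta>))"
        by (simp add: mult_exp_exp)
      finally show ?thesis .
    qed
    have "(\<integral>x. G (\<phi> x) \<partial>M) \<le> (\<integral>x. \<rho> powr (p + 2) * (C * exp (\<alpha> * \<bar>\<psi> x\<bar> powr \<beta>)) \<partial>M)"
      using mt pt G_integrable[OF exp_classI[OF \<phi> \<rho>(1) N \<rho>(2)]] by (intro integral_mono) (auto simp: \<alpha>_def)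
    also have "\<dots> = \<rho> powr (p + 2) * (C * (\<integral>x. exp (\<alpha> * \<bar>\<psi> x\<bar> powr \<beta>) \<partial>M))" by simp
    also have "\<dots> \<le> \<rho> powr (p + 2) * (C * CM)" using mt C(1) by (intro mult_left_mono) (auto simp: \<alpha>_def)
    also have "\<dots> \<le> (C * CM + 1) * \<rho> powr (p + 2)" by (simp add: algebra_simps)
    finally show ?thesis .
  qed
  have b2: "\<bar>\<integral>x. h x * \<bar>\<phi> x\<bar> powr (q + 1) \<partial>M\<bar> \<le> (H0 + CP + 1) * \<rho> powr (q + 1)"
    if \<phi>: "\<phi> \<in> T" and \<rho>: "\<rho> > 0" and N: "N \<phi> \<le> \<rho> ^ DIM('a)" for \<phi> \<rho>
  proof -
    define \<psi> where "\<psi> = (\<lambda>x. (1 / \<rho>) * \<phi> x)"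
    have \<psi>: "\<psi> \<in> T" "N \<psi> \<le> 1 ^ DIM('a)" using scaled[OF \<phi> \<rho>(1) N] by (auto simp: \<psi>_def)
    have "(\<integral>x. h x * \<bar>\<phi> x\<bar> powr (q + 1) \<partial>M) = (\<integral>x. \<rho> powr (q + 1) * (h x * \<bar>\<psi> x\<bar> powr (q + 1)) \<partial>M)"
    proof (rule Bochner_Integration.integral_cong[OF refl])
      fix x
      have \<phi>x: "\<bar>\<phi> x\<bar> = \<rho> * \<bar>\<psi> x\<bar>" using \<rho> by (simp add: \<psi>_def abs_mult)
      show "h x * \<bar>\<phi> x\<bar> powr (q + 1) = \<rho> powr (q + 1) * (h x * \<bar>\<psi> x\<bar> powr (q + 1))"
        unfolding \<phi>x using \<rho> by (simp add: powr_mult)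
    qed
    also have "\<dots> = \<rho> powr (q + 1) * (\<integral>x. h x * \<bar>\<psi> x\<bar> powr (q + 1) \<partial>M)" by simp
    finally have "\<bar>\<integral>x. h x * \<bar>\<phi> x\<bar> powr (q + 1) \<partial>M\<bar> = \<rho> powr (q + 1) * \<bar>\<integral>x. h x * \<bar>\<psi> x\<bar> powr (q + 1) \<partial>M\<bar>"
      by (simp add: abs_mult)
    also have "\<dots> \<le> \<rho> powr (q + 1) * (H0 + CP)"
    proof (intro mult_left_mono)
      have "\<bar>\<integral>x. h x * \<bar>\<psi> x\<bar> powr (q + 1) \<partial>M\<bar> \<le> H0 + (\<integral>x. \<bar>\<psi> x\<bar> ^ DIM('a) \<partial>M)"
        unfolding H0_def by (rule h_mult_integrable(2)) (use T_integrals[OF \<psi>(1)] in auto)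
      also have "(\<integral>x. \<bar>\<psi> x\<bar> ^ DIM('a) \<partial>M) \<le> CP" using CP(2)[OF \<psi>(1) zero_less_one \<psi>(2)] by simp
      finally show "\<bar>\<integral>x. h x * \<bar>\<psi> x\<bar> powr (q + 1) \<partial>M\<bar> \<le> H0 + CP" by simp
    qed simp
    also have "\<dots> \<le> (H0 + CP + 1) * \<rho> powr (q + 1)" by (simp add: algebra_simps)
    finally show ?thesis .
  qed
  have "C * CM + 1 > 0" using mult_nonneg_nonneg[OF less_imp_le[OF C(1)] CM_nonneg] by linarith
  moreover have "H0 + CP + 1 > 0" using H0 CP(1) by simp
  ultimately show ?thesis using that[OF _ _ b1 b2] by blast
qed

end

subsection \<open>Approximation in the Sobolev space\<close>

context mt_domain
begin

lemma dual_pairing_integrable: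
  assumes fm: "f \<in> borel_measurable M" and fi: "integrable M (\<lambda>x. \<bar>f x\<bar> powr \<beta>)"
    and Hm: "H \<in> borel_measurable M" and gi: "integrable M (\<lambda>x. \<bar>g x\<bar> ^ DIM('a))"
    and H: "AE x in M. \<bar>H x\<bar> \<le> \<bar>f x\<bar> * \<bar>g x\<bar>"
  shows "integrable M H"
proof (rule Bochner_Integration.integrable_bound[OF _ Hm])
  show "integrable M (\<lambda>x. \<bar>f x\<bar> powr \<beta> + \<bar>g x\<bar> ^ DIM('a))" using fi gi by auto
  show "AE x in M. norm (H x) \<le> norm (\<bar>f x\<bar> powr \<beta> + \<bar>g x\<bar> ^ DIM('a))"
    using H
  proof eventually_elim
    case (elim x)
    have d: "real DIM('a) \<ge> 2" using dim by simp
    have "\<bar>f x\<bar> * \<bar>g x\<bar> \<le> \<bar>f x\<bar> powr \<beta> + \<bar>g x\<bar> powr real DIM('a)"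
      using d \<beta>_bounds by (intro young_crude) (auto simp: \<beta>_def field_simps)
    then show ?case using elim dim by (simp add: powr_realpow')
  qed
qed

lemma power_integrable_diff:
  fixes X Y :: "'a \<Rightarrow> 'b::euclidean_space"
  assumes "X \<in> borel_measurable M" "Y \<in> borel_measurable M"
    and "integrable M (\<lambda>x. norm (X x) ^ DIM('a))" "integrable M (\<lambda>x. norm (Y x) ^ DIM('a))"
  shows "integrable M (\<lambda>x. norm (X x - Y x) ^ DIM('a))"
proof (rule Bochner_Integration.integrable_bound)
  show "integrable M (\<lambda>x. 2 ^ DIM('a) * (norm (X x) ^ DIM('a) + norm (Y x) ^ DIM('a)))" using assms by auto
  show "AE x in M. norm (norm (X x - Y x) ^ DIM('a)) \<le> norm (2 ^ DIM('a) * (norm (X x) ^ DIM('a) + norm (Y x) ^ DIM('a)))"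
  proof (rule AE_I2)
    fix x show "norm (norm (X x - Y x) ^ DIM('a)) \<le> norm (2 ^ DIM('a) * (norm (X x) ^ DIM('a) + norm (Y x) ^ DIM('a)))"
      using norm_add_power_le[of "X x" "- Y x" "DIM('a)"] by (simp add: abs_mult)
  qed
qed (use assms in auto)

lemma weak_grad_diff_test:
  assumes v: "has_weak_gradient \<Omega> v V" and \<phi>: "\<phi> \<in> T"
  shows "AE x in M. weak_grad \<Omega> (\<lambda>x. v x - \<phi> x) x = V x - grad \<phi> x"
  by (intro weak_grad_eq[OF open_\<Omega>] has_weak_gradient_diff[OF \<Omega>_borel v] has_weak_gradient_test[OF \<Omega>_borel \<phi>])

text \<open>\<open>weak_grad\<close> is an arbitrary choice among weak gradients. Its measurability
  has to be drawn from almost everywhere equality with a measurable gradient, through completeness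
  of the measure.\<close>

lemma borel_measurable_AE_M:
  fixes f g :: "'a \<Rightarrow> 'b::euclidean_space"
  assumes f: "f \<in> borel_measurable M" and ae: "AE x in M. f x = g x"
  shows "g \<in> borel_measurable M"
proof -
  have S: "\<Omega> \<inter> space lebesgue \<in> sets lebesgue" using \<Omega>_borel by simp
  have "(\<lambda>x. indicator \<Omega> x *\<^sub>R f x) \<in> borel_measurable lebesgue"
    using f borel_measurable_restrict_space_iff[OF S, of f] by simp
  moreover have "AE x in lebesgue. indicator \<Omega> x *\<^sub>R f x = indicator \<Omega> x *\<^sub>R g x"
  proof -
    have "AE x in lebesgue. x \<in> \<Omega> \<longrightarrow> f x = g x" using ae AE_restrict_space_iff[OF S] by simp
    then show ?thesis by eventually_elim (auto simp: indicator_def)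
  qed
  ultimately have "(\<lambda>x. indicator \<Omega> x *\<^sub>R g x) \<in> borel_measurable lebesgue"
    by (rule borel_measurable_AE)
  then show ?thesis using borel_measurable_restrict_space_iff[OF S, of g] by simp
qed

lemma pow_norm: "norm y powr real DIM('a) = norm (y :: 'b::euclidean_space) ^ DIM('a)"
  using dim by (simp add: powr_realpow')

lemma Sobolev_memI:
  assumes "u \<in> borel_measurable M" "D \<in> borel_measurable M"
    and "integrable M (\<lambda>x. \<bar>u x\<bar> ^ DIM('a))" "integrable M (\<lambda>x. norm (D x) ^ DIM('a))"
    and "has_weak_gradient \<Omega> u D"
  shows "u \<in> Sobolev (real DIM('a)) \<Omega>"
proof -
  have "u \<in> Lebesgue_space (real DIM('a)) \<Omega>" "D \<in> Lebesgue_space (real DIM('a)) \<Omega>"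
    using assms(1-4) pow_norm[of "u _"] by (simp_all add: Lebesgue_space_def pow_norm)
  then show ?thesis using assms(5) unfolding Sobolev_def by blast
qed

lemma Sobolev_norm_eq:
  "Sobolev_norm (real DIM('a)) \<Omega> u =
    ((\<integral>x. \<bar>u x\<bar> ^ DIM('a) \<partial>M) + (\<integral>x. norm (weak_grad \<Omega> u x) ^ DIM('a) \<partial>M)) powr (1 / real DIM('a))"
  unfolding Sobolev_norm_def pow_norm using pow_norm[of "u _"] by simp

text \<open>The Sobolev norm of a difference refers to the gradient chosen by
  \<open>weak_grad\<close>; uniqueness almost everywhere replaces it by
  \<open>D - grad (f k)\<close>.\<close>

lemma Sobolev0_memI:
  assumes u: "u \<in> borel_measurable M" "D \<in> borel_measurable M"
    and i: "integrable M (\<lambda>x. \<bar>u x\<bar> ^ DIM('a))" "integrable M (\<lambda>x. norm (D x) ^ DIM('a))"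
    and wg: "has_weak_gradient \<Omega> u D" and f: "\<And>k. f k \<in> T"
    and lim: "(\<lambda>k. \<integral>x. \<bar>f k x - u x\<bar> ^ DIM('a) \<partial>M) \<longlonglongrightarrow> 0"
      "(\<lambda>k. \<integral>x. norm (grad (f k) x - D x) ^ DIM('a) \<partial>M) \<longlonglongrightarrow> 0"
  shows "u \<in> Sobolev0 (real DIM('a)) \<Omega>"
  unfolding Sobolev0_def
proof (intro CollectI conjI allI impI)
  show "u \<in> Sobolev (real DIM('a)) \<Omega>" by (rule Sobolev_memI[OF u i wg])
  fix \<epsilon> :: real assume \<epsilon>: "\<epsilon> > 0"
  have "(\<lambda>k. (\<integral>x. \<bar>f k x - u x\<bar> ^ DIM('a) \<partial>M) + (\<integral>x. norm (grad (f k) x - D x) ^ DIM('a) \<partial>M)) \<longlonglongrightarrow> 0 + 0"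
    by (intro tendsto_add lim)
  moreover have "\<epsilon> ^ DIM('a) > 0" using \<epsilon> by simp
  ultimately obtain k where k: "(\<integral>x. \<bar>f k x - u x\<bar> ^ DIM('a) \<partial>M) + (\<integral>x. norm (grad (f k) x - D x) ^ DIM('a) \<partial>M) < \<epsilon> ^ DIM('a)"
    using order_tendstoD(2)[of _ "0 + 0" sequentially "\<epsilon> ^ DIM('a)"] eventually_happens[of _ sequentially] by fastforce
  have "(\<integral>x. norm (weak_grad \<Omega> (\<lambda>x. u x - f k x) x) ^ DIM('a) \<partial>M) = (\<integral>x. norm (grad (f k) x - D x) ^ DIM('a) \<partial>M)"
  proof (rule integral_cong_AE)
    have ae: "AE x in M. weak_grad \<Omega> (\<lambda>x. u x - f k x) x = D x - grad (f k) x"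
      by (rule weak_grad_diff_test[OF wg f])
    then show "AE x in M. norm (weak_grad \<Omega> (\<lambda>x. u x - f k x) x) ^ DIM('a) = norm (grad (f k) x - D x) ^ DIM('a)"
      by eventually_elim (simp add: norm_minus_commute)
    have m: "(\<lambda>x. D x - grad (f k) x) \<in> borel_measurable M" using u T_integrals(2)[OF f] by simp
    have "AE x in M. D x - grad (f k) x = weak_grad \<Omega> (\<lambda>x. u x - f k x) x" using ae by eventually_elim simp
    then have [measurable]: "weak_grad \<Omega> (\<lambda>x. u x - f k x) \<in> borel_measurable M" by (rule borel_measurable_AE_M[OF m])
    show "(\<lambda>x. norm (weak_grad \<Omega> (\<lambda>x. u x - f k x) x) ^ DIM('a)) \<in> borel_measurable M" by measurable
    show "(\<lambda>x. norm (grad (f k) x - D x) ^ DIM('a)) \<in> borel_measurable M" using u T_integrals(2)[OF f] by simp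
  qed
  moreover have "(\<integral>x. \<bar>u x - f k x\<bar> ^ DIM('a) \<partial>M) = (\<integral>x. \<bar>f k x - u x\<bar> ^ DIM('a) \<partial>M)"
    by (simp add: abs_minus_commute)
  ultimately have "Sobolev_norm (real DIM('a)) \<Omega> (\<lambda>x. u x - f k x) < (\<epsilon> ^ DIM('a)) powr (1 / real DIM('a))"
    unfolding Sobolev_norm_eq using k dim_pos
    by (intro powr_less_mono2) (auto intro!: add_nonneg_nonneg Bochner_Integration.integral_nonneg)
  also have "(\<epsilon> ^ DIM('a)) powr (1 / real DIM('a)) = \<epsilon>"
    using \<epsilon> dim_pos by (simp add: powr_realpow[symmetric] powr_powr)
  finally show "\<exists>\<phi>\<in>T. Sobolev_norm (real DIM('a)) \<Omega> (\<lambda>x. u x - \<phi> x) < \<epsilon>" using f by blast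
qed

lemma Sobolev0_approx:
  assumes v: "v \<in> Sobolev0 (real DIM('a)) \<Omega>"
  obtains f where "\<And>k. f k \<in> T"
    "v \<in> borel_measurable M" "weak_grad \<Omega> v \<in> borel_measurable M"
    "integrable M (\<lambda>x. \<bar>v x\<bar> ^ DIM('a))" "integrable M (\<lambda>x. norm (weak_grad \<Omega> v x) ^ DIM('a))"
    "(\<lambda>k. \<integral>x. \<bar>v x - f k x\<bar> ^ DIM('a) \<partial>M) \<longlonglongrightarrow> 0"
    "(\<lambda>k. \<integral>x. norm (weak_grad \<Omega> v x - grad (f k) x) ^ DIM('a) \<partial>M) \<longlonglongrightarrow> 0"
proof -
  obtain V where V: "has_weak_gradient \<Omega> v V" "V \<in> borel_measurable M" "integrable M (\<lambda>x. norm (V x) ^ DIM('a))"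
    and vm: "v \<in> borel_measurable M" and vi: "integrable M (\<lambda>x. \<bar>v x\<bar> ^ DIM('a))"
    using v pow_norm[of "v _"] unfolding Sobolev0_def Sobolev_def Lebesgue_space_def pow_norm by auto
  have ae: "AE x in M. V x = weak_grad \<Omega> v x"
    using weak_grad_eq[OF open_\<Omega> V(1)] by eventually_elim simp
  have Wm[measurable]: "weak_grad \<Omega> v \<in> borel_measurable M" by (rule borel_measurable_AE_M[OF V(2) ae])
  have Wi: "integrable M (\<lambda>x. norm (weak_grad \<Omega> v x) ^ DIM('a))"
    by (rule integrable_cong_AE_imp[OF V(3)]) (use ae in auto)
  have "\<exists>\<phi>\<in>T. Sobolev_norm (real DIM('a)) \<Omega> (\<lambda>x. v x - \<phi> x) < inverse (real (Suc k))" for k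
    using v by (simp add: Sobolev0_def)
  then obtain f where f: "\<And>k. f k \<in> T" "\<And>k. Sobolev_norm (real DIM('a)) \<Omega> (\<lambda>x. v x - f k x) < inverse (real (Suc k))"
    by metis
  define S where "S = (\<lambda>k. (\<integral>x. \<bar>v x - f k x\<bar> ^ DIM('a) \<partial>M) + (\<integral>x. norm (weak_grad \<Omega> (\<lambda>x. v x - f k x) x) ^ DIM('a) \<partial>M))"
  have S0: "S k \<ge> 0" for k unfolding S_def by (intro add_nonneg_nonneg Bochner_Integration.integral_nonneg) auto
  have S_le: "S k \<le> inverse (real (Suc k))" for k
  proof -
    have "S k powr (1 / real DIM('a)) < inverse (real (Suc k))" using f(2)[of k] by (simp only: Sobolev_norm_eq S_def)
    then have "(S k powr (1 / real DIM('a))) powr real DIM('a) \<le> inverse (real (Suc k)) powr real DIM('a)"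
      by (intro powr_mono2) auto
    moreover have "(S k powr (1 / real DIM('a))) powr real DIM('a) = S k" using S0[of k] dim_pos by (simp add: powr_powr)
    moreover have "inverse (real (Suc k)) powr real DIM('a) \<le> inverse (real (Suc k)) powr 1"
      using dim by (intro powr_mono') (auto simp: inverse_le_1_iff)
    ultimately show ?thesis by (simp del: of_nat_Suc)
  qed
  have S_lim: "S \<longlonglongrightarrow> 0"
    by (rule tendsto_sandwich[OF _ _ tendsto_const LIMSEQ_inverse_real_of_nat]) (use S0 S_le in auto)
  have "(\<lambda>k. \<integral>x. \<bar>v x - f k x\<bar> ^ DIM('a) \<partial>M) \<longlonglongrightarrow> 0"
    by (rule tendsto_sandwich[OF _ _ tendsto_const S_lim])
      (auto simp: S_def intro!: always_eventually Bochner_Integration.integral_nonneg)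
  moreover have "(\<lambda>k. \<integral>x. norm (weak_grad \<Omega> v x - grad (f k) x) ^ DIM('a) \<partial>M) \<longlonglongrightarrow> 0"
  proof -
    have eq: "(\<integral>x. norm (weak_grad \<Omega> (\<lambda>x. v x - f k x) x) ^ DIM('a) \<partial>M) = (\<integral>x. norm (weak_grad \<Omega> v x - grad (f k) x) ^ DIM('a) \<partial>M)" for k
    proof (rule integral_cong_AE)
      have ae2: "AE x in M. weak_grad \<Omega> (\<lambda>x. v x - f k x) x = weak_grad \<Omega> v x - grad (f k) x"
        by (rule weak_grad_diff_test[OF has_weak_gradient_weak_grad[OF V(1)] f(1)])
      then show "AE x in M. norm (weak_grad \<Omega> (\<lambda>x. v x - f k x) x) ^ DIM('a) = norm (weak_grad \<Omega> v x - grad (f k) x) ^ DIM('a)"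
        by eventually_elim simp
      have m: "(\<lambda>x. weak_grad \<Omega> v x - grad (f k) x) \<in> borel_measurable M" using Wm T_integrals(2)[OF f(1)] by simp
      have "AE x in M. weak_grad \<Omega> v x - grad (f k) x = weak_grad \<Omega> (\<lambda>x. v x - f k x) x" using ae2 by eventually_elim simp
      then have [measurable]: "weak_grad \<Omega> (\<lambda>x. v x - f k x) \<in> borel_measurable M" by (rule borel_measurable_AE_M[OF m])
      show "(\<lambda>x. norm (weak_grad \<Omega> (\<lambda>x. v x - f k x) x) ^ DIM('a)) \<in> borel_measurable M" by measurable
      show "(\<lambda>x. norm (weak_grad \<Omega> v x - grad (f k) x) ^ DIM('a)) \<in> borel_measurable M" using m by simp
    qed
    show ?thesis
      by (rule tendsto_sandwich[OF _ _ tendsto_const S_lim])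
        (auto simp: S_def eq intro!: always_eventually Bochner_Integration.integral_nonneg)
  qed
  ultimately show ?thesis using that f(1) vm Wm vi Wi by blast
qed

text \<open>Both combinations have the shape f + c g, with c = 1 and c = -1, so that one gradient
  formula serves for both.\<close>

lemma N_clarkson:
  assumes \<phi>: "\<phi> \<in> T" and \<psi>: "\<psi> \<in> T"
  shows "N (\<lambda>x. (1 / 2) * (\<phi> x + 1 * \<psi> x)) + N (\<lambda>x. (1 / 2) * (\<phi> x + (- 1) * \<psi> x)) \<le> (N \<phi> + N \<psi>) / 2"
proof -
  have s: "smooth \<phi>" "smooth \<psi>" using \<phi> \<psi> test_functions_smooth by auto
  have t: "(\<lambda>x. (1 / 2) * (\<phi> x + c * \<psi> x)) \<in> T" for c
    by (intro test_functions_scale test_functions_add_scaled \<phi> \<psi>)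
  have g: "grad (\<lambda>x. (1 / 2) * (\<phi> x + c * \<psi> x)) x = (1 / 2) *\<^sub>R (grad \<phi> x + c *\<^sub>R grad \<psi> x)" for c x
    by (simp only: grad_scale[OF test_functions_smooth[OF test_functions_add_scaled[OF \<phi> \<psi>]]] grad_add_scaled[OF s])
  have "N (\<lambda>x. (1 / 2) * (\<phi> x + 1 * \<psi> x)) + N (\<lambda>x. (1 / 2) * (\<phi> x + (- 1) * \<psi> x))
    = (\<integral>x. norm (grad (\<lambda>x. (1 / 2) * (\<phi> x + 1 * \<psi> x)) x) ^ DIM('a) + norm (grad (\<lambda>x. (1 / 2) * (\<phi> x + (- 1) * \<psi> x)) x) ^ DIM('a) \<partial>M)"
    unfolding N_def by (intro Bochner_Integration.integral_add[symmetric] T_integrals(6) t)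
  also have "\<dots> \<le> (\<integral>x. (norm (grad \<phi> x) ^ DIM('a) + norm (grad \<psi> x) ^ DIM('a)) / 2 \<partial>M)"
  proof (rule integral_mono)
    show "norm (grad (\<lambda>x. (1 / 2) * (\<phi> x + 1 * \<psi> x)) x) ^ DIM('a) + norm (grad (\<lambda>x. (1 / 2) * (\<phi> x + (- 1) * \<psi> x)) x) ^ DIM('a)
      \<le> (norm (grad \<phi> x) ^ DIM('a) + norm (grad \<psi> x) ^ DIM('a)) / 2" for x
      unfolding g using clarkson_power[OF dim, of "grad \<phi> x" "grad \<psi> x"] by simp
    show "integrable M (\<lambda>x. norm (grad (\<lambda>x. (1 / 2) * (\<phi> x + 1 * \<psi> x)) x) ^ DIM('a) + norm (grad (\<lambda>x. (1 / 2) * (\<phi> x + (- 1) * \<psi> x)) x) ^ DIM('a))"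
      by (intro Bochner_Integration.integrable_add T_integrals(6) t)
    show "integrable M (\<lambda>x. (norm (grad \<phi> x) ^ DIM('a) + norm (grad \<psi> x) ^ DIM('a)) / 2)"
      by (intro integrable_divide_zero Bochner_Integration.integrable_add T_integrals(6) \<phi> \<psi>)
  qed
  also have "\<dots> = (N \<phi> + N \<psi>) / 2" unfolding N_def using T_integrals(6)[OF \<phi>] T_integrals(6)[OF \<psi>] by simp
  finally show ?thesis .
qed

lemma N_add_scaled_le:
  assumes \<phi>: "\<phi> \<in> T" and \<psi>: "\<psi> \<in> T"
  shows "N (\<lambda>x. \<phi> x + t * \<psi> x) \<le> 2 ^ DIM('a) * (N \<phi> + \<bar>t\<bar> ^ DIM('a) * N \<psi>)"
proof -
  have s: "smooth \<phi>" "smooth \<psi>" using \<phi> \<psi> test_functions_smooth by auto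
  have g: "grad (\<lambda>x. \<phi> x + t * \<psi> x) x = grad \<phi> x + t *\<^sub>R grad \<psi> x" for x by (rule grad_add_scaled[OF s])
  have "N (\<lambda>x. \<phi> x + t * \<psi> x) \<le> (\<integral>x. 2 ^ DIM('a) * (norm (grad \<phi> x) ^ DIM('a) + \<bar>t\<bar> ^ DIM('a) * norm (grad \<psi> x) ^ DIM('a)) \<partial>M)"
    unfolding N_def
  proof (rule integral_mono)
    show "integrable M (\<lambda>x. norm (grad (\<lambda>x. \<phi> x + t * \<psi> x) x) ^ DIM('a))"
      by (intro T_integrals(6) test_functions_add_scaled \<phi> \<psi>)
    show "norm (grad (\<lambda>x. \<phi> x + t * \<psi> x) x) ^ DIM('a)
      \<le> 2 ^ DIM('a) * (norm (grad \<phi> x) ^ DIM('a) + \<bar>t\<bar> ^ DIM('a) * norm (grad \<psi> x) ^ DIM('a))" for x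
      unfolding g using norm_add_power_le[of "grad \<phi> x" "t *\<^sub>R grad \<psi> x" "DIM('a)"] by (simp add: power_mult_distrib)
  qed (use T_integrals(6)[OF \<phi>] T_integrals(6)[OF \<psi>] in auto)
  also have "\<dots> = 2 ^ DIM('a) * (N \<phi> + \<bar>t\<bar> ^ DIM('a) * N \<psi>)"
    unfolding N_def using T_integrals(6)[OF \<phi>] T_integrals(6)[OF \<psi>] by simp
  finally show ?thesis .
qed

lemma T_L1_compactness:
  assumes f: "\<And>k. f k \<in> T" and B: "\<And>k. N (f k) \<le> B"
  obtains s where "strict_mono (s :: nat \<Rightarrow> nat)"
    "\<And>\<epsilon>. \<epsilon> > 0 \<Longrightarrow> \<exists>K. \<forall>i\<ge>K. \<forall>j\<ge>K. (\<integral>x. \<bar>f (s i) x - f (s j) x\<bar> \<partial>M) < \<epsilon>"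
proof -
  interpret finite_measure M by (rule finite_M)
  have "\<exists>K. K \<subseteq> \<Omega> \<and> C1c K (f k) (grad (f k))" for k by (rule test_functions_C1c[OF f[of k]]) blast
  then obtain K where K: "\<And>k. K k \<subseteq> \<Omega>" "\<And>k. C1c (K k) (f k) (grad (f k))" by metis
  obtain R where R: "R > 0" "\<And>x. x \<in> \<Omega> \<Longrightarrow> norm x \<le> R" using bounded_\<Omega> unfolding bounded_pos by blast
  have G: "(\<integral>x. norm (grad (f k) x) \<partial>lborel) \<le> measure M (space M) + B" for k
  proof -
    have "(\<integral>x. norm (grad (f k) x) \<partial>lborel) = (\<integral>x. norm (grad (f k) x) \<partial>M)"
    proof (rule integral_lebesgue_on_support(1)[OF \<Omega>_borel, symmetric])
      show "(\<lambda>x. norm (grad (f k) x)) \<in> borel_measurable borel" using C1c_measurable(2)[OF K(2)] by simp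
      show "norm (grad (f k) x) = 0" if "x \<notin> \<Omega>" for x
        using K(1)[of k] K(2)[of k] that unfolding C1c_def by auto
    qed
    also have "\<dots> \<le> (\<integral>x. 1 + norm (grad (f k) x) ^ DIM('a) \<partial>M)"
    proof (rule integral_mono)
      show "norm (grad (f k) x) \<le> 1 + norm (grad (f k) x) ^ DIM('a)" for x
        using self_le_power[of "norm (grad (f k) x)" "DIM('a)"] dim_pos
        by (cases "norm (grad (f k) x) \<le> 1") (auto simp: add_increasing2)
    qed (use T_integrals[OF f] in auto)
    also have "\<dots> = measure M (space M) + N (f k)" unfolding N_def using T_integrals(6)[OF f] by simp
    finally show ?thesis using B[of k] by simp
  qed
  have Kc: "K k \<subseteq> cball 0 R" for k using K(1)[of k] R(2) by auto
  obtain s where s: "strict_mono (s :: nat \<Rightarrow> nat)"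
    "\<And>\<epsilon>. \<epsilon> > 0 \<Longrightarrow> \<exists>N. \<forall>i\<ge>N. \<forall>j\<ge>N. (\<integral>x. \<bar>f (s i) x - f (s j) x\<bar> \<partial>lborel) < \<epsilon>"
  proof (rule L1_compactness[of K f "\<lambda>k. grad (f k)" R "measure M (space M) + B", OF K(2) Kc R(1) G])
    fix s :: "nat \<Rightarrow> nat"
    assume "strict_mono s"
      "\<And>\<epsilon>. \<epsilon> > 0 \<Longrightarrow> \<exists>N. \<forall>i\<ge>N. \<forall>j\<ge>N. (\<integral>x. \<bar>f (s i) x - f (s j) x\<bar> \<partial>lborel) < \<epsilon>"
    then show ?thesis by (rule that)
  qed
  have "(\<integral>x. \<bar>f i x - f j x\<bar> \<partial>M) = (\<integral>x. \<bar>f i x - f j x\<bar> \<partial>lborel)" for i j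
  proof (rule integral_lebesgue_on_support(1)[OF \<Omega>_borel])
    show "(\<lambda>x. \<bar>f i x - f j x\<bar>) \<in> borel_measurable borel" using C1c_measurable(1)[OF K(2)] by simp
    show "\<bar>f i x - f j x\<bar> = 0" if "x \<notin> \<Omega>" for x using test_functions_zero[OF f that] by simp
  qed
  then show ?thesis using that[OF s(1)] s(2) by simp
qed

end

subsection \<open>Minimisation on a small ball\<close>

context kirchhoff
begin

text \<open>A primitive of (a s + b) / n; the factor 1/n cancels the n produced by differentiating
  the n-th power of the norm.\<close>

definition Phi :: "real \<Rightarrow> real" where
  "Phi s = a * s\<^sup>2 / (2 * real DIM('a)) + b * s / real DIM('a)"

definition J :: "real \<Rightarrow> ('a \<Rightarrow> real) \<Rightarrow> real" where
  "J lam \<phi> = Phi (N \<phi>) - lower_order lam \<phi>"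

text \<open>The quadratic part is monotone and convex on the nonnegative reals and gives away
  nothing. The linear part, with slope b/n > 0, turns the gap d of Clarkson's inequality into a gap
  of the energy.\<close>

lemma Phi_strongly_convex:
  assumes "0 \<le> x" "0 \<le> d" "x + d \<le> (A + B) / 2"
  shows "Phi x + b / real DIM('a) * d \<le> (Phi A + Phi B) / 2"
proof -
  have n: "real DIM('a) > 0" by simp
  have "x\<^sup>2 \<le> ((A + B) / 2)\<^sup>2" using assms by (intro power_mono) auto
  also have "\<dots> \<le> (A\<^sup>2 + B\<^sup>2) / 2"
    using sum_squares_bound[of A B] by (simp add: power2_eq_square field_simps)
  finally have "a / (2 * real DIM('a)) * x\<^sup>2 \<le> a / (2 * real DIM('a)) * ((A\<^sup>2 + B\<^sup>2) / 2)"
    using ab n by (intro mult_left_mono) auto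
  moreover have "b / real DIM('a) * (x + d) \<le> b / real DIM('a) * ((A + B) / 2)"
    using assms ab n by (intro mult_left_mono) auto
  moreover have "Phi s = a / (2 * real DIM('a)) * s\<^sup>2 + b / real DIM('a) * s" for s
    by (simp add: Phi_def)
  moreover have "\<alpha> * X + c * x + c * d \<le> ((\<alpha> * Y + c * A) + (\<alpha> * Z + c * B)) / 2"
    if "\<alpha> * X \<le> \<alpha> * ((Y + Z) / 2)" "c * (x + d) \<le> c * ((A + B) / 2)" for \<alpha> c X Y Z :: real
    using that by (simp add: algebra_simps)
  ultimately show ?thesis by presburger
qed

lemma Phi_ge: "0 \<le> s \<Longrightarrow> b * s / real DIM('a) \<le> Phi s"
  using ab by (simp add: Phi_def)

lemma Phi_mono: "0 \<le> s \<Longrightarrow> s \<le> t \<Longrightarrow> Phi s \<le> Phi t"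
  unfolding Phi_def using ab by (intro add_mono divide_right_mono mult_left_mono power_mono) auto

text \<open>Along t \<psi> the leading part is of order t^n, the weight term is exactly of order
  t^(q+1), and q + 1 < n; the primitive is nonnegative and only lowers the energy. For small t > 0
  the weight term wins.\<close>

lemma exists_negative_energy:
  assumes lam: "lam > 0" and \<rho>: "\<rho> > 0"
  obtains \<phi> where "\<phi> \<in> T" "N \<phi> \<le> \<rho> ^ DIM('a)" "J lam \<phi> < 0"
proof -
  obtain \<psi> where \<psi>: "\<psi> \<in> T" and I: "(\<integral>x. h x * \<bar>\<psi> x\<bar> powr (q + 1) \<partial>M) > 0"
    using exists_test_function_positive[OF open_\<Omega> h_locally_integrable _ h_pos, of "q + 1"] q by auto
  define \<kappa> where "\<kappa> = lam / (q + 1) * (\<integral>x. h x * \<bar>\<psi> x\<bar> powr (q + 1) \<partial>M)"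
  have \<kappa>: "\<kappa> > 0" using I lam q by (simp add: \<kappa>_def)
  define c where "c = Phi (N \<psi>)"
  have c: "c \<ge> 0" using Phi_ge[OF N_nonneg[of \<psi>]] N_nonneg[of \<psi>] ab by (auto simp: c_def intro: order_trans[rotated])
  define e where "e = real DIM('a) - (q + 1)"
  have e: "e > 0" using q by (simp add: e_def)
  have t0: "((\<lambda>t::real. t) \<longlongrightarrow> 0) (at_right 0)" by (rule tendsto_ident_at)
  have pos: "eventually (\<lambda>t::real. t > 0) (at_right 0)" by (rule eventually_at_right_less)
  have "((\<lambda>t::real. c * t powr e) \<longlongrightarrow> c * 0) (at_right 0)"
    using e pos by (intro tendsto_intros tendsto_zero_powrI[OF t0 tendsto_const]) (auto elim: eventually_mono)
  then have "eventually (\<lambda>t::real. c * t powr e < \<kappa>) (at_right 0)" using \<kappa> by (intro order_tendstoD(2)) auto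
  moreover have "((\<lambda>t::real. t ^ DIM('a) * N \<psi>) \<longlongrightarrow> 0 ^ DIM('a) * N \<psi>) (at_right 0)"
    by (intro tendsto_intros)
  then have "eventually (\<lambda>t::real. t ^ DIM('a) * N \<psi> < \<rho> ^ DIM('a)) (at_right 0)"
    using \<rho> dim_pos by (intro order_tendstoD(2)) (auto simp: power_0_left)
  moreover have "eventually (\<lambda>t::real. t < 1) (at_right 0)" using t0 by (rule order_tendstoD(2)) simp
  ultimately have "eventually (\<lambda>t::real. t > 0 \<and> t < 1 \<and> c * t powr e < \<kappa> \<and> t ^ DIM('a) * N \<psi> < \<rho> ^ DIM('a)) (at_right 0)"
    using pos by eventually_elim simp
  then obtain t :: real where t: "t > 0" "t < 1" "c * t powr e < \<kappa>" "t ^ DIM('a) * N \<psi> < \<rho> ^ DIM('a)"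
    using eventually_happens trivial_limit_at_right_real by blast
  define \<phi> where "\<phi> = (\<lambda>x. t * \<psi> x)"
  have \<phi>: "\<phi> \<in> T" unfolding \<phi>_def by (rule test_functions_scale[OF \<psi>])
  have N\<phi>: "N \<phi> = t ^ DIM('a) * N \<psi>" unfolding \<phi>_def N_scale[OF \<psi>] using t by simp
  have "Phi (N \<phi>) \<le> t ^ DIM('a) * c"
  proof -
    \<comment> \<open>For t < 1 the quadratic part is bounded by its multiple with t^n, so the
      leading part as a whole is at most t^n times its value at \<psi>.\<close>
    have "(t ^ DIM('a))\<^sup>2 \<le> t ^ DIM('a)"
      using t by (simp add: power2_eq_square mult_left_le power_le_one)
    then have "a * ((t ^ DIM('a))\<^sup>2 * (N \<psi>)\<^sup>2) / (2 * real DIM('a)) \<le> a * (t ^ DIM('a) * (N \<psi>)\<^sup>2) / (2 * real DIM('a))"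
      using ab by (intro divide_right_mono mult_left_mono mult_right_mono) auto
    then show ?thesis by (simp add: N\<phi> c_def Phi_def power_mult_distrib algebra_simps)
  qed
  also have "t ^ DIM('a) = t powr (q + 1) * t powr e"
    using t by (simp add: e_def powr_add[symmetric] powr_realpow)
  finally have "Phi (N \<phi>) \<le> t powr (q + 1) * (c * t powr e)" by (simp add: mult_ac)
  also have "\<dots> < t powr (q + 1) * \<kappa>" using t by (intro mult_strict_left_mono) auto
  also have "\<dots> = lam / (q + 1) * (\<integral>x. h x * \<bar>\<phi> x\<bar> powr (q + 1) \<partial>M)"
  proof -
    have "h x * \<bar>\<phi> x\<bar> powr (q + 1) = t powr (q + 1) * (h x * \<bar>\<psi> x\<bar> powr (q + 1))" for x
      using t by (simp add: \<phi>_def abs_mult powr_mult)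
    then have "(\<integral>x. h x * \<bar>\<phi> x\<bar> powr (q + 1) \<partial>M) = (\<integral>x. t powr (q + 1) * (h x * \<bar>\<psi> x\<bar> powr (q + 1)) \<partial>M)"
      by (intro Bochner_Integration.integral_cong refl)
    then show ?thesis by (simp add: \<kappa>_def)
  qed
  finally have "Phi (N \<phi>) < lam / (q + 1) * (\<integral>x. h x * \<bar>\<phi> x\<bar> powr (q + 1) \<partial>M)" .
  moreover have "0 \<le> (\<integral>x. G (\<phi> x) \<partial>M)"
    using prim_nonneg[OF p_pos \<beta>_bounds(3)] by (intro Bochner_Integration.integral_nonneg)
  ultimately have "J lam \<phi> < 0" by (simp add: J_def lower_order_def)
  moreover have "N \<phi> \<le> \<rho> ^ DIM('a)" using N\<phi> t by simp
  ultimately show ?thesis using that \<phi> by blast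
qed

text \<open>The lower bound leaves b/n times \<rho>^n / 2^(n+1) for the two lower order terms, half
  of it, \<kappa> \<rho>^n, for each. The primitive fits in by a small \<rho>; afterwards
  \<open>lam0\<close> is chosen for the weight term. As a consequence, negative energy forces
  \<open>N \<phi>\<close> below \<rho>^n / 2^(n+1).\<close>

lemma exists_parameters:
  obtains lam0 \<rho> where "lam0 > 0" "\<rho> > 0" "16 * \<rho> powr \<beta> \<le> mt_rate TYPE('a)"
    "\<And>lam \<phi>. 0 < lam \<Longrightarrow> lam < lam0 \<Longrightarrow> \<phi> \<in> T \<Longrightarrow> N \<phi> \<le> \<rho> ^ DIM('a) \<Longrightarrow>
      b / real DIM('a) * (N \<phi> - (1 / 2 ^ (DIM('a) + 1)) * \<rho> ^ DIM('a)) \<le> J lam \<phi>"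
proof -
  obtain C1 C2 where C: "C1 > 0" "C2 > 0"
    "\<And>\<phi> \<rho>. \<phi> \<in> T \<Longrightarrow> \<rho> > 0 \<Longrightarrow> 16 * \<rho> powr \<beta> \<le> mt_rate TYPE('a) \<Longrightarrow> N \<phi> \<le> \<rho> ^ DIM('a) \<Longrightarrow>
      (\<integral>x. G (\<phi> x) \<partial>M) \<le> C1 * \<rho> powr (p + 2)"
    "\<And>\<phi> \<rho>. \<phi> \<in> T \<Longrightarrow> \<rho> > 0 \<Longrightarrow> N \<phi> \<le> \<rho> ^ DIM('a) \<Longrightarrow>
      \<bar>\<integral>x. h x * \<bar>\<phi> x\<bar> powr (q + 1) \<partial>M\<bar> \<le> C2 * \<rho> powr (q + 1)"
    by (rule ball_bounds) blast
  define \<kappa> where "\<kappa> = b / real DIM('a) * (1 / 2 ^ (DIM('a) + 1)) / 2"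
  have \<kappa>: "\<kappa> > 0" using ab by (simp add: \<kappa>_def)
  define e where "e = p + 2 - real DIM('a)"
  have e: "e > 0" using p_gt by (simp add: e_def)
  have t0: "((\<lambda>t::real. t) \<longlongrightarrow> 0) (at_right 0)" by (rule tendsto_ident_at)
  have pos: "eventually (\<lambda>t::real. t > 0) (at_right 0)" by (rule eventually_at_right_less)
  have "((\<lambda>t::real. C1 * t powr e) \<longlongrightarrow> C1 * 0) (at_right 0)"
    using e pos by (intro tendsto_intros tendsto_zero_powrI[OF t0 tendsto_const]) (auto elim: eventually_mono)
  then have "eventually (\<lambda>t::real. C1 * t powr e < \<kappa>) (at_right 0)" using \<kappa> by (intro order_tendstoD(2)) auto
  moreover have "((\<lambda>t::real. 16 * t powr \<beta>) \<longlongrightarrow> 16 * 0) (at_right 0)"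
    using \<beta>_bounds(3) pos by (intro tendsto_intros tendsto_zero_powrI[OF t0 tendsto_const]) (auto elim: eventually_mono)
  then have "eventually (\<lambda>t::real. 16 * t powr \<beta> < mt_rate TYPE('a)) (at_right 0)"
    using mt_rate_pos[where 'a='a] by (intro order_tendstoD(2)) auto
  ultimately have "eventually (\<lambda>t::real. t > 0 \<and> C1 * t powr e < \<kappa> \<and> 16 * t powr \<beta> < mt_rate TYPE('a)) (at_right 0)"
    using pos by eventually_elim simp
  then obtain \<rho> :: real where \<rho>: "\<rho> > 0" "C1 * \<rho> powr e < \<kappa>" "16 * \<rho> powr \<beta> < mt_rate TYPE('a)"
    using eventually_happens trivial_limit_at_right_real by blast
  define lam0 where "lam0 = \<kappa> * \<rho> ^ DIM('a) * (q + 1) / (C2 * \<rho> powr (q + 1))"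
  have lam0: "lam0 > 0" using \<kappa> \<rho>(1) q C(2) by (simp add: lam0_def)
  have "b / real DIM('a) * (N \<phi> - (1 / 2 ^ (DIM('a) + 1)) * \<rho> ^ DIM('a)) \<le> J lam \<phi>"
    if lam: "0 < lam" "lam < lam0" and \<phi>: "\<phi> \<in> T" and N\<phi>: "N \<phi> \<le> \<rho> ^ DIM('a)" for lam \<phi>
  proof -
    have "(\<integral>x. G (\<phi> x) \<partial>M) \<le> C1 * \<rho> powr (p + 2)" using C(3)[OF \<phi> \<rho>(1) _ N\<phi>] \<rho>(3) by simp
    also have "\<dots> = (C1 * \<rho> powr e) * \<rho> ^ DIM('a)"
      using \<rho>(1) by (simp add: e_def powr_diff powr_realpow)
    also have "\<dots> \<le> \<kappa> * \<rho> ^ DIM('a)" using \<rho> by (intro mult_right_mono) auto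
    finally have 1: "(\<integral>x. G (\<phi> x) \<partial>M) \<le> \<kappa> * \<rho> ^ DIM('a)" .
    have "lam / (q + 1) * (\<integral>x. h x * \<bar>\<phi> x\<bar> powr (q + 1) \<partial>M) \<le> lam / (q + 1) * (C2 * \<rho> powr (q + 1))"
      using C(4)[OF \<phi> \<rho>(1) N\<phi>] lam q by (intro mult_left_mono) auto
    also have "\<dots> \<le> lam0 / (q + 1) * (C2 * \<rho> powr (q + 1))"
      using lam q C(2) by (intro mult_right_mono divide_right_mono) auto
    also have "\<dots> = \<kappa> * \<rho> ^ DIM('a)" using \<rho>(1) C(2) q by (simp add: lam0_def)
    finally have 2: "lam / (q + 1) * (\<integral>x. h x * \<bar>\<phi> x\<bar> powr (q + 1) \<partial>M) \<le> \<kappa> * \<rho> ^ DIM('a)" .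
    have "b / real DIM('a) * ((1 / 2 ^ (DIM('a) + 1)) * \<rho> ^ DIM('a)) = 2 * (\<kappa> * \<rho> ^ DIM('a))"
      by (simp add: \<kappa>_def)
    moreover have "b / real DIM('a) * (N \<phi> - (1 / 2 ^ (DIM('a) + 1)) * \<rho> ^ DIM('a))
      = b * N \<phi> / real DIM('a) - b / real DIM('a) * ((1 / 2 ^ (DIM('a) + 1)) * \<rho> ^ DIM('a))"
      by (simp add: right_diff_distrib)
    moreover note Phi_ge[OF N_nonneg[of \<phi>]]
    ultimately show ?thesis using 1 2 unfolding J_def lower_order_def by linarith
  qed
  then show ?thesis using that[OF lam0 \<rho>(1) less_imp_le[OF \<rho>(3)]] by blast
qed

end

section \<open>Minimising sequences and their strong limit\<close>

locale kirchhoff_small = kirchhoff \<Omega> \<beta> a b p q \<gamma> h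
  for \<Omega> :: "'a::euclidean_space set" and \<beta> a b p q \<gamma> h +
  fixes lam \<rho> :: real
  assumes lam: "lam > 0" and \<rho>: "\<rho> > 0" "16 * \<rho> powr \<beta> \<le> mt_rate TYPE('a)"
    and J_ge: "\<And>\<phi>. \<phi> \<in> T \<Longrightarrow> N \<phi> \<le> \<rho> ^ DIM('a) \<Longrightarrow>
      b / real DIM('a) * (N \<phi> - (1 / 2 ^ (DIM('a) + 1)) * \<rho> ^ DIM('a)) \<le> J lam \<phi>"
begin

definition small_ball :: "('a \<Rightarrow> real) set" where
  "small_ball = {\<phi> \<in> T. N \<phi> \<le> \<rho> ^ DIM('a)}"

definition J_min :: real where
  "J_min = Inf (J lam ` small_ball)"

lemma ball_exp_class: "\<phi> \<in> small_ball \<Longrightarrow> \<phi> \<in> exp_class"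
  unfolding small_ball_def using \<rho> exp_classI by blast

lemma J_min_le: "\<phi> \<in> small_ball \<Longrightarrow> J_min \<le> J lam \<phi>"
  unfolding J_min_def
proof (rule cInf_lower)
  have "- (b / real DIM('a) * ((1 / 2 ^ (DIM('a) + 1)) * \<rho> ^ DIM('a))) \<le> J lam \<phi>" if "\<phi> \<in> small_ball" for \<phi>
  proof -
    have "b / real DIM('a) * (0 - (1 / 2 ^ (DIM('a) + 1)) * \<rho> ^ DIM('a))
      \<le> b / real DIM('a) * (N \<phi> - (1 / 2 ^ (DIM('a) + 1)) * \<rho> ^ DIM('a))"
      using ab N_nonneg[of \<phi>] by (intro mult_left_mono) auto
    also have "\<dots> \<le> J lam \<phi>" using J_ge that by (simp add: small_ball_def)
    finally show ?thesis by simp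
  qed
  then show "bdd_below (J lam ` small_ball)" by (intro bdd_belowI2) 
qed simp

lemma J_min_neg: "J_min < 0"
proof -
  obtain \<phi> where "\<phi> \<in> small_ball" "J lam \<phi> < 0"
    using exists_negative_energy[OF lam \<rho>(1)] unfolding small_ball_def by blast
  then show ?thesis using J_min_le[of \<phi>] by linarith
qed

lemma zero_in_ball: "(\<lambda>x. 0) \<in> small_ball"
  unfolding small_ball_def using zero_test_function \<rho>(1) dim_pos by (simp add: N_def grad_zero power_0_left)

lemma lower_order_abs: "lower_order l (\<lambda>x. \<bar>u x\<bar>) = lower_order l u"
  using prim_abs[OF p_pos \<beta>_bounds(3)] by (simp add: lower_order_def)

text \<open>The absolute value of an almost minimiser has the same lower order terms but need not be
  smooth. Its smooth substitute is uniformly e-close, which keeps the lower order terms within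
  \<epsilon>/2, and its leading part is no larger.\<close>

lemma nonneg_almost_minimiser:
  assumes \<epsilon>: "\<epsilon> > 0"
  obtains \<phi> where "\<phi> \<in> small_ball" "\<And>x. 0 \<le> \<phi> x" "J lam \<phi> < J_min + \<epsilon>"
proof -
  have "\<exists>\<phi>\<in>small_ball. J lam \<phi> < J_min + \<epsilon> / 2"
  proof (rule ccontr)
    assume "\<not> ?thesis"
    then have "J_min + \<epsilon> / 2 \<le> Inf (J lam ` small_ball)" using zero_in_ball by (intro cInf_greatest) (auto simp: not_less)
    then show False using \<epsilon> by (simp add: J_min_def)
  qed
  then obtain \<phi> where \<phi>: "\<phi> \<in> small_ball" "J lam \<phi> < J_min + \<epsilon> / 2" by blast
  then have T\<phi>: "\<phi> \<in> T" and N\<phi>: "N \<phi> \<le> \<rho> ^ DIM('a)" by (auto simp: small_ball_def)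
  have "\<epsilon> / 2 > 0" using \<epsilon> by simp
  then obtain \<delta> where \<delta>: "\<delta> > 0" "\<And>u v. u \<in> exp_class \<Longrightarrow> v \<in> exp_class \<Longrightarrow> (\<integral>x. \<bar>u x - v x\<bar> \<partial>M) < \<delta> \<Longrightarrow>
    \<bar>lower_order lam u - lower_order lam v\<bar> < \<epsilon> / 2"
    by (rule lower_order_uniformly_continuous[where lam=lam]) blast
  interpret finite_measure M by (rule finite_M)
  define mm where "mm = measure M (space M)"
  have mm: "mm \<ge> 0" by (simp add: mm_def)
  define e where "e = \<delta> / (mm + 1)"
  have e: "e > 0" using \<delta>(1) mm by (simp add: e_def)
  have emm: "e * mm < \<delta>" using \<delta>(1) mm by (simp add: e_def field_simps)
  define \<psi> where "\<psi> = (\<lambda>x. soft_abs e (\<phi> x))"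
  have T\<psi>: "\<psi> \<in> T" unfolding \<psi>_def by (rule test_functions_soft_abs[OF e T\<phi>])
  have N\<psi>: "N \<psi> \<le> N \<phi>"
    unfolding N_def
  proof (rule integral_mono)
    show "norm (grad \<psi> x) ^ DIM('a) \<le> norm (grad \<phi> x) ^ DIM('a)" for x
    proof -
      have "grad \<psi> x = (\<phi> x / sqrt ((\<phi> x)\<^sup>2 + e\<^sup>2)) *\<^sub>R grad \<phi> x"
        unfolding \<psi>_def by (rule grad_compose[OF test_functions_smooth[OF T\<phi>] soft_abs_deriv(1)[OF e]])
      then have "norm (grad \<psi> x) \<le> 1 * norm (grad \<phi> x)"
        using soft_abs_deriv(2)[OF e, of "\<phi> x"] by (simp only: norm_scaleR) (rule mult_right_mono, simp_all)
      then show ?thesis by (intro power_mono) auto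
    qed
  qed (intro T_integrals(6) T\<phi> T\<psi>)+
  then have B\<psi>: "\<psi> \<in> small_ball" using T\<psi> N\<phi> by (simp add: small_ball_def)
  have abs_class: "(\<lambda>x. \<bar>\<phi> x\<bar>) \<in> exp_class"
    using T_integrals(1)[OF T\<phi>] by (intro exp_class_mono[OF ball_exp_class[OF \<phi>(1)]]) auto
  have "(\<integral>x. \<bar>\<bar>\<phi> x\<bar> - \<psi> x\<bar> \<partial>M) \<le> (\<integral>x. e \<partial>M)"
  proof (rule integral_mono)
    show "integrable M (\<lambda>x. \<bar>\<bar>\<phi> x\<bar> - \<psi> x\<bar>)" using T_integrals(3)[OF T\<phi>] T_integrals(3)[OF T\<psi>] by auto
    show "\<bar>\<bar>\<phi> x\<bar> - \<psi> x\<bar> \<le> e" for x using soft_abs_bounds[OF e, of "\<phi> x"] by (simp add: \<psi>_def)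
  qed simp
  also have "\<dots> = e * mm" by (simp add: mm_def mult.commute)
  finally have "(\<integral>x. \<bar>\<bar>\<phi> x\<bar> - \<psi> x\<bar> \<partial>M) < \<delta>" using emm by simp
  from \<delta>(2)[OF abs_class ball_exp_class[OF B\<psi>] this]
  have "\<bar>lower_order lam \<phi> - lower_order lam \<psi>\<bar> < \<epsilon> / 2" by (simp add: lower_order_abs)
  then have "J lam \<psi> < J_min + \<epsilon>"
    using \<phi>(2) Phi_mono[OF N_nonneg N\<psi>] unfolding J_def by linarith
  moreover have "0 \<le> \<psi> x" for x using soft_abs_bounds(1)[OF e] by (simp add: \<psi>_def)
  ultimately show ?thesis using that B\<psi> by blast
qed

lemma minimising_sequence:
  obtains f where "\<And>k. f k \<in> small_ball" "\<And>k x. 0 \<le> f k x" "\<And>k. J lam (f k) < 0"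
    "(\<lambda>k. J lam (f k)) \<longlonglongrightarrow> J_min"
    "\<And>\<epsilon>. \<epsilon> > 0 \<Longrightarrow> \<exists>K. \<forall>i\<ge>K. \<forall>j\<ge>K. (\<integral>x. \<bar>f i x - f j x\<bar> \<partial>M) < \<epsilon>"
proof -
  \<comment> \<open>The minimum with \<open>- J_min\<close> forces negative energy for every member
    of the sequence and not only eventually.\<close>
  define e where "e = (\<lambda>k::nat. min (inverse (real (Suc k))) (- J_min))"
  have "\<exists>\<phi>. \<phi> \<in> small_ball \<and> (\<forall>x. 0 \<le> \<phi> x) \<and> J lam \<phi> < J_min + e k" for k
  proof -
    have "e k > 0" using J_min_neg by (simp add: e_def)
    then show ?thesis by (rule nonneg_almost_minimiser) blast
  qed
  then obtain f where f: "\<And>k. f k \<in> small_ball" "\<And>k x. 0 \<le> f k x" "\<And>k. J lam (f k) < J_min + e k" by metis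
  have fT: "f k \<in> T" "N (f k) \<le> \<rho> ^ DIM('a)" for k using f(1)[of k] by (auto simp: small_ball_def)
  obtain s where s: "strict_mono (s :: nat \<Rightarrow> nat)"
    and Cs: "\<And>\<epsilon>. \<epsilon> > 0 \<Longrightarrow> \<exists>K. \<forall>i\<ge>K. \<forall>j\<ge>K. (\<integral>x. \<bar>f (s i) x - f (s j) x\<bar> \<partial>M) < \<epsilon>"
  proof (rule T_L1_compactness[of f, OF fT])
    fix s :: "nat \<Rightarrow> nat"
    assume "strict_mono s"
      "\<And>\<epsilon>. \<epsilon> > 0 \<Longrightarrow> \<exists>K. \<forall>i\<ge>K. \<forall>j\<ge>K. (\<integral>x. \<bar>f (s i) x - f (s j) x\<bar> \<partial>M) < \<epsilon>"
    then show ?thesis by (rule that)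
  qed
  have Jlim: "(\<lambda>k. J lam (f k)) \<longlonglongrightarrow> J_min"
  proof (rule tendsto_sandwich)
    show "\<forall>\<^sub>F k in sequentially. J_min \<le> J lam (f k)" using J_min_le f(1) by simp
    show "\<forall>\<^sub>F k in sequentially. J lam (f k) \<le> J_min + inverse (real (Suc k))"
    proof (intro always_eventually allI)
      fix k show "J lam (f k) \<le> J_min + inverse (real (Suc k))"
        using f(3)[of k] min.cobounded1[of "inverse (real (Suc k))" "- J_min"] unfolding e_def by linarith
    qed
    show "(\<lambda>k. J_min) \<longlonglongrightarrow> J_min" by simp
    have "(\<lambda>k. J_min + inverse (real (Suc k))) \<longlonglongrightarrow> J_min + 0"
      by (intro tendsto_intros LIMSEQ_inverse_real_of_nat)
    then show "(\<lambda>k. J_min + inverse (real (Suc k))) \<longlonglongrightarrow> J_min" by simp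
  qed
  have Jneg: "J lam (f k) < 0" for k
    using f(3)[of k] min.cobounded2[of "inverse (real (Suc k))" "- J_min"] unfolding e_def by linarith
  show ?thesis
  proof (rule that[of "\<lambda>k. f (s k)"])
    show "(\<lambda>k. J lam (f (s k))) \<longlonglongrightarrow> J_min"
      using LIMSEQ_subseq_LIMSEQ[OF Jlim s] by (simp add: comp_def)
  qed (use f Jneg Cs in auto)
qed

text \<open>The midpoint of two members lies in the ball, so its energy is at least
  \<open>J_min\<close>. Both members have energy close to \<open>J_min\<close>, and L1 closeness
  makes all lower order terms nearly equal; hence the convexity gap, a multiple of \<open>N\<close>
  of half the difference, must be small.\<close>

lemma gradient_Cauchy:
  assumes f: "\<And>k. f k \<in> small_ball" and Jlim: "(\<lambda>k. J lam (f k)) \<longlonglongrightarrow> J_min"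
    and Cau: "\<And>\<epsilon>. \<epsilon> > 0 \<Longrightarrow> \<exists>K. \<forall>i\<ge>K. \<forall>j\<ge>K. (\<integral>x. \<bar>f i x - f j x\<bar> \<partial>M) < \<epsilon>"
    and \<epsilon>: "\<epsilon> > 0"
  shows "\<exists>K. \<forall>i\<ge>K. \<forall>j\<ge>K. N (\<lambda>x. f i x + (- 1) * f j x) < \<epsilon>"
proof -
  have fT: "f k \<in> T" "N (f k) \<le> \<rho> ^ DIM('a)" for k using f[of k] by (auto simp: small_ball_def)
  \<comment> \<open>Here (1/2)^n comes from halving the difference; the errors from energies and
    lower order terms together stay below 3 \<eta>.\<close>
  define \<eta> where "\<eta> = b / real DIM('a) * ((1 / 2) ^ DIM('a) * \<epsilon>) / 3"
  have \<eta>: "\<eta> > 0" using ab \<epsilon> by (simp add: \<eta>_def)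
  obtain \<delta> where \<delta>: "\<delta> > 0" "\<And>u v. u \<in> exp_class \<Longrightarrow> v \<in> exp_class \<Longrightarrow> (\<integral>x. \<bar>u x - v x\<bar> \<partial>M) < \<delta> \<Longrightarrow>
    \<bar>lower_order lam u - lower_order lam v\<bar> < \<eta>"
    by (rule lower_order_uniformly_continuous[where lam=lam, OF \<eta>]) blast
  obtain K1 where K1: "\<And>i j. i \<ge> K1 \<Longrightarrow> j \<ge> K1 \<Longrightarrow> (\<integral>x. \<bar>f i x - f j x\<bar> \<partial>M) < \<delta>"
    using Cau[OF \<delta>(1)] by blast
  obtain K2 where K2: "\<And>i. i \<ge> K2 \<Longrightarrow> \<bar>J lam (f i) - J_min\<bar> < \<eta>"
    using LIMSEQ_D[OF Jlim \<eta>] by auto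
  have "N (\<lambda>x. f i x + (- 1) * f j x) < \<epsilon>" if ij: "i \<ge> max K1 K2" "j \<ge> max K1 K2" for i j
  proof -
    define mid where "mid = (\<lambda>x. (1 / 2) * (f i x + 1 * f j x))"
    define df where "df = (\<lambda>x. f i x + (- 1) * f j x)"
    have midT: "mid \<in> T" unfolding mid_def by (intro test_functions_scale test_functions_add_scaled fT)
    have dfT: "df \<in> T" unfolding df_def by (intro test_functions_add_scaled fT)
    have cl: "N mid + N (\<lambda>x. (1 / 2) * df x) \<le> (N (f i) + N (f j)) / 2"
      unfolding mid_def df_def by (rule N_clarkson[OF fT(1) fT(1)])
    define w where "w = N (\<lambda>x. (1 / 2) * df x)"
    have w: "w \<ge> 0" "N mid + w \<le> (N (f i) + N (f j)) / 2" using cl N_nonneg by (simp_all only: w_def)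
    then have "N mid \<le> \<rho> ^ DIM('a)" using fT(2)[of i] fT(2)[of j] by argo
    then have midB: "mid \<in> small_ball" using midT by (simp add: small_ball_def)
    have "Phi (N mid) + b / real DIM('a) * w \<le> (Phi (N (f i)) + Phi (N (f j))) / 2"
      using w by (intro Phi_strongly_convex N_nonneg)
    moreover have "J_min \<le> Phi (N mid) - lower_order lam mid" using J_min_le[OF midB] by (simp add: J_def)
    moreover have "\<bar>lower_order lam (f k) - lower_order lam mid\<bar> < \<eta>" if "k = i \<or> k = j" for k
    proof (rule \<delta>(2)[OF ball_exp_class[OF f] ball_exp_class[OF midB]])
      have "(\<integral>x. \<bar>f k x - mid x\<bar> \<partial>M) = (\<integral>x. (1 / 2) * \<bar>f i x - f j x\<bar> \<partial>M)"
        using that by (intro Bochner_Integration.integral_cong refl) (auto simp: mid_def field_simps)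
      also have "\<dots> \<le> (\<integral>x. \<bar>f i x - f j x\<bar> \<partial>M)" by (simp add: Bochner_Integration.integral_nonneg)
      also have "\<dots> < \<delta>" using K1 ij by simp
      finally show "(\<integral>x. \<bar>f k x - mid x\<bar> \<partial>M) < \<delta>" .
    qed
    from this[of i] this[of j] have "\<bar>lower_order lam (f i) - lower_order lam mid\<bar> < \<eta>" "\<bar>lower_order lam (f j) - lower_order lam mid\<bar> < \<eta>"
      by auto
    moreover have "J lam (f i) < J_min + \<eta>" "J lam (f j) < J_min + \<eta>" using K2[of i] K2[of j] ij by auto
    moreover have "W < 3 * e"
      if "P + W \<le> (X + Y) / 2" "m \<le> P - K" "\<bar>U - K\<bar> < e" "\<bar>V - K\<bar> < e" "X - U < m + e" "Y - V < m + e"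
      for P W X Y m K e U V :: real
      using that unfolding abs_less_iff by argo
    ultimately have "b / real DIM('a) * w < 3 * \<eta>"
      unfolding J_def by blast
    also have "3 * \<eta> = b / real DIM('a) * ((1 / 2) ^ DIM('a) * \<epsilon>)" by (simp add: \<eta>_def)
    also have "w = (1 / 2) ^ DIM('a) * N df" using N_scale[OF dfT, of "1 / 2"] by (simp add: w_def)
    finally have "b / real DIM('a) * ((1 / 2) ^ DIM('a) * N df) < b / real DIM('a) * ((1 / 2) ^ DIM('a) * \<epsilon>)" .
    moreover have pos: "b / real DIM('a) > 0" "(1 / 2 :: real) ^ DIM('a) > 0" using ab by auto
    ultimately have "N df < \<epsilon>" by (simp only: mult_less_cancel_left_pos)
    then show ?thesis by (simp only: df_def)
  qed
  then show ?thesis by blast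
qed

text \<open>Completeness is applied twice in L^n: to the gradients by their Cauchy property, and to
  the functions through the Poincare inequality. The L1 Cauchy property has served only to obtain
  the former.\<close>

lemma exists_limit:
  obtains f u D where "\<And>k. f k \<in> small_ball" "\<And>k. J lam (f k) < 0" "(\<lambda>k. J lam (f k)) \<longlonglongrightarrow> J_min"
    "u \<in> borel_measurable M" "D \<in> borel_measurable M"
    "integrable M (\<lambda>x. \<bar>u x\<bar> ^ DIM('a))" "integrable M (\<lambda>x. norm (D x) ^ DIM('a))"
    "AE x in M. 0 \<le> u x" "has_weak_gradient \<Omega> u D"
    "(\<lambda>k. \<integral>x. \<bar>f k x - u x\<bar> ^ DIM('a) \<partial>M) \<longlonglongrightarrow> 0"
    "(\<lambda>k. \<integral>x. norm (grad (f k) x - D x) ^ DIM('a) \<partial>M) \<longlonglongrightarrow> 0"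
    "(\<lambda>k. \<integral>x. \<bar>f k x - u x\<bar> \<partial>M) \<longlonglongrightarrow> 0"
    "\<exists>s. strict_mono (s :: nat \<Rightarrow> nat) \<and> (AE x in M. (\<lambda>k. f (s k) x) \<longlonglongrightarrow> u x)"
proof -
  obtain f where f: "\<And>k. f k \<in> small_ball" "\<And>k x. 0 \<le> f k x" "\<And>k. J lam (f k) < 0"
    "(\<lambda>k. J lam (f k)) \<longlonglongrightarrow> J_min"
    "\<And>\<epsilon>. \<epsilon> > 0 \<Longrightarrow> \<exists>K. \<forall>i\<ge>K. \<forall>j\<ge>K. (\<integral>x. \<bar>f i x - f j x\<bar> \<partial>M) < \<epsilon>"
    by (rule minimising_sequence) (rule that)
  have fT: "f k \<in> T" for k using f(1)[of k] by (simp add: small_ball_def)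
  note fi = T_integrals[OF fT]
  have gdiff: "grad (\<lambda>x. f i x + (- 1) * f j x) x = grad (f i) x - grad (f j) x" for i j x
    using grad_add_scaled[OF test_functions_smooth[OF fT] test_functions_smooth[OF fT], where c="- 1"] by simp
  have NC: "\<exists>K. \<forall>i\<ge>K. \<forall>j\<ge>K. N (\<lambda>x. f i x + (- 1) * f j x) < \<epsilon>" if "\<epsilon> > 0" for \<epsilon>
    by (rule gradient_Cauchy[OF f(1) f(4) f(5) that])
  have gi: "integrable M (\<lambda>x. norm (grad (f i) x - grad (f j) x) ^ DIM('a))" for i j
    by (intro power_integrable_diff fi)
  have gC: "\<exists>K. \<forall>i\<ge>K. \<forall>j\<ge>K. (\<integral>x. norm (grad (f i) x - grad (f j) x) ^ DIM('a) \<partial>M) < \<epsilon>" if "\<epsilon> > 0" for \<epsilon>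
    using NC[OF that] unfolding N_def gdiff .
  have vi: "integrable M (\<lambda>x. norm (f i x - f j x) ^ DIM('a))" for i j
    using fi by (intro power_integrable_diff) auto
  obtain CP where CP: "CP \<ge> 0" "\<And>\<phi> \<tau>. \<phi> \<in> T \<Longrightarrow> \<tau> > 0 \<Longrightarrow> N \<phi> \<le> \<tau> ^ DIM('a) \<Longrightarrow>
    (\<integral>x. \<bar>\<phi> x\<bar> ^ DIM('a) \<partial>M) \<le> CP * \<tau> ^ DIM('a)" by (rule Poincare_power) blast
  have vC: "\<exists>K. \<forall>i\<ge>K. \<forall>j\<ge>K. (\<integral>x. norm (f i x - f j x) ^ DIM('a) \<partial>M) < \<epsilon>" if \<epsilon>: "\<epsilon> > 0" for \<epsilon>
  proof -
    \<comment> \<open>Then CP \<tau>^n < \<epsilon>, and the shift by 1 in CP + 1 covers CP =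
      0.\<close>
    define \<tau> where "\<tau> = root DIM('a) (\<epsilon> / (CP + 1))"
    have \<tau>: "\<tau> > 0" "\<tau> ^ DIM('a) = \<epsilon> / (CP + 1)" using \<epsilon> CP(1) dim_pos by (auto simp: \<tau>_def real_root_gt_zero)
    have "\<tau> ^ DIM('a) > 0" using \<tau>(1) by simp
    then obtain K where K: "\<And>i j. i \<ge> K \<Longrightarrow> j \<ge> K \<Longrightarrow> N (\<lambda>x. f i x + (- 1) * f j x) < \<tau> ^ DIM('a)" using NC by blast
    have "(\<integral>x. norm (f i x - f j x) ^ DIM('a) \<partial>M) < \<epsilon>" if "i \<ge> K" "j \<ge> K" for i j
    proof -
      have "(\<integral>x. \<bar>f i x + (- 1) * f j x\<bar> ^ DIM('a) \<partial>M) \<le> CP * \<tau> ^ DIM('a)"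
        using K[OF that] by (intro CP(2) test_functions_add_scaled fT \<tau>(1)) simp
      also have "\<dots> < \<epsilon>" unfolding \<tau>(2) using \<epsilon> CP(1) by (simp add: field_simps)
      finally show ?thesis by simp
    qed
    then show ?thesis by blast
  qed
  obtain D where D: "D \<in> borel_measurable M" "\<And>i. integrable M (\<lambda>x. norm (grad (f i) x - D x) ^ DIM('a))"
    "(\<lambda>i. \<integral>x. norm (grad (f i) x - D x) ^ DIM('a) \<partial>M) \<longlonglongrightarrow> 0"
  proof (rule Lp_complete[OF finite_M, of "\<lambda>k. grad (f k)" "DIM('a)"])
    show "grad (f k) \<in> borel_measurable M" for k by (rule fi(2))
    show "integrable M (\<lambda>x. norm (grad (f i) x - grad (f j) x) ^ DIM('a))" for i j by (rule gi)
    show "\<exists>K. \<forall>i\<ge>K. \<forall>j\<ge>K. (\<integral>x. norm (grad (f i) x - grad (f j) x) ^ DIM('a) \<partial>M) < \<epsilon>" if "\<epsilon> > 0" for \<epsilon>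
      by (rule gC[OF that])
  qed (use dim_pos in auto)
  obtain u s where u: "u \<in> borel_measurable M" "strict_mono (s :: nat \<Rightarrow> nat)" "AE x in M. (\<lambda>k. f (s k) x) \<longlonglongrightarrow> u x"
    "\<And>i. integrable M (\<lambda>x. norm (f i x - u x) ^ DIM('a))"
    "(\<lambda>i. \<integral>x. norm (f i x - u x) ^ DIM('a) \<partial>M) \<longlonglongrightarrow> 0"
  proof (rule Lp_complete[OF finite_M, of f "DIM('a)"])
    show "f k \<in> borel_measurable M" for k by (rule fi(1))
    show "integrable M (\<lambda>x. norm (f i x - f j x) ^ DIM('a))" for i j by (rule vi)
    show "\<exists>K. \<forall>i\<ge>K. \<forall>j\<ge>K. (\<integral>x. norm (f i x - f j x) ^ DIM('a) \<partial>M) < \<epsilon>" if "\<epsilon> > 0" for \<epsilon>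
      by (rule vC[OF that])
  qed (use dim_pos in auto)
  have Di: "integrable M (\<lambda>x. norm (D x) ^ DIM('a))"
    using power_integrable_diff[of "grad (f 0)" "\<lambda>x. grad (f 0) x - D x"] fi(2,6)[of 0] D(1) D(2)[of 0] by simp
  have ui: "integrable M (\<lambda>x. \<bar>u x\<bar> ^ DIM('a))"
    using power_integrable_diff[of "f 0" "\<lambda>x. f 0 x - u x"] fi(1,5)[of 0] u(1) u(4)[of 0] by simp
  have un: "AE x in M. 0 \<le> u x"
    using u(3)
  proof eventually_elim
    case (elim x)
    then show ?case using f(2) by (intro LIMSEQ_le_const) auto
  qed
  have L1u: "\<And>k. integrable M (\<lambda>x. f k x - u x)" "(\<lambda>k. \<integral>x. norm (f k x - u x) \<partial>M) \<longlonglongrightarrow> 0"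
    using L1_tendsto[of "\<lambda>k x. f k x - u x"] fi(1) u(1,4,5) by auto
  have L1D: "\<And>k. integrable M (\<lambda>x. grad (f k) x - D x)" "(\<lambda>k. \<integral>x. norm (grad (f k) x - D x) \<partial>M) \<longlonglongrightarrow> 0"
    using L1_tendsto[of "\<lambda>k x. grad (f k) x - D x"] fi(2) D by auto
  have "integrable M (\<lambda>x. f 0 x - (f 0 x - u x))" by (intro Bochner_Integration.integrable_diff fi(3) L1u(1))
  then have iu: "integrable M u" by simp
  have "integrable M (\<lambda>x. grad (f 0) x - (grad (f 0) x - D x))" by (intro Bochner_Integration.integrable_diff fi(4) L1D(1))
  then have iD: "integrable M D" by simp
  have wg: "has_weak_gradient \<Omega> u D"
    using has_weak_gradient_limit[OF \<Omega>_borel fT iu iD] L1u(2) L1D(2) by simp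
  show ?thesis
    by (rule that[of f u D]) (use f u D Di ui un wg L1u(2) in auto)
qed

end

subsection \<open>The Euler--Lagrange equation\<close>

locale kirchhoff_limit = kirchhoff_small \<Omega> \<beta> a b p q \<gamma> h lam \<rho>
  for \<Omega> :: "'a::euclidean_space set" and \<beta> a b p q \<gamma> h lam \<rho> +
  fixes f :: "nat \<Rightarrow> 'a \<Rightarrow> real" and u :: "'a \<Rightarrow> real" and D :: "'a \<Rightarrow> 'a"
  assumes f: "\<And>k. f k \<in> small_ball" "\<And>k. J lam (f k) < 0" "(\<lambda>k. J lam (f k)) \<longlonglongrightarrow> J_min"
    and um: "u \<in> borel_measurable M" and Dm: "D \<in> borel_measurable M"
    and ui: "integrable M (\<lambda>x. \<bar>u x\<bar> ^ DIM('a))" and Di: "integrable M (\<lambda>x. norm (D x) ^ DIM('a))"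
    and wg: "has_weak_gradient \<Omega> u D"
    and ulim: "(\<lambda>k. \<integral>x. \<bar>f k x - u x\<bar> ^ DIM('a) \<partial>M) \<longlonglongrightarrow> 0"
    and Dlim: "(\<lambda>k. \<integral>x. norm (grad (f k) x - D x) ^ DIM('a) \<partial>M) \<longlonglongrightarrow> 0"
    and uL1: "(\<lambda>k. \<integral>x. \<bar>f k x - u x\<bar> \<partial>M) \<longlonglongrightarrow> 0"
    and usub: "\<exists>s. strict_mono (s :: nat \<Rightarrow> nat) \<and> (AE x in M. (\<lambda>k. f (s k) x) \<longlonglongrightarrow> u x)"
begin

lemma fT: "f k \<in> T" using f(1) by (simp add: small_ball_def)

text \<open>In the outer shell of the ball \<open>J_ge\<close> would make the energy nonnegative.
  The sequence therefore keeps a distance from the boundary that does not depend on k.\<close>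

lemma N_f_small: "N (f k) \<le> (1 / 2 ^ (DIM('a) + 1)) * \<rho> ^ DIM('a)"
proof (rule ccontr)
  assume "\<not> ?thesis"
  then have "0 \<le> b / real DIM('a) * (N (f k) - (1 / 2 ^ (DIM('a) + 1)) * \<rho> ^ DIM('a))"
    using ab by (intro mult_nonneg_nonneg) auto
  also have "\<dots> \<le> J lam (f k)" using f(1)[of k] by (intro J_ge) (auto simp: small_ball_def)
  finally show False using f(2)[of k] by simp
qed

text \<open>For such t the shift contributes at most \<rho>^n / 2^(n+1). The bound 1 allows
  \<bar>t\<bar>^n to be replaced by \<bar>t\<bar>, and \<open>N \<psi> + 1\<close> avoids a zero
  denominator.\<close>

definition radius :: "('a \<Rightarrow> real) \<Rightarrow> real" where
  "radius \<psi> = min 1 ((1 / 2 ^ (DIM('a) + 1)) * \<rho> ^ DIM('a) / (N \<psi> + 1))"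

lemma radius: "radius \<psi> > 0" "radius \<psi> \<le> 1"
  using \<rho>(1) N_nonneg[of \<psi>] by (auto simp: radius_def)

text \<open>This accounts for the constant 2^(n+1): a factor 2^n is lost by the crude bound for the
  power of a sum and a factor 2 by the two summands. The radius does not depend on k, so the limit
  inherits the freedom to move.\<close>

lemma shift_in_ball:
  assumes \<psi>: "\<psi> \<in> T" and t: "\<bar>t\<bar> \<le> radius \<psi>"
  shows "(\<lambda>x. f k x + t * \<psi> x) \<in> small_ball"
proof -
  define c where "c = (1 / 2 ^ (DIM('a) + 1)) * \<rho> ^ DIM('a)"
  have c: "2 ^ DIM('a) * (c + c) = \<rho> ^ DIM('a)" by (simp add: c_def)
  have "\<bar>t\<bar> ^ DIM('a) \<le> \<bar>t\<bar> ^ 1" using t radius(2)[of \<psi>] dim_pos by (intro power_decreasing) auto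
  then have "\<bar>t\<bar> ^ DIM('a) * N \<psi> \<le> radius \<psi> * N \<psi>" using t N_nonneg[of \<psi>] by (intro mult_right_mono) auto
  also have "\<dots> \<le> (c / (N \<psi> + 1)) * N \<psi>" using N_nonneg[of \<psi>] by (intro mult_right_mono) (auto simp: radius_def c_def)
  also have "\<dots> \<le> c" using N_nonneg[of \<psi>] \<rho>(1) by (simp add: c_def divide_le_eq mult_left_mono)
  finally have "\<bar>t\<bar> ^ DIM('a) * N \<psi> \<le> c" .
  then have "2 ^ DIM('a) * (N (f k) + \<bar>t\<bar> ^ DIM('a) * N \<psi>) \<le> 2 ^ DIM('a) * (c + c)"
    using N_f_small[of k] by (intro mult_left_mono add_mono) (auto simp: c_def)
  then have "2 ^ DIM('a) * (N (f k) + \<bar>t\<bar> ^ DIM('a) * N \<psi>) \<le> \<rho> ^ DIM('a)" by (simp only: c)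
  then have "N (\<lambda>x. f k x + t * \<psi> x) \<le> \<rho> ^ DIM('a)" by (rule order_trans[OF N_add_scaled_le[OF fT \<psi>]])
  then show ?thesis unfolding small_ball_def using test_functions_add_scaled[OF fT \<psi>] by simp
qed

text \<open>The shifted members lie in the ball and thus in the class, and a subsequence of them
  converges almost everywhere.\<close>

lemma shift_exp_class:
  assumes \<psi>: "\<psi> \<in> T" and t: "\<bar>t\<bar> \<le> radius \<psi>"
  shows "(\<lambda>x. u x + t * \<psi> x) \<in> exp_class"
proof -
  obtain s where s: "AE x in M. (\<lambda>k. f (s k) x) \<longlonglongrightarrow> u x" using usub by blast
  show ?thesis
  proof (rule exp_class_closed)
    show "(\<lambda>x. f (s k) x + t * \<psi> x) \<in> exp_class" for k
      by (intro ball_exp_class shift_in_ball \<psi> t)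
    show "(\<lambda>x. u x + t * \<psi> x) \<in> borel_measurable M" using um T_integrals(1)[OF \<psi>] by simp
    show "AE x in M. (\<lambda>k. f (s k) x + t * \<psi> x) \<longlonglongrightarrow> u x + t * \<psi> x"
      using s by eventually_elim (intro tendsto_intros)
  qed
qed

lemma u_exp_class: "u \<in> exp_class"
  using shift_exp_class[OF zero_test_function, of 0] radius(1)[of "\<lambda>x. 0"] by simp

text \<open>\<open>J\<close> is formulated with classical gradients, which the limit need not have;
  this is its extension to the line through the limit, with the strong limit D in the role of the
  gradient.\<close>

definition energy :: "('a \<Rightarrow> real) \<Rightarrow> real \<Rightarrow> real" where
  "energy \<psi> t = Phi (\<integral>x. norm (D x + t *\<^sub>R grad \<psi> x) ^ DIM('a) \<partial>M) - lower_order lam (\<lambda>x. u x + t * \<psi> x)"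

lemma gradient_shift_integrable:
  assumes \<psi>: "\<psi> \<in> T"
  shows "integrable M (\<lambda>x. norm (D x + t *\<^sub>R grad \<psi> x) ^ DIM('a))"
  using power_integrable_diff[of D "\<lambda>x. (- t) *\<^sub>R grad \<psi> x"] Dm Di T_integrals(2,6)[OF \<psi>]
  by (simp add: power_mult_distrib)

text \<open>Strong convergence of the gradients is spent on the leading part; the lower order terms
  need only L1 convergence within the class.\<close>

lemma energy_tendsto:
  assumes \<psi>: "\<psi> \<in> T" and t: "\<bar>t\<bar> \<le> radius \<psi>"
  shows "(\<lambda>k. J lam (\<lambda>x. f k x + t * \<psi> x)) \<longlonglongrightarrow> energy \<psi> t"
proof -
  have g: "grad (\<lambda>x. f k x + t * \<psi> x) x = grad (f k) x + t *\<^sub>R grad \<psi> x" for k x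
    by (rule grad_add_scaled[OF test_functions_smooth[OF fT] test_functions_smooth[OF \<psi>]])
  have sT: "(\<lambda>x. f k x + t * \<psi> x) \<in> T" "N (\<lambda>x. f k x + t * \<psi> x) \<le> \<rho> ^ DIM('a)" for k
    using shift_in_ball[OF \<psi> t, of k] by (auto simp: small_ball_def)
  have "(\<lambda>k. N (\<lambda>x. f k x + t * \<psi> x)) \<longlonglongrightarrow> (\<integral>x. norm (D x + t *\<^sub>R grad \<psi> x) ^ DIM('a) \<partial>M)"
    unfolding N_def
  proof (rule norm_power_integral_tendsto)
    show "grad (\<lambda>x. f k x + t * \<psi> x) \<in> borel_measurable M" "integrable M (\<lambda>x. norm (grad (\<lambda>x. f k x + t * \<psi> x) x) ^ DIM('a))" for k
      using T_integrals[OF sT(1)] by auto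
    show "(\<lambda>x. D x + t *\<^sub>R grad \<psi> x) \<in> borel_measurable M" using Dm T_integrals(2)[OF \<psi>] by simp
    show "integrable M (\<lambda>x. norm (D x + t *\<^sub>R grad \<psi> x) ^ DIM('a))" by (rule gradient_shift_integrable[OF \<psi>])
    show "(\<integral>x. norm (grad (\<lambda>x. f k x + t * \<psi> x) x) ^ DIM('a) \<partial>M) \<le> \<rho> ^ DIM('a)" for k
      using sT(2) by (simp add: N_def)
    show "(\<lambda>k. \<integral>x. norm (grad (\<lambda>x. f k x + t * \<psi> x) x - (D x + t *\<^sub>R grad \<psi> x)) ^ DIM('a) \<partial>M) \<longlonglongrightarrow> 0"
      unfolding g using Dlim by simp
  qed
  then have "(\<lambda>k. Phi (N (\<lambda>x. f k x + t * \<psi> x))) \<longlonglongrightarrow> Phi (\<integral>x. norm (D x + t *\<^sub>R grad \<psi> x) ^ DIM('a) \<partial>M)"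
    unfolding Phi_def by (intro tendsto_intros) auto
  moreover have "(\<lambda>k. lower_order lam (\<lambda>x. f k x + t * \<psi> x)) \<longlonglongrightarrow> lower_order lam (\<lambda>x. u x + t * \<psi> x)"
  proof (rule LIMSEQ_I)
    fix r :: real assume r: "r > 0"
    obtain \<delta> where \<delta>: "\<delta> > 0" "\<And>v w. v \<in> exp_class \<Longrightarrow> w \<in> exp_class \<Longrightarrow> (\<integral>x. \<bar>v x - w x\<bar> \<partial>M) < \<delta> \<Longrightarrow>
      \<bar>lower_order lam v - lower_order lam w\<bar> < r"
      by (rule lower_order_uniformly_continuous[where lam=lam, OF r]) blast
    obtain K where K: "\<And>k. k \<ge> K \<Longrightarrow> (\<integral>x. \<bar>f k x - u x\<bar> \<partial>M) < \<delta>"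
      using LIMSEQ_D[OF uL1 \<delta>(1)] by (auto simp: abs_less_iff)
    have "norm (lower_order lam (\<lambda>x. f k x + t * \<psi> x) - lower_order lam (\<lambda>x. u x + t * \<psi> x)) < r" if "k \<ge> K" for k
    proof -
      have "(\<integral>x. \<bar>(f k x + t * \<psi> x) - (u x + t * \<psi> x)\<bar> \<partial>M) < \<delta>" using K[OF that] by simp
      from \<delta>(2)[OF ball_exp_class[OF shift_in_ball[OF \<psi> t]] shift_exp_class[OF \<psi> t] this] show ?thesis by simp
    qed
    then show "\<exists>K. \<forall>k\<ge>K. norm (lower_order lam (\<lambda>x. f k x + t * \<psi> x) - lower_order lam (\<lambda>x. u x + t * \<psi> x)) < r"
      by blast
  qed
  ultimately show ?thesis unfolding J_def energy_def by (rule tendsto_diff)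
qed

lemma energy_zero: "energy \<psi> 0 = J_min"
proof -
  have "energy \<psi> 0 = energy (\<lambda>x. 0) 0" by (simp add: energy_def)
  moreover have "(\<lambda>k. J lam (f k)) \<longlonglongrightarrow> energy (\<lambda>x. 0) 0"
    using energy_tendsto[OF zero_test_function, of 0] radius(1)[of "\<lambda>x. 0"] by simp
  ultimately show ?thesis using f(3) LIMSEQ_unique by metis
qed

text \<open>For each fixed t the energies of the shifted sequence are at least \<open>J_min\<close>,
  and so is their limit, while t = 0 attains this value. No membership of the limit in the ball of
  test functions is involved.\<close>

lemma energy_ge:
  assumes "\<psi> \<in> T" "\<bar>t\<bar> \<le> radius \<psi>"
  shows "energy \<psi> 0 \<le> energy \<psi> t"
  unfolding energy_zero using shift_in_ball[OF assms] J_min_le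
  by (intro LIMSEQ_le_const[OF energy_tendsto[OF assms]]) blast

text \<open>For u = 0 the lower order terms vanish and the energy would be nonnegative, whereas it
  equals \<open>J_min < 0\<close>.\<close>

lemma nontrivial: "\<not> (AE x in M. u x = 0)"
proof
  assume z: "AE x in M. u x = 0"
  have [measurable]: "u \<in> borel_measurable M" "h \<in> borel_measurable M" "G \<in> borel_measurable borel"
    using um h_measurable G_measurable by auto
  have "(\<integral>x. G (u x) \<partial>M) = (\<integral>x. 0 \<partial>M)"
    using z by (intro integral_cong_AE) (auto simp: prim(1)[OF p_pos \<beta>_bounds(3)])
  moreover have "(\<integral>x. h x * \<bar>u x\<bar> powr (q + 1) \<partial>M) = (\<integral>x. 0 \<partial>M)"
    using z by (intro integral_cong_AE) auto
  ultimately have "lower_order lam u = 0" by (simp add: lower_order_def)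
  then have "energy (\<lambda>x. 0) 0 = Phi (\<integral>x. norm (D x) ^ DIM('a) \<partial>M)" by (simp add: energy_def)
  moreover have "0 \<le> Phi (\<integral>x. norm (D x) ^ DIM('a) \<partial>M)"
    unfolding Phi_def using ab by (intro add_nonneg_nonneg divide_nonneg_nonneg mult_nonneg_nonneg Bochner_Integration.integral_nonneg) auto
  ultimately show False using energy_zero[of "\<lambda>x. 0"] J_min_neg by simp
qed

section \<open>Differentiation of the energy along test functions\<close>

lemma deriv_gradient_term:
  assumes \<psi>: "\<psi> \<in> T"
  shows "((\<lambda>t. \<integral>x. norm (D x + t *\<^sub>R grad \<psi> x) ^ DIM('a) \<partial>M) has_real_derivative
    real DIM('a) * (\<integral>x. norm (D x) ^ (DIM('a) - 2) * (D x \<bullet> grad \<psi> x) \<partial>M)) (at 0)"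
proof -
  obtain B where B: "B \<ge> 0" "\<And>x. \<bar>\<psi> x\<bar> \<le> B" "\<And>x. norm (grad \<psi> x) \<le> B" using test_functions_bounded[OF \<psi>] by blast
  have [measurable]: "D \<in> borel_measurable M" "grad \<psi> \<in> borel_measurable M" using Dm T_integrals(2)[OF \<psi>] by auto
  interpret finite_measure M by (rule finite_M)
  define f' where "f' = (\<lambda>t x. real DIM('a) * norm (D x + t *\<^sub>R grad \<psi> x) ^ (DIM('a) - 2) * ((D x + t *\<^sub>R grad \<psi> x) \<bullet> grad \<psi> x))"
  define w where "w = (\<lambda>x. real DIM('a) * B * (1 + 2 ^ DIM('a) * (norm (D x) ^ DIM('a) + B ^ DIM('a))))"
  have "((\<lambda>t. \<integral>x. norm (D x + t *\<^sub>R grad \<psi> x) ^ DIM('a) \<partial>M) has_real_derivative (\<integral>x. f' 0 x \<partial>M)) (at 0)"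
  proof (rule has_derivative_integral[where r=1 and w=w and f'=f'])
    show "integrable M (\<lambda>x. norm (D x + t *\<^sub>R grad \<psi> x) ^ DIM('a))" for t by (rule gradient_shift_integrable[OF \<psi>])
    show "f' 0 \<in> borel_measurable M" unfolding f'_def by measurable
    show "((\<lambda>t. norm (D x + t *\<^sub>R grad \<psi> x) ^ DIM('a)) has_real_derivative f' t x) (at t)" for t x
      unfolding f'_def by (rule norm_power_deriv[OF dim])
    show "integrable M w" unfolding w_def using Di by auto
    show "\<bar>f' t x\<bar> \<le> w x" if t: "\<bar>t\<bar> < 1" for t x
    proof -
      define z where "z = D x + t *\<^sub>R grad \<psi> x"
      have "\<bar>z \<bullet> grad \<psi> x\<bar> \<le> norm z * B"
        by (rule order_trans[OF Cauchy_Schwarz_ineq2 mult_left_mono[OF B(3) norm_ge_zero]])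
      then have "\<bar>f' t x\<bar> \<le> real DIM('a) * norm z ^ (DIM('a) - 2) * (norm z * B)"
        unfolding f'_def z_def[symmetric] by (simp add: abs_mult mult_left_mono)
      also have "\<dots> = real DIM('a) * B * (norm z ^ (DIM('a) - 2) * norm z)" by simp
      also have "norm z ^ (DIM('a) - 2) * norm z \<le> 1 + norm z ^ DIM('a)"
      proof -
        obtain m where m: "DIM('a) = Suc (Suc m)" using dim by (metis Suc_le_D numeral_2_eq_2 Suc_le_mono)
        show ?thesis
        proof (cases "norm z \<le> 1")
          case True
          then have "norm z ^ Suc m \<le> 1" by (intro power_le_one) auto
          then show ?thesis unfolding m by (simp add: mult.commute add_increasing2)
        next
          case False
          then have "norm z ^ Suc m \<le> norm z ^ Suc (Suc m)" by (intro power_increasing) auto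
          then show ?thesis unfolding m by (simp add: mult.commute)
        qed
      qed
      also have "norm z ^ DIM('a) \<le> 2 ^ DIM('a) * (norm (D x) ^ DIM('a) + B ^ DIM('a))"
      proof -
        have "norm (t *\<^sub>R grad \<psi> x) \<le> 1 * B" unfolding norm_scaleR using t B by (intro mult_mono) auto
        then have "norm (t *\<^sub>R grad \<psi> x) ^ DIM('a) \<le> B ^ DIM('a)" by (intro power_mono) auto
        then have "2 ^ DIM('a) * (norm (D x) ^ DIM('a) + norm (t *\<^sub>R grad \<psi> x) ^ DIM('a)) \<le> 2 ^ DIM('a) * (norm (D x) ^ DIM('a) + B ^ DIM('a))"
          by simp
        then show ?thesis unfolding z_def using norm_add_power_le order_trans by blast
      qed
      finally show ?thesis using B(1) by (simp add: w_def mult_left_mono)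
    qed
  qed simp
  moreover have "(\<integral>x. f' 0 x \<partial>M) = real DIM('a) * (\<integral>x. norm (D x) ^ (DIM('a) - 2) * (D x \<bullet> grad \<psi> x) \<partial>M)"
    unfolding f'_def by (simp add: mult.assoc)
  ultimately show ?thesis by simp
qed

lemma deriv_primitive_term:
  assumes \<psi>: "\<psi> \<in> T"
  shows "((\<lambda>t. \<integral>x. G (u x + t * \<psi> x) \<partial>M) has_real_derivative (\<integral>x. g (u x) * \<psi> x \<partial>M)) (at 0)"
proof -
  obtain B where B: "B \<ge> 0" "\<And>x. \<bar>\<psi> x\<bar> \<le> B" "\<And>x. norm (grad \<psi> x) \<le> B"
    using test_functions_bounded[OF \<psi>] by blast
  have [measurable]: "u \<in> borel_measurable M" "\<psi> \<in> borel_measurable M" "g \<in> borel_measurable borel"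
    using um T_integrals(1)[OF \<psi>] g_measurable by auto
  obtain C where C: "C > 0" "\<And>s. \<bar>g s\<bar> \<le> C * exp (2 * \<bar>s\<bar> powr \<beta>)"
    using nonlin_le_exp[OF p_pos \<beta>_bounds(3)] by blast
  define w where "w = (\<lambda>x. (C * exp (8 * B powr \<beta>) * B) * exp (8 * \<bar>u x\<bar> powr \<beta>))"
  define f' where "f' = (\<lambda>t x. g (u x + t * \<psi> x) * \<psi> x)"
  have "((\<lambda>t. \<integral>x. G (u x + t * \<psi> x) \<partial>M) has_real_derivative (\<integral>x. f' 0 x \<partial>M)) (at 0)"
  proof (rule has_derivative_integral[where r="radius \<psi>" and w=w and f'=f'])
    show "radius \<psi> > 0" by (rule radius)
    show "integrable M (\<lambda>x. G (u x + t * \<psi> x))" if "\<bar>t\<bar> < radius \<psi>" for t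
      using that by (intro G_integrable shift_exp_class \<psi>) simp
    show "f' 0 \<in> borel_measurable M" unfolding f'_def by measurable
    show "((\<lambda>t. G (u x + t * \<psi> x)) has_real_derivative f' t x) (at t)" for t x
      unfolding f'_def by (rule DERIV_chain2[OF prim(2)[OF p_pos \<beta>_bounds(3)]]) (auto intro!: derivative_eq_intros)
    show "integrable M w" unfolding w_def by (intro integrable_mult_right exp_class_exp_integrable u_exp_class) simp
    show "\<bar>f' t x\<bar> \<le> w x" if t: "\<bar>t\<bar> < radius \<psi>" for t x
    proof -
      \<comment> \<open>A bounded shift at most doubles this maximum. Since 2^\<beta> \<le> 4, the
        rate 2 of the nonlinearity becomes 8, still within the class, and the part with B is a
        constant.\<close>
      define m where "m = max \<bar>u x\<bar> B"
      have "\<bar>t * \<psi> x\<bar> \<le> 1 * B" unfolding abs_mult using t radius(2)[of \<psi>] B by (intro mult_mono) auto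
      then have "\<bar>u x + t * \<psi> x\<bar> \<le> 2 * m" using abs_triangle_ineq[of "u x" "t * \<psi> x"] by (auto simp: m_def max_def)
      then have "\<bar>u x + t * \<psi> x\<bar> powr \<beta> \<le> (2 * m) powr \<beta>" using \<beta>_bounds by (intro powr_mono2) auto
      also have "\<dots> = 2 powr \<beta> * m powr \<beta>" using B by (simp add: powr_mult m_def)
      also have "\<dots> \<le> 4 * (\<bar>u x\<bar> powr \<beta> + B powr \<beta>)"
      proof (intro mult_mono)
        have "(2::real) powr \<beta> \<le> 2 powr 2" using \<beta>_bounds by (intro powr_mono) auto
        then show "(2::real) powr \<beta> \<le> 4" by simp
        show "m powr \<beta> \<le> \<bar>u x\<bar> powr \<beta> + B powr \<beta>" by (auto simp: m_def max_def)
      qed auto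
      finally have "exp (2 * \<bar>u x + t * \<psi> x\<bar> powr \<beta>) \<le> exp (8 * \<bar>u x\<bar> powr \<beta> + 8 * B powr \<beta>)" by simp
      then have "\<bar>g (u x + t * \<psi> x)\<bar> \<le> C * exp (8 * \<bar>u x\<bar> powr \<beta> + 8 * B powr \<beta>)"
        using C by (meson mult_left_mono less_imp_le order_trans)
      then have "\<bar>f' t x\<bar> \<le> (C * exp (8 * \<bar>u x\<bar> powr \<beta> + 8 * B powr \<beta>)) * B"
        unfolding f'_def abs_mult using B C(1) by (intro mult_mono) auto
      also have "\<dots> = w x" by (simp add: w_def exp_add)
      finally show ?thesis .
    qed
  qed
  then show ?thesis by (simp add: f'_def)
qed

lemma deriv_weight_term:
  assumes \<psi>: "\<psi> \<in> T"
  shows "((\<lambda>t. \<integral>x. h x * \<bar>u x + t * \<psi> x\<bar> powr (q + 1) \<partial>M) has_real_derivative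
    (q + 1) * (\<integral>x. h x * \<bar>u x\<bar> powr (q - 1) * u x * \<psi> x \<partial>M)) (at 0)"
proof -
  obtain B where B: "B \<ge> 0" "\<And>x. \<bar>\<psi> x\<bar> \<le> B" "\<And>x. norm (grad \<psi> x) \<le> B"
    using test_functions_bounded[OF \<psi>] by blast
  have [measurable]: "u \<in> borel_measurable M" "\<psi> \<in> borel_measurable M" "h \<in> borel_measurable M"
    using um T_integrals(1)[OF \<psi>] h_measurable by auto
  interpret finite_measure M by (rule finite_M)
  define w where "w = (\<lambda>x. (q + 1) * B * (\<bar>h x\<bar> powr \<gamma> + 2 ^ DIM('a) * (\<bar>u x\<bar> ^ DIM('a) + (B + 1) ^ DIM('a))))"
  define f' where "f' = (\<lambda>t x. h x * ((q + 1) * (\<bar>u x + t * \<psi> x\<bar> powr (q + 1 - 2) * (u x + t * \<psi> x)) * \<psi> x))"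
  have "((\<lambda>t. \<integral>x. h x * \<bar>u x + t * \<psi> x\<bar> powr (q + 1) \<partial>M) has_real_derivative (\<integral>x. f' 0 x \<partial>M)) (at 0)"
  proof (rule has_derivative_integral[where r="radius \<psi>" and w=w and f'=f'])
    show "radius \<psi> > 0" by (rule radius)
    show "integrable M (\<lambda>x. h x * \<bar>u x + t * \<psi> x\<bar> powr (q + 1))" if "\<bar>t\<bar> < radius \<psi>" for t
      using that shift_exp_class[OF \<psi>, of t] exp_class_measurable exp_class_power_integrable
      by (intro h_mult_integrable(1)) auto
    show "f' 0 \<in> borel_measurable M" unfolding f'_def by measurable
    show "((\<lambda>t. h x * \<bar>u x + t * \<psi> x\<bar> powr (q + 1)) has_real_derivative f' t x) (at t)" for t x
    proof -
      have "((\<lambda>t. \<bar>u x + t * \<psi> x\<bar> powr (q + 1)) has_real_derivative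
        (q + 1) * (\<bar>u x + t * \<psi> x\<bar> powr (q + 1 - 2) * (u x + t * \<psi> x)) * \<psi> x) (at t)"
        by (rule DERIV_chain2[OF abs_powr_deriv]) (use q in \<open>auto intro!: derivative_eq_intros\<close>)
      then show ?thesis unfolding f'_def by (rule DERIV_cmult)
    qed
    show "integrable M w" unfolding w_def using h_powr ui by auto
    show "\<bar>f' t x\<bar> \<le> w x" if t: "\<bar>t\<bar> < radius \<psi>" for t x
    proof -
      define s where "s = u x + t * \<psi> x"
      \<comment> \<open>The summand 1 ensures m \<ge> 1, so that \<bar>s\<bar>^q is at most m^(q+1)
        and \<open>h_mult_le\<close> applies to the derivative as well.\<close>
      define m where "m = \<bar>u x\<bar> + (B + 1)"
      have m1: "m \<ge> 1" using B by (simp add: m_def)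
      have "\<bar>t * \<psi> x\<bar> \<le> 1 * B" unfolding abs_mult using t radius(2)[of \<psi>] B by (intro mult_mono) auto
      then have sm: "\<bar>s\<bar> \<le> m" using abs_triangle_ineq[of "u x" "t * \<psi> x"] by (simp add: s_def m_def)
      have "\<bar>\<bar>s\<bar> powr (q + 1 - 2) * s\<bar> = \<bar>s\<bar> powr q"
        using powr_add[of "\<bar>s\<bar>" "q - 1" 1] by (cases "s = 0") (auto simp: abs_mult)
      also have "\<dots> \<le> m powr q" using sm q by (intro powr_mono2) auto
      also have "\<dots> \<le> m powr (q + 1)" using m1 by (intro powr_mono) auto
      finally have "\<bar>\<bar>s\<bar> powr (q + 1 - 2) * s\<bar> \<le> m powr (q + 1)" .
      then have "\<bar>h x\<bar> * \<bar>\<bar>s\<bar> powr (q + 1 - 2) * s\<bar> \<le> \<bar>h x\<bar> * \<bar>m\<bar> powr (q + 1)"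
        using m1 by (intro mult_left_mono) auto
      also have "\<dots> \<le> \<bar>h x\<bar> powr \<gamma> + \<bar>m\<bar> ^ DIM('a)" by (rule h_mult_le)
      also have "\<bar>m\<bar> ^ DIM('a) \<le> 2 ^ DIM('a) * (\<bar>u x\<bar> ^ DIM('a) + (B + 1) ^ DIM('a))"
        using norm_add_power_le[of "\<bar>u x\<bar>" "B + 1" "DIM('a)"] B(1) by (simp add: m_def)
      finally have "\<bar>h x\<bar> * \<bar>\<bar>s\<bar> powr (q + 1 - 2) * s\<bar>
        \<le> \<bar>h x\<bar> powr \<gamma> + 2 ^ DIM('a) * (\<bar>u x\<bar> ^ DIM('a) + (B + 1) ^ DIM('a))" by simp
      then have "(\<bar>h x\<bar> * \<bar>\<bar>s\<bar> powr (q + 1 - 2) * s\<bar>) * \<bar>\<psi> x\<bar>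
        \<le> (\<bar>h x\<bar> powr \<gamma> + 2 ^ DIM('a) * (\<bar>u x\<bar> ^ DIM('a) + (B + 1) ^ DIM('a))) * B"
        using B by (intro mult_mono) auto
      then have "(q + 1) * ((\<bar>h x\<bar> * \<bar>\<bar>s\<bar> powr (q + 1 - 2) * s\<bar>) * \<bar>\<psi> x\<bar>)
        \<le> (q + 1) * ((\<bar>h x\<bar> powr \<gamma> + 2 ^ DIM('a) * (\<bar>u x\<bar> ^ DIM('a) + (B + 1) ^ DIM('a))) * B)"
        using q by (intro mult_left_mono) auto
      moreover have "\<bar>f' t x\<bar> = (q + 1) * ((\<bar>h x\<bar> * \<bar>\<bar>s\<bar> powr (q + 1 - 2) * s\<bar>) * \<bar>\<psi> x\<bar>)"
        using q unfolding f'_def s_def[symmetric] by (simp add: abs_mult)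
      ultimately show ?thesis unfolding w_def by (simp only: mult_ac)
    qed
  qed
  moreover have "f' 0 = (\<lambda>x. (q + 1) * (h x * \<bar>u x\<bar> powr (q - 1) * u x * \<psi> x))"
    by (simp add: f'_def mult_ac)
  ultimately show ?thesis by simp
qed

definition kirchhoff_coeff :: real where
  "kirchhoff_coeff = a * (\<integral>x. norm (D x) ^ DIM('a) \<partial>M) + b"

text \<open>The energy on the line has an interior local minimum at t = 0, so its derivative there
  vanishes; the three preceding derivatives make this explicit.\<close>

lemma Euler_Lagrange_test:
  assumes \<psi>: "\<psi> \<in> T"
  shows "kirchhoff_coeff * (\<integral>x. norm (D x) ^ (DIM('a) - 2) * (D x \<bullet> grad \<psi> x) \<partial>M)
    = (\<integral>x. g (u x) * \<psi> x \<partial>M) + lam * (\<integral>x. h x * \<bar>u x\<bar> powr (q - 1) * u x * \<psi> x \<partial>M)"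
proof -
  define A where "A = (\<lambda>t. \<integral>x. norm (D x + t *\<^sub>R grad \<psi> x) ^ DIM('a) \<partial>M)"
  define I1 where "I1 = (\<integral>x. norm (D x) ^ (DIM('a) - 2) * (D x \<bullet> grad \<psi> x) \<partial>M)"
  define I2 where "I2 = (\<integral>x. g (u x) * \<psi> x \<partial>M)"
  define I3 where "I3 = (\<integral>x. h x * \<bar>u x\<bar> powr (q - 1) * u x * \<psi> x \<partial>M)"
  have n: "real DIM('a) > 0" by simp
  have dA: "(A has_real_derivative real DIM('a) * I1) (at 0)"
    unfolding A_def I1_def by (rule deriv_gradient_term[OF \<psi>])
  have dPhi: "(Phi has_real_derivative (a * s / real DIM('a) + b / real DIM('a))) (at s)" for s
    unfolding Phi_def by (auto intro!: derivative_eq_intros simp: field_simps)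
  have "((\<lambda>t. Phi (A t)) has_real_derivative (a * A 0 / real DIM('a) + b / real DIM('a)) * (real DIM('a) * I1)) (at 0)"
    by (rule DERIV_chain2[OF dPhi dA])
  moreover have "((\<lambda>t. lower_order lam (\<lambda>x. u x + t * \<psi> x)) has_real_derivative I2 + lam / (q + 1) * ((q + 1) * I3)) (at 0)"
    unfolding lower_order_def I2_def I3_def
    by (intro DERIV_add DERIV_cmult deriv_primitive_term deriv_weight_term \<psi>)
  ultimately have "(energy \<psi> has_real_derivative
      (a * A 0 / real DIM('a) + b / real DIM('a)) * (real DIM('a) * I1) - (I2 + lam / (q + 1) * ((q + 1) * I3))) (at 0)"
    unfolding energy_def[abs_def] A_def by (rule DERIV_diff)
  then have "(a * A 0 / real DIM('a) + b / real DIM('a)) * (real DIM('a) * I1) - (I2 + lam / (q + 1) * ((q + 1) * I3)) = 0"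
  proof (rule DERIV_local_min)
    show "0 < radius \<psi>" by (rule radius)
    show "\<forall>t. \<bar>0 - t\<bar> < radius \<psi> \<longrightarrow> energy \<psi> 0 \<le> energy \<psi> t" using energy_ge[OF \<psi>] by simp
  qed
  moreover have "(a * A 0 / real DIM('a) + b / real DIM('a)) * (real DIM('a) * I1) = kirchhoff_coeff * I1"
    using n by (simp add: kirchhoff_coeff_def A_def field_simps)
  moreover have "lam / (q + 1) * ((q + 1) * I3) = lam * I3" using q by simp
  ultimately show ?thesis unfolding I1_def I2_def I3_def by simp
qed

section \<open>From test functions to the Sobolev space\<close>

text \<open>The three coefficient functions of the equation lie in L^\<beta>, the dual of L^n. For
  the gradient the reason is (n - 1) \<beta> = n.\<close>

lemma gradient_dual: "(\<lambda>x. norm (D x) ^ (DIM('a) - 1)) \<in> borel_measurable M"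
  "integrable M (\<lambda>x. \<bar>norm (D x) ^ (DIM('a) - 1)\<bar> powr \<beta>)"
proof -
  show "(\<lambda>x. norm (D x) ^ (DIM('a) - 1)) \<in> borel_measurable M" using Dm by simp
  have "\<bar>norm (D x) ^ (DIM('a) - 1)\<bar> powr \<beta> = norm (D x) ^ DIM('a)" for x
  proof -
    have "norm (D x) powr real (DIM('a) - 1) = norm (D x) ^ (DIM('a) - 1)"
      by (rule powr_realpow') (use dim in auto)
    then have "\<bar>norm (D x) ^ (DIM('a) - 1)\<bar> powr \<beta> = (norm (D x) powr real (DIM('a) - 1)) powr \<beta>"
      by (simp only: power_abs abs_norm_cancel)
    also have "\<dots> = norm (D x) powr (real (DIM('a) - 1) * \<beta>)" by (rule powr_powr)
    also have "real (DIM('a) - 1) * \<beta> = real DIM('a)" using dim by (simp add: \<beta>_def of_nat_diff)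
    finally show ?thesis by (simp only: pow_norm)
  qed
  then show "integrable M (\<lambda>x. \<bar>norm (D x) ^ (DIM('a) - 1)\<bar> powr \<beta>)" using Di by simp
qed

lemma nonlin_dual: "(\<lambda>x. g (u x)) \<in> borel_measurable M" "integrable M (\<lambda>x. \<bar>g (u x)\<bar> powr \<beta>)"
proof -
  have [measurable]: "u \<in> borel_measurable M" "g \<in> borel_measurable borel" using um g_measurable by auto
  show "(\<lambda>x. g (u x)) \<in> borel_measurable M" by measurable
  obtain C where C: "C > 0" "\<And>s. \<bar>g s\<bar> \<le> C * exp (2 * \<bar>s\<bar> powr \<beta>)"
    using nonlin_le_exp[OF p_pos \<beta>_bounds(3)] by blast
  show "integrable M (\<lambda>x. \<bar>g (u x)\<bar> powr \<beta>)"
  proof (rule exp_class_bound_integrable[OF u_exp_class])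
    show "\<bar>\<bar>g (u x)\<bar> powr \<beta>\<bar> \<le> C powr \<beta> * exp (4 * \<bar>u x\<bar> powr \<beta>)" for x
    proof -
      have "\<bar>g (u x)\<bar> powr \<beta> \<le> (C * exp (2 * \<bar>u x\<bar> powr \<beta>)) powr \<beta>"
        using C \<beta>_bounds by (intro powr_mono2) auto
      also have "\<dots> = C powr \<beta> * exp (\<beta> * (2 * \<bar>u x\<bar> powr \<beta>))"
        using C(1) by (simp add: powr_mult powr_def[of "exp _"])
      also have "\<dots> \<le> C powr \<beta> * exp (4 * \<bar>u x\<bar> powr \<beta>)"
      proof -
        have "\<beta> * (2 * \<bar>u x\<bar> powr \<beta>) \<le> 2 * (2 * \<bar>u x\<bar> powr \<beta>)" using \<beta>_bounds by (intro mult_right_mono) auto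
        then show ?thesis by (intro mult_left_mono) auto
      qed
      finally show ?thesis by simp
    qed
  qed auto
qed

text \<open>Raised to the power \<beta>, the coefficient is a product of \<bar>h\<bar>^\<beta> and
  \<bar>u\<bar>^(q \<beta>). The conjugate exponents \<gamma>/\<beta> and (n - 1)/q turn it into
  \<bar>h\<bar>^\<gamma> + \<bar>u\<bar>^n, which is precisely what the integrability assumption on
  \<open>h\<close> provides for.\<close>

lemma weight_dual:
  "(\<lambda>x. h x * \<bar>u x\<bar> powr (q - 1) * u x) \<in> borel_measurable M"
  "integrable M (\<lambda>x. \<bar>h x * \<bar>u x\<bar> powr (q - 1) * u x\<bar> powr \<beta>)"
proof -
  have [measurable]: "u \<in> borel_measurable M" "h \<in> borel_measurable M" using um h_measurable by auto
  show m: "(\<lambda>x. h x * \<bar>u x\<bar> powr (q - 1) * u x) \<in> borel_measurable M" by measurable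
  define d where "d = real DIM('a)"
  have d: "d \<ge> 2" "q < d - 1" using dim q by (auto simp: d_def)
  have \<beta>d: "\<beta> = d / (d - 1)" by (simp add: \<beta>_def d_def)
  have \<gamma>d: "\<gamma> = d / (d - q - 1)" by (simp add: \<gamma>_def d_def)
  show "integrable M (\<lambda>x. \<bar>h x * \<bar>u x\<bar> powr (q - 1) * u x\<bar> powr \<beta>)"
  proof (rule Bochner_Integration.integrable_bound)
    show "integrable M (\<lambda>x. \<bar>h x\<bar> powr \<gamma> + \<bar>u x\<bar> ^ DIM('a))" using h_powr ui by auto
    show "(\<lambda>x. \<bar>h x * \<bar>u x\<bar> powr (q - 1) * u x\<bar> powr \<beta>) \<in> borel_measurable M" by measurable
    show "AE x in M. norm (\<bar>h x * \<bar>u x\<bar> powr (q - 1) * u x\<bar> powr \<beta>) \<le> norm (\<bar>h x\<bar> powr \<gamma> + \<bar>u x\<bar> ^ DIM('a))"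
    proof (rule AE_I2)
      fix x
      have "\<bar>h x * \<bar>u x\<bar> powr (q - 1) * u x\<bar> = \<bar>h x\<bar> * \<bar>u x\<bar> powr q"
        using powr_add[of "\<bar>u x\<bar>" "q - 1" 1] by (cases "u x = 0") (auto simp: abs_mult)
      then have "\<bar>h x * \<bar>u x\<bar> powr (q - 1) * u x\<bar> powr \<beta> = \<bar>h x\<bar> powr \<beta> * \<bar>u x\<bar> powr (q * \<beta>)"
        by (simp add: powr_mult powr_powr)
      also have "\<dots> \<le> (\<bar>h x\<bar> powr \<beta>) powr (\<gamma> / \<beta>) + (\<bar>u x\<bar> powr (q * \<beta>)) powr ((d - 1) / q)"
      proof (rule young_crude)
        have e: "\<gamma> / \<beta> = (d - 1) / (d - q - 1)" using d by (simp add: \<gamma>d \<beta>d)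
        show "1 < \<gamma> / \<beta>" unfolding e using d q by simp
        have "(d - 1) / (d - q - 1) - 1 = q / (d - q - 1)" using d q by (simp add: field_simps)
        then show "(d - 1) / q = \<gamma> / \<beta> / (\<gamma> / \<beta> - 1)" unfolding e using d q by simp
      qed auto
      also have "(\<bar>h x\<bar> powr \<beta>) powr (\<gamma> / \<beta>) = \<bar>h x\<bar> powr \<gamma>" using \<beta>_bounds by (simp add: powr_powr)
      also have "(\<bar>u x\<bar> powr (q * \<beta>)) powr ((d - 1) / q) = \<bar>u x\<bar> ^ DIM('a)"
      proof -
        have "q * \<beta> * ((d - 1) / q) = real DIM('a)" using d q by (simp add: \<beta>d d_def)
        then show ?thesis by (simp only: powr_powr pow_dim)
      qed
      finally show "norm (\<bar>h x * \<bar>u x\<bar> powr (q - 1) * u x\<bar> powr \<beta>) \<le> norm (\<bar>h x\<bar> powr \<gamma> + \<bar>u x\<bar> ^ DIM('a))" by simp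
    qed
  qed
qed

lemma gradient_pairing_le: "\<bar>norm z ^ (DIM('a) - 2) * (z \<bullet> y)\<bar> \<le> \<bar>norm z ^ (DIM('a) - 1)\<bar> * \<bar>norm y\<bar>"
  for z y :: 'a
proof -
  have "\<bar>norm z ^ (DIM('a) - 2) * (z \<bullet> y)\<bar> \<le> norm z ^ (DIM('a) - 2) * (norm z * norm y)"
    unfolding abs_mult using Cauchy_Schwarz_ineq2[of z y] by (simp add: mult_left_mono)
  also have "\<dots> = norm z ^ Suc (DIM('a) - 2) * norm y" by simp
  also have "Suc (DIM('a) - 2) = DIM('a) - 1" using dim by simp
  finally show ?thesis by simp
qed

text \<open>Every term is linear in the direction and continuous for the L^n norms of the direction
  and its gradient, because the coefficients lie in L^\<beta>; density of test functions extends the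
  equation.\<close>

lemma Euler_Lagrange:
  assumes v: "v \<in> Sobolev0 (real DIM('a)) \<Omega>"
  defines "V \<equiv> weak_grad \<Omega> v"
  shows "integrable M (\<lambda>x. norm (D x) ^ (DIM('a) - 2) * (D x \<bullet> V x))"
    "integrable M (\<lambda>x. g (u x) * v x)"
    "integrable M (\<lambda>x. h x * \<bar>u x\<bar> powr (q - 1) * u x * v x)"
    "kirchhoff_coeff * (\<integral>x. norm (D x) ^ (DIM('a) - 2) * (D x \<bullet> V x) \<partial>M)
      = (\<integral>x. g (u x) * v x \<partial>M) + lam * (\<integral>x. h x * \<bar>u x\<bar> powr (q - 1) * u x * v x \<partial>M)"
proof -
  obtain \<psi> where \<psi>: "\<And>k. \<psi> k \<in> T"
    and vm[measurable]: "v \<in> borel_measurable M" and Vm[measurable]: "V \<in> borel_measurable M"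
    and vi: "integrable M (\<lambda>x. \<bar>v x\<bar> ^ DIM('a))" and Vi: "integrable M (\<lambda>x. norm (V x) ^ DIM('a))"
    and vlim: "(\<lambda>k. \<integral>x. \<bar>v x - \<psi> k x\<bar> ^ DIM('a) \<partial>M) \<longlonglongrightarrow> 0"
    and Vlim: "(\<lambda>k. \<integral>x. norm (V x - grad (\<psi> k) x) ^ DIM('a) \<partial>M) \<longlonglongrightarrow> 0"
    by (rule Sobolev0_approx[OF v, folded V_def]) (rule that)
  have [measurable]: "D \<in> borel_measurable M" by (rule Dm)
  note \<psi>i = T_integrals[OF \<psi>]
  have [measurable]: "\<psi> k \<in> borel_measurable M" "grad (\<psi> k) \<in> borel_measurable M" for k using \<psi>i by auto
  define U2 where "U2 = (\<lambda>x. g (u x))"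
  define U3 where "U3 = (\<lambda>x. h x * \<bar>u x\<bar> powr (q - 1) * u x)"
  have U2: "U2 \<in> borel_measurable M" "integrable M (\<lambda>x. \<bar>U2 x\<bar> powr \<beta>)"
    unfolding U2_def by (fact nonlin_dual)+
  have U3: "U3 \<in> borel_measurable M" "integrable M (\<lambda>x. \<bar>U3 x\<bar> powr \<beta>)"
    unfolding U3_def by (fact weight_dual)+
  define P1 where "P1 = (\<lambda>w x. norm (D x) ^ (DIM('a) - 2) * (D x \<bullet> w x))"
  have P1m: "P1 w \<in> borel_measurable M" if "w \<in> borel_measurable M" for w
    unfolding P1_def using that Dm by (intro borel_measurable_times borel_measurable_power borel_measurable_inner) auto
  have P1i: "integrable M (P1 w)" if w: "w \<in> borel_measurable M" "integrable M (\<lambda>x. norm (w x) ^ DIM('a))" for w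
  proof (rule dual_pairing_integrable[OF gradient_dual P1m[OF w(1)], where g="\<lambda>x. norm (w x)"])
    show "integrable M (\<lambda>x. \<bar>norm (w x)\<bar> ^ DIM('a))" using w(2) by simp
    show "AE x in M. \<bar>P1 w x\<bar> \<le> \<bar>norm (D x) ^ (DIM('a) - 1)\<bar> * \<bar>norm (w x)\<bar>"
      unfolding P1_def by (intro AE_I2 gradient_pairing_le)
  qed
  have mi: "integrable M (\<lambda>x. U x * w x)"
    if U: "U \<in> borel_measurable M" "integrable M (\<lambda>x. \<bar>U x\<bar> powr \<beta>)"
      and w: "w \<in> borel_measurable M" "integrable M (\<lambda>x. \<bar>w x\<bar> ^ DIM('a))" for U w
    by (rule dual_pairing_integrable[OF U borel_measurable_times[OF U(1) w(1)] w(2)]) (simp add: abs_mult)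
  have di: "integrable M (\<lambda>x. \<bar>v x - \<psi> k x\<bar> ^ DIM('a))" for k
    using power_integrable_diff[of v "\<psi> k"] vi \<psi>i(5) by simp
  have Di': "integrable M (\<lambda>x. norm (V x - grad (\<psi> k) x) ^ DIM('a))" for k
    using power_integrable_diff[of V "grad (\<psi> k)"] Vi \<psi>i(6) by simp
  have l1: "(\<lambda>k. \<integral>x. P1 (\<lambda>x. V x - grad (\<psi> k) x) x \<partial>M) \<longlonglongrightarrow> 0"
  proof (rule dual_pairing_tendsto(2)[OF gradient_dual, where g="\<lambda>k x. norm (V x - grad (\<psi> k) x)"])
    show "P1 (\<lambda>x. V x - grad (\<psi> k) x) \<in> borel_measurable M" for k
      by (intro P1m borel_measurable_diff Vm \<psi>i)
    show "AE x in M. \<bar>P1 (\<lambda>x. V x - grad (\<psi> k) x) x\<bar> \<le> \<bar>norm (D x) ^ (DIM('a) - 1)\<bar> * \<bar>norm (V x - grad (\<psi> k) x)\<bar>" for k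
      unfolding P1_def by (intro AE_I2 gradient_pairing_le)
  qed (use Di' Vlim in auto)
  have ml: "(\<lambda>k. \<integral>x. U x * (v x - \<psi> k x) \<partial>M) \<longlonglongrightarrow> 0"
    if U: "U \<in> borel_measurable M" "integrable M (\<lambda>x. \<bar>U x\<bar> powr \<beta>)" for U
  proof (rule dual_pairing_tendsto(2)[OF U, where g="\<lambda>k x. v x - \<psi> k x"])
    show "(\<lambda>x. U x * (v x - \<psi> k x)) \<in> borel_measurable M" for k
      by (intro borel_measurable_times borel_measurable_diff U vm \<psi>i)
    show "AE x in M. \<bar>U x * (v x - \<psi> k x)\<bar> \<le> \<bar>U x\<bar> * \<bar>v x - \<psi> k x\<bar>" for k by (simp add: abs_mult)
  qed (use di vlim in auto)
  have e1: "(\<integral>x. P1 (\<lambda>x. V x - grad (\<psi> k) x) x \<partial>M) = (\<integral>x. P1 V x \<partial>M) - (\<integral>x. P1 (grad (\<psi> k)) x \<partial>M)" for k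
    using Bochner_Integration.integral_diff[OF P1i[OF Vm Vi] P1i[OF \<psi>i(2,6)]]
    by (simp add: P1_def inner_diff_right right_diff_distrib)
  have me: "(\<integral>x. U x * (v x - \<psi> k x) \<partial>M) = (\<integral>x. U x * v x \<partial>M) - (\<integral>x. U x * \<psi> k x \<partial>M)"
    if U: "U \<in> borel_measurable M" "integrable M (\<lambda>x. \<bar>U x\<bar> powr \<beta>)" for U k
    unfolding right_diff_distrib
    by (rule Bochner_Integration.integral_diff[OF mi[OF U vm vi] mi[OF U \<psi>i(1,5)]])
  have test: "kirchhoff_coeff * (\<integral>x. P1 (grad (\<psi> k)) x \<partial>M) = (\<integral>x. U2 x * \<psi> k x \<partial>M) + lam * (\<integral>x. U3 x * \<psi> k x \<partial>M)" for k
    unfolding P1_def U2_def U3_def by (rule Euler_Lagrange_test[OF \<psi>])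
  \<comment> \<open>The defect of the equation for v. Subtracting the valid equation for each
    approximating test function leaves the defect unchanged, while the difference tends to
    0.\<close>
  define R where "R = kirchhoff_coeff * (\<integral>x. P1 V x \<partial>M) - ((\<integral>x. U2 x * v x \<partial>M) + lam * (\<integral>x. U3 x * v x \<partial>M))"
  have "(\<lambda>k. kirchhoff_coeff * (\<integral>x. P1 (\<lambda>x. V x - grad (\<psi> k) x) x \<partial>M)
      - ((\<integral>x. U2 x * (v x - \<psi> k x) \<partial>M) + lam * (\<integral>x. U3 x * (v x - \<psi> k x) \<partial>M)))
    \<longlonglongrightarrow> kirchhoff_coeff * 0 - (0 + lam * 0)"
    by (intro tendsto_intros l1 ml U2 U3)
  moreover have "kirchhoff_coeff * (\<integral>x. P1 (\<lambda>x. V x - grad (\<psi> k) x) x \<partial>M)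
      - ((\<integral>x. U2 x * (v x - \<psi> k x) \<partial>M) + lam * (\<integral>x. U3 x * (v x - \<psi> k x) \<partial>M)) = R" for k
  proof -
    have "c * (A - B) - ((X - Y) + l * (Z - W)) = c * A - (X + l * Z)" if "c * B = Y + l * W" for A B X Y Z W c l :: real
      using that by (simp add: algebra_simps)
    from this[OF test[of k]] show ?thesis by (simp only: e1 me[OF U2] me[OF U3] R_def)
  qed
  ultimately have "(\<lambda>k::nat. R) \<longlonglongrightarrow> 0" by simp
  then have "R = 0" by (simp add: LIMSEQ_const_iff)
  then have "kirchhoff_coeff * (\<integral>x. P1 V x \<partial>M) = (\<integral>x. U2 x * v x \<partial>M) + lam * (\<integral>x. U3 x * v x \<partial>M)"
    by (simp only: R_def right_minus_eq)
  then show "kirchhoff_coeff * (\<integral>x. norm (D x) ^ (DIM('a) - 2) * (D x \<bullet> V x) \<partial>M)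
      = (\<integral>x. g (u x) * v x \<partial>M) + lam * (\<integral>x. h x * \<bar>u x\<bar> powr (q - 1) * u x * v x \<partial>M)"
    by (simp only: P1_def U2_def U3_def)
  show "integrable M (\<lambda>x. norm (D x) ^ (DIM('a) - 2) * (D x \<bullet> V x))"
    using P1i[OF Vm Vi] by (simp only: P1_def)
  show "integrable M (\<lambda>x. g (u x) * v x)" using mi[OF U2 vm vi] by (simp only: U2_def)
  show "integrable M (\<lambda>x. h x * \<bar>u x\<bar> powr (q - 1) * u x * v x)" using mi[OF U3 vm vi] by (simp only: U3_def)
qed

lemma u_Sobolev0: "u \<in> Sobolev0 (real DIM('a)) \<Omega>"
  by (rule Sobolev0_memI[OF um Dm ui Di wg fT ulim Dlim])

lemma weak_grad_u: "AE x in M. weak_grad \<Omega> u x = D x"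
  by (rule weak_grad_eq[OF open_\<Omega> wg])

end

text \<open>The zero function satisfies the weak equation for every \<open>lam\<close>, so the
  conclusion also excludes functions that vanish almost everywhere.\<close>

theorem theorem3p2:
  fixes \<Omega> :: "(real ^ 'n) set"
    and h :: "real ^ 'n \<Rightarrow> real"
    and m :: "real \<Rightarrow> real"
    and a b p q \<beta> \<gamma> :: real
  assumes "CARD('n) \<ge> 2"
    and "bounded_smooth_domain \<Omega>"
    and "0 < q" and "q < real CARD('n) - 1" and "2 * real CARD('n) - 1 < p + 1"
    and "\<beta> = real CARD('n) / (real CARD('n) - 1)"
    and "a > 0" and "b > 0" and "\<And>s. m s = a * s + b"
    and "\<gamma> = real CARD('n) / (real CARD('n) - q - 1)"
    and "h \<in> Lebesgue_space \<gamma> \<Omega>"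
    and "\<not> (AE x in lebesgue_on \<Omega>. max (h x) 0 = 0)"
  shows "\<exists>lam00>0. \<forall>lam. 0 < lam \<and> lam < lam00 \<longrightarrow>
           (\<exists>u. weak_solution m p q \<beta> h lam \<Omega> u \<and> \<not> (AE x in lebesgue_on \<Omega>. u x = 0))"
proof -
  have card: "DIM(real ^ 'n) = CARD('n)" by simp
  interpret kirchhoff \<Omega> \<beta> a b p q \<gamma> h
    by unfold_locales (use assms in \<open>auto simp: bounded_smooth_domain_def\<close>)
  obtain lam0 \<rho> where lam0: "lam0 > 0" and \<rho>: "\<rho> > 0" "16 * \<rho> powr \<beta> \<le> mt_rate TYPE(real ^ 'n)"
    and J_ge: "\<And>lam \<phi>. 0 < lam \<Longrightarrow> lam < lam0 \<Longrightarrow> \<phi> \<in> T \<Longrightarrow> N \<phi> \<le> \<rho> ^ DIM(real ^ 'n) \<Longrightarrow>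
      b / real DIM(real ^ 'n) * (N \<phi> - (1 / 2 ^ (DIM(real ^ 'n) + 1)) * \<rho> ^ DIM(real ^ 'n)) \<le> J lam \<phi>"
    by (rule exists_parameters) (rule that)
  have "\<exists>u. weak_solution m p q \<beta> h lam \<Omega> u \<and> \<not> (AE x in M. u x = 0)" if lam: "0 < lam" "lam < lam0" for lam
  proof -
    interpret kirchhoff_small \<Omega> \<beta> a b p q \<gamma> h lam \<rho>
      by unfold_locales (use lam \<rho> in \<open>blast intro: J_ge[OF lam]\<close>)+
    show ?thesis
    proof (rule exists_limit)
      fix f :: "nat \<Rightarrow> real ^ 'n \<Rightarrow> real" and u D
      assume f: "\<And>k. f k \<in> small_ball" "\<And>k. J lam (f k) < 0" "(\<lambda>k. J lam (f k)) \<longlonglongrightarrow> J_min"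
        and um: "u \<in> borel_measurable M" and Dm: "D \<in> borel_measurable M"
        and ui: "integrable M (\<lambda>x. \<bar>u x\<bar> ^ DIM(real ^ 'n))"
        and Di: "integrable M (\<lambda>x. norm (D x) ^ DIM(real ^ 'n))"
        and u0: "AE x in M. 0 \<le> u x" and wg: "has_weak_gradient \<Omega> u D"
        and ulim: "(\<lambda>k. \<integral>x. \<bar>f k x - u x\<bar> ^ DIM(real ^ 'n) \<partial>M) \<longlonglongrightarrow> 0"
        and Dlim: "(\<lambda>k. \<integral>x. norm (grad (f k) x - D x) ^ DIM(real ^ 'n) \<partial>M) \<longlonglongrightarrow> 0"
        and uL1: "(\<lambda>k. \<integral>x. \<bar>f k x - u x\<bar> \<partial>M) \<longlonglongrightarrow> 0"
        and usub: "\<exists>s. strict_mono (s :: nat \<Rightarrow> nat) \<and> (AE x in M. (\<lambda>k. f (s k) x) \<longlonglongrightarrow> u x)"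
      interpret kirchhoff_limit \<Omega> \<beta> a b p q \<gamma> h lam \<rho> f u D
        by unfold_locales (fact f um Dm ui Di wg ulim Dlim uL1 usub)+
      \<comment> \<open>The weak formulation mentions the chosen gradient, the Euler-Lagrange
        equation the strong limit D; they agree almost everywhere, so the coefficient and all
        integrals are transferred.\<close>
      define W where "W = weak_grad \<Omega> u"
      have W: "AE x in M. W x = D x" unfolding W_def by (rule weak_grad_u)
      have "AE x in M. D x = W x" using W by eventually_elim simp
      from borel_measurable_AE_M[OF Dm this] have Wm: "W \<in> borel_measurable M" .
      have "(\<integral>x. norm (W x) ^ CARD('n) \<partial>M) = (\<integral>x. norm (D x) ^ CARD('n) \<partial>M)"
        by (rule integral_cong_AE) (use W Wm Dm in auto)
      then have coeff: "m (\<integral>x. norm (W x) ^ CARD('n) \<partial>M) = kirchhoff_coeff"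
        by (simp add: assms(9) kirchhoff_coeff_def)
      have "weak_solution m p q \<beta> h lam \<Omega> u"
        unfolding weak_solution_def Let_def W_def[symmetric] coeff
      proof (intro conjI ballI)
        show "u \<in> Sobolev0 (real CARD('n)) \<Omega>" using u_Sobolev0 by (simp only: card)
        show "AE x in M. 0 \<le> u x" by (rule u0)
        fix v assume "v \<in> Sobolev0 (real CARD('n)) \<Omega>"
        then have v: "v \<in> Sobolev0 (real DIM(real ^ 'n)) \<Omega>" by (simp only: card)
        have Vm: "weak_grad \<Omega> v \<in> borel_measurable M" by (rule Sobolev0_approx[OF v])
        define A where "A = (\<lambda>X x. norm (X x) ^ (CARD('n) - 2) * (X x \<bullet> weak_grad \<Omega> v x))"
        have Am: "A X \<in> borel_measurable M" if "X \<in> borel_measurable M" for X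
          unfolding A_def using that Vm
          by (intro borel_measurable_times borel_measurable_power borel_measurable_inner) auto
        have AE: "AE x in M. A D x = A W x" using W by eventually_elim (simp add: A_def)
        note EL = Euler_Lagrange[OF v, unfolded card]
        have "integrable M (A D)" unfolding A_def by (rule EL(1))
        then have AW: "integrable M (A W)" by (rule integrable_cong_AE_imp[OF _ Am[OF Wm]]) (use AE in auto)
        then show "integrable M (\<lambda>x. norm (W x) ^ (CARD('n) - 2) * (W x \<bullet> weak_grad \<Omega> v x))"
          by (simp only: A_def)
        show "integrable M (\<lambda>x. u x * \<bar>u x\<bar> powr p * exp (\<bar>u x\<bar> powr \<beta>) * v x)"
          using EL(2) by (simp only: nonlin_def)
        show "integrable M (\<lambda>x. h x * \<bar>u x\<bar> powr (q - 1) * u x * v x)" by (rule EL(3))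
        have "(\<integral>x. A W x \<partial>M) = (\<integral>x. A D x \<partial>M)"
          by (rule integral_cong_AE[OF Am[OF Wm] Am[OF Dm]]) (use AE in auto)
        then show "kirchhoff_coeff * (\<integral>x. norm (W x) ^ (CARD('n) - 2) * (W x \<bullet> weak_grad \<Omega> v x) \<partial>M)
          = (\<integral>x. u x * \<bar>u x\<bar> powr p * exp (\<bar>u x\<bar> powr \<beta>) * v x \<partial>M)
            + lam * (\<integral>x. h x * \<bar>u x\<bar> powr (q - 1) * u x * v x \<partial>M)"
          using EL(4) by (simp only: A_def nonlin_def)
      qed
      then show ?thesis using nontrivial by blast
    qed
  qed
  then show ?thesis using lam0 by blast
qed

end
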